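(* Let $F\in\mathcal{S}^{\sharp}_1$ with Dirichlet coefficients $a(n)$, and let $q$, $\eta$, $\theta$, $\omega^*$, $\mathfrak{a}$ and $\widetilde{a}(n)$ be the invariants and data of $F$ described in the context. Let $\alpha\in(0,1]$. Then the linear twist $F(s,\alpha)$ satisfies, as an identity of meromorphic functions of $s\in\mathbb{C}$, the functional equation \[ F(1-s,\alpha)=\frac{\omega^*\,\Gamma(s-i\theta)\,q^{s-i\theta-\frac{1}{2}}}{i^{\mathfrak{a}}(2\pi)^{s-i\theta}}\Big(e^{i\frac{\pi}{2}(s-i\theta)}\,\overline{F}_*(s,0,-\alpha q)+(-1)^{\mathfrak{a}}e^{-i\frac{\pi}{2}(s-i\theta)}\,\overline{F}_*(s,0,\alpha q)\Big). \]
   Context: The extended Selberg class $\mathcal{S}^{\sharp}$ consists of the non-identically-zero Dirichlet series $F(s)=\sum_{n\ge1}a(n)n^{-s}$, absolutely convergent for $\Re s>1$, such that $(s-1)^mF(s)$ is entire of finite order for some integer $m\ge0$, and satisfying a functional equation $\Phi(s)=\omega\overline{\Phi}(1-s)$ with $\Phi(s)=Q^s\prod_{j=1}^r\Gamma(\lambda_js+\mu_j)F(s)$, where $Q>0$, $\lambda_j>0$, $\Re\mu_j\ge0$, $|\omega|=1$ and $\overline{\Phi}(s)=\overline{\Phi(\bar s)}$. The degree is $d=2\sum_j\lambda_j$, and $\mathcal{S}^{\sharp}_1$ is the set of $F\in\mathcal{S}^{\sharp}$ of degree $1$. For such $F$ put $\beta=\prod_j\lambda_j^{2\lambda_j}$,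 the conductor $q=2\pi Q^2\beta$, $\xi=2\sum_j(\mu_j-\tfrac12)=\eta+i\theta$ with $\eta,\theta\in\mathbb{R}$, and the root number $\omega^*=\omega(\beta Q^2)^{i\theta}\prod_j\lambda_j^{-2i\Im\mu_j}$; it is known that $q\in\mathbb{N}$, $\eta\in\{-1,0\}$, and that $\widetilde{a}(n):=a(n)n^{i\theta}$ is periodic in $n$ of period $q$ (so it is extended to all $n\in\mathbb{Z}$ by periodicity). Put $\mathfrak{a}=\eta+1$. The linear twist is $F(s,\alpha)=\sum_{n\ge1}a(n)n^{-s}e(-n\alpha)$, $e(x)=e^{2\pi i x}$, defined for $\Re s>1$ and continued meromorphically to $\mathbb{C}$. For $\beta'\in\mathbb{R}$ define, for $\Re s>1$, $\overline{F}_*(s,0,\beta')=\sum_{n\in\mathbb{Z},\,n+\beta'>0}\overline{\widetilde{a}(n)}\,(n+\beta')^{-(s-i\theta)}$ (the conjugate-coefficient version of $F_*(s,0,\beta')=\sum_{n+\beta'>0}\widetilde a(n)(n+\beta')^{-(s+i\theta)}$), extended by meromorphic continuation. *)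

theory Defs
  imports "HOL-Complex_Analysis.Complex_Analysis"
begin

text \<open>
  Meromorphic functions are total functions here. Requiring \<^const>\<open>nicely_meromorphic_on\<close> fixes
  their values at removable singularities and sets them to 0 at poles, so that a continuation
  from the half-plane \<open>Re s > 1\<close> is unique as a function.
\<close>

definition is_mero_continuation :: "(complex \<Rightarrow> complex) \<Rightarrow> (complex \<Rightarrow> complex) \<Rightarrow> bool" where
  "is_mero_continuation f g \<longleftrightarrow>
     g nicely_meromorphic_on UNIV \<and> (\<forall>s. Re s > 1 \<longrightarrow> g s = f s)"

definition mero_continuation :: "(complex \<Rightarrow> complex) \<Rightarrow> complex \<Rightarrow> complex" where
  "mero_continuation f = (THE g. is_mero_continuation f g)"

lemma is_mero_continuation_unique:
  assumes "is_mero_continuation f g" "is_mero_continuation f h"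
  shows   "g = h"
proof
  fix z
  have g: "g nicely_meromorphic_on UNIV" and h: "h nicely_meromorphic_on UNIV"
    and eq: "\<And>s. Re s > 1 \<Longrightarrow> g s - h s = 0"
    using assms by (auto simp: is_mero_continuation_def)
  have mero: "(\<lambda>s. g s - h s) meromorphic_on UNIV"
    using g h by (intro meromorphic_intros) (auto simp: nicely_meromorphic_on_def)
  have "eventually (\<lambda>s. g s - h s = 0) (cosparse UNIV)"
  proof (rule ccontr)
    assume "\<not> ?thesis"
    with mero have "eventually (\<lambda>s. g s - h s \<noteq> 0) (cosparse UNIV)"
      using meromorphic_imp_constant_or_avoid[of "\<lambda>s. g s - h s" UNIV 0] by auto
    hence "eventually (\<lambda>s. g s - h s \<noteq> 0) (at 2)"
      by (rule eventually_cosparse_imp_eventually_at) auto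
    moreover have "eventually (\<lambda>s. s \<in> {s. Re s > 1}) (at 2)"
      by (rule eventually_at_in_open') (auto simp: open_halfspace_Re_gt)
    ultimately have "eventually (\<lambda>s::complex. False) (at 2)"
      by eventually_elim (use eq in auto)
    thus False by simp
  qed
  hence ev: "eventually (\<lambda>s. g s = h s) (at z)"
    using eventually_cosparse_imp_eventually_at[of "\<lambda>s. g s - h s = 0" UNIV z UNIV] by simp
  have "is_pole g z \<longleftrightarrow> is_pole h z"
    using ev by (intro is_pole_cong) auto
  moreover have "g \<midarrow>z\<rightarrow> c \<longleftrightarrow> h \<midarrow>z\<rightarrow> c" for c
    using ev by (intro tendsto_cong) auto
  moreover have "is_pole g z \<and> g z = 0 \<or> g \<midarrow>z\<rightarrow> g z" "is_pole h z \<and> h z = 0 \<or> h \<midarrow>z\<rightarrow> h z"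
    using g h by (auto simp: nicely_meromorphic_on_def)
  ultimately show "g z = h z"
    by (metis LIM_unique at_neq_bot not_tendsto_and_filterlim_at_infinity is_pole_def)
qed

lemma mero_continuation_eqI: "is_mero_continuation f g \<Longrightarrow> mero_continuation f = g"
  unfolding mero_continuation_def by (blast intro: the_equality is_mero_continuation_unique)


record selberg_data =
  Qpar  :: real
  rnum  :: nat
  lam   :: "nat \<Rightarrow> real"
  mu    :: "nat \<Rightarrow> complex"
  omega :: complex

definition entire_finite_order :: "(complex \<Rightarrow> complex) \<Rightarrow> bool" where
  "entire_finite_order G \<longleftrightarrow> G holomorphic_on UNIV \<and>
     (\<exists>\<rho>::real. \<forall>\<^sub>F s in at_infinity. norm (G s) \<le> exp (norm s powr \<rho>))"

definition conj_fun :: "(complex \<Rightarrow> complex) \<Rightarrow> complex \<Rightarrow> complex" where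
  "conj_fun \<Phi> s = cnj (\<Phi> (cnj s))"

definition completed :: "selberg_data \<Rightarrow> (complex \<Rightarrow> complex) \<Rightarrow> complex \<Rightarrow> complex" where
  "completed D F s =
     of_real (Qpar D) powr s * (\<Prod>j=1..rnum D. Gamma (of_real (lam D j) * s + mu D j)) * F s"

text \<open>
  \<open>extended_selberg a F D\<close>: \<open>F\<close> belongs to the extended Selberg class, has Dirichlet
  coefficients \<open>a(n)\<close>, \<open>n \<ge> 1\<close> (the value \<open>a 0\<close> is irrelevant), and satisfies the functional
  equation with data \<open>D\<close>. Since \<^const>\<open>Gamma\<close> has the dummy value 0 at its poles, the functional
  equation is stated as equality of meromorphic functions, i.e. off a closed discrete set.
\<close>

definition extended_selberg ::
    "(nat \<Rightarrow> complex) \<Rightarrow> (complex \<Rightarrow> complex) \<Rightarrow> selberg_data \<Rightarrow> bool" where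
  "extended_selberg a F D \<longleftrightarrow>
     (\<forall>s. Re s > 1 \<longrightarrow>
        (\<lambda>n. norm (a n * of_nat n powr (-s))) summable_on {1..} \<and>
        F s = (\<Sum>\<^sub>\<infinity>n\<in>{1..}. a n * of_nat n powr (-s))) \<and>
     (\<exists>s. Re s > 1 \<and> F s \<noteq> 0) \<and>
     (\<exists>(m::nat) G. entire_finite_order G \<and> (\<forall>s. s \<noteq> 1 \<longrightarrow> G s = (s - 1) ^ m * F s)) \<and>
     Qpar D > 0 \<and> (\<forall>j\<in>{1..rnum D}. lam D j > 0 \<and> Re (mu D j) \<ge> 0) \<and> norm (omega D) = 1 \<and>
     (\<forall>\<^sub>\<approx>s\<in>UNIV. completed D F s = omega D * conj_fun (completed D F) (1 - s))"


definition sel_degree :: "selberg_data \<Rightarrow> real" where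
  "sel_degree D = 2 * (\<Sum>j=1..rnum D. lam D j)"

definition sel_beta :: "selberg_data \<Rightarrow> real" where
  "sel_beta D = (\<Prod>j=1..rnum D. lam D j powr (2 * lam D j))"

definition conductor :: "selberg_data \<Rightarrow> real" where
  "conductor D = 2 * pi * (Qpar D)\<^sup>2 * sel_beta D"

definition sel_xi :: "selberg_data \<Rightarrow> complex" where
  "sel_xi D = 2 * (\<Sum>j=1..rnum D. mu D j - 1 / 2)"

definition sel_eta :: "selberg_data \<Rightarrow> real" where
  "sel_eta D = Re (sel_xi D)"

definition sel_theta :: "selberg_data \<Rightarrow> real" where
  "sel_theta D = Im (sel_xi D)"

definition root_number :: "selberg_data \<Rightarrow> complex" where
  "root_number D = omega D * of_real (sel_beta D * (Qpar D)\<^sup>2) powr (\<i> * of_real (sel_theta D)) *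
     (\<Prod>j=1..rnum D. of_real (lam D j) powr (-2 * \<i> * of_real (Im (mu D j))))"

definition sel_parity :: "selberg_data \<Rightarrow> real" where
  "sel_parity D = sel_eta D + 1"

text \<open>
  In degree 1 the conductor \<open>q\<close> is a positive integer (whence the floor below) and
  \<open>a(n) n\<^bsup>i\<theta>\<^esup>\<close>, \<open>n \<ge> 1\<close>, has period \<open>q\<close>; for \<open>n \<le> 0\<close> the periodic extension takes its value at the
  representative of \<open>n\<close> modulo \<open>q\<close> in \<open>{1..q}\<close>.
\<close>

definition atilde :: "(nat \<Rightarrow> complex) \<Rightarrow> selberg_data \<Rightarrow> int \<Rightarrow> complex" where
  "atilde a D n =
     (let k = nat (if n \<ge> 1 then n else (n - 1) mod \<lfloor>conductor D\<rfloor> + 1)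
      in  a k * of_nat k powr (\<i> * of_real (sel_theta D)))"


definition linear_twist :: "(nat \<Rightarrow> complex) \<Rightarrow> complex \<Rightarrow> real \<Rightarrow> complex" where
  "linear_twist a s \<alpha> = mero_continuation
     (\<lambda>s. \<Sum>\<^sub>\<infinity>n\<in>{1..}. a n * of_nat n powr (-s) * cis (-2 * pi * of_nat n * \<alpha>)) s"

text \<open>\<open>Fbar_star a D s b\<close> is \<open>F\<close>-bar-star at \<open>(s, 0, b)\<close>.\<close>

definition Fbar_star :: "(nat \<Rightarrow> complex) \<Rightarrow> selberg_data \<Rightarrow> complex \<Rightarrow> real \<Rightarrow> complex" where
  "Fbar_star a D s b = mero_continuation
     (\<lambda>s. \<Sum>\<^sub>\<infinity>n\<in>{n::int. of_int n + b > 0}.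
        cnj (atilde a D n) * of_real (of_int n + b) powr (-(s - \<i> * of_real (sel_theta D)))) s"

end

theory Submission
  imports Defs
begin

text \<open>
  Let \<open>f z = \<Sum> a(n) exp (-2\<pi>nz)\<close>. The Mellin representation of \<open>f\<close>, shifted across the critical strip by the
  functional equation, and Stirling's formula show that as \<open>z = y + i\<alpha>\<close> tends to the imaginary axis, \<open>f\<close>
  has a singularity of type \<open>y\<^bsup>i\<theta>-1\<^esup>\<close>, whose leading coefficient is a constant times the conjugate of \<open>a(n) n\<^bsup>i\<theta>\<^esup>\<close>
  when \<open>q\<alpha> = n\<close> is an integer, and 0 otherwise. Since \<open>f\<close> is invariant under \<open>\<alpha> \<mapsto> \<alpha> + 1\<close>, the numbers \<open>a(n) n\<^bsup>i\<theta>\<^esup>\<close> have period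
  \<open>q\<close> and \<open>q\<close> is an integer; comparing \<open>\<alpha>\<close> with \<open>-\<alpha>\<close> gives their parity, and
  summing over \<open>\<alpha> = m/q\<close> with weights \<open>e(mk/q)\<close> isolates a single residue class and yields their finite Fourier expansion.
  The linear twist is thereby a finite combination of periodic zeta functions, whose functional equation in terms of
  Hurwitz zeta functions comes from the partial fractions of \<open>1 / (exp (y - 2\<pi>ix) - 1)\<close>; regrouping
  the Hurwitz series by residue classes modulo \<open>q\<close> gives the two series on the right-hand side.
\<close>

section \<open>Integrals depending on a parameter and shifts of vertical lines\<close>

text \<open>The lines Re s = 3/2 and Re s = -1/2 are exchanged by s -> 1 - s, so on the left one the
  functional equation turns F into an absolutely convergent series with conjugated coefficients.
  Degree one enters through Stirling's formula: because the \<open>lam j\<close> sum to 1/2, the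
  terms t ln t and t in the exponents of the Gamma quotient cancel those of \<open>Gamma s\<close>,
  and there remain a constant, t^(-i theta) and the oscillations exp (i t ln (n / (q \<alpha>))), of
  which only n = q \<alpha> is stationary. F is only known to be of finite order, so no convexity
  bound is at hand when the line is moved; a damping factor of higher order takes its place. The
  finite Fourier expansion expresses the numbers a(n) n^(i theta) by their own conjugates. This is
  why the Hurwitz formula, applied to the exponentials, directly produces series with conjugated
  coefficients. The parity enters as the sign exp (i pi (eta + 1)): it governs the symmetry n -> -n
  of the coefficients, and its square is 1 because reflecting twice is the identity.\<close>

lemma set_integrable_continuous_bound:
  fixes f :: "real \<Rightarrow> complex" and g :: "real \<Rightarrow> real"
  assumes "set_integrable lborel S g" "S \<in> sets borel" "continuous_on S f"
    and "\<And>t. t \<in> S \<Longrightarrow> norm (f t) \<le> g t"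
  shows "set_integrable lborel S f"
  using assms(1)
proof (rule set_integrable_bound)
  show "set_borel_measurable lborel S f"
    unfolding set_borel_measurable_def
    using borel_measurable_continuous_on_indicator[OF assms(2,3)] by simp
  show "AE x in lborel. x \<in> S \<longrightarrow> cmod (f x) \<le> norm (g x)"
    using assms(4) by (intro always_eventually) (auto intro: order_trans[OF _ abs_ge_self])
qed

lemma set_integral_dominated_convergence:
  fixes f :: "nat \<Rightarrow> real \<Rightarrow> complex" and g :: "real \<Rightarrow> real"
  assumes g: "set_integrable lborel S g" and S: "S \<in> sets borel"
    and cont: "\<And>i. continuous_on S (f i)" and contF: "F \<in> borel_measurable borel \<or> continuous_on S F"
    and bound: "\<And>i t. t \<in> S \<Longrightarrow> norm (f i t) \<le> g t"
    and lim: "\<And>t. t \<in> S \<Longrightarrow> (\<lambda>i. f i t) \<longlonglongrightarrow> F t"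
  shows "(\<lambda>i. LINT t:S|lborel. f i t) \<longlonglongrightarrow> (LINT t:S|lborel. F t)"
  unfolding set_lebesgue_integral_def
proof (rule integral_dominated_convergence)
  show "integrable lborel (\<lambda>x. indicat_real S x *\<^sub>R g x)"
    using g unfolding set_integrable_def .
  show "(\<lambda>x. indicat_real S x *\<^sub>R f i x) \<in> borel_measurable lborel" for i
    using borel_measurable_continuous_on_indicator[OF S cont[of i]] by simp
  show "(\<lambda>x. indicat_real S x *\<^sub>R F x) \<in> borel_measurable lborel"
    using contF
  proof
    assume "F \<in> borel_measurable borel"
    thus ?thesis using S by (auto intro!: borel_measurable_scaleR borel_measurable_indicator)
  next
    assume "continuous_on S F"
    thus ?thesis using borel_measurable_continuous_on_indicator[OF S] by simp
  qed
  show "AE x in lborel. (\<lambda>i. indicat_real S x *\<^sub>R f i x) \<longlonglongrightarrow> indicat_real S x *\<^sub>R F x"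
    using lim by (intro always_eventually) (auto intro!: tendsto_intros simp: indicator_def)
  show "AE x in lborel. norm (indicat_real S x *\<^sub>R f i x) \<le> indicat_real S x *\<^sub>R g x" for i
    using bound by (intro always_eventually) (auto simp: indicator_def)
qed

lemma set_integral_norm_le:
  fixes f :: "real \<Rightarrow> complex" and g :: "real \<Rightarrow> real"
  assumes g: "set_integrable lborel S g" and S: "S \<in> sets borel" and f: "set_integrable lborel S f"
    and bound: "\<And>t. t \<in> S \<Longrightarrow> norm (f t) \<le> g t"
  shows "norm (LINT t:S|lborel. f t) \<le> (LINT t:S|lborel. g t)"
proof -
  have "norm (LINT t:S|lborel. f t) \<le> (LINT t:S|lborel. norm (f t))"
    by (rule set_integral_norm_bound[OF f])
  also have "\<dots> \<le> (LINT t:S|lborel. g t)"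
    by (rule set_integral_mono) (use assms set_integrable_norm[OF f] in auto)
  finally show ?thesis .
qed

text \<open>Cauchy's inequality on discs of half the radius bounds the derivative in s, and hence
  the difference quotients, by a multiple of the integrable bound \<open>g\<close>. Dominated
  convergence then differentiates under the integral sign.\<close>

lemma has_field_derivative_set_integral:
  fixes f :: "complex \<Rightarrow> real \<Rightarrow> complex" and g :: "real \<Rightarrow> real"
  assumes g: "set_integrable lborel S g" and S: "S \<in> sets borel" and r: "r > 0"
    and hol: "\<And>t. t \<in> S \<Longrightarrow> (\<lambda>s. f s t) holomorphic_on cball s0 r"
    and cont: "\<And>s. s \<in> cball s0 r \<Longrightarrow> continuous_on S (f s)"
    and bound: "\<And>s t. s \<in> cball s0 r \<Longrightarrow> t \<in> S \<Longrightarrow> norm (f s t) \<le> g t"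
  shows "\<exists>D. ((\<lambda>s. LINT t:S|lborel. f s t) has_field_derivative D) (at s0)"
proof -
  \<comment> \<open>The indicator makes \<open>D\<close> a pointwise limit of measurable functions
    on the whole line, which yields its measurability without continuity of the derivative in
    t.\<close>
  define D where "D = (\<lambda>t. indicator S t *\<^sub>R deriv (\<lambda>s. f s t) s0)"
  have hol': "(\<lambda>s. f s t) holomorphic_on ball s0 r" if "t \<in> S" for t
    using hol[OF that] by (rule holomorphic_on_subset) auto
  have der: "((\<lambda>s. f s t) has_field_derivative deriv (\<lambda>s. f s t) s) (at s)"
    if "t \<in> S" "s \<in> ball s0 r" for s t
    using hol'[OF that(1)] that(2) by (rule holomorphic_derivI[OF _ open_ball])
  have quot: "(\<lambda>h. (f (s0 + h) t - f s0 t) / h) \<midarrow>0\<rightarrow> deriv (\<lambda>s. f s t) s0" if "t \<in> S" for t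
    using der[OF that, of s0] r by (simp add: DERIV_def)
  have dbound: "norm (deriv (\<lambda>s. f s t) s) \<le> 2 * g t / r" if "t \<in> S" "s \<in> ball s0 (r/2)" for s t
  proof -
    have sub: "cball s (r/2) \<subseteq> cball s0 r"
    proof
      fix x assume "x \<in> cball s (r/2)"
      thus "x \<in> cball s0 r"
        using that(2) dist_triangle[of s0 x s] by simp
    qed
    have "norm ((deriv ^^ 1) (\<lambda>s. f s t) s) \<le> fact 1 * g t / (r/2) ^ 1"
    proof (rule Cauchy_inequality)
      show "(\<lambda>s. f s t) holomorphic_on ball s (r/2)"
        by (rule holomorphic_on_subset[OF hol[OF that(1)]]) (use sub in auto)
      show "continuous_on (cball s (r/2)) (\<lambda>s. f s t)"
        by (rule holomorphic_on_imp_continuous_on, rule holomorphic_on_subset[OF hol[OF that(1)] sub])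
      show "norm (f x t) \<le> g t" if "norm (s - x) = r/2" for x
        by (rule bound) (use sub that \<open>t \<in> S\<close> in \<open>auto simp: dist_norm\<close>)
    qed (use r in auto)
    thus ?thesis by (simp add: field_simps)
  qed
  have qbound: "norm ((f (s0 + h) t - f s0 t) / h) \<le> 2 * g t / r"
    if "t \<in> S" "norm h < r/2" "h \<noteq> 0" for h t
  proof -
    have "norm (f (s0 + h) t - f s0 t) \<le> (2 * g t / r) * norm ((s0 + h) - s0)"
    proof (rule field_differentiable_bound[of "ball s0 (r/2)"])
      show "((\<lambda>s. f s t) has_field_derivative deriv (\<lambda>s. f s t) z) (at z within ball s0 (r / 2))"
        if "z \<in> ball s0 (r/2)" for z
        using der[OF \<open>t \<in> S\<close>, of z] that r by (auto intro: has_field_derivative_at_within)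
    qed (use dbound that r in \<open>auto simp: dist_norm\<close>)
    thus ?thesis using that by (simp add: norm_divide divide_le_eq)
  qed
  have int: "set_integrable lborel S (f s)" if "s \<in> cball s0 r" for s
    by (rule set_integrable_continuous_bound[OF g S cont[OF that] bound[OF that]])
  have "(\<lambda>h. ((LINT t:S|lborel. f (s0 + h) t) - (LINT t:S|lborel. f s0 t)) / h) \<midarrow>0\<rightarrow> (LINT t:S|lborel. D t)"
    unfolding tendsto_at_iff_sequentially
  proof (intro allI impI)
    fix X :: "nat \<Rightarrow> complex" assume X: "\<forall>i. X i \<in> UNIV - {0}" "X \<longlonglongrightarrow> 0"
    from X(2) r have "eventually (\<lambda>i. norm (X i) < r/2) sequentially"
      using order_tendstoD(2)[OF tendsto_norm[OF X(2)], of "r/2"] by simp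
    then obtain N where N: "\<And>i. i \<ge> N \<Longrightarrow> norm (X i) < r/2"
      by (auto simp: eventually_sequentially)
    have XN: "(\<lambda>i. X (i + N)) \<longlonglongrightarrow> 0" using X(2) by (rule LIMSEQ_ignore_initial_segment)
    have mem: "s0 + X (i + N) \<in> cball s0 r" for i
      using N[of "i + N"] r by (simp add: dist_norm)
    have lim: "(\<lambda>i. (f (s0 + X (i + N)) t - f s0 t) / X (i + N)) \<longlonglongrightarrow> deriv (\<lambda>s. f s t) s0"
      if "t \<in> S" for t
      by (rule filterlim_compose[OF quot[OF that]]) (use XN X in \<open>auto simp: filterlim_at\<close>)
    have conti: "continuous_on S (\<lambda>t. (f (s0 + X (i + N)) t - f s0 t) / X (i + N))" for i
      using X(1) mem[of i] r by (intro continuous_intros cont) auto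
    have "(\<lambda>i. LINT t:S|lborel. (f (s0 + X (i + N)) t - f s0 t) / X (i + N)) \<longlonglongrightarrow> (LINT t:S|lborel. D t)"
    proof (rule set_integral_dominated_convergence[where g = "\<lambda>t. 2 * g t / r"])
      show "set_integrable lborel S (\<lambda>t. 2 * g t / r)" using g by (auto intro: set_integrable_mult_right)
      show "D \<in> borel_measurable borel \<or> continuous_on S D"
      proof (rule disjI1, rule borel_measurable_LIMSEQ_metric)
        show "(\<lambda>t. indicator S t *\<^sub>R ((f (s0 + X (i + N)) t - f s0 t) / X (i + N))) \<in> borel_measurable borel" for i
          by (rule borel_measurable_continuous_on_indicator[OF S conti])
        show "(\<lambda>i. indicator S t *\<^sub>R ((f (s0 + X (i + N)) t - f s0 t) / X (i + N))) \<longlonglongrightarrow> D t" for t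
          using lim[of t] by (cases "t \<in> S") (auto simp: D_def)
      qed
      show "norm ((f (s0 + X (i + N)) t - f s0 t) / X (i + N)) \<le> 2 * g t / r" if "t \<in> S" for i t
        by (rule qbound) (use that N X(1) in auto)
      show "(\<lambda>i. (f (s0 + X (i + N)) t - f s0 t) / X (i + N)) \<longlonglongrightarrow> D t" if "t \<in> S" for t
        using lim[OF that] that by (simp add: D_def)
    qed (use S conti in auto)
    also have "(\<lambda>i. LINT t:S|lborel. (f (s0 + X (i + N)) t - f s0 t) / X (i + N)) =
       (\<lambda>i. ((LINT t:S|lborel. f (s0 + X (i+N)) t) - (LINT t:S|lborel. f s0 t)) / X (i+N))"
      using int[OF mem] int[of s0] r by (simp add: set_integral_diff)
    finally show "((\<lambda>h. ((LINT t:S|lborel. f (s0 + h) t) - (LINT t:S|lborel. f s0 t)) / h) \<circ> X) \<longlonglongrightarrow> (LINT t:S|lborel. D t)"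
      by (rule_tac LIMSEQ_offset[of _ N]) (simp add: o_def)
  qed
  thus ?thesis by (auto simp: DERIV_def)
qed

lemma holomorphic_on_set_integral:
  fixes f :: "complex \<Rightarrow> real \<Rightarrow> complex"
  assumes U: "open U" and S: "S \<in> sets borel"
    and hol: "\<And>t. t \<in> S \<Longrightarrow> (\<lambda>s. f s t) holomorphic_on U"
    and cont: "\<And>s. s \<in> U \<Longrightarrow> continuous_on S (f s)"
    and bound: "\<And>s. s \<in> U \<Longrightarrow> \<exists>r>0. \<exists>g. set_integrable lborel S g \<and>
                  (\<forall>s'\<in>cball s r \<inter> U. \<forall>t\<in>S. norm (f s' t) \<le> g t)"
  shows "(\<lambda>s. LINT t:S|lborel. f s t) holomorphic_on U"
  unfolding holomorphic_on_open[OF U]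
proof
  fix s assume s: "s \<in> U"
  obtain r g where rg: "r > 0" "set_integrable lborel S g"
      "\<And>s' t. s' \<in> cball s r \<inter> U \<Longrightarrow> t \<in> S \<Longrightarrow> norm (f s' t) \<le> g t"
    using bound[OF s] by blast
  obtain r' where r': "r' > 0" "cball s r' \<subseteq> U" using U s open_contains_cball by blast
  show "\<exists>D. ((\<lambda>s. LINT t:S|lborel. f s t) has_field_derivative D) (at s)"
  proof (rule has_field_derivative_set_integral[OF rg(2) S, of "min r r'"])
    have sub: "cball s (min r r') \<subseteq> cball s r \<inter> U" using r' by auto
    show "(\<lambda>s. f s t) holomorphic_on cball s (min r r')" if "t \<in> S" for t
      using hol[OF that] sub by (blast intro: holomorphic_on_subset)
  qed (use rg r' cont in auto)
qed

lemma set_integrable_exp_decay: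
  fixes c :: real assumes "c > 0"
  shows "set_integrable lborel {T..} (\<lambda>t. exp (- c * t))"
    and "(LINT t:{T..}|lborel. exp (- c * t)) = exp (- c * T) / c"
proof -
  have hi: "((\<lambda>t. exp (- c * t)) has_integral exp (- c * T) / c) {T..}"
    using has_integral_exp_minus_to_infinity[OF assms] by (simp add: mult.commute)
  have "(\<lambda>t. exp (- c * t)) absolutely_integrable_on {T..}"
    by (rule nonnegative_absolutely_integrable_1) (use hi in auto)
  hence "set_integrable lebesgue {T..} (\<lambda>t. exp (- c * t))" .
  hence "set_integrable lborel {T..} (\<lambda>t. exp (- c * t))"
    by (simp add: absolutely_integrable_on_def set_integrable_def integrable_completion)
  thus si: "set_integrable lborel {T..} (\<lambda>t. exp (- c * t))" .
  show "(LINT t:{T..}|lborel. exp (- c * t)) = exp (- c * T) / c"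
    using set_borel_integral_eq_integral(2)[OF si] hi by (simp add: integral_unique)
qed

section \<open>Integrals over rectangles and shifts across half strips\<close>

lemma contour_integral_linepath_same_Im:
  assumes "a < b"
  shows "contour_integral (linepath (Complex a c) (Complex b c)) f = integral {a..b} (\<lambda>x. f (Complex x c))"
proof -
  \<comment> \<open>Exchanging real and imaginary part turns the horizontal segment into a vertical
    one, for which \<open>contour_integral_linepath_same_Re\<close> is available; the factor - \<i>
    corrects the direction.\<close>
  define g where "g = (\<lambda>w. f (Complex (Im w) (Re w)))"
  have "contour_integral (linepath (Complex a c) (Complex b c)) f =
      of_real (b - a) * integral {0..1} (\<lambda>x. f (linepath (Complex a c) (Complex b c) x))"
    by (simp add: contour_integral_integral Complex_eq)
  also have "(\<lambda>x. f (linepath (Complex a c) (Complex b c) x)) = (\<lambda>x. g (linepath (Complex c a) (Complex c b) x))"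
    unfolding g_def by (intro ext arg_cong[of _ _ f]) (simp add: linepath_def complex_eq_iff)
  also have "of_real (b - a) * integral {0..1} (\<lambda>x. g (linepath (Complex c a) (Complex c b) x)) =
      - \<i> * contour_integral (linepath (Complex c a) (Complex c b)) g"
  proof -
    have "contour_integral (linepath (Complex c a) (Complex c b)) g =
        (Complex c b - Complex c a) * integral {0..1} (\<lambda>x. g (linepath (Complex c a) (Complex c b) x))"
      by (simp add: contour_integral_integral)
    also have "Complex c b - Complex c a = \<i> * of_real (b - a)" by (simp add: complex_eq_iff)
    finally show ?thesis by (simp flip: mult.assoc)
  qed
  also have "\<dots> = integral {a..b} (\<lambda>x. f (Complex x c))"
    by (subst contour_integral_linepath_same_Re[of _ c _ a b]) (use assms in \<open>auto simp: g_def\<close>)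
  finally show ?thesis .
qed

lemma continuous_on_Complex [continuous_intros]:
  "continuous_on S f \<Longrightarrow> continuous_on S g \<Longrightarrow> continuous_on S (\<lambda>x. Complex (f x) (g x))"
  unfolding Complex_eq by (intro continuous_intros)

lemma contour_integral_rectpath:
  fixes h :: "complex \<Rightarrow> complex"
  assumes ab: "a < b" "c < d"
    and cont: "continuous_on (path_image (rectpath (Complex a c) (Complex b d))) h"
  shows "contour_integral (rectpath (Complex a c) (Complex b d)) h =
    (LINT x:{a..b}|lborel. h (Complex x c)) + \<i> * (LINT t:{c..d}|lborel. h (Complex b t))
    - (LINT x:{a..b}|lborel. h (Complex x d)) - \<i> * (LINT t:{c..d}|lborel. h (Complex a t))"
proof -
  define P where "P = path_image (rectpath (Complex a c) (Complex b d))"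
  have P: "P = closed_segment (Complex a c) (Complex b c) \<union> closed_segment (Complex b c) (Complex b d)
      \<union> closed_segment (Complex b d) (Complex a d) \<union> closed_segment (Complex a d) (Complex a c)"
    unfolding P_def rectpath_def Let_def by (simp add: path_image_join Un_assoc)
  have P': "s \<in> P \<longleftrightarrow> (a \<le> Re s \<and> Re s \<le> b \<and> (Im s = c \<or> Im s = d)) \<or> (c \<le> Im s \<and> Im s \<le> d \<and> (Re s = a \<or> Re s = b))" for s
    using ab unfolding P_def by (subst path_image_rectpath) auto
  have ci: "h contour_integrable_on linepath u v" if "closed_segment u v \<subseteq> P" for u v
    using that cont unfolding P_def
    by (intro contour_integrable_continuous_linepath) (blast intro: continuous_on_subset)
  have segs: "closed_segment (Complex a c) (Complex b c) \<subseteq> P" "closed_segment (Complex b c) (Complex b d) \<subseteq> P"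
     "closed_segment (Complex b d) (Complex a d) \<subseteq> P" "closed_segment (Complex a d) (Complex a c) \<subseteq> P"
    unfolding P by auto
  have hor: "continuous_on {a..b} (\<lambda>x. h (Complex x y))" if "y = c \<or> y = d" for y
    by (rule continuous_on_compose2[OF cont[folded P_def]]) (use that in \<open>auto simp: P' intro!: continuous_intros\<close>)
  have ver: "continuous_on {c..d} (\<lambda>t. h (Complex x t))" if "x = a \<or> x = b" for x
    by (rule continuous_on_compose2[OF cont[folded P_def]]) (use that in \<open>auto simp: P' intro!: continuous_intros\<close>)
  have eq: "integral {l..u} f = (LINT x:{l..u}|lborel. f x)" if "continuous_on {l..u} f" for f :: "real \<Rightarrow> complex" and l u
    using set_borel_integral_eq_integral(2)[OF borel_integrable_atLeastAtMost'[OF that]] by simp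
  have "contour_integral (rectpath (Complex a c) (Complex b d)) h =
     contour_integral (linepath (Complex a c) (Complex b c)) h + contour_integral (linepath (Complex b c) (Complex b d)) h
     + contour_integral (linepath (Complex b d) (Complex a d)) h + contour_integral (linepath (Complex a d) (Complex a c)) h"
    unfolding rectpath_def Let_def by (simp add: ci segs add_ac)
  also have "contour_integral (linepath (Complex b d) (Complex a d)) h = - contour_integral (linepath (Complex a d) (Complex b d)) h"
    by (rule contour_integral_reverse_linepath) (rule continuous_on_subset[OF cont[folded P_def]], use segs in \<open>simp add: closed_segment_commute\<close>)
  also have "contour_integral (linepath (Complex a d) (Complex a c)) h = - contour_integral (linepath (Complex a c) (Complex a d)) h"
    by (rule contour_integral_reverse_linepath) (rule continuous_on_subset[OF cont[folded P_def]], use segs in \<open>simp add: closed_segment_commute\<close>)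
  finally show ?thesis
    using ab by (simp add: contour_integral_linepath_same_Im contour_integral_linepath_same_Re eq hor ver)
qed

lemma tendsto_set_integral_Icc_at_top:
  fixes f :: "real \<Rightarrow> complex"
  assumes "set_integrable lborel {a..} f"
  shows "((\<lambda>b. LINT y:{a..b}|lborel. f y) \<longlongrightarrow> (LINT y:{a..}|lborel. f y)) at_top"
proof -
  have "uniform_limit {()} (\<lambda>b x. LINT y:{a..b}|lborel. f y) (\<lambda>x. LINT y:{a..}|lborel. f y) at_top"
    by (rule uniform_limit_set_lebesgue_integral_at_top[where g = "\<lambda>t. norm (f t)"])
       (use assms set_integrable_norm[OF assms] in \<open>auto simp: set_integrable_def set_borel_measurable_def\<close>)
  from tendsto_uniform_limitI[OF this] show ?thesis by simp
qed

text \<open>In a vertical strip - \<i> s is Im s times a factor that tends to 1 as Im s grows, so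
  the real part of its powers is comparable to the powers of Im s. This is what makes exp (-
  \<epsilon> (- \<i> s)^M) small high up in the strip.\<close>

lemma Re_power_half_strip:
  fixes a b :: real
  shows "\<exists>T1>0. \<forall>s. a \<le> Re s \<longrightarrow> Re s \<le> b \<longrightarrow> Im s \<ge> T1 \<longrightarrow> Re ((- \<i> * s) ^ M) \<ge> Im s ^ M / 2"
proof -
  have "((\<lambda>u::complex. (1 + u) ^ M) \<longlongrightarrow> (1 + 0) ^ M) (at 0)" by (intro tendsto_intros)
  hence "eventually (\<lambda>u::complex. dist ((1 + u) ^ M) 1 < 1/2) (at 0)"
    using tendstoD[of _ 1 "at 0" "1/2"] by simp
  then obtain r where r: "r > 0" "\<And>u::complex. u \<noteq> 0 \<Longrightarrow> norm u < r \<Longrightarrow> dist ((1 + u) ^ M) 1 < 1/2"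
    unfolding eventually_at by (auto simp: dist_norm)
  define K where "K = \<bar>a\<bar> + \<bar>b\<bar> + 1"
  define T1 where "T1 = K / r + 1"
  have K: "K > 0" by (simp add: K_def)
  have T1: "T1 > 0" using K r by (simp add: T1_def add_pos_pos)
  show ?thesis
  proof (intro exI[of _ T1] conjI allI impI T1)
    fix s :: complex assume s: "a \<le> Re s" "Re s \<le> b" "Im s \<ge> T1"
    define u where "u = - \<i> * of_real (Re s) / of_real (Im s)"
    have t: "Im s > 0" using s T1 by linarith
    have "\<bar>Re s\<bar> < K" using s by (auto simp: K_def)
    hence "norm u < K / Im s" using t by (simp add: u_def norm_divide norm_mult divide_strict_right_mono)
    also have "\<dots> \<le> r"
    proof -
      have "K / r \<le> Im s" using s by (simp add: T1_def)
      thus ?thesis using t r by (simp add: field_simps)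
    qed
    finally have u: "norm u < r" .
    have d: "dist ((1 + u) ^ M) 1 < 1/2" using r(2)[OF _ u] by (cases "u = 0") auto
    hence "\<bar>Re ((1 + u) ^ M - 1)\<bar> < 1/2" using abs_Re_le_cmod[of "(1 + u) ^ M - 1"] unfolding dist_norm by linarith
    hence R: "Re ((1 + u) ^ M) \<ge> 1/2" by (simp add: abs_if split: if_splits)
    have "- \<i> * s = of_real (Im s) * (1 + u)" using t by (simp add: u_def complex_eq_iff field_simps)
    hence "(- \<i> * s) ^ M = of_real (Im s ^ M) * (1 + u) ^ M" by (simp add: power_mult_distrib)
    hence "Re ((- \<i> * s) ^ M) = Im s ^ M * Re ((1 + u) ^ M)" by simp
    also have "\<dots> \<ge> Im s ^ M * (1/2)" using R t by (intro mult_left_mono) auto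
    finally show "Re ((- \<i> * s) ^ M) \<ge> Im s ^ M / 2" by simp
  qed
qed

text \<open>
  The factor \<open>exp (- \<epsilon> * (- \<i> * s) ^ M)\<close> decays faster than any function of smaller order can grow,
  which replaces the Phragmen--Lindelof principle.
\<close>

lemma half_strip_shift:
  fixes a b T0 :: real and N :: nat and h :: "complex \<Rightarrow> complex"
  assumes ab: "a < b" and T0: "T0 > 0"
    and T1: "\<And>s. a \<le> Re s \<Longrightarrow> Re s \<le> b \<Longrightarrow> Im s \<ge> T0 \<Longrightarrow> Re ((- \<i> * s) ^ Suc N) \<ge> Im s ^ Suc N / 2"
    and hol: "h holomorphic_on {s. a \<le> Re s \<and> Re s \<le> b \<and> T0 \<le> Im s}"
    and growth: "\<And>s. a \<le> Re s \<Longrightarrow> Re s \<le> b \<Longrightarrow> T0 \<le> Im s \<Longrightarrow> norm (h s) \<le> C * exp (Im s ^ N)"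
    and inta: "set_integrable lborel {T0..} (\<lambda>t. h (Complex a t))"
    and intb: "set_integrable lborel {T0..} (\<lambda>t. h (Complex b t))"
  shows "(LINT t:{T0..}|lborel. h (Complex b t)) - (LINT t:{T0..}|lborel. h (Complex a t)) =
        \<i> * (LINT x:{a..b}|lborel. h (Complex x T0))"
proof -
  define M where "M = Suc N"
  define S where "S = {s. a \<le> Re s \<and> Re s \<le> b \<and> T0 \<le> Im s}"
  have C: "C \<ge> 0"
  proof -
    have "0 \<le> C * exp (T0 ^ N)" using growth[of "Complex a T0"] ab
      by (smt (verit) complex.sel norm_ge_zero)
    thus ?thesis by (simp add: zero_le_mult_iff)
  qed
  define k where "k = (\<lambda>\<epsilon> s. h s * exp (- of_real \<epsilon> * (- \<i> * s) ^ M))"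
  have kexp: "norm (exp (- of_real \<epsilon> * (- \<i> * s) ^ M)) \<le> exp (- \<epsilon> * Im s ^ M / 2)" if "\<epsilon> > 0" "s \<in> S" for \<epsilon> s
  proof -
    have "Re ((- \<i> * s) ^ M) \<ge> Im s ^ M / 2" using T1[of s] that by (auto simp: S_def M_def)
    hence "\<epsilon> * (Im s ^ M / 2) \<le> \<epsilon> * Re ((- \<i> * s) ^ M)" using that by (intro mult_left_mono) auto
    thus ?thesis by (simp del: mult_minus_left)
  qed
  have knorm: "norm (k \<epsilon> s) \<le> norm (h s)" if "\<epsilon> > 0" "s \<in> S" for \<epsilon> s
  proof -
    have "exp (- \<epsilon> * Im s ^ M / 2) \<le> 1" using that T0 by (auto simp: S_def)
    thus ?thesis using kexp[OF that] unfolding k_def norm_mult by (intro mult_left_le) auto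
  qed
  have khol: "k \<epsilon> holomorphic_on S" for \<epsilon>
    unfolding k_def using hol[folded S_def] by (intro holomorphic_intros)
  have kcont: "continuous_on S (k \<epsilon>)" for \<epsilon> by (rule holomorphic_on_imp_continuous_on[OF khol])
  have hcont: "continuous_on S h" by (rule holomorphic_on_imp_continuous_on[OF hol[folded S_def]])
  have cv: "continuous_on {T0..} (\<lambda>t. f (Complex x t))" if "continuous_on S f" "x = a \<or> x = b" for f :: "complex \<Rightarrow> complex" and x
    by (rule continuous_on_compose2[OF that(1)]) (use that(2) ab in \<open>auto simp: S_def intro!: continuous_intros\<close>)
  have ch: "continuous_on {a..b} (\<lambda>x. f (Complex x t))" if "continuous_on S f" "t \<ge> T0" for f :: "complex \<Rightarrow> complex" and t
    by (rule continuous_on_compose2[OF that(1)]) (use that(2) ab in \<open>auto simp: S_def intro!: continuous_intros\<close>)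
  have kint: "set_integrable lborel {T0..} (\<lambda>t. k \<epsilon> (Complex x t))" if "\<epsilon> > 0" "x = a \<or> x = b" for \<epsilon> x
  proof (rule set_integrable_continuous_bound[where g = "\<lambda>t. norm (h (Complex x t))"])
    show "set_integrable lborel {T0..} (\<lambda>t. norm (h (Complex x t)))"
      using inta intb that by (auto intro: set_integrable_norm)
    show "continuous_on {T0..} (\<lambda>t. k \<epsilon> (Complex x t))" using cv[OF kcont that(2)] .
    show "norm (k \<epsilon> (Complex x t)) \<le> norm (h (Complex x t))" if "t \<in> {T0..}" for t
      using that \<open>x = a \<or> x = b\<close> ab by (intro knorm \<open>\<epsilon> > 0\<close>) (auto simp: S_def)
  qed auto
  have step: "(LINT t:{T0..}|lborel. k \<epsilon> (Complex b t)) - (LINT t:{T0..}|lborel. k \<epsilon> (Complex a t)) =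
      \<i> * (LINT x:{a..b}|lborel. k \<epsilon> (Complex x T0))" if \<epsilon>: "\<epsilon> > 0" for \<epsilon>
  proof -
    have rect: "(LINT x:{a..b}|lborel. k \<epsilon> (Complex x T0)) + \<i> * (LINT t:{T0..T}|lborel. k \<epsilon> (Complex b t))
      - (LINT x:{a..b}|lborel. k \<epsilon> (Complex x T)) - \<i> * (LINT t:{T0..T}|lborel. k \<epsilon> (Complex a t)) = 0" if "T > T0" for T
    proof -
      have sub: "cbox (Complex a T0) (Complex b T) \<subseteq> S" by (auto simp: S_def in_cbox_complex_iff)
      have pi: "path_image (rectpath (Complex a T0) (Complex b T)) \<subseteq> cbox (Complex a T0) (Complex b T)"
        by (rule path_image_rectpath_subset_cbox) (use ab that in auto)
      have "(k \<epsilon> has_contour_integral 0) (rectpath (Complex a T0) (Complex b T))"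
        by (rule Cauchy_theorem_convex_simple[of _ "cbox (Complex a T0) (Complex b T)"])
           (use pi holomorphic_on_subset[OF khol sub] in auto)
      hence "contour_integral (rectpath (Complex a T0) (Complex b T)) (k \<epsilon>) = 0"
        by (rule contour_integral_unique)
      thus ?thesis
        by (subst (asm) contour_integral_rectpath) (use ab that continuous_on_subset[OF kcont order_trans[OF pi sub]] in auto)
    qed
    \<comment> \<open>On the top edge growth of order exp (T^N) meets damping of order exp (-
      \<epsilon> T^(N + 1) / 2), so the edge contributes nothing in the limit for every fixed
      \<epsilon>.\<close>
    have top: "((\<lambda>T. LINT x:{a..b}|lborel. k \<epsilon> (Complex x T)) \<longlongrightarrow> 0) at_top"
    proof (rule Lim_null_comparison)
      have "filterlim (\<lambda>T::real. (\<epsilon> / 2 * T + (-1)) * T ^ N) at_top at_top"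
      proof (rule filterlim_at_top_mono)
        show lin: "filterlim (\<lambda>T::real. \<epsilon> / 2 * T + (-1)) at_top at_top"
          using \<epsilon> filterlim_tendsto_add_at_top[OF tendsto_const[of "-1"] filterlim_tendsto_pos_mult_at_top[OF tendsto_const[of "\<epsilon>/2"] _ filterlim_ident]]
          by (simp add: add.commute)
        have "eventually (\<lambda>T::real. \<epsilon> / 2 * T + (-1) \<ge> 0) at_top"
          using lin by (simp only: filterlim_at_top)
        thus "eventually (\<lambda>T::real. \<epsilon> / 2 * T + (-1) \<le> (\<epsilon> / 2 * T + (-1)) * T ^ N) at_top"
          using eventually_ge_at_top[of 1]
        proof eventually_elim
          case (elim T)
          show ?case using mult_left_mono[of 1 "T ^ N" "\<epsilon> / 2 * T + (-1)"] elim one_le_power[of T N] by simp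
        qed
      qed
      hence "filterlim (\<lambda>T::real. - ((\<epsilon> / 2 * T + (-1)) * T ^ N)) at_bot at_top"
        by (simp add: filterlim_uminus_at_bot)
      hence "((\<lambda>T::real. exp (- ((\<epsilon> / 2 * T + (-1)) * T ^ N))) \<longlongrightarrow> 0) at_top"
        by (rule filterlim_compose[OF exp_at_bot])
      from tendsto_mult_right_zero[OF this, of "(b - a) * C"]
      show "((\<lambda>T::real. (b - a) * C * exp (- ((\<epsilon> / 2 * T + (-1)) * T ^ N))) \<longlongrightarrow> 0) at_top" .
      show "\<forall>\<^sub>F T in at_top. norm (LINT x:{a..b}|lborel. k \<epsilon> (Complex x T)) \<le> (b - a) * C * exp (- ((\<epsilon> / 2 * T + (-1)) * T ^ N))"
        using eventually_ge_at_top[of T0]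
      proof eventually_elim
        case (elim T)
        have "norm (LINT x:{a..b}|lborel. k \<epsilon> (Complex x T)) \<le> (LINT x:{a..b}|lborel. C * exp (- ((\<epsilon> / 2 * T + (-1)) * T ^ N)))"
        proof (rule set_integral_norm_le)
          show "set_integrable lborel {a..b} (\<lambda>x. k \<epsilon> (Complex x T))"
            by (intro borel_integrable_atLeastAtMost' ch kcont elim)
          show "set_integrable lborel {a..b} (\<lambda>x. C * exp (- ((\<epsilon> / 2 * T + (-1)) * T ^ N)))"
            by (intro borel_integrable_atLeastAtMost') auto
          fix x assume x: "x \<in> {a..b}"
          have "norm (k \<epsilon> (Complex x T)) \<le> (C * exp (T ^ N)) * exp (- \<epsilon> * T ^ M / 2)"
            unfolding k_def norm_mult using kexp[OF \<epsilon>, of "Complex x T"] growth[of "Complex x T"] x elim C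
            by (intro mult_mono) (auto simp: S_def)
          also have "\<dots> = C * exp (- ((\<epsilon> / 2 * T + (-1)) * T ^ N))"
            by (simp add: M_def algebra_simps flip: exp_add)
          finally show "norm (k \<epsilon> (Complex x T)) \<le> \<dots>" .
        qed auto
        also have "\<dots> = (b - a) * C * exp (- ((\<epsilon> / 2 * T + (-1)) * T ^ N))" using ab by (simp add: set_lebesgue_integral_def)
        finally show ?case .
      qed
    qed
    have "((\<lambda>T. (LINT x:{a..b}|lborel. k \<epsilon> (Complex x T0)) + \<i> * (LINT t:{T0..T}|lborel. k \<epsilon> (Complex b t))
      - (LINT x:{a..b}|lborel. k \<epsilon> (Complex x T)) - \<i> * (LINT t:{T0..T}|lborel. k \<epsilon> (Complex a t))) \<longlongrightarrow>
      (LINT x:{a..b}|lborel. k \<epsilon> (Complex x T0)) + \<i> * (LINT t:{T0..}|lborel. k \<epsilon> (Complex b t))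
      - 0 - \<i> * (LINT t:{T0..}|lborel. k \<epsilon> (Complex a t))) at_top"
      by (intro tendsto_intros top tendsto_set_integral_Icc_at_top kint \<epsilon>) auto
    moreover have "((\<lambda>T. (LINT x:{a..b}|lborel. k \<epsilon> (Complex x T0)) + \<i> * (LINT t:{T0..T}|lborel. k \<epsilon> (Complex b t))
      - (LINT x:{a..b}|lborel. k \<epsilon> (Complex x T)) - \<i> * (LINT t:{T0..T}|lborel. k \<epsilon> (Complex a t))) \<longlongrightarrow> 0) at_top"
      by (rule tendsto_eventually) (use eventually_gt_at_top[of T0] in eventually_elim, use rect in blast)
    ultimately have "(LINT x:{a..b}|lborel. k \<epsilon> (Complex x T0)) + \<i> * (LINT t:{T0..}|lborel. k \<epsilon> (Complex b t))
      - 0 - \<i> * (LINT t:{T0..}|lborel. k \<epsilon> (Complex a t)) = 0"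
      using tendsto_unique[of "at_top :: real filter"] by fastforce
    hence "\<i> * ((LINT t:{T0..}|lborel. k \<epsilon> (Complex b t)) - (LINT t:{T0..}|lborel. k \<epsilon> (Complex a t))) =
       - (LINT x:{a..b}|lborel. k \<epsilon> (Complex x T0))" by (simp add: algebra_simps)
    from arg_cong[OF this, of "\<lambda>x. - \<i> * x"] show ?thesis by (simp flip: mult.assoc)
  qed
  have elim: "(\<lambda>n. k (1 / real (Suc n)) s) \<longlonglongrightarrow> h s" for s
  proof -
    have "(\<lambda>n. h s * exp (- of_real (1 / real (Suc n)) * (- \<i> * s) ^ M)) \<longlonglongrightarrow> h s * exp (- of_real 0 * (- \<i> * s) ^ M)"
      by (intro tendsto_intros LIMSEQ_Suc lim_const_over_n)
    thus ?thesis by (simp add: k_def)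
  qed
  \<comment> \<open>Only now does \<epsilon> tend to 0. The damping factor has modulus at most 1 on
    the half strip, so |h| itself, integrable on both vertical edges, dominates.\<close>
  have lim_ver: "(\<lambda>n. LINT t:{T0..}|lborel. k (1 / real (Suc n)) (Complex x t)) \<longlonglongrightarrow> (LINT t:{T0..}|lborel. h (Complex x t))"
    if "x = a \<or> x = b" for x
  proof (rule set_integral_dominated_convergence[where g = "\<lambda>t. norm (h (Complex x t))"])
    show "set_integrable lborel {T0..} (\<lambda>t. norm (h (Complex x t)))"
      using inta intb that by (auto intro: set_integrable_norm)
    show "norm (k (1 / real (Suc n)) (Complex x t)) \<le> norm (h (Complex x t))" if "t \<in> {T0..}" for n t
      using that \<open>x = a \<or> x = b\<close> ab by (intro knorm) (auto simp: S_def)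
  qed (use cv[OF kcont that] cv[OF hcont that] elim in auto)
  have lim_hor: "(\<lambda>n. LINT x:{a..b}|lborel. k (1 / real (Suc n)) (Complex x T0)) \<longlonglongrightarrow> (LINT x:{a..b}|lborel. h (Complex x T0))"
  proof (rule set_integral_dominated_convergence[where g = "\<lambda>x. norm (h (Complex x T0))"])
    show "set_integrable lborel {a..b} (\<lambda>x. norm (h (Complex x T0)))"
      by (intro set_integrable_norm borel_integrable_atLeastAtMost' ch hcont) auto
    show "norm (k (1 / real (Suc n)) (Complex x T0)) \<le> norm (h (Complex x T0))" if "x \<in> {a..b}" for n x
      using that ab by (intro knorm) (auto simp: S_def)
  qed (use ch[OF kcont] ch[OF hcont] elim in auto)
  show "(LINT t:{T0..}|lborel. h (Complex b t)) - (LINT t:{T0..}|lborel. h (Complex a t)) =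
      \<i> * (LINT x:{a..b}|lborel. h (Complex x T0))"
  proof (rule LIMSEQ_unique)
    show "(\<lambda>n. \<i> * (LINT x:{a..b}|lborel. k (1 / real (Suc n)) (Complex x T0))) \<longlonglongrightarrow> \<i> * (LINT x:{a..b}|lborel. h (Complex x T0))"
      by (intro tendsto_intros lim_hor)
    have "(\<lambda>n. (LINT t:{T0..}|lborel. k (1 / real (Suc n)) (Complex b t)) - (LINT t:{T0..}|lborel. k (1 / real (Suc n)) (Complex a t)))
      \<longlonglongrightarrow> (LINT t:{T0..}|lborel. h (Complex b t)) - (LINT t:{T0..}|lborel. h (Complex a t))"
      by (intro tendsto_intros lim_ver) auto
    thus "(\<lambda>n. \<i> * (LINT x:{a..b}|lborel. k (1 / real (Suc n)) (Complex x T0)))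
      \<longlonglongrightarrow> (LINT t:{T0..}|lborel. h (Complex b t)) - (LINT t:{T0..}|lborel. h (Complex a t))"
      by (subst step[symmetric]) auto
  qed
qed

section \<open>Stirling's formula on vertical lines\<close>

text \<open>The error of Ln (1 + a / w) against a / w is quadratic in 1 / w and therefore survives
  multiplication by w. The lemma serves for the limit in the Gamma product, for replacing Ln (A +
  \<i> \<tau>) by Ln (\<i> \<tau>) in Stirling's formula, and later for
  \<open>phase\<close>.\<close>

lemma tendsto_add_mult_Ln_one_plus:
  fixes a b :: complex
  shows "((\<lambda>w. (w + b) * Ln (1 + a / w)) \<longlongrightarrow> a) at_infinity"
proof -
  have inv: "((\<lambda>w::complex. c / w) \<longlongrightarrow> 0) at_infinity" for c :: complex
    using tendsto_divide_0[OF tendsto_const filterlim_ident] by blast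
  have ev: "eventually (\<lambda>w. norm (a / w) < 1/2 \<and> w \<noteq> 0) at_infinity"
    using order_tendstoD(2)[OF tendsto_norm[OF inv[of a]], of "1/2"]
    by (auto intro!: eventually_conj eventually_not_equal_at_infinity)
  have L0: "((\<lambda>w. Ln (1 + a / w)) \<longlongrightarrow> 0) at_infinity"
    using tendsto_Ln[OF tendsto_add[OF tendsto_const inv[of a]], of 1] by simp
  have "((\<lambda>w. w * Ln (1 + a / w) - a) \<longlongrightarrow> 0) at_infinity"
  proof (rule Lim_null_comparison)
    have "((\<lambda>w::complex. norm (2 * norm a ^ 2 / w)) \<longlongrightarrow> 0) at_infinity"
      using tendsto_norm_zero[OF inv[of "2 * norm a ^ 2"]] by simp
    thus "((\<lambda>w::complex. 2 * norm a ^ 2 / norm w) \<longlongrightarrow> 0) at_infinity"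
      by (simp add: norm_divide norm_mult norm_power)
    show "eventually (\<lambda>w. norm (w * Ln (1 + a / w) - a) \<le> 2 * norm a ^ 2 / norm w) at_infinity"
      using ev
    proof eventually_elim
      case (elim w)
      have "norm (Ln (1 + a / w) - a / w) \<le> norm (a / w) ^ 2 / (1 - norm (a / w))"
        by (rule Ln_approx_linear) (use elim in auto)
      also have "\<dots> \<le> norm (a / w) ^ 2 / (1/2)"
        using elim by (intro divide_left_mono) auto
      finally have *: "norm (Ln (1 + a / w) - a / w) \<le> 2 * norm (a / w) ^ 2" by simp
      have "w * Ln (1 + a / w) - a = w * (Ln (1 + a / w) - a / w)"
        using elim by (simp add: field_simps)
      also have "norm \<dots> \<le> norm w * (2 * norm (a / w) ^ 2)"
        unfolding norm_mult using * by (intro mult_left_mono) auto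
      also have "\<dots> = 2 * norm a ^ 2 / norm w"
        using elim by (simp add: norm_divide field_simps power2_eq_square)
      finally show ?case .
    qed
  qed
  from tendsto_add[OF tendsto_add[OF this tendsto_const[of a]] tendsto_mult[OF tendsto_const[of b] L0]]
  show ?thesis by (simp add: algebra_simps)
qed

text \<open>The summand of Gudermann's series: summed over w = z + n it gives the remainder of
  Stirling's formula for the logarithm of \<open>Gamma z\<close>.\<close>

definition stirling_term :: "complex \<Rightarrow> complex" where
  "stirling_term w = (w + 1/2) * Ln (1 + 1 / w) - 1"

text \<open>With v = 1 / w the shift by 1/2 removes the term of first order: (1 / v + 1/2) (v - v^2
  / 2) = 1 - v^2 / 4. What remains is of order v^2, so the series over w = z + n converges.\<close>

lemma norm_stirling_term_le:
  assumes w: "norm w \<ge> 2"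
  shows "norm (stirling_term w) \<le> 3 / norm w ^ 2"
proof -
  define v where "v = 1 / w"
  have v: "norm v \<le> 1/2" "v \<noteq> 0" using w by (auto simp: v_def norm_divide divide_le_eq)
  define \<phi> where "\<phi> = (\<lambda>v. Ln (1 + v) - v + v ^ 2 / 2 :: complex)"
  have pos: "1 + x \<notin> \<real>\<^sub>\<le>\<^sub>0" if "norm x \<le> 1/2" for x :: complex
  proof -
    have "\<bar>Re x\<bar> \<le> 1/2" using abs_Re_le_cmod[of x] that by linarith
    thus ?thesis by (auto simp: complex_nonpos_Reals_iff)
  qed
  have "norm (\<phi> v - \<phi> 0) \<le> 2 * norm v ^ 2 * norm (v - 0)"
  proof (rule field_differentiable_bound[of "cball 0 (norm v)" _ "\<lambda>x. inverse (1 + x) - 1 + x"])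
    fix x :: complex assume x: "x \<in> cball 0 (norm v)"
    hence x': "norm x \<le> 1/2" "norm x \<le> norm v" using v by auto
    have nz: "1 + x \<noteq> 0"
    proof
      assume "1 + x = 0"
      thus False using pos[OF x'(1)] by simp
    qed
    show "(\<phi> has_field_derivative inverse (1 + x) - 1 + x) (at x within cball 0 (norm v))"
      unfolding \<phi>_def by (rule derivative_eq_intros refl pos x')+ (use nz in auto)
    have "inverse (1 + x) - 1 + x = x ^ 2 / (1 + x)"
      using nz by (simp add: field_simps power2_eq_square)
    also have "norm \<dots> \<le> norm v ^ 2 / (1/2)"
    proof -
      have "1/2 \<le> norm (1 + x)" using norm_triangle_ineq2[of 1 "-x"] x' by simp
      moreover have "norm x ^ 2 \<le> norm v ^ 2" using x' by (intro power_mono) auto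
      ultimately show ?thesis unfolding norm_divide norm_power by (intro frac_le) auto
    qed
    finally show "norm (inverse (1 + x) - 1 + x) \<le> 2 * norm v ^ 2" by simp
  qed auto
  hence \<phi>: "norm (\<phi> v) \<le> 2 * norm v ^ 3" by (simp add: \<phi>_def power2_eq_square power3_eq_cube)
  have "stirling_term w = (1 / v + 1/2) * (\<phi> v + v - v^2 / 2) - 1"
    by (simp add: stirling_term_def \<phi>_def v_def)
  also have "\<dots> = (1 / v + 1/2) * \<phi> v - v ^ 2 / 4"
    using v(2) by (simp add: field_simps power2_eq_square)
  also have "norm \<dots> \<le> (1 / norm v + 1/2) * (2 * norm v ^ 3) + norm v ^ 2 / 4"
  proof -
    have "norm (1 / v + 1/2) \<le> 1 / norm v + 1/2"
      using norm_triangle_ineq[of "1/v" "1/2"] by (simp add: norm_divide)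
    hence "norm ((1 / v + 1/2) * \<phi> v) \<le> (1 / norm v + 1/2) * (2 * norm v ^ 3)"
      unfolding norm_mult using \<phi> by (intro mult_mono) auto
    thus ?thesis
      using norm_triangle_ineq4[of "(1 / v + 1/2) * \<phi> v" "v^2/4"] by (simp add: norm_divide norm_power)
  qed
  also have "\<dots> = norm v ^ 2 * (2 + norm v + 1/4)"
    using v(2) by (simp add: field_simps power2_eq_square power3_eq_cube)
  also have "\<dots> \<le> norm v ^ 2 * 3" using v by (intro mult_left_mono) auto
  finally show ?thesis by (simp add: v_def norm_divide power_divide)
qed

lemma Ln_one_plus_inverse:
  assumes "Im w > 0"
  shows "Ln (1 + 1 / w) = Ln (w + 1) - Ln w"
proof (rule Ln_unique)
  have nz: "w \<noteq> 0" "w + 1 \<noteq> 0" using assms by (auto simp: complex_eq_iff)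
  show "exp (Ln (w + 1) - Ln w) = 1 + 1 / w" using nz by (simp add: exp_diff field_simps)
  have "0 < Im (Ln w) \<and> Im (Ln w) < pi" "0 < Im (Ln (w+1)) \<and> Im (Ln (w+1)) < pi"
    using Im_Ln_pos_lt[OF nz(1)] Im_Ln_pos_lt[OF nz(2)] assms by auto
  thus "- pi < Im (Ln (w + 1) - Ln w)" "Im (Ln (w + 1) - Ln w) \<le> pi" by auto
qed

text \<open>The sum telescopes except for the terms - Ln (z + n). Exponentiating turns these into
  the Pochhammer symbol, so no logarithm of Gamma has to be chosen.\<close>

lemma exp_sum_stirling_term:
  assumes "Im z > 0"
  shows "exp (\<Sum>n<N. stirling_term (z + of_nat n)) =
    exp ((z + of_nat N - 1/2) * Ln (z + of_nat N) - (z - 1/2) * Ln z - of_nat N) / pochhammer z N"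
proof (induction N)
  case (Suc N)
  let ?w = "z + of_nat N"
  have nz: "?w \<noteq> 0" using assms by (auto simp: complex_eq_iff)
  have "stirling_term ?w = (?w + 1/2) * (Ln (?w + 1) - Ln ?w) - 1"
    using Ln_one_plus_inverse[of ?w] assms by (simp add: stirling_term_def)
  hence "exp (stirling_term ?w) =
     exp ((?w + 1 - 1/2) * Ln (?w + 1) - (?w - 1/2) * Ln ?w - 1 - Ln ?w)"
    by (intro arg_cong[of _ _ exp]) (simp add: algebra_simps)
  also have "\<dots> = exp ((?w + 1 - 1/2) * Ln (?w + 1) - (?w - 1/2) * Ln ?w - 1) / ?w"
    using nz by (subst exp_diff) auto
  finally have "exp (stirling_term ?w) = exp ((?w + 1 - 1/2) * Ln (?w + 1) - (?w - 1/2) * Ln ?w - 1) / ?w" .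
  hence "exp (\<Sum>n<Suc N. stirling_term (z + of_nat n)) =
      exp ((?w - 1/2) * Ln ?w - (z - 1/2) * Ln z - of_nat N) / pochhammer z N *
      (exp ((?w + 1 - 1/2) * Ln (?w + 1) - (?w - 1/2) * Ln ?w - 1) / ?w)"
    using Suc.IH by (simp add: exp_add)
  also have "\<dots> = (exp ((?w - 1/2) * Ln ?w - (z - 1/2) * Ln z - of_nat N) *
      exp ((?w + 1 - 1/2) * Ln (?w + 1) - (?w - 1/2) * Ln ?w - 1)) / pochhammer z (Suc N)"
    by (simp add: pochhammer_Suc)
  also have "exp ((?w - 1/2) * Ln ?w - (z - 1/2) * Ln z - of_nat N) *
      exp ((?w + 1 - 1/2) * Ln (?w + 1) - (?w - 1/2) * Ln ?w - 1) =
      exp ((z + of_nat (Suc N) - 1/2) * Ln (z + of_nat (Suc N)) - (z - 1/2) * Ln z - of_nat (Suc N))"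
    unfolding exp_add[symmetric] by (intro arg_cong[of _ _ exp]) (simp add: algebra_simps)
  finally show ?case .
qed auto

lemma norm_ge_Im_2: "Im z \<ge> 2 \<Longrightarrow> norm (z + of_nat n) \<ge> 2"
  using abs_Im_le_cmod[of "z + of_nat n"] by simp

lemma summable_inverse_shifted_square: "summable (\<lambda>n. 3 / ((real n + c)\<^sup>2 + 1))"
proof (rule summable_comparison_test_ev)
  show "summable (\<lambda>n. 12 * inverse (real n ^ 2))"
    by (intro summable_mult inverse_power_summable) auto
  show "eventually (\<lambda>n. norm (3 / ((real n + c)\<^sup>2 + 1)) \<le> 12 * inverse (real n ^ 2)) sequentially"
    using eventually_ge_at_top[of "nat \<lceil>2 * \<bar>c\<bar>\<rceil> + 1"]
  proof eventually_elim
    case (elim n)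
    hence n: "real n \<ge> 2 * \<bar>c\<bar>" "n > 0" by linarith+
    hence "real n / 2 \<le> real n + c" by linarith
    hence "(real n / 2)\<^sup>2 \<le> (real n + c)\<^sup>2" by (intro power_mono) auto
    hence "real n ^ 2 / 4 \<le> (real n + c)\<^sup>2 + 1" by (simp add: power_divide)
    hence "3 / ((real n + c)\<^sup>2 + 1) \<le> 3 / (real n ^ 2 / 4)" using n(2) by (intro divide_left_mono mult_pos_pos) (auto simp: add_nonneg_pos)
    thus ?case by (simp add: field_simps)
  qed
qed

text \<open>The bound involves z only through its real part. Along a vertical line it is therefore
  uniform, which lets Tannery's theorem take the limit Im z -> infinity inside the series.\<close>

lemma norm_stirling_term_shift_le:
  assumes "Im z \<ge> 2"
  shows "norm (stirling_term (z + of_nat n)) \<le> 3 / ((real n + Re z)\<^sup>2 + 1)"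
proof -
  have "norm (stirling_term (z + of_nat n)) \<le> 3 / norm (z + of_nat n) ^ 2"
    by (intro norm_stirling_term_le norm_ge_Im_2 assms)
  also have "\<dots> \<le> 3 / ((real n + Re z)\<^sup>2 + 1)"
  proof (rule divide_left_mono)
    have "1 \<le> (Im z)\<^sup>2" using assms by (simp add: power2_eq_square) (smt (verit) mult_less_cancel_left1)
    thus "(real n + Re z)\<^sup>2 + 1 \<le> norm (z + of_nat n) ^ 2" by (simp add: cmod_power2 add.commute)
    show "0 < cmod (z + of_nat n) ^ 2 * ((real n + Re z)\<^sup>2 + 1)"
      using norm_ge_Im_2[OF assms, of n] by (intro mult_pos_pos) (auto simp: add_nonneg_pos)
  qed auto
  finally show ?thesis .
qed

lemma summable_stirling_term:
  assumes "Im z \<ge> 2"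
  shows "summable (\<lambda>n. stirling_term (z + of_nat n))"
  by (rule summable_comparison_test'[OF summable_inverse_shifted_square])
     (use norm_stirling_term_shift_le[OF assms] in blast)

text \<open>The constant is the same for all \<open>z\<close>; it is identified as \<open>sqrt (2 * pi)\<close> further below.\<close>

lemma Gamma_eq_stirling_series:
  obtains \<kappa> :: real where "\<kappa> > 0"
    "\<And>z. Im z \<ge> 2 \<Longrightarrow> Gamma z = of_real \<kappa> * exp ((z - 1/2) * Ln z - z + (\<Sum>n. stirling_term (z + of_nat n)))"
proof -
  \<comment> \<open>\<open>c\<close> collects the factors of \<open>Gamma_series\<close> that do not
    involve z. Its limit is \<open>K z\<close> for every z with Im z \<ge> 2, hence \<open>K\<close>
    is constant there.\<close>
  define c where "c = (\<lambda>N::nat. exp ((real N + 1/2) * ln (real N) - real N) / fact N)"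
  define K where "K = (\<lambda>z. exp (\<Sum>n. stirling_term (z + of_nat n)) / (Gamma z * exp (z - (z - 1/2) * Ln z)))"
  have nonpos: "z \<notin> \<int>\<^sub>\<le>\<^sub>0" if "Im z \<ge> 2" for z :: complex
    using that by (auto elim!: nonpos_Ints_cases)
  have lim: "(\<lambda>N. complex_of_real (c N)) \<longlonglongrightarrow> K z" if z: "Im z \<ge> 2" for z
  proof -
    define r where "r = (\<lambda>N::nat. exp ((of_nat N + (z - 1/2)) * Ln (1 + z / of_nat N) - z) * (z + of_nat N) / of_nat N)"
    have eq: "exp (\<Sum>n<N. stirling_term (z + of_nat n)) =
        Gamma_series z N * of_real (c N) * r N * exp (z - (z - 1/2) * Ln z)" if N: "N > 0" for N
    proof -
      have zN: "z + of_nat N \<noteq> 0" using z by (auto simp: complex_eq_iff)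
      have p: "pochhammer z N \<noteq> 0" using nonpos[OF z] by (auto simp: pochhammer_eq_0_iff)
      have "z + of_nat N = of_nat N * (1 + z / of_nat N)" using N by (simp add: field_simps)
      moreover have "1 + z / of_nat N \<noteq> 0" using N zN by (simp add: field_simps)
      ultimately have Ln: "Ln (z + of_nat N) = of_real (ln (real N)) + Ln (1 + z / of_nat N)"
        using Ln_times_of_nat[of N "1 + z / of_nat N"] N by simp
      have "Gamma_series z N * of_real (c N) * r N * exp (z - (z - 1/2) * Ln z) =
        (exp (z * of_real (ln (of_nat N))) * exp ((of_nat N + 1/2) * of_real (ln (real N)) - of_nat N) *
         exp ((of_nat N + (z - 1/2)) * Ln (1 + z / of_nat N) - z) * exp (z - (z - 1/2) * Ln z) / of_nat N) / pochhammer z N"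
      proof -
        have gen: "F * e1 / (P * w) * (e2 / F) * (e3 * w / n) * e4 = (e1 * e2 * e3 * e4 / n) / P"
          if "F \<noteq> 0" "w \<noteq> 0" for F e1 P w e2 e3 e4 n :: complex
          using that by (simp add: mult_ac)
        have c': "complex_of_real (c N) = exp ((of_nat N + 1/2) * of_real (ln (real N)) - of_nat N) / fact N"
          by (simp add: c_def flip: exp_of_real)
        show ?thesis
          unfolding Gamma_series_def c' r_def Suc_eq_plus1[symmetric] pochhammer_Suc
          by (rule gen) (use zN in auto)
      qed
      also have "exp (z * of_real (ln (of_nat N))) * exp ((of_nat N + 1/2) * of_real (ln (real N)) - of_nat N) *
         exp ((of_nat N + (z - 1/2)) * Ln (1 + z / of_nat N) - z) * exp (z - (z - 1/2) * Ln z) / of_nat N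
         = exp ((z + of_nat N - 1/2) * Ln (z + of_nat N) - (z - 1/2) * Ln z - of_nat N)"
      proof -
        have expN: "exp (- complex_of_real (ln (real N))) = inverse (of_nat N)"
          using N exp_of_real[of "ln (real N)", where 'a = complex] by (simp add: exp_minus)
        define l where "l = complex_of_real (ln (real N))"
        define L where "L = Ln (1 + z / of_nat N)"
        have "exp (z * l) * exp ((of_nat N + 1/2) * l - of_nat N) * exp ((of_nat N + (z - 1/2)) * L - z) *
            exp (z - (z - 1/2) * Ln z) * exp (- l) =
            exp ((z + of_nat N - 1/2) * (l + L) - (z - 1/2) * Ln z - of_nat N)"
          unfolding exp_add[symmetric] by (intro arg_cong[of _ _ exp]) (simp add: algebra_simps)
        also have "exp (- l) = inverse (of_nat N)" unfolding l_def by (rule expN)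
        finally show ?thesis unfolding Ln l_def L_def divide_inverse[of _ "of_nat N :: complex"] .
      qed
      finally show ?thesis using exp_sum_stirling_term[of z N] z by simp
    qed
    have r: "r \<longlonglongrightarrow> 1"
    proof -
      have A: "(\<lambda>N::nat. (of_nat N + (z - 1/2)) * Ln (1 + z / of_nat N)) \<longlonglongrightarrow> z"
        by (rule filterlim_compose[OF tendsto_add_mult_Ln_one_plus tendsto_of_nat])
      have B: "(\<lambda>N::nat. z / of_nat N) \<longlonglongrightarrow> 0" by (rule lim_const_over_n)
      have "(\<lambda>N::nat. exp ((of_nat N + (z - 1/2)) * Ln (1 + z / of_nat N) - z) * (z / of_nat N + 1)) \<longlonglongrightarrow> exp (z - z) * (0 + 1)"
        by (intro tendsto_intros A B)
      hence "(\<lambda>N::nat. exp ((of_nat N + (z - 1/2)) * Ln (1 + z / of_nat N) - z) * (z / of_nat N + 1)) \<longlonglongrightarrow> 1" by simp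
      thus ?thesis
        by (rule Lim_transform_eventually)
           (use eventually_gt_at_top[of 0] in eventually_elim, simp add: r_def field_simps)
    qed
    have "(\<lambda>N. exp (\<Sum>n<N. stirling_term (z + of_nat n)) / (Gamma_series z N * r N * exp (z - (z - 1/2) * Ln z)))
      \<longlonglongrightarrow> exp (\<Sum>n. stirling_term (z + of_nat n)) / (Gamma z * 1 * exp (z - (z - 1/2) * Ln z))"
      by (intro tendsto_intros r summable_LIMSEQ summable_stirling_term z)
         (use Gamma_eq_zero_iff nonpos[OF z] in auto)
    hence "(\<lambda>N. exp (\<Sum>n<N. stirling_term (z + of_nat n)) / (Gamma_series z N * r N * exp (z - (z - 1/2) * Ln z))) \<longlonglongrightarrow> K z"
      by (simp add: K_def)
    thus ?thesis
    proof (rule Lim_transform_eventually)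
      show "\<forall>\<^sub>F N in sequentially. exp (\<Sum>n<N. stirling_term (z + of_nat n)) / (Gamma_series z N * r N * exp (z - (z - 1/2) * Ln z)) = complex_of_real (c N)"
        using eventually_gt_at_top[of 0]
      proof eventually_elim
        case (elim N)
        have "exp (\<Sum>n<N. stirling_term (z + of_nat n)) \<noteq> 0" by simp
        hence "Gamma_series z N * of_real (c N) * r N * exp (z - (z - 1/2) * Ln z) \<noteq> 0" using eq[OF elim] by simp
        thus ?case unfolding eq[OF elim] by simp
      qed
    qed
  qed
  define \<kappa> where "\<kappa> = Re (K (2 * \<i>))"
  have "(\<lambda>N. Re (complex_of_real (c N))) \<longlonglongrightarrow> \<kappa>"
    unfolding \<kappa>_def by (intro tendsto_Re lim) auto
  hence c\<kappa>: "c \<longlonglongrightarrow> \<kappa>" by simp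
  have K: "K z = of_real \<kappa>" if "Im z \<ge> 2" for z
    using LIMSEQ_unique[OF lim[OF that] tendsto_of_real[OF c\<kappa>]] .
  have "\<kappa> \<ge> 0"
    by (rule tendsto_lowerbound[OF c\<kappa>]) (auto simp: c_def)
  moreover have "\<kappa> \<noteq> 0"
  proof -
    have "K (2 * \<i>) \<noteq> 0" using nonpos[of "2 * \<i>"] by (simp add: K_def Gamma_eq_zero_iff)
    thus ?thesis using K[of "2 * \<i>"] by simp
  qed
  ultimately have pos: "\<kappa> > 0" by simp
  show ?thesis
  proof (rule that[of "1 / \<kappa>"])
    fix z :: complex assume z: "Im z \<ge> 2"
    have "Gamma z \<noteq> 0" using nonpos[OF z] by (simp add: Gamma_eq_zero_iff)
    moreover have "exp (z - (z - 1/2) * Ln z) = inverse (exp ((z - 1/2) * Ln z - z))"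
      by (simp flip: exp_minus)
    ultimately show "Gamma z = of_real (1 / \<kappa>) * exp ((z - 1/2) * Ln z - z + (\<Sum>n. stirling_term (z + of_nat n)))"
      using K[OF z] pos unfolding K_def exp_add by (simp add: divide_simps mult_ac)
  qed (use pos in auto)
qed

lemma norm_Gamma_half_line:
  "norm (Gamma (Complex (1/2) t)) ^ 2 = pi / cosh (pi * t)"
proof -
  have "Gamma (Complex (1/2) t) * Gamma (1 - Complex (1/2) t) = of_real pi / sin (of_real pi * Complex (1/2) t)"
    by (rule Gamma_reflection_complex)
  also have "1 - Complex (1/2) t = cnj (Complex (1/2) t)" by (simp add: complex_eq_iff)
  also have "of_real pi * Complex (1/2) t = of_real pi / 2 + \<i> * of_real (pi * t)"
    by (simp add: complex_eq_iff)
  also have "sin \<dots> = cos (\<i> * of_real (pi * t))" by (simp add: sin_add)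
  also have "\<dots> = of_real (cosh (pi * t))"
    by (simp add: cos_exp_eq cosh_def scaleR_conv_of_real exp_minus flip: mult.assoc exp_of_real)
  finally have "Gamma (Complex (1/2) t) * cnj (Gamma (Complex (1/2) t)) = of_real (pi / cosh (pi * t))"
    by (simp add: cnj_Gamma)
  thus ?thesis unfolding complex_norm_square[symmetric] by (simp only: of_real_eq_iff flip: of_real_power)
qed

text \<open>The approximation is written with ln \<tau> + \<i> pi / 2, the logarithm of \<i> \<tau>,
  and not with that of A + \<i> \<tau>: the exponents of several Gamma factors can then be added as
  polynomials in \<tau> and ln \<tau>.\<close>

lemma Stirling_vertical:
  fixes A :: complex
  shows "((\<lambda>\<tau>. Gamma (A + \<i> * of_real \<tau>) /
     (of_real (sqrt (2 * pi)) * exp ((\<i> * of_real \<tau> + A - 1/2) * (of_real (ln \<tau>) + \<i> * of_real (pi/2)) - \<i> * of_real \<tau>)))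
     \<longlongrightarrow> 1) at_top"
proof -
  obtain \<kappa> :: real where \<kappa>: "\<kappa> > 0"
    "\<And>z. Im z \<ge> 2 \<Longrightarrow> Gamma z = of_real \<kappa> * exp ((z - 1/2) * Ln z - z + (\<Sum>n. stirling_term (z + of_nat n)))"
    using Gamma_eq_stirling_series by metis
  define E where "E = (\<lambda>A \<tau>. exp ((\<i> * of_real \<tau> + A - 1/2) * (of_real (ln \<tau>) + \<i> * of_real (pi/2)) - \<i> * of_real \<tau>))"
  have main: "((\<lambda>\<tau>. Gamma (A + \<i> * of_real \<tau>) / E A \<tau>) \<longlongrightarrow> of_real \<kappa>) at_top" for A
  proof -
    have inf: "filterlim (\<lambda>\<tau>. \<i> * complex_of_real \<tau>) at_infinity at_top"
    proof -
      have "filterlim (\<lambda>\<tau>. norm (\<i> * complex_of_real \<tau>)) at_top at_top"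
        by (simp add: norm_mult filterlim_abs_real)
      thus ?thesis by (simp only: filterlim_at_infinity_conv_norm_at_top)
    qed
    have R: "((\<lambda>\<tau>. \<Sum>n. stirling_term (A + \<i> * of_real \<tau> + of_nat n)) \<longlongrightarrow> (\<Sum>n::nat. 0)) at_top"
    proof -
      have "((\<lambda>\<tau>. stirling_term (A + \<i> * of_real \<tau> + of_nat n)) \<longlongrightarrow> 0) at_top" for n
      proof -
        have "filterlim (\<lambda>\<tau>. A + of_nat n + \<i> * of_real \<tau>) at_infinity at_top"
          by (intro tendsto_add_filterlim_at_infinity[OF tendsto_const inf])
        hence "((\<lambda>\<tau>. (A + of_nat n + \<i> * of_real \<tau> + 1/2) * Ln (1 + 1 / (A + of_nat n + \<i> * of_real \<tau>)) - 1) \<longlongrightarrow> 1 - 1) at_top"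
          by (intro tendsto_diff tendsto_const filterlim_compose[OF tendsto_add_mult_Ln_one_plus[where b="1/2"]])
        thus ?thesis by (simp add: stirling_term_def add_ac)
      qed
      moreover have "eventually (\<lambda>(n,\<tau>). norm (stirling_term (A + \<i> * of_real \<tau> + of_nat n)) \<le> 3 / ((real n + Re A)\<^sup>2 + 1)) (at_top \<times>\<^sub>F at_top)"
      proof -
        have "eventually (\<lambda>\<tau>. \<tau> \<ge> 2 - Im A) at_top" by (rule eventually_ge_at_top)
        hence "eventually (\<lambda>(n::nat, \<tau>). \<tau> \<ge> 2 - Im A) (at_top \<times>\<^sub>F at_top)"
          by (subst eventually_prod2) auto
        thus ?thesis
        proof eventually_elim
          case (elim x)
          thus ?case
            using norm_stirling_term_shift_le[of "A + \<i> * of_real (snd x)" "fst x"] by (cases x) simp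
        qed
      qed
      ultimately show ?thesis
        using tannerys_theorem[of "\<lambda>n \<tau>. stirling_term (A + \<i> * of_real \<tau> + of_nat n)" "\<lambda>_. 0" at_top "\<lambda>n. 3 / ((real n + Re A)\<^sup>2 + 1)"]
          summable_inverse_shifted_square by auto
    qed
    have L: "((\<lambda>\<tau>. (\<i> * of_real \<tau> + (A - 1/2)) * Ln (1 + A / (\<i> * of_real \<tau>))) \<longlongrightarrow> A) at_top"
      by (rule filterlim_compose[OF tendsto_add_mult_Ln_one_plus inf])
    have "((\<lambda>\<tau>. of_real \<kappa> * exp ((\<i> * of_real \<tau> + (A - 1/2)) * Ln (1 + A / (\<i> * of_real \<tau>)) - A +
        (\<Sum>n. stirling_term (A + \<i> * of_real \<tau> + of_nat n)))) \<longlongrightarrow> of_real \<kappa> * exp (A - A + (\<Sum>n::nat. 0))) at_top"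
      by (intro tendsto_intros R L)
    hence "((\<lambda>\<tau>. of_real \<kappa> * exp ((\<i> * of_real \<tau> + (A - 1/2)) * Ln (1 + A / (\<i> * of_real \<tau>)) - A +
        (\<Sum>n. stirling_term (A + \<i> * of_real \<tau> + of_nat n)))) \<longlongrightarrow> of_real \<kappa>) at_top" by simp
    thus ?thesis
    proof (rule Lim_transform_eventually)
      show "\<forall>\<^sub>F \<tau> in at_top. of_real \<kappa> * exp ((\<i> * of_real \<tau> + (A - 1/2)) * Ln (1 + A / (\<i> * of_real \<tau>)) - A +
        (\<Sum>n. stirling_term (A + \<i> * of_real \<tau> + of_nat n))) = Gamma (A + \<i> * of_real \<tau>) / E A \<tau>"
        using eventually_ge_at_top[of "max 2 (2 - Im A)"] eventually_gt_at_top[of "norm A"]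
      proof eventually_elim
        case (elim \<tau>)
        define h where "h = A / (\<i> * of_real \<tau>)"
        have nh: "norm h < 1" using elim by (simp add: h_def norm_divide norm_mult)
        hence Reh: "Re (1 + h) > 0" using abs_Re_le_cmod[of h] by simp
        hence h0: "1 + h \<noteq> 0" by (metis less_irrefl zero_complex.sel(1))
        have Imh: "\<bar>Im (Ln (1 + h))\<bar> < pi / 2" using Re_Ln_pos_lt[OF h0] Reh by simp
        have "A + \<i> * of_real \<tau> = (of_real \<tau> * \<i>) * (1 + h)" using elim by (simp add: h_def field_simps)
        also have "Ln \<dots> = Ln (of_real \<tau> * \<i>) + Ln (1 + h)"
        proof (rule Ln_times_simple)
          have "Im (Ln (of_real \<tau> * \<i>)) = pi / 2" using elim Ln_times_of_real[of \<tau> \<i>] by simp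
          thus "- pi < Im (Ln (of_real \<tau> * \<i>)) + Im (Ln (1 + h))" "Im (Ln (of_real \<tau> * \<i>)) + Im (Ln (1 + h)) \<le> pi"
            using Imh by linarith+
        qed (use elim h0 in auto)
        also have "Ln (of_real \<tau> * \<i>) = of_real (ln \<tau>) + \<i> * of_real (pi/2)"
          using elim Ln_times_of_real[of \<tau> \<i>] by (simp add: Ln_of_real)
        finally have Ln: "Ln (A + \<i> * of_real \<tau>) = of_real (ln \<tau>) + \<i> * of_real (pi/2) + Ln (1 + h)" .
        have "Gamma (A + \<i> * of_real \<tau>) = of_real \<kappa> * exp ((A + \<i> * of_real \<tau> - 1/2) * Ln (A + \<i> * of_real \<tau>) - (A + \<i> * of_real \<tau>) + (\<Sum>n. stirling_term (A + \<i> * of_real \<tau> + of_nat n)))"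
          by (rule \<kappa>(2)) (use elim in auto)
        also have "(A + \<i> * of_real \<tau> - 1/2) * Ln (A + \<i> * of_real \<tau>) - (A + \<i> * of_real \<tau>) =
            ((\<i> * of_real \<tau> + A - 1/2) * (of_real (ln \<tau>) + \<i> * of_real (pi/2)) - \<i> * of_real \<tau>) + ((\<i> * of_real \<tau> + (A - 1/2)) * Ln (1 + h) - A)"
          unfolding Ln by (simp add: algebra_simps)
        finally show ?case unfolding E_def h_def by (simp add: exp_add exp_diff)
      qed
    qed
  qed
  \<comment> \<open>The constant does not depend on A, so the exact modulus on the line A = 1/2
    determines it.\<close>
  have "((\<lambda>\<tau>. norm (Gamma (1/2 + \<i> * of_real \<tau>) / E (1/2) \<tau>) ^ 2) \<longlongrightarrow> norm (complex_of_real \<kappa>) ^ 2) at_top"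
    by (intro tendsto_intros main)
  moreover have "norm (Gamma (1/2 + \<i> * of_real \<tau>) / E (1/2) \<tau>) ^ 2 = 2 * pi / (1 + exp (- 2 * pi * \<tau>))" for \<tau>
  proof -
    have "1/2 + \<i> * of_real \<tau> = Complex (1/2) \<tau>" by (simp add: complex_eq_iff)
    moreover have "norm (E (1/2) \<tau>) = exp (- (pi * \<tau>) / 2)" by (simp add: E_def)
    ultimately have "norm (Gamma (1/2 + \<i> * of_real \<tau>) / E (1/2) \<tau>) ^ 2 = pi / cosh (pi * \<tau>) / exp (- (pi * \<tau>) / 2) ^ 2"
      by (simp add: norm_divide power_divide norm_Gamma_half_line)
    also have "exp (- (pi * \<tau>) / 2) ^ 2 = exp (- (pi * \<tau>))" by (simp flip: exp_of_nat_mult)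
    also have "pi / cosh (pi * \<tau>) / exp (- (pi * \<tau>)) = pi / (exp (- (pi * \<tau>)) * cosh (pi * \<tau>))" by simp
    also have "exp (- (pi * \<tau>)) * cosh (pi * \<tau>) = (1 + exp (- 2 * pi * \<tau>)) / 2"
      by (simp add: cosh_def field_simps flip: exp_add)
    finally show ?thesis by simp
  qed
  moreover have "((\<lambda>\<tau>. 2 * pi / (1 + exp (- 2 * pi * \<tau>))) \<longlongrightarrow> 2 * pi / (1 + 0)) at_top"
  proof (intro tendsto_intros)
    show "((\<lambda>\<tau>. exp (- 2 * pi * \<tau>)) \<longlongrightarrow> 0) at_top"
      by (rule filterlim_compose[OF exp_at_bot], rule filterlim_tendsto_neg_mult_at_bot[OF tendsto_const _ filterlim_ident]) simp
  qed auto
  ultimately have "\<kappa> ^ 2 = 2 * pi"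
    using tendsto_unique[of "at_top :: real filter"] by simp
  hence "\<kappa> = sqrt (2 * pi)" using \<kappa>(1) by (metis less_imp_le real_sqrt_unique)
  hence "((\<lambda>\<tau>. Gamma (A + \<i> * of_real \<tau>) / E A \<tau> / of_real (sqrt (2 * pi))) \<longlongrightarrow> of_real (sqrt (2 * pi)) / of_real (sqrt (2 * pi))) at_top"
    using main[of A] by (intro tendsto_intros) auto
  thus ?thesis by (simp add: E_def mult.commute)
qed

section \<open>The Cahen--Mellin integral\<close>

lemma set_integral_reflect_Ici:
  fixes f :: "real \<Rightarrow> complex"
  shows "(LINT t:{T..}|lborel. f (- t)) = (LINT t:{..-T}|lborel. f t)"
    and "set_integrable lborel {T..} (\<lambda>t. f (- t)) \<longleftrightarrow> set_integrable lborel {..-T} f"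
proof -
  have eq: "indicat_real {T..} t *\<^sub>R f (- t) = indicat_real {..-T} (0 + (-1) * t) *\<^sub>R f (0 + (-1) * t)" for t
    by (auto simp: indicator_def)
  show "(LINT t:{T..}|lborel. f (- t)) = (LINT t:{..-T}|lborel. f t)"
    unfolding set_lebesgue_integral_def eq
    by (subst (2) lborel_integral_real_affine[where c = "-1" and t = 0]) auto
  show "set_integrable lborel {T..} (\<lambda>t. f (- t)) \<longleftrightarrow> set_integrable lborel {..-T} f"
    unfolding set_integrable_def eq
    by (subst lborel_integrable_real_affine_iff) auto
qed

text \<open>The lines are cut at the heights T and -T. \<open>half_strip_shift\<close> handles the
  upper part and, after s -> -s, the lower one; the residue theorem handles the rectangle in
  between. The horizontal edges appear twice with opposite signs and cancel. The point p may be
  regular, with residue 0.\<close>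

lemma strip_shift_residue:
  fixes h :: "complex \<Rightarrow> complex" and a b a' b' :: real
  assumes ab: "a' < a" "a < Re p" "Re p < b" "b < b'" "Im p = 0"
    and hol: "h holomorphic_on {s. a' < Re s \<and> Re s < b'} - {p}"
    and growth: "\<And>s. a \<le> Re s \<Longrightarrow> Re s \<le> b \<Longrightarrow> \<bar>Im s\<bar> \<ge> 1 \<Longrightarrow> norm (h s) \<le> C * exp (\<bar>Im s\<bar> ^ N)"
    and inta: "integrable lborel (\<lambda>t. h (Complex a t))"
    and intb: "integrable lborel (\<lambda>t. h (Complex b t))"
  shows "(LINT t|lborel. h (Complex b t)) - (LINT t|lborel. h (Complex a t)) = 2 * pi * residue h p"
proof -
  define U where "U = {s. a' < Re s \<and> Re s < b'}"
  have U: "open U" "convex U" "connected U"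
    unfolding U_def
    by (auto simp: Collect_conj_eq open_halfspace_Re_gt open_halfspace_Re_lt convex_halfspace_Re_gt
        convex_halfspace_Re_lt intro!: convex_connected convex_Int)
  obtain T1 where T1: "T1 > 0" "\<And>s. a \<le> Re s \<Longrightarrow> Re s \<le> b \<Longrightarrow> Im s \<ge> T1 \<Longrightarrow> Re ((- \<i> * s) ^ Suc N) \<ge> Im s ^ Suc N / 2"
    using Re_power_half_strip[of a b "Suc N"] by blast
  obtain T2 where T2: "T2 > 0" "\<And>s. -b \<le> Re s \<Longrightarrow> Re s \<le> -a \<Longrightarrow> Im s \<ge> T2 \<Longrightarrow> Re ((- \<i> * s) ^ Suc N) \<ge> Im s ^ Suc N / 2"
    using Re_power_half_strip[of "-b" "-a" "Suc N"] by blast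
  define T where "T = Max {T1, T2, 1}"
  have T: "T \<ge> T1" "T \<ge> T2" "T \<ge> 1" by (auto simp: T_def)
  have sub: "set_integrable lborel S (\<lambda>t. h (Complex x t))" if "x = a \<or> x = b" "S \<in> sets lborel" for x S
  proof -
    have "set_integrable lborel UNIV (\<lambda>t. h (Complex x t))"
      using inta intb that unfolding set_integrable_def by auto
    thus ?thesis by (rule set_integrable_subset) (use that in auto)
  qed
  have upper: "(LINT t:{T..}|lborel. h (Complex b t)) - (LINT t:{T..}|lborel. h (Complex a t)) =
        \<i> * (LINT x:{a..b}|lborel. h (Complex x T))"
  proof (rule half_strip_shift[where C = C and N = N])
    show "h holomorphic_on {s. a \<le> Re s \<and> Re s \<le> b \<and> T \<le> Im s}"
      by (rule holomorphic_on_subset[OF hol]) (use ab T in auto)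
    show "norm (h s) \<le> C * exp (Im s ^ N)" if "a \<le> Re s" "Re s \<le> b" "T \<le> Im s" for s
      using growth[of s] T that by simp
    show "Re ((- \<i> * s) ^ Suc N) \<ge> Im s ^ Suc N / 2" if "a \<le> Re s" "Re s \<le> b" "T \<le> Im s" for s
      by (rule T1) (use that T in auto)
  qed (use T sub ab in auto)
  have lower: "(LINT t:{..-T}|lborel. h (Complex a t)) - (LINT t:{..-T}|lborel. h (Complex b t)) =
        \<i> * (LINT x:{a..b}|lborel. h (Complex x (-T)))"
  proof -
    have neg: "- Complex (-x) t = Complex x (-t)" for x t by (simp add: complex_eq_iff)
    have neg': "- Complex x t = Complex (-x) (-t)" for x t by (simp add: complex_eq_iff)
    have "(LINT t:{T..}|lborel. h (- Complex (-a) t)) - (LINT t:{T..}|lborel. h (- Complex (-b) t)) =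
        \<i> * (LINT x:{-b..-a}|lborel. h (- Complex x T))"
    proof (rule half_strip_shift[where C = C and N = N])
      have "(h \<circ> uminus) holomorphic_on {s. -b \<le> Re s \<and> Re s \<le> -a \<and> T \<le> Im s}"
        by (intro holomorphic_on_compose holomorphic_on_subset[OF hol] holomorphic_intros) (use ab T in auto)
      thus "(\<lambda>s. h (- s)) holomorphic_on {s. -b \<le> Re s \<and> Re s \<le> -a \<and> T \<le> Im s}" by (simp add: o_def)
      show "norm (h (-s)) \<le> C * exp (Im s ^ N)" if "-b \<le> Re s" "Re s \<le> -a" "T \<le> Im s" for s
        using growth[of "- s"] T that by simp
      show "Re ((- \<i> * s) ^ Suc N) \<ge> Im s ^ Suc N / 2" if "-b \<le> Re s" "Re s \<le> -a" "T \<le> Im s" for s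
        by (rule T2) (use that T in auto)
      show "set_integrable lborel {T..} (\<lambda>t. h (- Complex (-b) t))" "set_integrable lborel {T..} (\<lambda>t. h (- Complex (-a) t))"
        unfolding neg by (subst set_integral_reflect_Ici, rule sub, auto)+
    qed (use T ab in auto)
    also have "(LINT x:{-b..-a}|lborel. h (- Complex x T)) = (LINT x:{a..b}|lborel. h (Complex x (-T)))"
    proof -
      have eq: "indicat_real {-b..-a} t *\<^sub>R h (- Complex t T) = indicat_real {a..b} (0 + (-1) * t) *\<^sub>R h (Complex (0 + (-1) * t) (-T))" for t
        by (auto simp: indicator_def neg')
      show ?thesis unfolding set_lebesgue_integral_def eq
        by (subst (2) lborel_integral_real_affine[where c = "-1" and t = 0]) auto
    qed
    finally show ?thesis unfolding neg
      by (simp only: set_integral_reflect_Ici(1)[of T "\<lambda>t. h (Complex x t)" for x])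
  qed
  have mid: "(LINT x:{a..b}|lborel. h (Complex x (-T))) + \<i> * (LINT t:{-T..T}|lborel. h (Complex b t))
    - (LINT x:{a..b}|lborel. h (Complex x T)) - \<i> * (LINT t:{-T..T}|lborel. h (Complex a t)) = 2 * pi * \<i> * residue h p"
  proof -
    define R where "R = rectpath (Complex a (-T)) (Complex b T)"
    have box: "p \<in> box (Complex a (-T)) (Complex b T)" using ab T by (auto simp: in_box_complex_iff)
    have pi: "path_image R \<subseteq> cbox (Complex a (-T)) (Complex b T) - box (Complex a (-T)) (Complex b T)"
      unfolding R_def by (subst path_image_rectpath_cbox_minus_box) (use ab T in auto)
    have pi': "path_image R \<subseteq> U - {p}"
      using pi box ab by (fastforce simp: U_def in_cbox_complex_iff)
    have "contour_integral R h = 2 * pi * \<i> * (\<Sum>p\<in>{p}. winding_number R p * residue h p)"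
    proof (rule Residue_theorem[OF U(1,3)])
      show "\<forall>z. z \<notin> U \<longrightarrow> winding_number R z = 0"
        unfolding R_def using ab T
        by (intro allI impI winding_number_rectpath_outside) (auto simp: U_def in_cbox_complex_iff)
    qed (use hol pi' in \<open>auto simp: U_def R_def\<close>)
    moreover have "winding_number R p = 1" unfolding R_def by (rule winding_number_rectpath[OF box])
    ultimately have "contour_integral R h = 2 * pi * \<i> * residue h p" by simp
    moreover have "continuous_on (path_image R) h"
      by (rule continuous_on_subset[OF holomorphic_on_imp_continuous_on[OF hol] pi'[unfolded U_def]])
    ultimately show ?thesis
      unfolding R_def by (subst (asm) contour_integral_rectpath) (use ab T in auto)
  qed
  have split: "(LINT t|lborel. h (Complex x t)) = (LINT t:{..-T}|lborel. h (Complex x t)) + (LINT t:{-T..T}|lborel. h (Complex x t)) + (LINT t:{T..}|lborel. h (Complex x t))"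
    if x: "x = a \<or> x = b" for x
  proof -
    have "(LINT t|lborel. h (Complex x t)) = (LINT t:(({..-T} \<union> {-T..T}) \<union> {T..})|lborel. h (Complex x t))"
    proof -
      have "({..-T} \<union> {-T..T}) \<union> {T..} = UNIV" using T by auto
      thus ?thesis by (simp add: set_lebesgue_integral_def)
    qed
    also have "\<dots> = (LINT t:{..-T} \<union> {-T..T}|lborel. h (Complex x t)) + (LINT t:{T..}|lborel. h (Complex x t))"
    proof (rule set_integral_Un_AE)
      show "AE t in lborel. \<not> (t \<in> {..- T} \<union> {- T..T} \<and> t \<in> {T..})"
        using AE_lborel_singleton[of T] by eventually_elim (use T in auto)
    qed (use x sub in auto)
    also have "(LINT t:{..-T} \<union> {-T..T}|lborel. h (Complex x t)) = (LINT t:{..-T}|lborel. h (Complex x t)) + (LINT t:{-T..T}|lborel. h (Complex x t))"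
    proof (rule set_integral_Un_AE)
      show "AE t in lborel. \<not> (t \<in> {..- T} \<and> t \<in> {- T..T})"
        using AE_lborel_singleton[of "-T"] by eventually_elim (use T in auto)
    qed (use x sub in auto)
    finally show ?thesis .
  qed
  have alg: "(l1 + m1 + u1) - (l2 + m2 + u2) = 2 * pi * r"
    if "u1 - u2 = \<i> * tp" "l2 - l1 = \<i> * bt" "bt + \<i> * m1 - tp - \<i> * m2 = 2 * pi * \<i> * r"
    for l1 l2 m1 m2 u1 u2 tp bt r :: complex
  proof -
    have "\<i> * ((l1 + m1 + u1) - (l2 + m2 + u2)) = \<i> * (u1 - u2) - \<i> * (l2 - l1) + (\<i> * m1 - \<i> * m2)"
      by (simp add: algebra_simps)
    also have "\<dots> = bt + \<i> * m1 - tp - \<i> * m2"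
    proof -
      have ii: "\<i> * (\<i> * x) = - x" for x by (simp flip: mult.assoc)
      show ?thesis unfolding that(1,2) ii by simp
    qed
    also have "\<dots> = \<i> * (2 * pi * r)" unfolding that(3) by simp
    finally show ?thesis by simp
  qed
  show ?thesis
    unfolding split[of a, simplified] split[of b, simplified] by (rule alg[OF upper lower mid])
qed

section \<open>Bounds for the Gamma function in vertical strips and on vertical lines\<close>

lemma norm_Gamma_le_Gamma_Re:
  assumes "Re z > 0"
  shows "norm (Gamma z) \<le> Gamma (Re z)"
proof -
  have "norm (integral {0..} (\<lambda>t. of_real t powr (z - 1) / of_real (exp t))) \<le> integral {0..} (\<lambda>t. t powr (Re z - 1) / exp t)"
  proof (rule integral_norm_bound_integral)
    show "norm (complex_of_real t powr (z - 1) / of_real (exp t)) \<le> t powr (Re z - 1) / exp t" if "t \<in> {0..}" for t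
      using that by (simp add: norm_divide norm_powr_real_powr)
  qed (use Gamma_integral_complex[OF assms] Gamma_integral_real[OF assms] in auto)
  thus ?thesis
    using Gamma_integral_complex[OF assms] Gamma_integral_real[OF assms] by (simp add: integral_unique)
qed

text \<open>Moving s to the right by M multiplies Gamma by factors s + i, each of modulus at least 1
  because |Im s| \<ge> 1; to the right of 1 the real Gamma function bounds it. This crude estimate
  suffices for the growth condition in the shift lemmas.\<close>

lemma Gamma_bounded_vertical_strip:
  "\<exists>C>0. \<forall>s. a \<le> Re s \<longrightarrow> Re s \<le> b \<longrightarrow> \<bar>Im s\<bar> \<ge> 1 \<longrightarrow> norm (Gamma s) \<le> C"
proof -
  define M where "M = nat \<lceil>1 - a\<rceil>"
  have M: "a + M \<ge> 1" unfolding M_def by linarith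
  have "compact (Gamma ` {a + real M..b + real M})"
    by (intro compact_continuous_image continuous_on_Gamma) (use M in \<open>auto elim!: nonpos_Ints_cases\<close>)
  then obtain B where B: "\<And>x. x \<in> {a + real M..b + real M} \<Longrightarrow> norm (Gamma x) \<le> B"
    using compact_imp_bounded bounded_iff by (metis (no_types, lifting) imageI)
  show ?thesis
  proof (intro exI[of _ "\<bar>B\<bar> + 1"] conjI allI impI)
    fix s :: complex assume s: "a \<le> Re s" "Re s \<le> b" "\<bar>Im s\<bar> \<ge> 1"
    have ns: "s \<notin> \<int>\<^sub>\<le>\<^sub>0" using s by (auto elim!: nonpos_Ints_cases)
    have p: "norm (pochhammer s M) \<ge> 1"
    proof -
      have "norm (s + of_nat i) \<ge> 1" for i using abs_Im_le_cmod[of "s + of_nat i"] s by simp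
      thus ?thesis unfolding pochhammer_prod prod_norm[symmetric] by (intro prod_ge_1) auto
    qed
    have G0: "Gamma s \<noteq> 0" using ns by (simp add: Gamma_eq_zero_iff)
    have "norm (Gamma s) \<le> norm (pochhammer s M) * norm (Gamma s)" using p by (simp add: mult_le_cancel_right1)
    also have "\<dots> = norm (Gamma (s + of_nat M))"
      using G0 by (simp add: pochhammer_Gamma[OF ns] norm_divide)
    also have "\<dots> \<le> Gamma (Re (s + of_nat M))" by (rule norm_Gamma_le_Gamma_Re) (use s M in auto)
    also have "\<dots> \<le> B" using B[of "Re s + real M"] s by auto
    finally show "norm (Gamma s) \<le> \<bar>B\<bar> + 1" by linarith
  qed auto
qed

lemma norm_Gamma_half_line_le: "norm (Gamma (Complex (1/2) t)) \<le> sqrt (2 * pi) * exp (- pi * \<bar>t\<bar> / 2)"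
proof -
  have "exp (pi * \<bar>t\<bar>) \<le> 2 * cosh (pi * t)" by (cases "t \<ge> 0") (auto simp: cosh_def)
  hence "pi / cosh (pi * t) \<le> pi / (exp (pi * \<bar>t\<bar>) / 2)" by (intro divide_left_mono) auto
  also have "\<dots> = 2 * pi * exp (- pi * \<bar>t\<bar>)" by (simp add: exp_minus field_simps)
  also have "\<dots> = (sqrt (2 * pi) * exp (- pi * \<bar>t\<bar> / 2)) ^ 2"
    by (simp add: power_mult_distrib flip: exp_of_nat_mult)
  finally have "norm (Gamma (Complex (1/2) t)) ^ 2 \<le> (sqrt (2 * pi) * exp (- pi * \<bar>t\<bar> / 2)) ^ 2"
    by (simp add: norm_Gamma_half_line)
  thus ?thesis by (rule power2_le_imp_le) auto
qed

text \<open>Going N steps to the left of Re s = 1/2 divides Gamma by factors at least as large as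
  those of \<open>pochhammer (1/2) N\<close>, taken in reverse order. This factorial gain makes the
  shifted integrals in \<open>Cahen_Mellin\<close> tend to 0.\<close>

lemma norm_Gamma_half_integer_line_le:
  "norm (Gamma (Complex (1/2 - real N) t)) \<le> sqrt (2 * pi) / pochhammer (1/2) N * exp (- pi * \<bar>t\<bar> / 2)"
proof -
  define s where "s = Complex (1/2 - real N) t"
  have ns: "s \<notin> \<int>\<^sub>\<le>\<^sub>0"
  proof
    assume "s \<in> \<int>\<^sub>\<le>\<^sub>0"
    then obtain n where "s = - of_nat n" by (auto elim: nonpos_Ints_cases')
    hence "1/2 - real N = - real n" by (simp add: s_def complex_eq_iff)
    hence "real (2 * N) = real (2 * n + 1)" by simp
    hence "2 * N = 2 * n + 1" by (simp only: of_nat_eq_iff)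
    thus False by presburger
  qed
  have p: "pochhammer (1/2) N \<le> norm (pochhammer s N)"
  proof -
    have "pochhammer (1/2 :: real) N = (\<Prod>i=0..<N. 1/2 + real i)" by (simp add: pochhammer_prod)
    also have "\<dots> = (\<Prod>i=0..<N. 1/2 + real (N - Suc i))"
      by (rule prod.reindex_bij_witness[of _ "\<lambda>i. N - Suc i" "\<lambda>i. N - Suc i"]) auto
    also have "\<dots> \<le> (\<Prod>i=0..<N. norm (s + of_nat i))"
    proof (rule prod_mono)
      fix i assume "i \<in> {0..<N}"
      hence "1/2 + real (N - Suc i) = \<bar>Re (s + of_nat i)\<bar>" by (simp add: s_def of_nat_diff)
      thus "0 \<le> 1/2 + real (N - Suc i) \<and> 1/2 + real (N - Suc i) \<le> norm (s + of_nat i)"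
        using abs_Re_le_cmod[of "s + of_nat i"] by simp
    qed
    finally show ?thesis by (simp add: pochhammer_prod prod_norm)
  qed
  have pp: "pochhammer (1/2 :: real) N > 0" by (intro pochhammer_pos) auto
  have "s + of_nat N = Complex (1/2) t" by (simp add: s_def complex_eq_iff)
  hence eq: "pochhammer s N = Gamma (Complex (1/2) t) / Gamma s" using pochhammer_Gamma[OF ns, of N] by simp
  have "Gamma s \<noteq> 0" using ns by (simp add: Gamma_eq_zero_iff)
  hence "norm (Gamma s) = norm (Gamma (Complex (1/2) t)) / norm (pochhammer s N)"
    using p pp unfolding eq by (auto simp: norm_divide)
  also have "\<dots> \<le> (sqrt (2 * pi) * exp (- pi * \<bar>t\<bar> / 2)) / pochhammer (1/2) N"
    by (intro frac_le norm_Gamma_half_line_le p pp) auto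
  finally show ?thesis by (simp add: s_def)
qed

lemma norm_Gamma_three_halves_line_le:
  "norm (Gamma (Complex (3/2) t)) \<le> sqrt (2 * pi) * (1 + \<bar>t\<bar>) * exp (- pi * \<bar>t\<bar> / 2)"
proof -
  have eq: "Complex (3/2) t = Complex (1/2) t + 1" by (simp add: complex_eq_iff)
  have "Gamma (Complex (3/2) t) = Complex (1/2) t * Gamma (Complex (1/2) t)"
    unfolding eq by (rule Gamma_plus1) (auto simp: complex_eq_iff elim!: nonpos_Ints_cases)
  also have "norm \<dots> \<le> (1 + \<bar>t\<bar>) * (sqrt (2 * pi) * exp (- pi * \<bar>t\<bar> / 2))"
    unfolding norm_mult using cmod_le[of "Complex (1/2) t"] by (intro mult_mono norm_Gamma_half_line_le) auto
  finally show ?thesis by (simp add: mult_ac)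
qed

lemma integrable_exp_abs:
  assumes "d > 0"
  shows "integrable lborel (\<lambda>t::real. exp (- d * \<bar>t\<bar>))"
proof -
  have "set_integrable lborel ({..0} \<union> {0..}) (\<lambda>t::real. complex_of_real (exp (- d * \<bar>t\<bar>)))"
  proof (rule set_integrable_Un)
    have *: "set_integrable lborel {0..} (\<lambda>t::real. complex_of_real (exp (- d * \<bar>t\<bar>)))"
      using set_integrable_exp_decay(1)[OF assms, of 0]
      by (rule set_integrable_continuous_bound) (auto intro!: continuous_intros)
    thus "set_integrable lborel {0..} (\<lambda>t::real. complex_of_real (exp (- d * \<bar>t\<bar>)))" .
    show "set_integrable lborel {..0} (\<lambda>t::real. complex_of_real (exp (- d * \<bar>t\<bar>)))"
      using set_integral_reflect_Ici(2)[of 0 "\<lambda>t. complex_of_real (exp (- d * \<bar>t\<bar>))"] * by simp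
  qed auto
  moreover have "{..0} \<union> {0..} = (UNIV :: real set)" by auto
  ultimately have "integrable lborel (\<lambda>t::real. complex_of_real (exp (- d * \<bar>t\<bar>)))"
    by (simp add: set_integrable_def)
  from integrable_Re[OF this] show ?thesis by simp
qed

lemma norm_powr_minus_Complex:
  fixes w :: complex
  assumes "w \<noteq> 0"
  shows "norm (w powr (- Complex c t)) = norm w powr (- c) * exp (t * Arg w)"
  using assms by (simp add: norm_powr_complex)

lemma abs_Arg_less_pi_half: "Re w > 0 \<Longrightarrow> \<bar>Arg w\<bar> < pi / 2"
  using Re_Ln_pos_lt[of w] by (cases "w = 0") (auto simp: Arg_eq_Im_Ln)

lemma one_plus_abs_mult_exp_le:
  fixes d t :: real
  assumes d0: "d > 0"
  shows "(1 + \<bar>t\<bar>) * exp (- d * \<bar>t\<bar>) \<le> (1 + 2 / d) * exp (- (d/2) * \<bar>t\<bar>)"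
proof -
  have "d / 2 * \<bar>t\<bar> \<le> exp (d / 2 * \<bar>t\<bar>)" using exp_ge_add_one_self[of "d / 2 * \<bar>t\<bar>"] by linarith
  hence "\<bar>t\<bar> \<le> 2 / d * exp (d / 2 * \<bar>t\<bar>)" using d0 by (simp add: field_simps)
  moreover have "1 \<le> exp (d / 2 * \<bar>t\<bar>)" using d0 by simp
  ultimately have "1 + \<bar>t\<bar> \<le> (1 + 2 / d) * exp (d / 2 * \<bar>t\<bar>)"
    unfolding distrib_right mult_1 by (rule add_mono[rotated])
  hence "(1 + \<bar>t\<bar>) * exp (- d * \<bar>t\<bar>) \<le> (1 + 2 / d) * exp (d / 2 * \<bar>t\<bar>) * exp (- d * \<bar>t\<bar>)"
    by (intro mult_right_mono) auto
  also have "\<dots> = (1 + 2 / d) * exp (- (d/2) * \<bar>t\<bar>)" by (simp add: mult.assoc flip: exp_add)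
  finally show ?thesis .
qed

lemma Mellin_line_bound:
  fixes w :: complex
  assumes w: "Re w > 0" and d: "d = pi / 2 - \<bar>Arg w\<bar>"
  shows "d > 0"
    and "norm (Gamma (Complex (1/2 - real N) t) * w powr (- Complex (1/2 - real N) t))
          \<le> norm w powr (real N - 1/2) * sqrt (2 * pi) / pochhammer (1/2) N * exp (- d * \<bar>t\<bar>)"
    and "norm (Gamma (Complex (3/2) t) * w powr (- Complex (3/2) t))
          \<le> norm w powr (- 3/2) * sqrt (2 * pi) * (1 + 2 / d) * exp (- (d/2) * \<bar>t\<bar>)"
proof -
  show d0: "d > 0" using abs_Arg_less_pi_half[OF w] d by simp
  have w0: "w \<noteq> 0" using w by auto
  have pw: "norm (w powr (- Complex c t)) \<le> norm w powr (- c) * exp (\<bar>t\<bar> * \<bar>Arg w\<bar>)" for c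
    unfolding norm_powr_minus_Complex[OF w0] by (intro mult_left_mono) (auto simp: abs_mult[symmetric])
  have ex: "exp (- pi * \<bar>t\<bar> / 2) * exp (\<bar>t\<bar> * \<bar>Arg w\<bar>) = exp (- d * \<bar>t\<bar>)"
    unfolding d exp_add[symmetric] by (simp add: algebra_simps)
  have "norm (Gamma (Complex (1/2 - real N) t) * w powr (- Complex (1/2 - real N) t))
     \<le> (sqrt (2 * pi) / pochhammer (1/2) N * exp (- pi * \<bar>t\<bar> / 2)) * (norm w powr (- (1/2 - real N)) * exp (\<bar>t\<bar> * \<bar>Arg w\<bar>))"
    unfolding norm_mult by (intro mult_mono norm_Gamma_half_integer_line_le pw) (auto intro!: divide_nonneg_nonneg pochhammer_nonneg)
  also have "\<dots> = norm w powr (real N - 1/2) * sqrt (2 * pi) / pochhammer (1/2) N * (exp (- pi * \<bar>t\<bar> / 2) * exp (\<bar>t\<bar> * \<bar>Arg w\<bar>))"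
    by (simp add: mult_ac)
  finally show "norm (Gamma (Complex (1/2 - real N) t) * w powr (- Complex (1/2 - real N) t))
          \<le> norm w powr (real N - 1/2) * sqrt (2 * pi) / pochhammer (1/2) N * exp (- d * \<bar>t\<bar>)" unfolding ex .
  have "norm (Gamma (Complex (3/2) t) * w powr (- Complex (3/2) t))
     \<le> (sqrt (2 * pi) * (1 + \<bar>t\<bar>) * exp (- pi * \<bar>t\<bar> / 2)) * (norm w powr (- (3/2)) * exp (\<bar>t\<bar> * \<bar>Arg w\<bar>))"
    unfolding norm_mult by (intro mult_mono norm_Gamma_three_halves_line_le pw) auto
  also have "\<dots> = norm w powr (- 3/2) * sqrt (2 * pi) * ((1 + \<bar>t\<bar>) * (exp (- pi * \<bar>t\<bar> / 2) * exp (\<bar>t\<bar> * \<bar>Arg w\<bar>)))"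
    by (simp add: mult_ac)
  also have "\<dots> \<le> norm w powr (- 3/2) * sqrt (2 * pi) * ((1 + 2 / d) * exp (- (d/2) * \<bar>t\<bar>))"
    unfolding ex by (intro mult_left_mono one_plus_abs_mult_exp_le[OF d0]) auto
  finally show "norm (Gamma (Complex (3/2) t) * w powr (- Complex (3/2) t))
          \<le> norm w powr (- 3/2) * sqrt (2 * pi) * (1 + 2 / d) * exp (- (d/2) * \<bar>t\<bar>)" by (simp add: mult_ac)
qed

lemma half_line_not_nonpos_Ints:
  "Complex (1/2 - real N) t \<notin> \<int>\<^sub>\<le>\<^sub>0" "Complex (3/2) t \<notin> \<int>\<^sub>\<le>\<^sub>0"
proof -
  show "Complex (1/2 - real N) t \<notin> \<int>\<^sub>\<le>\<^sub>0"
  proof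
    assume "Complex (1/2 - real N) t \<in> \<int>\<^sub>\<le>\<^sub>0"
    then obtain n where "Complex (1/2 - real N) t = - of_nat n" by (auto elim: nonpos_Ints_cases')
    hence "1/2 - real N = - real n" by (simp add: complex_eq_iff)
    hence "real (2 * N) = real (2 * n + 1)" by simp
    hence "2 * N = 2 * n + 1" by (simp only: of_nat_eq_iff)
    thus False by presburger
  qed
qed (auto elim!: nonpos_Ints_cases simp: complex_eq_iff)

lemma Mellin_line_integrable:
  fixes w :: complex
  assumes w: "Re w > 0" and c: "c = 3/2 \<or> c = 1/2 - real N"
  shows "integrable lborel (\<lambda>t. Gamma (Complex c t) * w powr (- Complex c t))"
proof -
  define d where "d = pi / 2 - \<bar>Arg w\<bar>"
  note b = Mellin_line_bound[OF w d_def]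
  obtain K d' where d': "d' > 0" "\<And>t. norm (Gamma (Complex c t) * w powr (- Complex c t)) \<le> K * exp (- d' * \<bar>t\<bar>)"
    using b(1) b(2)[of N] b(3) c by (metis half_gt_zero)
  have nz: "w \<noteq> 0" using w by auto
  have "set_integrable lborel UNIV (\<lambda>t. Gamma (Complex c t) * w powr (- Complex c t))"
  proof (rule set_integrable_continuous_bound)
    show "set_integrable lborel UNIV (\<lambda>t. K * exp (- d' * \<bar>t\<bar>))"
      using integrable_exp_abs[OF d'(1)] by (simp add: set_integrable_def)
    have "continuous_on UNIV (\<lambda>t. Gamma (Complex c t))"
      by (rule continuous_on_compose2[OF continuous_on_Gamma[of "- \<int>\<^sub>\<le>\<^sub>0"]])
         (use c half_line_not_nonpos_Ints in \<open>(auto; fail) | (intro continuous_intros) | blast\<close>)+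
    thus "continuous_on UNIV (\<lambda>t. Gamma (Complex c t) * w powr (- Complex c t))"
      using nz w by (intro continuous_intros) auto
  qed (use d' in auto)
  thus ?thesis by (simp add: set_integrable_def)
qed

lemma Mellin_integrand_growth:
  fixes w :: complex
  assumes w: "Re w > 0"
  shows "\<exists>C. \<forall>s. a \<le> Re s \<longrightarrow> Re s \<le> b \<longrightarrow> \<bar>Im s\<bar> \<ge> 1 \<longrightarrow> norm (Gamma s * w powr (- s)) \<le> C * exp (\<bar>Im s\<bar> ^ 2)"
proof -
  obtain C where C: "C > 0" "\<And>s. a \<le> Re s \<Longrightarrow> Re s \<le> b \<Longrightarrow> \<bar>Im s\<bar> \<ge> 1 \<Longrightarrow> norm (Gamma s) \<le> C"
    using Gamma_bounded_vertical_strip[of a b] by blast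
  have w0: "w \<noteq> 0" using w by auto
  define K where "K = exp ((\<bar>a\<bar> + \<bar>b\<bar>) * \<bar>ln (norm w)\<bar> + 1)"
  show ?thesis
  proof (intro exI[of _ "C * K"] allI impI)
    fix s :: complex assume s: "a \<le> Re s" "Re s \<le> b" "\<bar>Im s\<bar> \<ge> 1"
    have "norm (w powr (- s)) = exp (- Re s * ln (norm w) + Im s * Arg w)"
      using w0 by (simp add: norm_powr_complex powr_def exp_add Arg_eq_Im_Ln)
    also have "\<dots> \<le> exp (((\<bar>a\<bar> + \<bar>b\<bar>) * \<bar>ln (norm w)\<bar> + 1) + \<bar>Im s\<bar> ^ 2)"
    proof -
      have "- Re s * ln (norm w) \<le> \<bar>Re s\<bar> * \<bar>ln (norm w)\<bar>" by (metis abs_ge_self abs_minus_cancel abs_mult)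
      also have "\<dots> \<le> (\<bar>a\<bar> + \<bar>b\<bar>) * \<bar>ln (norm w)\<bar>" using s by (intro mult_right_mono) auto
      finally have 1: "- Re s * ln (norm w) \<le> (\<bar>a\<bar> + \<bar>b\<bar>) * \<bar>ln (norm w)\<bar>" .
      have "Im s * Arg w \<le> \<bar>Im s\<bar> * \<bar>Arg w\<bar>" by (metis abs_ge_self abs_mult)
      also have "\<dots> \<le> \<bar>Im s\<bar> * 2" using abs_Arg_less_pi_half[OF w] pi_less_4 by (intro mult_left_mono) auto
      also have "\<dots> \<le> 1 + \<bar>Im s\<bar> ^ 2" using zero_le_power2[of "\<bar>Im s\<bar> - 1"] by (simp add: power2_diff)
      finally show ?thesis using 1 by simp
    qed
    also have "\<dots> = K * exp (\<bar>Im s\<bar> ^ 2)" by (simp add: K_def exp_add)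
    finally have "norm (w powr (- s)) \<le> K * exp (\<bar>Im s\<bar> ^ 2)" .
    hence "norm (Gamma s * w powr (- s)) \<le> C * (K * exp (\<bar>Im s\<bar> ^ 2))"
      unfolding norm_mult using C s by (intro mult_mono) auto
    thus "norm (Gamma s * w powr (- s)) \<le> C * K * exp (\<bar>Im s\<bar> ^ 2)" by (simp add: mult.assoc)
  qed
qed

text \<open>Moving the line to the left past 0, -1, -2, ... picks up the terms of the exponential
  series as residues of Gamma. The lines lie at half-odd integers in order to stay clear of the
  poles.\<close>

theorem Cahen_Mellin:
  fixes w :: complex
  assumes w: "Re w > 0"
  shows "(LINT t|lborel. Gamma (Complex (3/2) t) * w powr (- Complex (3/2) t)) = 2 * pi * exp (- w)"
proof -
  define h where "h = (\<lambda>s::complex. Gamma s * w powr (- s))"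
  define J where "J = (\<lambda>c. LINT t|lborel. h (Complex c t))"
  have w0: "w \<noteq> 0" using w by auto
  have int: "integrable lborel (\<lambda>t. h (Complex c t))" if "c = 3/2 \<or> c = 1/2 - real N" for c N
    unfolding h_def by (rule Mellin_line_integrable[OF w that])
  obtain C where C: "\<And>a b s. a \<le> Re s \<Longrightarrow> Re s \<le> b \<Longrightarrow> \<bar>Im s\<bar> \<ge> 1 \<Longrightarrow> norm (h s) \<le> C a b * exp (\<bar>Im s\<bar> ^ 2)"
    using Mellin_integrand_growth[OF w] unfolding h_def by metis
  have hhol: "h holomorphic_on A" if "A \<inter> \<int>\<^sub>\<le>\<^sub>0 = {}" for A
    unfolding h_def using that w0 by (intro holomorphic_intros) auto
  \<comment> \<open>No pole lies between 1/2 and 3/2: the shift lemma is applied at the regular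
    point 1, where the residue is 0.\<close>
  have first: "J (3/2) = J (1/2)"
  proof -
    have hol: "h holomorphic_on {s. 1/4 < Re s \<and> Re s < 2}"
      by (rule hhol) (auto elim!: nonpos_Ints_cases)
    have op: "open {s. 1/4 < Re s \<and> Re s < 2}"
      unfolding Collect_conj_eq by (intro open_Int open_halfspace_Re_gt open_halfspace_Re_lt)
    have "J (3/2) - J (1/2) = 2 * pi * residue h 1"
      unfolding J_def
      by (rule strip_shift_residue[of "1/4" _ _ _ 2 _ "C (1/2) (3/2)" 2])
         (use C int[of "1/2" 0] int[of "3/2"] holomorphic_on_subset[OF hol] in auto)
    also have "residue h 1 = 0" by (rule residue_holo[OF op _ hol]) auto
    finally show ?thesis by simp
  qed
  have step: "J (1/2 - real N) = 2 * pi * ((-w) ^ N / fact N) + J (1/2 - real (Suc N))" for N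
  proof -
    define U where "U = {s::complex. - real N - 3/4 < Re s \<and> Re s < - real N + 3/4}"
    have op: "open U"
      unfolding U_def Collect_conj_eq by (intro open_Int open_halfspace_Re_gt open_halfspace_Re_lt)
    have hol: "h holomorphic_on U - {- of_nat N}"
    proof (rule hhol, rule equals0I)
      fix s assume "s \<in> (U - {- of_nat N}) \<inter> \<int>\<^sub>\<le>\<^sub>0"
      then obtain n where n: "s = - of_nat n" "s \<in> U" "s \<noteq> - of_nat N" by (auto elim: nonpos_Ints_cases')
      hence "\<bar>real n - real N\<bar> < 1" by (auto simp: U_def)
      hence "n = N" by linarith
      thus False using n by simp
    qed
    have "J (1/2 - real N) - J (1/2 - real (Suc N)) = 2 * pi * residue h (- of_nat N)"
      unfolding J_def
      by (rule strip_shift_residue[of "- real N - 3/4" _ _ _ "- real N + 3/4" _ "C (1/2 - real (Suc N)) (1/2 - real N)" 2])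
         (use C int[of "1/2 - real N" N] int[of "1/2 - real (Suc N)" "Suc N"] hol[unfolded U_def] in auto)
    also have "residue h (- of_nat N) = (-1) ^ N / fact N * w powr (- (- of_nat N))"
    proof (rule residue_simple'[OF op _ hol])
      have "((\<lambda>s. (Gamma s * (s + of_nat N)) * w powr (- s)) \<longlongrightarrow> (-1) ^ N / fact N * w powr (- (- of_nat N))) (at (- of_nat N))"
        using w0 w by (intro tendsto_intros Gamma_residues) (auto simp: complex_nonpos_Reals_iff)
      thus "((\<lambda>s. h s * (s - - of_nat N)) \<longlongrightarrow> (-1) ^ N / fact N * w powr (- (- of_nat N))) (at (- of_nat N))"
        by (simp add: h_def mult_ac)
    qed (auto simp: U_def)
    also have "w powr (- (- of_nat N)) = w ^ N" using w0 by (simp add: powr_nat')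
    also have "(-1) ^ N / fact N * w ^ N = (-w) ^ N / fact N" unfolding power_minus[of w N] by simp
    finally show ?thesis by (simp add: algebra_simps)
  qed
  have sums: "J (1/2) = 2 * pi * (\<Sum>k<N. (-w) ^ k / fact k) + J (1/2 - real N)" for N
  proof (induction N)
    case (Suc N)
    thus ?case using step[of N] by (simp add: algebra_simps)
  qed simp
  have lim0: "(\<lambda>N. J (1/2 - real N)) \<longlonglongrightarrow> 0"
  proof -
    define d where "d = pi / 2 - \<bar>Arg w\<bar>"
    note b = Mellin_line_bound[OF w d_def]
    define E where "E = (LINT t|lborel. exp (- d * \<bar>t\<bar>))"
    have bnd: "norm (J (1/2 - real N)) \<le> norm w powr (real N - 1/2) * sqrt (2 * pi) / pochhammer (1/2) N * E" for N
    proof -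
      have "norm (J (1/2 - real N)) \<le> (LINT t|lborel. norm w powr (real N - 1/2) * sqrt (2 * pi) / pochhammer (1/2) N * exp (- d * \<bar>t\<bar>))"
        unfolding J_def
        by (rule Bochner_Integration.integral_norm_bound_integral)
           (use int[of "1/2 - real N" N] b(2)[of N] integrable_exp_abs[OF b(1)] in \<open>auto simp: h_def\<close>)
      thus ?thesis by (simp add: E_def)
    qed
    \<comment> \<open>The index is raised by one because \<open>pochhammer (1/2) (Suc n)\<close> is
      at least n! / 2; the bound then becomes the general term of the series for exp (norm
      w).\<close>
    have "(\<lambda>n. J (1/2 - real (Suc n))) \<longlonglongrightarrow> 0"
    proof (rule Lim_null_comparison)
      have poch: "pochhammer (1/2 :: real) (Suc n) \<ge> fact n / 2" for n
      proof (induction n)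
        case (Suc n)
        have "fact (Suc n) / 2 = (fact n / 2) * (real n + 1)" by simp
        also have "\<dots> \<le> pochhammer (1/2) (Suc n) * (1/2 + real (Suc n))" using Suc.IH by (intro mult_mono pochhammer_nonneg) auto
        also have "\<dots> = pochhammer (1/2) (Suc (Suc n))" by (rule pochhammer_Suc[symmetric])
        finally show ?case .
      qed auto
      have "(\<lambda>n. norm w powr (1/2) * sqrt (2 * pi) * \<bar>E\<bar> * 2 * (norm w ^ n / fact n)) \<longlonglongrightarrow> norm w powr (1/2) * sqrt (2 * pi) * \<bar>E\<bar> * 2 * 0"
      proof (intro tendsto_mult tendsto_const)
        show "(\<lambda>n. norm w ^ n / fact n) \<longlonglongrightarrow> 0"
          using summable_LIMSEQ_zero[OF summable_exp[of "norm w"]] by (simp add: divide_inverse mult.commute)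
      qed
      thus "(\<lambda>n. norm w powr (1/2) * sqrt (2 * pi) * \<bar>E\<bar> * 2 * (norm w ^ n / fact n)) \<longlonglongrightarrow> 0" by simp
      show "\<forall>\<^sub>F n in sequentially. norm (J (1/2 - real (Suc n))) \<le> norm w powr (1/2) * sqrt (2 * pi) * \<bar>E\<bar> * 2 * (norm w ^ n / fact n)"
      proof (intro always_eventually allI)
        fix n
        have "norm (J (1/2 - real (Suc n))) \<le> norm w powr (real (Suc n) - 1/2) * sqrt (2 * pi) / pochhammer (1/2) (Suc n) * E"
          by (rule bnd)
        also have "\<dots> \<le> norm w powr (real (Suc n) - 1/2) * sqrt (2 * pi) / (fact n / 2) * \<bar>E\<bar>"
        proof (rule mult_mono)
          have "pochhammer (1/2 :: real) (Suc n) > 0" by (rule pochhammer_pos) simp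
          thus "norm w powr (real (Suc n) - 1/2) * sqrt (2 * pi) / pochhammer (1/2) (Suc n) \<le> norm w powr (real (Suc n) - 1/2) * sqrt (2 * pi) / (fact n / 2)"
            using poch[of n] by (intro divide_left_mono mult_pos_pos) auto
          show "0 \<le> E" unfolding E_def by (rule Bochner_Integration.integral_nonneg) auto
        qed auto
        also have "norm w powr (real (Suc n) - 1/2) = norm w powr (1/2) * norm w ^ n"
          using w0 powr_add[of "norm w" "1/2" "real n"] by (simp add: powr_realpow)
        finally show "norm (J (1/2 - real (Suc n))) \<le> norm w powr (1/2) * sqrt (2 * pi) * \<bar>E\<bar> * 2 * (norm w ^ n / fact n)"
          by (simp add: mult_ac)
      qed
    qed
    thus ?thesis by (rule LIMSEQ_imp_Suc)
  qed
  have "(\<lambda>N. 2 * pi * (\<Sum>k<N. (-w) ^ k / fact k) + J (1/2 - real N)) \<longlonglongrightarrow> 2 * pi * exp (- w) + 0"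
  proof (intro tendsto_intros lim0)
    show "(\<lambda>N. \<Sum>k<N. (-w) ^ k / fact k) \<longlonglongrightarrow> exp (- w)"
      using exp_converges[of "- w"] by (simp add: sums_def scaleR_conv_of_real divide_inverse mult.commute)
  qed
  hence "(\<lambda>N. J (1/2)) \<longlonglongrightarrow> 2 * pi * exp (- w)" unfolding sums[symmetric] by simp
  hence "J (1/2) = 2 * pi * exp (- w)" by (simp add: LIMSEQ_const_iff)
  thus ?thesis using first by (simp add: J_def h_def)
qed

section \<open>Laplace transforms\<close>

lemma set_integrable_powr_exp_real:
  fixes p c :: real
  assumes "p > 0" "c > 0"
  shows "set_integrable lborel {0<..} (\<lambda>t. t powr (p - 1) * exp (- c * t))"
proof -
  have "(\<lambda>t. complex_of_real t powr (of_real p - 1) / of_real (exp (c * t))) absolutely_integrable_on {0<..}"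
    by (rule absolutely_integrable_Gamma_integral) (use assms in auto)
  hence "set_integrable lebesgue {0<..} (\<lambda>t. norm (complex_of_real t powr (of_real p - 1) / of_real (exp (c * t))))"
    by (rule set_integrable_norm)
  also have "?this \<longleftrightarrow> set_integrable lebesgue {0<..} (\<lambda>t. t powr (p - 1) * exp (- c * t))"
    by (rule set_integrable_cong) (auto simp: norm_divide norm_powr_real_powr exp_minus field_simps)
  finally have "integrable lebesgue (\<lambda>t. indicat_real {0<..} t *\<^sub>R (t powr (p - 1) * exp (- c * t)))"
    by (simp add: set_integrable_def)
  thus ?thesis
    unfolding set_integrable_def by (subst (asm) integrable_completion) auto
qed

lemma set_integrable_powr_exp:
  fixes u c :: complex
  assumes "Re u > 0" "Re c > 0"
  shows "set_integrable lborel {0<..} (\<lambda>t. of_real t powr (u - 1) * exp (- c * of_real t))"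
  by (rule set_integrable_continuous_bound[OF set_integrable_powr_exp_real[OF assms]])
     (auto intro!: continuous_intros simp: norm_mult norm_powr_real_powr)

text \<open>For real c this is Euler's integral after the substitution t -> c t. Both sides are
  holomorphic in c, so the identity extends from the positive axis to the half-plane.\<close>

lemma Laplace_powr:
  fixes u c :: complex
  assumes u: "Re u > 0" and c: "Re c > 0"
  shows "(LINT t:{0<..}|lborel. of_real t powr (u - 1) * exp (- c * of_real t)) = Gamma u * c powr (- u)"
proof -
  define S where "S = {c::complex. Re c > 0}"
  define I where "I = (\<lambda>c. LINT t:{0<..}|lborel. of_real t powr (u - 1) * exp (- c * of_real t))"
  have S: "open S" "connected S" unfolding S_def
    by (auto intro!: open_halfspace_Re_gt convex_connected convex_halfspace_Re_gt)
  have hol: "I holomorphic_on S"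
    unfolding I_def
  proof (rule holomorphic_on_set_integral[OF S(1)])
    fix s assume s: "s \<in> S"
    hence s0: "Re s > 0" by (simp add: S_def)
    show "\<exists>r>0. \<exists>g. set_integrable lborel {0<..} g \<and> (\<forall>s'\<in>cball s r \<inter> S. \<forall>t\<in>{0<..}. norm (of_real t powr (u - 1) * exp (- s' * of_real t)) \<le> g t)"
    proof (intro exI[of _ "Re s / 2"] exI[of _ "\<lambda>t. t powr (Re u - 1) * exp (- (Re s / 2) * t)"] conjI ballI)
      show "set_integrable lborel {0<..} (\<lambda>t. t powr (Re u - 1) * exp (- (Re s / 2) * t))"
        by (rule set_integrable_powr_exp_real) (use u s0 in auto)
      fix s' t :: complex and t' :: real assume s': "s' \<in> cball s (Re s / 2) \<inter> S" and t: "t' \<in> {0<..}"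
      have "\<bar>Re (s - s')\<bar> \<le> Re s / 2" using abs_Re_le_cmod[of "s - s'"] s' by (auto simp: dist_norm)
      hence "Re s / 2 \<le> Re s'" unfolding minus_complex.sel by linarith
      thus "norm (of_real t' powr (u - 1) * exp (- s' * of_real t')) \<le> t' powr (Re u - 1) * exp (- (Re s / 2) * t')"
        using t by (auto simp: norm_mult norm_powr_real_powr intro!: mult_left_mono mult_right_mono)
    qed (use s0 in auto)
  qed (auto intro!: holomorphic_intros continuous_intros)
  have real: "I (of_real x) = Gamma u * of_real x powr (- u)" if x: "x > 0" for x :: real
  proof -
    have "Gamma u = integral {0<..} (\<lambda>t. of_real t powr (u - 1) / of_real (exp t))"
      using Gamma_integral_complex'[OF u] by (simp add: integral_unique)
    also have "\<dots> = integral {0<..} (\<lambda>t. of_real t powr (u - 1) * exp (- 1 * of_real t))"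
      by (rule integral_cong) (simp add: exp_minus divide_inverse exp_of_real)
    also have "\<dots> = (LINT t:{0<..}|lborel. of_real t powr (u - 1) * exp (- 1 * of_real t))"
      by (rule set_borel_integral_eq_integral(2)[symmetric], rule set_integrable_powr_exp) (use u in auto)
    also have "\<dots> = of_real x * (LINT t|lborel. indicat_real {0<..} (0 + x * t) *\<^sub>R (of_real (0 + x * t) powr (u - 1) * exp (- 1 * of_real (0 + x * t))))"
      unfolding set_lebesgue_integral_def
      using lborel_integral_real_affine[of x "\<lambda>t. indicat_real {0<..} t *\<^sub>R (of_real t powr (u - 1) * exp (- 1 * of_real t))" 0] x
      by (simp add: scaleR_conv_of_real)
    also have "(\<lambda>t. indicat_real {0<..} (0 + x * t) *\<^sub>R (of_real (0 + x * t) powr (u - 1) * exp (- 1 * of_real (0 + x * t)))) =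
       (\<lambda>t. of_real x powr (u - 1) * (indicat_real {0<..} t *\<^sub>R (of_real t powr (u - 1) * exp (- of_real x * of_real t))))"
      using x by (auto simp: fun_eq_iff indicator_def powr_times_real zero_less_mult_iff)
    also have "of_real x * (LINT t|lborel. of_real x powr (u - 1) * (indicat_real {0<..} t *\<^sub>R (of_real t powr (u - 1) * exp (- of_real x * of_real t)))) =
        of_real x * of_real x powr (u - 1) * I (of_real x)"
      unfolding I_def set_lebesgue_integral_def
      by (simp only: Bochner_Integration.integral_mult_right_zero mult.assoc)
    also have "of_real x * of_real x powr (u - 1) = complex_of_real x powr u"
      using x by (simp add: powr_diff)
    finally show ?thesis using x by (simp add: powr_minus field_simps)
  qed
  have "I c - Gamma u * c powr (- u) = 0"
  proof (rule analytic_continuation[of "\<lambda>c. I c - Gamma u * c powr (- u)" S "of_real ` {0<..}" 1])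
    show "(\<lambda>c. I c - Gamma u * c powr (- u)) holomorphic_on S"
      by (intro holomorphic_intros hol) (auto simp: S_def complex_nonpos_Reals_iff)
    have lim: "(\<lambda>n. complex_of_real (1 + 1 / real (Suc n))) \<longlonglongrightarrow> of_real (1 + 0)"
      by (intro tendsto_intros LIMSEQ_Suc lim_const_over_n)
    show "1 islimpt complex_of_real ` {0<..}"
      unfolding islimpt_sequential
      by (rule exI[of _ "\<lambda>n. complex_of_real (1 + 1 / real (Suc n))"])
         (use lim in \<open>auto simp: add_pos_pos simp del: of_real_add of_nat_Suc intro!: imageI\<close>)
  qed (use S c real in \<open>auto simp: S_def\<close>)
  thus ?thesis by (simp add: I_def)
qed

lemma continuous_on_suminf_exp:
  assumes "summable (\<lambda>n. norm (b n :: complex))"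
  shows "continuous_on UNIV (\<lambda>t::real. \<Sum>n. b n * exp (\<i> * of_real (t * x n)))"
proof -
  have "uniform_limit UNIV (\<lambda>N t. \<Sum>n<N. b n * exp (\<i> * of_real (t * x n))) (\<lambda>t. \<Sum>n. b n * exp (\<i> * of_real (t * x n))) sequentially"
    by (rule Weierstrass_m_test[OF _ assms]) (simp add: norm_mult)
  thus ?thesis
    by (rule uniform_limit_theorem[rotated]) (auto intro!: always_eventually continuous_intros)
qed

text \<open>An Abelian theorem: only the stationary frequencies \<open>x n = 0\<close> contribute to the singularity.\<close>

lemma Laplace_almost_periodic_limit:
  fixes W :: "real \<Rightarrow> complex" and D :: "real \<Rightarrow> complex" and b :: "nat \<Rightarrow> complex" and x :: "nat \<Rightarrow> real"
    and \<theta> d :: real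
  assumes W: "W \<in> borel_measurable borel" "\<And>t. norm (W t) \<le> M" "(W \<longlongrightarrow> K) at_top"
    and b: "summable (\<lambda>n. norm (b n))" and d: "d > 0"
    and D: "((\<lambda>y. D y / of_real y) \<longlongrightarrow> of_real d) (at_right 0)"
  defines "u \<equiv> 1 - \<i> * of_real \<theta>"
  shows "((\<lambda>y. of_real y powr u * (LINT t:{0<..}|lborel.
             W t * (of_real t powr (u - 1) * (\<Sum>n. b n * exp (\<i> * of_real (t * x n))) * exp (- D y * of_real t))))
      \<longlongrightarrow> K * (Gamma u * of_real d powr (- u)) * (\<Sum>n. if x n = 0 then b n else 0)) (at_right 0)"
proof -
  define S where "S = (\<lambda>t. \<Sum>n. b n * exp (\<i> * of_real (t * x n)))"
  define B where "B = (\<Sum>n. norm (b n))"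
  define k where "k = (\<lambda>y t. complex_of_real t powr (u - 1) * S t * exp (- D y * of_real t))"
  have S: "continuous_on UNIV S" unfolding S_def by (rule continuous_on_suminf_exp[OF b])
  have SB: "norm (S t) \<le> B" for t
  proof -
    have "norm (S t) \<le> (\<Sum>n. norm (b n * exp (\<i> * of_real (t * x n))))"
      unfolding S_def by (rule summable_norm) (use b in \<open>simp add: norm_mult\<close>)
    thus ?thesis by (simp add: norm_mult B_def)
  qed
  have B0: "B \<ge> 0" unfolding B_def by (rule suminf_nonneg[OF b]) auto
  have M0: "M \<ge> 0" using W(2)[of 0] norm_ge_zero order_trans by blast
  have Reu: "Re u = 1" by (simp add: u_def)
  \<comment> \<open>Since D y / y tends to d > 0, the decay rate Re (D y) is at least half of d y
    near 0. All bounds below are for such y.\<close>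
  have ev: "eventually (\<lambda>y. y > 0 \<and> Re (D y) \<ge> y * d / 2) (at_right 0)"
  proof -
    have "((\<lambda>y. Re (D y / of_real y)) \<longlongrightarrow> Re (of_real d)) (at_right 0)" by (intro tendsto_Re D)
    hence "eventually (\<lambda>y. Re (D y / of_real y) > d / 2) (at_right 0)"
      by (rule order_tendstoD) (use d in auto)
    thus ?thesis using eventually_at_right_less[of 0]
      by eventually_elim (auto simp: Re_divide_of_real field_simps)
  qed
  have knorm: "norm (k y t) \<le> B * exp (- (y * d / 2) * t)" if "y > 0" "Re (D y) \<ge> y * d / 2" "t > 0" for y t
  proof -
    have "norm (k y t) = norm (S t) * exp (- Re (D y) * t)"
      using that by (simp add: k_def norm_mult norm_powr_real_powr Reu)
    also have "\<dots> \<le> B * exp (- (y * d / 2) * t)" using SB[of t] B0 that by (intro mult_mono) (auto simp: mult_right_mono)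
    finally show ?thesis .
  qed
  have kcont: "continuous_on {0<..} (k y)" for y
    unfolding k_def by (intro continuous_intros continuous_on_subset[OF S]) auto
  have expint: "set_integrable lborel {0<..} (\<lambda>t. exp (- c * t))" "(LINT t:{0<..}|lborel. exp (- c * t)) = 1 / c" if "c > 0" for c :: real
  proof -
    have i: "set_integrable lborel {0..} (\<lambda>t. exp (- c * t))" by (rule set_integrable_exp_decay(1)[OF that])
    show "set_integrable lborel {0<..} (\<lambda>t. exp (- c * t))" by (rule set_integrable_subset[OF i]) auto
    have "(LINT t:{0<..}|lborel. exp (- c * t)) = (LINT t:{0..}|lborel. exp (- c * t))"
    proof (rule set_integral_cong_set)
      have "AE t in lborel. t \<noteq> (0::real)" by (rule AE_lborel_singleton)
      thus "AE t in lborel. (t \<in> {0::real..}) = (t \<in> {0<..})" by eventually_elim auto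
      have "(\<lambda>t. exp (- c * t)) \<in> borel_measurable borel" by (intro borel_measurable_continuous_onI continuous_intros)
      thus "set_borel_measurable lborel {0<..} (\<lambda>t. exp (- c * t))" "set_borel_measurable lborel {0..} (\<lambda>t. exp (- c * t))"
        by (auto simp: set_borel_measurable_def)
    qed
    thus "(LINT t:{0<..}|lborel. exp (- c * t)) = 1 / c" using set_integrable_exp_decay(2)[OF that, of 0] by simp
  qed
  have kint: "set_integrable lborel {0<..} (k y)" if "y > 0" "Re (D y) \<ge> y * d / 2" for y
    by (rule set_integrable_continuous_bound[OF set_integrable_mult_right[of "B" "lborel" "{0<..}" "\<lambda>t. exp (- (y * d / 2) * t)"]])
       (use expint(1)[of "y * d / 2"] knorm that d kcont in auto)
  have Vint: "set_integrable lborel {0<..} (\<lambda>t. V t * k y t)"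
    if y: "y > 0" "Re (D y) \<ge> y * d / 2" and V: "V \<in> borel_measurable borel" "\<And>t. norm (V t) \<le> M'" for y V M'
  proof -
    have M'0: "M' \<ge> 0" using V(2)[of 0] norm_ge_zero order_trans by blast
    have "set_integrable lborel {0<..} (\<lambda>t. of_real M' * k y t)" using kint[OF y] by auto
    thus ?thesis
    proof (rule set_integrable_bound)
      have "(\<lambda>t. V t * (indicat_real {0<..} t *\<^sub>R k y t)) \<in> borel_measurable borel"
        by (intro borel_measurable_times V borel_measurable_continuous_on_indicator kcont) auto
      thus "set_borel_measurable lborel {0<..} (\<lambda>t. V t * k y t)"
        unfolding set_borel_measurable_def by (simp add: mult.commute scaleR_conv_of_real mult.left_commute)
      show "AE t in lborel. t \<in> {0<..} \<longrightarrow> norm (V t * k y t) \<le> norm (of_real M' * k y t)"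
        using V(2) M'0 by (intro always_eventually) (auto simp: norm_mult intro!: mult_right_mono)
    qed
  qed
  have norm_y: "norm (complex_of_real y powr u) = y" if "y > 0" for y
    using that by (simp add: norm_powr_real_powr Reu)
  have Dlim: "(D \<longlongrightarrow> 0) (at_right 0)"
  proof -
    have id: "((\<lambda>y::real. complex_of_real y) \<longlongrightarrow> of_real 0) (at_right 0)"
      by (intro tendsto_of_real tendsto_ident_at)
    have "((\<lambda>y. D y / of_real y * of_real y) \<longlongrightarrow> of_real d * of_real 0) (at_right 0)"
      by (intro tendsto_mult D id)
    hence "((\<lambda>y. D y / of_real y * of_real y) \<longlongrightarrow> 0) (at_right 0)" by simp
    thus ?thesis
      by (rule Lim_transform_eventually) (use eventually_at_right_less[of 0] in eventually_elim, auto)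
  qed
  have main: "((\<lambda>y. of_real y powr u * (LINT t:{0<..}|lborel. k y t)) \<longlongrightarrow> (\<Sum>n. if x n = 0 then b n * (Gamma u * of_real d powr (- u)) else 0)) (at_right 0)"
  proof -
    \<comment> \<open>\<open>a n y\<close> is y^u times the Laplace transform of the n-th term. For
      x n \<noteq> 0 the power (D y - \<i> x n)^(-u) stays bounded as y tends to 0, so the factor
      y^u sends the term to 0.\<close>
    define a where "a = (\<lambda>n y. b n * (Gamma u * (of_real y powr u * (D y - \<i> * of_real (x n)) powr (- u))))"
    define C where "C = norm (Gamma u) * (2 / d * exp (\<bar>\<theta>\<bar> * pi))"
    have eq: "of_real y powr u * (LINT t:{0<..}|lborel. k y t) = (\<Sum>n. a n y)" if y: "y > 0" "Re (D y) \<ge> y * d / 2" for y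
    proof -
      have Dpos: "Re (D y) > 0" using y d by (smt (verit) divide_pos_pos mult_pos_pos zero_less_numeral)
      define f where "f = (\<lambda>n t. indicat_real {0<..} t *\<^sub>R (b n * (complex_of_real t powr (u - 1) * exp (- (D y - \<i> * of_real (x n)) * of_real t))))"
      have fint: "integrable lborel (f n)" for n
        using set_integrable_mult_right[OF set_integrable_powr_exp[of u "D y - \<i> * of_real (x n)"], of "b n"] Dpos Reu
        unfolding f_def set_integrable_def by simp
      have fnorm: "norm (f n t) = norm (b n) * (indicat_real {0<..} t * exp (- Re (D y) * t))" for n t
        by (auto simp: f_def norm_mult norm_powr_real_powr Reu indicator_def)
      have "(LINT t:{0<..}|lborel. k y t) = (LINT t|lborel. (\<Sum>n. f n t))"
        unfolding set_lebesgue_integral_def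
      proof (rule Bochner_Integration.integral_cong[OF refl])
        fix t :: real
        have sm: "summable (\<lambda>n. b n * exp (\<i> * of_real (t * x n)))"
          by (rule summable_norm_cancel) (use b in \<open>simp add: norm_mult\<close>)
        have "(\<Sum>n. f n t) = (\<Sum>n. (b n * exp (\<i> * of_real (t * x n))) * (indicat_real {0<..} t *\<^sub>R (of_real t powr (u - 1) * exp (- D y * of_real t))))"
          by (intro suminf_cong) (simp add: f_def ring_distribs exp_add exp_minus exp_diff field_simps scaleR_conv_of_real)
        also have "\<dots> = S t * (indicat_real {0<..} t *\<^sub>R (of_real t powr (u - 1) * exp (- D y * of_real t)))"
          unfolding S_def by (rule suminf_mult2[symmetric, OF sm])
        finally show "indicat_real {0<..} t *\<^sub>R k y t = (\<Sum>n. f n t)"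
          by (simp add: k_def scaleR_conv_of_real mult_ac)
      qed
      also have "\<dots> = (\<Sum>n. LINT t|lborel. f n t)"
      proof (rule integral_suminf[OF fint])
        show "AE t in lborel. summable (\<lambda>n. norm (f n t))"
          unfolding fnorm by (intro always_eventually allI summable_mult2 b)
        show "summable (\<lambda>n. LINT t|lborel. norm (f n t))"
          unfolding fnorm Bochner_Integration.integral_mult_right_zero by (intro summable_mult2 b)
      qed
      also have "(\<lambda>n. LINT t|lborel. f n t) = (\<lambda>n. b n * (Gamma u * (D y - \<i> * of_real (x n)) powr (- u)))"
      proof
        fix n
        have "(LINT t|lborel. f n t) = b n * (LINT t:{0<..}|lborel. of_real t powr (u - 1) * exp (- (D y - \<i> * of_real (x n)) * of_real t))"
          unfolding f_def set_lebesgue_integral_def[symmetric] by simp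
        also have "(LINT t:{0<..}|lborel. of_real t powr (u - 1) * exp (- (D y - \<i> * of_real (x n)) * of_real t)) = Gamma u * (D y - \<i> * of_real (x n)) powr (- u)"
          by (rule Laplace_powr) (use Dpos Reu in auto)
        finally show "(LINT t|lborel. f n t) = b n * (Gamma u * (D y - \<i> * of_real (x n)) powr (- u))" .
      qed
      finally have *: "(LINT t:{0<..}|lborel. k y t) = (\<Sum>n. b n * (Gamma u * (D y - \<i> * of_real (x n)) powr (- u)))" .
      have "summable (\<lambda>n. LINT t|lborel. f n t)"
      proof (rule summable_integral[OF fint])
        show "AE t in lborel. summable (\<lambda>n. norm (f n t))"
          unfolding fnorm by (intro always_eventually allI summable_mult2 b)
        show "summable (\<lambda>n. LINT t|lborel. norm (f n t))"
          unfolding fnorm Bochner_Integration.integral_mult_right_zero by (intro summable_mult2 b)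
      qed
      hence sm: "summable (\<lambda>n. b n * (Gamma u * (D y - \<i> * of_real (x n)) powr (- u)))"
        unfolding \<open>(\<lambda>n. LINT t|lborel. f n t) = (\<lambda>n. b n * (Gamma u * (D y - \<i> * of_real (x n)) powr (- u)))\<close> .
      show ?thesis unfolding * suminf_mult[OF sm, symmetric] a_def by (intro suminf_cong) (simp add: mult_ac)
    qed
    have "((\<lambda>y. \<Sum>n. a n y) \<longlongrightarrow> (\<Sum>n. if x n = 0 then b n * (Gamma u * of_real d powr (- u)) else 0)) (at_right 0)"
    proof -
      have lim: "(a n \<longlongrightarrow> (if x n = 0 then b n * (Gamma u * of_real d powr (- u)) else 0)) (at_right 0)" for n
      proof (cases "x n = 0")
        case True
        have "((\<lambda>y. b n * (Gamma u * (D y / of_real y) powr (- u))) \<longlongrightarrow> b n * (Gamma u * of_real d powr (- u))) (at_right 0)"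
          by (intro tendsto_intros D) (use d in auto)
        hence "(a n \<longlongrightarrow> b n * (Gamma u * of_real d powr (- u))) (at_right 0)"
        proof (rule Lim_transform_eventually)
          show "\<forall>\<^sub>F y in at_right 0. b n * (Gamma u * (D y / of_real y) powr (- u)) = a n y"
            using eventually_at_right_less[of 0]
          proof eventually_elim
            case (elim y)
            have "D y = of_real y * (D y / of_real y)" using elim by simp
            hence "D y powr (- u) = of_real y powr (- u) * (D y / of_real y) powr (- u)"
              using powr_times_real_left[of "of_real y" "D y / of_real y" "- u"] elim by simp
            thus ?case using elim True by (simp add: a_def powr_minus)
          qed
        qed
        thus ?thesis using True by simp
      next
        case False
        have y0: "((\<lambda>y::real. complex_of_real y powr u) \<longlongrightarrow> 0) (at_right 0)"
        proof (rule tendsto_norm_zero_cancel)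
          have "((\<lambda>y::real. y) \<longlongrightarrow> 0) (at_right 0)" by (rule tendsto_ident_at)
          thus "((\<lambda>y::real. norm (complex_of_real y powr u)) \<longlongrightarrow> 0) (at_right 0)"
            by (rule Lim_transform_eventually) (use eventually_at_right_less[of 0] in eventually_elim, simp add: norm_y)
        qed
        have "((\<lambda>y. b n * (Gamma u * (of_real y powr u * (D y - \<i> * of_real (x n)) powr (- u)))) \<longlongrightarrow>
              b n * (Gamma u * (0 * (0 - \<i> * of_real (x n)) powr (- u)))) (at_right 0)"
          by (intro tendsto_intros Dlim y0) (use False in \<open>auto simp: complex_nonpos_Reals_iff\<close>)
        thus ?thesis using False by (simp add: a_def)
      qed
      \<comment> \<open>The lower bound y d / 2 for |z| is compensated exactly by |y^u| = y, and the
        argument of z costs at most exp (|\<theta>| pi). The bound is thus uniform in y, as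
        Tannery's theorem requires.\<close>
      have bnd: "norm (a n y) \<le> C * norm (b n)" if y: "y > 0" "Re (D y) \<ge> y * d / 2" for n y
      proof -
        define z where "z = D y - \<i> * of_real (x n)"
        have "y * d / 2 \<le> Re z" using y by (simp add: z_def)
        also have "\<dots> \<le> norm z" by (rule complex_Re_le_cmod)
        finally have z: "y * d / 2 \<le> norm z" .
        have ydpos: "y * d / 2 > 0" using y d by simp
        have "norm (z powr (- u)) = norm z powr (- 1) * exp (- \<theta> * Arg z)"
          using Reu by (simp add: norm_powr_complex u_def)
        also have "\<dots> \<le> (2 / (y * d)) * exp (\<bar>\<theta>\<bar> * pi)"
        proof (rule mult_mono)
          have "norm z powr (- 1) = 1 / norm z" using z ydpos by (simp add: powr_minus field_simps)
          also have "\<dots> \<le> 1 / (y * d / 2)" using z ydpos by (intro divide_left_mono mult_pos_pos) linarith+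
          finally show "norm z powr (- 1) \<le> 2 / (y * d)" by simp
          have "- \<theta> * Arg z \<le> \<bar>\<theta>\<bar> * \<bar>Arg z\<bar>" by (metis abs_ge_self abs_minus_cancel abs_mult)
          also have "\<dots> \<le> \<bar>\<theta>\<bar> * pi" using Arg_le_pi[of z] mpi_less_Arg[of z] by (intro mult_left_mono) auto
          finally show "exp (- \<theta> * Arg z) \<le> exp (\<bar>\<theta>\<bar> * pi)" by simp
        qed (use y d in auto)
        finally have "norm (of_real y powr u * z powr (- u)) \<le> y * ((2 / (y * d)) * exp (\<bar>\<theta>\<bar> * pi))"
          unfolding norm_mult norm_y[OF y(1)] using y by (intro mult_left_mono) auto
        also have "\<dots> = 2 / d * exp (\<bar>\<theta>\<bar> * pi)" using y by simp
        finally have "norm (b n) * (norm (Gamma u) * norm (of_real y powr u * z powr (- u))) \<le> norm (b n) * (norm (Gamma u) * (2 / d * exp (\<bar>\<theta>\<bar> * pi)))"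
          by (intro mult_left_mono) auto
        thus ?thesis by (simp add: a_def C_def z_def norm_mult mult_ac)
      qed
      have "\<forall>\<^sub>F (n, y) in at_top \<times>\<^sub>F at_right 0. norm (a n y) \<le> C * norm (b n)"
      proof -
        have "\<forall>\<^sub>F (n::nat, y) in at_top \<times>\<^sub>F at_right 0. y > 0 \<and> Re (D y) \<ge> y * d / 2"
          using ev by (subst eventually_prod2) auto
        thus ?thesis by eventually_elim (use bnd in auto)
      qed
      from tannerys_theorem[OF lim this summable_mult[OF b]] show ?thesis by simp
    qed
    thus ?thesis
      by (rule Lim_transform_eventually) (use ev in eventually_elim, use eq in auto)
  qed
  \<comment> \<open>Beyond T the difference W - K is small. On (0, T] it is merely bounded, but
    there its integral is bounded independently of y, and |y^u| = y makes it vanish.\<close>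
  have err: "((\<lambda>y. of_real y powr u * (LINT t:{0<..}|lborel. (W t - K) * k y t)) \<longlongrightarrow> 0) (at_right 0)"
  proof (rule tendstoI)
    fix e :: real assume e: "e > 0"
    \<comment> \<open>The tail contributes at most 2 \<epsilon> B / d, which this choice makes
      smaller than e / 2; B + 1 in place of B guards against B = 0.\<close>
    define \<epsilon> where "\<epsilon> = e * d / (4 * (B + 1))"
    have \<epsilon>: "\<epsilon> > 0" using e d B0 by (simp add: \<epsilon>_def)
    have "eventually (\<lambda>t. dist (W t) K < \<epsilon>) at_top" using W(3) \<epsilon> by (rule tendstoD)
    then obtain T0 where T0: "\<And>t. t \<ge> T0 \<Longrightarrow> dist (W t) K < \<epsilon>" by (auto simp: eventually_at_top_linorder)
    define T where "T = max T0 1"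
    define M' where "M' = M + norm K"
    have WK: "norm (W t - K) \<le> M'" for t
      using norm_triangle_ineq4[of "W t" K] W(2)[of t] by (simp add: M'_def)
    have M'0: "M' \<ge> 0" using M0 by (simp add: M'_def)
    have bound: "norm (LINT t:{0<..}|lborel. (W t - K) * k y t) \<le> \<epsilon> * B * (2 / (y * d)) + M' * B * T"
      if y: "y > 0" "Re (D y) \<ge> y * d / 2" for y
    proof -
      define c where "c = y * d / 2"
      have c: "c > 0" using y d by (simp add: c_def)
      have i1: "set_integrable lborel {0<..} (\<lambda>t. \<epsilon> * B * exp (- c * t))" using expint(1)[OF c] by auto
      have i2: "set_integrable lborel {0<..} (\<lambda>t. M' * B * indicat_real {0..T} t)"
      proof -
        have "integrable lborel (\<lambda>t. M' * B * indicat_real {0<..T} t)"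
          by (intro integrable_mult_right integrable_real_indicator) (auto simp: T_def)
        also have "(\<lambda>t. M' * B * indicat_real {0<..T} t) = (\<lambda>t. indicat_real {0<..} t *\<^sub>R (M' * B * indicat_real {0..T} t))"
          by (auto simp: fun_eq_iff indicator_def)
        finally show ?thesis unfolding set_integrable_def .
      qed
      have "norm (LINT t:{0<..}|lborel. (W t - K) * k y t) \<le> (LINT t:{0<..}|lborel. \<epsilon> * B * exp (- c * t) + M' * B * indicat_real {0..T} t)"
      proof (rule set_integral_norm_le)
        show "set_integrable lborel {0<..} (\<lambda>t. \<epsilon> * B * exp (- c * t) + M' * B * indicat_real {0..T} t)"
          using i1 i2 by (rule set_integral_add(1))
        show "set_integrable lborel {0<..} (\<lambda>t. (W t - K) * k y t)"
          by (rule Vint[OF y _ WK]) (use W(1) in auto)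
        fix t :: real assume t: "t \<in> {0<..}"
        have kt: "norm (k y t) \<le> B * exp (- c * t)" using knorm[OF y] t by (simp add: c_def)
        show "norm ((W t - K) * k y t) \<le> \<epsilon> * B * exp (- c * t) + M' * B * indicat_real {0..T} t"
        proof (cases "t \<le> T")
          case True
          have "norm ((W t - K) * k y t) \<le> M' * (B * exp (- c * t))"
            unfolding norm_mult by (intro mult_mono WK kt M'0) auto
          also have "\<dots> \<le> M' * (B * 1)" using t c M'0 B0 by (intro mult_left_mono) auto
          also have "\<dots> \<le> \<epsilon> * B * exp (- c * t) + M' * B * indicat_real {0..T} t"
            using True t \<epsilon> B0 by (auto simp: indicator_def)
          finally show ?thesis .
        next
          case False
          hence "norm (W t - K) \<le> \<epsilon>" using T0[of t] by (auto simp: T_def dist_norm less_imp_le)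
          hence "norm ((W t - K) * k y t) \<le> \<epsilon> * (B * exp (- c * t))"
            unfolding norm_mult using \<epsilon> by (intro mult_mono kt) auto
          thus ?thesis using False by (simp add: indicator_def)
        qed
      qed auto
      also have "\<dots> = \<epsilon> * B * (1 / c) + M' * B * (LINT t:{0<..}|lborel. indicat_real {0..T} t)"
        using set_integral_add(2)[OF i1 i2] expint(2)[OF c] by simp
      also have "(LINT t:{0<..}|lborel. indicat_real {0..T} t) = T"
      proof -
        have "(LINT t:{0<..}|lborel. indicat_real {0..T} t) = (LINT t|lborel. indicat_real {0<..T} t)"
          unfolding set_lebesgue_integral_def by (rule Bochner_Integration.integral_cong) (auto simp: indicator_def)
        thus ?thesis by (simp add: T_def)
      qed
      finally show ?thesis by (simp add: c_def)
    qed
    have "((\<lambda>y::real. \<epsilon> * B * 2 / d + M' * B * T * y) \<longlongrightarrow> \<epsilon> * B * 2 / d + M' * B * T * 0) (at_right 0)"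
      by (intro tendsto_intros)
    moreover have "\<epsilon> * B * 2 / d + M' * B * T * 0 < e"
    proof -
      have "\<epsilon> * B * 2 / d = e * (B / (2 * (B + 1)))"
      proof -
        have "e * d / (4 * c) * B * 2 / d = e * (B / (2 * c))" if "c > 0" for c
          using d that by (simp add: field_simps)
        from this[of "B + 1"] show ?thesis using B0 by (simp add: \<epsilon>_def)
      qed
      also have "\<dots> < e * 1" using e B0 by (intro mult_strict_left_mono) (auto simp: field_simps)
      finally show ?thesis by simp
    qed
    ultimately have "eventually (\<lambda>y::real. \<epsilon> * B * 2 / d + M' * B * T * y < e) (at_right 0)"
      by (rule order_tendstoD)
    thus "eventually (\<lambda>y. dist (of_real y powr u * (LINT t:{0<..}|lborel. (W t - K) * k y t)) 0 < e) (at_right 0)"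
      using ev
    proof eventually_elim
      case (elim y)
      have "norm (of_real y powr u * (LINT t:{0<..}|lborel. (W t - K) * k y t)) \<le> y * (\<epsilon> * B * (2 / (y * d)) + M' * B * T)"
        unfolding norm_mult norm_y[OF conjunct1[OF elim(2)]] using elim by (intro mult_left_mono bound) auto
      also have "\<dots> = \<epsilon> * B * 2 / d + M' * B * T * y" using elim d by (simp add: field_simps)
      also have "\<dots> < e" using elim by simp
      finally show ?case by simp
    qed
  qed
  have "((\<lambda>y. K * (of_real y powr u * (LINT t:{0<..}|lborel. k y t)) + of_real y powr u * (LINT t:{0<..}|lborel. (W t - K) * k y t))
    \<longlongrightarrow> K * (\<Sum>n. if x n = 0 then b n * (Gamma u * of_real d powr (- u)) else 0) + 0) (at_right 0)"
    by (intro tendsto_intros main err)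
  also have "K * (\<Sum>n. if x n = 0 then b n * (Gamma u * of_real d powr (- u)) else 0) + 0 =
      K * (Gamma u * of_real d powr (- u)) * (\<Sum>n. if x n = 0 then b n else 0)"
  proof -
    have sm: "summable (\<lambda>n. if x n = 0 then b n else 0)"
      by (rule summable_comparison_test'[OF b]) auto
    have "(\<Sum>n. if x n = 0 then b n * (Gamma u * of_real d powr (- u)) else 0) = (\<Sum>n. (if x n = 0 then b n else 0) * (Gamma u * of_real d powr (- u)))"
      by (intro suminf_cong) auto
    also have "\<dots> = (\<Sum>n. if x n = 0 then b n else 0) * (Gamma u * of_real d powr (- u))"
      by (rule suminf_mult2[symmetric, OF sm])
    finally show ?thesis by simp
  qed
  finally show ?thesis
  proof (rule Lim_transform_eventually)
    show "\<forall>\<^sub>F y in at_right 0. K * (of_real y powr u * (LINT t:{0<..}|lborel. k y t)) + of_real y powr u * (LINT t:{0<..}|lborel. (W t - K) * k y t)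
      = of_real y powr u * (LINT t:{0<..}|lborel. W t * (of_real t powr (u - 1) * (\<Sum>n. b n * exp (\<i> * of_real (t * x n))) * exp (- D y * of_real t)))"
      using ev
    proof eventually_elim
      case (elim y)
      have WK: "norm (W t - K) \<le> M + norm K" for t
        using norm_triangle_ineq4[of "W t" K] W(2)[of t] by simp
      have i2: "set_integrable lborel {0<..} (\<lambda>t. (W t - K) * k y t)"
        by (rule Vint[OF _ _ _ WK]) (use W(1) elim in auto)
      have i1: "set_integrable lborel {0<..} (\<lambda>t. K * k y t)" using kint elim by auto
      have "(LINT t:{0<..}|lborel. W t * k y t) = (LINT t:{0<..}|lborel. K * k y t + (W t - K) * k y t)"
        by (simp add: algebra_simps)
      also have "\<dots> = K * (LINT t:{0<..}|lborel. k y t) + (LINT t:{0<..}|lborel. (W t - K) * k y t)"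
        using set_integral_add(2)[OF i1 i2] by simp
      finally show ?case by (simp add: k_def S_def algebra_simps)
    qed
  qed
qed

section \<open>Boundary behaviour of the exponential series\<close>

text \<open>The analytic input of the contour argument alone. The functional equation is required
  only on Re s = -1/2 at large height, where no Gamma factor takes a dummy value at a pole, and
  \<open>a 0 = 0\<close> lets the series start at index 0. The locale is closed under complex
  conjugation of all data, see \<open>degree_one_cnj\<close>.\<close>

locale degree_one =
  fixes a :: "nat \<Rightarrow> complex" and F :: "complex \<Rightarrow> complex" and Q :: real and r :: nat
    and lam :: "nat \<Rightarrow> real" and mu :: "nat \<Rightarrow> complex" and om :: complex
  assumes a0: "a 0 = 0"
    and a_summable: "summable (\<lambda>n. norm (a n) * real n powr (-3/2))"
    and F_series: "\<And>t. F (Complex (3/2) t) = (\<Sum>n. a n * of_nat n powr (- Complex (3/2) t))"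
    and F_hol: "F holomorphic_on - {1}"
    and F_growth: "\<exists>\<rho> R. \<forall>s. norm s \<ge> R \<longrightarrow> norm (F s) \<le> exp (norm s powr \<rho>)"
    and Q_pos: "Q > 0" and lam_pos: "\<And>j. j \<in> {1..r} \<Longrightarrow> lam j > 0"
    and degree: "2 * (\<Sum>j=1..r. lam j) = 1"
    and fun_eq: "\<exists>T. \<forall>t. \<bar>t\<bar> \<ge> T \<longrightarrow> F (Complex (-1/2) t) =
        om * of_real Q powr (1 - 2 * Complex (-1/2) t) *
        (\<Prod>j=1..r. Gamma (of_real (lam j) * (1 - Complex (-1/2) t) + cnj (mu j)) / Gamma (of_real (lam j) * Complex (-1/2) t + mu j)) *
        cnj (F (1 - cnj (Complex (-1/2) t)))"
begin

definition \<theta> :: real where "\<theta> = 2 * (\<Sum>j=1..r. Im (mu j))"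
definition \<eta> :: real where "\<eta> = 2 * (\<Sum>j=1..r. Re (mu j)) - real r"
definition q :: real where "q = 2 * pi * Q\<^sup>2 * (\<Prod>j=1..r. lam j powr (2 * lam j))"
definition Lam :: complex where "Lam = (\<Prod>j=1..r. of_real (lam j) powr (-2 * \<i> * of_real (Im (mu j))))"

text \<open>The limit of \<open>weight\<close> at infinity, that is, what Stirling's formula leaves
  after all growing terms have cancelled.\<close>

definition Stirling_const :: complex where
  "Stirling_const = om * of_real (sqrt q) * Lam * exp (- \<i> * of_real (pi * (\<eta> + 1) / 2))"

definition gamma_quotient :: "real \<Rightarrow> complex" where
  "gamma_quotient t = om * of_real Q powr (1 - 2 * Complex (-1/2) t) *
        (\<Prod>j=1..r. Gamma (of_real (lam j) * (1 - Complex (-1/2) t) + cnj (mu j)) / Gamma (of_real (lam j) * Complex (-1/2) t + mu j))"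

text \<open>
  The factor of the integrand on the line \<open>Re s = -1/2\<close> that converges as \<open>t\<close> tends to infinity; the
  oscillation that remains is \<open>exp (i t freq)\<close>.
\<close>

definition weight :: "real \<Rightarrow> complex" where
  "weight t = Gamma (Complex (-1/2) t) * gamma_quotient t * exp (- Complex (-1/2) t * (\<i> * of_real (pi/2))) *
     exp (Complex (-1/2) t * of_real (ln (q / (2*pi)))) * exp (\<i> * of_real (\<theta> * ln t))"

lemma prod_lam_powr_pos: "(\<Prod>j=1..r. lam j powr f j) > 0"
  by (rule prod_pos) (use lam_pos in force)

lemma q_pos: "q > 0"
  unfolding q_def using Q_pos prod_lam_powr_pos by (intro mult_pos_pos) auto

lemma ln_q: "ln (q / (2 * pi)) = 2 * ln Q + 2 * (\<Sum>j=1..r. lam j * ln (lam j))"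
proof -
  have "q / (2 * pi) = Q\<^sup>2 * (\<Prod>j=1..r. lam j powr (2 * lam j))" by (simp add: q_def)
  also have "ln \<dots> = ln (Q\<^sup>2) + ln (\<Prod>j=1..r. lam j powr (2 * lam j))"
    using Q_pos prod_lam_powr_pos by (intro ln_mult_pos) auto
  also have "ln (\<Prod>j=1..r. lam j powr (2 * lam j)) = (\<Sum>j=1..r. ln (lam j powr (2 * lam j)))"
    by (rule ln_prod) (use lam_pos in force)+
  also have "\<dots> = (\<Sum>j=1..r. 2 * (lam j * ln (lam j)))"
    using lam_pos by (intro sum.cong refl) (simp add: ln_powr)
  finally show ?thesis using Q_pos by (simp add: ln_realpow sum_distrib_left)
qed

text \<open>The exponent in \<open>Stirling_vertical\<close> for
  \<open>Gamma (A + \<i> * \<tau>)\<close>.\<close>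

abbreviation (input) SE :: "complex \<Rightarrow> real \<Rightarrow> complex" where
  "SE A \<tau> \<equiv> (\<i> * of_real \<tau> + A - 1/2) * (of_real (ln \<tau>) + \<i> * of_real (pi/2)) - \<i> * of_real \<tau>"

text \<open>Degree one is used here. With the \<open>lam j\<close> summing to 1/2, the Gamma
  quotient contributes - t ln t + t to the imaginary part and ln t to the real part, opposite to
  \<open>Gamma s\<close>. The remaining ln t in the imaginary part cancels against \<theta> ln t,
  and the terms t ln (lam j) and t ln Q against ln (q / (2 pi)), which is what the conductor is made
  for.\<close>

lemma Stirling_exponents_cancel:
  assumes t: "t > 0"
  shows "SE (-1/2) t + (\<Sum>j=1..r. cnj (SE (of_real (3/2 * lam j) + mu j) (lam j * t)) - SE (of_real (-1/2 * lam j) + mu j) (lam j * t))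
     + (1 - 2 * Complex (-1/2) t) * of_real (ln Q) + (- Complex (-1/2) t * (\<i> * of_real (pi/2)))
     + Complex (-1/2) t * of_real (ln (q / (2*pi))) + \<i> * of_real (\<theta> * ln t) =
     of_real (ln (q / (2 * pi)) / 2) + (\<Sum>j=1..r. -2 * \<i> * of_real (Im (mu j)) * of_real (ln (lam j))) - \<i> * of_real (pi * (\<eta> + 1) / 2)"
proof -
  define l where "l = ln t"
  define LB where "LB = (\<Sum>j=1..r. lam j * ln (lam j))"
  define LM where "LM = (\<Sum>j=1..r. Im (mu j) * ln (lam j))"
  define MI where "MI = (\<Sum>j=1..r. Im (mu j))"
  define MR where "MR = (\<Sum>j=1..r. Re (mu j))"
  have L: "(\<Sum>j=1..r. lam j) = 1/2" using degree by simp
  have X: "cnj (SE (of_real (3/2 * lam j) + mu j) (lam j * t)) - SE (of_real (-1/2 * lam j) + mu j) (lam j * t) =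
     Complex (2 * lam j * l + 2 * (lam j * ln (lam j)))
       (- 2 * t * l * lam j - 2 * t * (lam j * ln (lam j)) - 2 * l * Im (mu j) - 2 * (Im (mu j) * ln (lam j))
        - pi / 2 * lam j - pi * Re (mu j) + pi / 2 + 2 * t * lam j)"
    if "j \<in> {1..r}" for j
  proof -
    have ln: "ln (lam j * t) = ln (lam j) + l" using lam_pos[OF that] t by (simp add: l_def ln_mult)
    show ?thesis unfolding ln by (simp add: complex_eq_iff) (simp add: field_simps)
  qed
  have sumX: "(\<Sum>j=1..r. cnj (SE (of_real (3/2 * lam j) + mu j) (lam j * t)) - SE (of_real (-1/2 * lam j) + mu j) (lam j * t)) =
     Complex (l + 2 * LB) (- t * l - 2 * t * LB - 2 * l * MI - 2 * LM - pi / 4 - pi * MR + real r * pi / 2 + t)"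
  proof -
    have "(\<Sum>j=1..r. cnj (SE (of_real (3/2 * lam j) + mu j) (lam j * t)) - SE (of_real (-1/2 * lam j) + mu j) (lam j * t)) =
       (\<Sum>j=1..r. Complex (2 * lam j * l + 2 * (lam j * ln (lam j)))
       (- 2 * t * l * lam j - 2 * t * (lam j * ln (lam j)) - 2 * l * Im (mu j) - 2 * (Im (mu j) * ln (lam j))
        - pi / 2 * lam j - pi * Re (mu j) + pi / 2 + 2 * t * lam j))"
      by (intro sum.cong refl X)
    also have "\<dots> = Complex (\<Sum>j=1..r. 2 * lam j * l + 2 * (lam j * ln (lam j)))
      (\<Sum>j=1..r. - 2 * t * l * lam j - 2 * t * (lam j * ln (lam j)) - 2 * l * Im (mu j) - 2 * (Im (mu j) * ln (lam j))
        - pi / 2 * lam j - pi * Re (mu j) + pi / 2 + 2 * t * lam j)"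
      by (simp add: complex_eq_iff)
    also have "(\<Sum>j=1..r. 2 * lam j * l + 2 * (lam j * ln (lam j))) = 2 * l * (\<Sum>j=1..r. lam j) + 2 * LB"
      unfolding LB_def sum_distrib_left sum.distrib[symmetric] by (intro sum.cong) (auto simp: algebra_simps)
    also have "(\<Sum>j=1..r. - 2 * t * l * lam j - 2 * t * (lam j * ln (lam j)) - 2 * l * Im (mu j) - 2 * (Im (mu j) * ln (lam j))
        - pi / 2 * lam j - pi * Re (mu j) + pi / 2 + 2 * t * lam j) =
        - 2 * t * l * (\<Sum>j=1..r. lam j) - 2 * t * LB - 2 * l * MI - 2 * LM - pi / 2 * (\<Sum>j=1..r. lam j) - pi * MR + real r * (pi / 2) + 2 * t * (\<Sum>j=1..r. lam j)"
      unfolding LB_def LM_def MI_def MR_def sum_distrib_left by (simp add: sum.distrib sum_subtractf sum_negf)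
    finally show ?thesis unfolding L by simp
  qed
  have sumM: "(\<Sum>j=1..r. -2 * \<i> * of_real (Im (mu j)) * of_real (ln (lam j))) = -2 * \<i> * of_real LM"
    unfolding LM_def of_real_sum sum_distrib_left by (intro sum.cong) auto
  show ?thesis
    unfolding sumX sumM ln_q LB_def[symmetric] \<theta>_def \<eta>_def MI_def[symmetric] MR_def[symmetric] l_def[symmetric]
    by (simp add: complex_eq_iff) (simp add: field_simps)
qed

lemma weight_limit: "(weight \<longlongrightarrow> Stirling_const) at_top"
proof -
  define G where "G = (\<lambda>A \<tau>. Gamma (A + \<i> * of_real \<tau>) / (of_real (sqrt (2 * pi)) * exp (SE A \<tau>)))"
  have G1: "((\<lambda>\<tau>. G A \<tau>) \<longlongrightarrow> 1) at_top" for A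
    using Stirling_vertical[of A] by (simp add: G_def)
  have Gl: "((\<lambda>t. G A (lam j * t)) \<longlongrightarrow> 1) at_top" if "j \<in> {1..r}" for A j
    by (rule filterlim_compose[OF G1]) (use lam_pos[OF that] in \<open>auto intro!: filterlim_tendsto_pos_mult_at_top[OF tendsto_const _ filterlim_ident]\<close>)
  have "((\<lambda>t. Stirling_const * G (-1/2) t * (\<Prod>j=1..r. cnj (G (of_real (3/2 * lam j) + mu j) (lam j * t)) / G (of_real (-1/2 * lam j) + mu j) (lam j * t)))
    \<longlongrightarrow> Stirling_const * 1 * (\<Prod>j=1..r. cnj 1 / 1)) at_top"
    by (intro tendsto_intros G1 Gl) auto
  hence "((\<lambda>t. Stirling_const * G (-1/2) t * (\<Prod>j=1..r. cnj (G (of_real (3/2 * lam j) + mu j) (lam j * t)) / G (of_real (-1/2 * lam j) + mu j) (lam j * t)))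
    \<longlongrightarrow> Stirling_const) at_top" by simp
  thus ?thesis
  proof (rule Lim_transform_eventually)
    show "\<forall>\<^sub>F t in at_top. Stirling_const * G (-1/2) t * (\<Prod>j=1..r. cnj (G (of_real (3/2 * lam j) + mu j) (lam j * t)) / G (of_real (-1/2 * lam j) + mu j) (lam j * t)) = weight t"
      using eventually_gt_at_top[of 0]
    proof eventually_elim
      case (elim t)
      have GE: "Gamma (A + \<i> * of_real \<tau>) = G A \<tau> * (of_real (sqrt (2 * pi)) * exp (SE A \<tau>))" for A \<tau>
        by (simp add: G_def)
      have g0: "Gamma (Complex (-1/2) t) = G (-1/2) t * (of_real (sqrt (2 * pi)) * exp (SE (-1/2) t))"
        using GE[of "-1/2" t] by (simp add: Complex_eq)
      have gj: "Gamma (of_real (lam j) * (1 - Complex (-1/2) t) + cnj (mu j)) / Gamma (of_real (lam j) * Complex (-1/2) t + mu j) =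
         cnj (G (of_real (3/2 * lam j) + mu j) (lam j * t)) / G (of_real (-1/2 * lam j) + mu j) (lam j * t) *
         exp (cnj (SE (of_real (3/2 * lam j) + mu j) (lam j * t)) - SE (of_real (-1/2 * lam j) + mu j) (lam j * t))" for j
      proof -
        have 1: "of_real (lam j) * (1 - Complex (-1/2) t) + cnj (mu j) = cnj ((of_real (3/2 * lam j) + mu j) + \<i> * of_real (lam j * t))"
          by (simp add: complex_eq_iff algebra_simps)
        have 2: "of_real (lam j) * Complex (-1/2) t + mu j = (of_real (-1/2 * lam j) + mu j) + \<i> * of_real (lam j * t)"
          by (simp add: complex_eq_iff algebra_simps)
        have 3: "cnj g * (c * e1) / (g' * (c * e2)) = cnj g / g' * (e1 / e2)" if "c \<noteq> 0" for g g' c e1 e2 :: complex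
          using that by simp
        show ?thesis unfolding 1 2 cnj_Gamma[symmetric] GE complex_cnj_mult complex_cnj_complex_of_real exp_cnj[symmetric] exp_diff
          by (rule 3) simp
      qed
      have Qp: "of_real Q powr (1 - 2 * Complex (-1/2) t) = exp ((1 - 2 * Complex (-1/2) t) * of_real (ln Q))"
        using Q_pos by (simp add: powr_def Ln_of_real)
      define GG where "GG = (\<Prod>j=1..r. cnj (G (of_real (3/2 * lam j) + mu j) (lam j * t)) / G (of_real (-1/2 * lam j) + mu j) (lam j * t))"
      have "weight t = om * G (-1/2) t * GG * of_real (sqrt (2 * pi)) *
          (exp (SE (-1/2) t) * exp (\<Sum>j=1..r. cnj (SE (of_real (3/2 * lam j) + mu j) (lam j * t)) - SE (of_real (-1/2 * lam j) + mu j) (lam j * t))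
           * exp ((1 - 2 * Complex (-1/2) t) * of_real (ln Q)) * exp (- Complex (-1/2) t * (\<i> * of_real (pi/2)))
           * exp (Complex (-1/2) t * of_real (ln (q / (2*pi)))) * exp (\<i> * of_real (\<theta> * ln t)))"
        unfolding weight_def gamma_quotient_def g0 gj Qp prod.distrib GG_def[symmetric] exp_sum[OF finite_atLeastAtMost]
        by (simp only: mult_ac)
      also have "\<dots> = om * G (-1/2) t * GG * of_real (sqrt (2 * pi)) *
        exp (of_real (ln (q / (2 * pi)) / 2) + (\<Sum>j=1..r. -2 * \<i> * of_real (Im (mu j)) * of_real (ln (lam j))) - \<i> * of_real (pi * (\<eta> + 1) / 2))"
        unfolding exp_add[symmetric] Stirling_exponents_cancel[OF elim] ..
      also have "\<dots> = om * G (-1/2) t * GG * (of_real (sqrt (2 * pi)) * exp (of_real (ln (q / (2 * pi)) / 2))) *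
         exp (\<Sum>j=1..r. -2 * \<i> * of_real (Im (mu j)) * of_real (ln (lam j))) * exp (- \<i> * of_real (pi * (\<eta> + 1) / 2))"
      proof -
        have e3: "exp (A + B - C) = exp A * exp B * exp (- C)" for A B C :: complex
          by (simp add: exp_add exp_diff exp_minus divide_inverse)
        show ?thesis unfolding e3 mult_minus_left by (simp only: mult.assoc)
      qed
      also have "exp (\<Sum>j=1..r. -2 * \<i> * of_real (Im (mu j)) * of_real (ln (lam j))) = Lam"
        unfolding Lam_def exp_sum[OF finite_atLeastAtMost] using lam_pos
        by (intro prod.cong refl) (simp add: powr_def Ln_of_real less_imp_neq[symmetric])
      also have "of_real (sqrt (2 * pi)) * exp (complex_of_real (ln (q / (2 * pi)) / 2)) = of_real (sqrt q)"
      proof -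
        have "exp (ln (q / (2 * pi)) / 2) = sqrt (q / (2 * pi))"
          using q_pos by (simp add: ln_sqrt[symmetric])
        hence "sqrt (2 * pi) * exp (ln (q / (2 * pi)) / 2) = sqrt q" by (simp flip: real_sqrt_mult)
        thus ?thesis unfolding exp_of_real by (simp flip: of_real_mult)
      qed
      finally show ?case unfolding Stirling_const_def GG_def[symmetric] by (simp only: mult_ac)
    qed
  qed
qed

section \<open>The Mellin representation of the exponential series\<close>

definition f :: "complex \<Rightarrow> complex" where
  "f z = (\<Sum>n. a n * exp (- of_real (2 * pi) * of_nat n * z))"

definition h :: "complex \<Rightarrow> complex \<Rightarrow> complex" where
  "h z s = Gamma s * F s * (of_real (2 * pi) * z) powr (- s)"

lemma norm_of_nat_powr: "norm (of_nat n powr s :: complex) = real n powr Re s"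
  by (simp add: norm_powr_real_powr)

lemma F_summable: "summable (\<lambda>n. norm (a n * of_nat n powr (- Complex (3/2) t)))"
  using a_summable by (simp add: norm_mult norm_of_nat_powr)

lemma norm_F_le: "norm (F (Complex (3/2) t)) \<le> (\<Sum>n. norm (a n) * real n powr (-3/2))"
  unfolding F_series using summable_norm[OF F_summable] by (simp add: norm_mult norm_of_nat_powr)

text \<open>The Dirichlet series converges absolutely on Re s = 3/2, so \<open>Cahen_Mellin\<close>
  can be summed term by term. It does not apply to n = 0, where \<open>a 0 = 0\<close> takes
  over.\<close>

lemma f_eq_Mellin:
  fixes z :: complex
  assumes z: "Re z > 0"
  shows "f z = (LINT t|lborel. h z (Complex (3/2) t)) / (2 * pi)"
    and "integrable lborel (\<lambda>t. h z (Complex (3/2) t))"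
    and "summable (\<lambda>n. a n * exp (- of_real (2 * pi) * of_nat n * z))"
proof -
  define w where "w = of_real (2 * pi) * z"
  have w: "Re w > 0" using z by (simp add: w_def)
  define m where "m = (\<lambda>t. Gamma (Complex (3/2) t) * w powr (- Complex (3/2) t))"
  have mint: "integrable lborel m" unfolding m_def by (rule Mellin_line_integrable[OF w, of _ 0]) simp
  define g where "g = (\<lambda>n t. a n * of_nat n powr (- Complex (3/2) t) * m t)"
  have g_eq: "g n = (\<lambda>t. a n * (Gamma (Complex (3/2) t) * (of_nat n * w) powr (- Complex (3/2) t)))" for n
    by (auto simp: g_def m_def powr_times_real_left fun_eq_iff)
  have gint: "integrable lborel (g n)" for n
  proof (cases "n = 0")
    case False
    have "integrable lborel (\<lambda>t. Gamma (Complex (3/2) t) * (of_nat n * w) powr (- Complex (3/2) t))"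
      by (rule Mellin_line_integrable[of _ _ 0]) (use w False in auto)
    thus ?thesis unfolding g_eq by simp
  qed (simp add: g_def a0)
  have gI: "(LINT t|lborel. g n t) = 2 * pi * (a n * exp (- of_real (2 * pi) * of_nat n * z))" for n
  proof (cases "n = 0")
    case False
    have "(LINT t|lborel. Gamma (Complex (3/2) t) * (of_nat n * w) powr (- Complex (3/2) t)) = 2 * pi * exp (- (of_nat n * w))"
      by (rule Cahen_Mellin) (use w False in auto)
    thus ?thesis unfolding g_eq by (simp add: w_def mult_ac)
  qed (simp add: g_def a0)
  have gn: "norm (g n t) = norm (a n) * real n powr (-3/2) * norm (m t)" for n t
    by (simp add: g_def norm_mult norm_of_nat_powr)
  have sm1: "AE t in lborel. summable (\<lambda>n. norm (g n t))"
    unfolding gn by (intro always_eventually allI summable_mult2 a_summable)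
  have sm2: "summable (\<lambda>n. LINT t|lborel. norm (g n t))"
    unfolding gn Bochner_Integration.integral_mult_right_zero by (intro summable_mult2 a_summable)
  have sumg: "(\<Sum>n. g n t) = h z (Complex (3/2) t)" for t
  proof -
    have "(\<Sum>n. g n t) = F (Complex (3/2) t) * m t"
      unfolding g_def F_series by (rule suminf_mult2[symmetric, OF summable_norm_cancel[OF F_summable]])
    thus ?thesis by (simp add: h_def m_def w_def mult_ac)
  qed
  show "integrable lborel (\<lambda>t. h z (Complex (3/2) t))"
    using integrable_suminf[OF gint sm1 sm2] unfolding sumg .
  have "(LINT t|lborel. h z (Complex (3/2) t)) = (\<Sum>n. 2 * pi * (a n * exp (- of_real (2 * pi) * of_nat n * z)))"
    using integral_suminf[OF gint sm1 sm2] unfolding sumg gI .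
  moreover have sm: "summable (\<lambda>n. 2 * pi * (a n * exp (- of_real (2 * pi) * of_nat n * z)))"
    using summable_integral[OF gint sm1 sm2] unfolding gI .
  show "summable (\<lambda>n. a n * exp (- of_real (2 * pi) * of_nat n * z))"
    using sm summable_mult_D[of "2 * pi :: complex"] by simp
  ultimately show "f z = (LINT t|lborel. h z (Complex (3/2) t)) / (2 * pi)"
    unfolding f_def using \<open>summable (\<lambda>n. a n * exp (- of_real (2 * pi) * of_nat n * z))\<close>
    by (simp add: suminf_mult)
qed

lemma Arg_first_quadrant:
  fixes z :: complex
  assumes "Re z > 0" "Im z > 0"
  shows "0 < Arg (of_real (2 * pi) * z)" "Arg (of_real (2 * pi) * z) < pi / 2"
proof -
  have "of_real (2 * pi) * z \<noteq> 0" using assms by auto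
  hence "0 < Im (Ln (of_real (2 * pi) * z))" using Im_Ln_pos_lt[of "of_real (2 * pi) * z"] assms by simp
  thus "0 < Arg (of_real (2 * pi) * z)" using \<open>of_real (2 * pi) * z \<noteq> 0\<close> by (simp add: Arg_eq_Im_Ln)
  show "Arg (of_real (2 * pi) * z) < pi / 2" using abs_Arg_less_pi_half[of "of_real (2 * pi) * z"] assms by simp
qed

text \<open>As y tends to 0 the argument of z rises to pi / 2, and the margin of decay is lost only
  as t tends to plus infinity. Below a fixed height the integral stays bounded and is negligible
  against the singularity of order 1 / y.\<close>

lemma lower_part_bounded:
  assumes T0: "T0 > 0" and al: "\<alpha> > 0"
  shows "\<exists>C. \<forall>y>0. norm (LINT t:{..T0}|lborel. h (Complex y \<alpha>) (Complex (3/2) t)) \<le> C"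
proof -
  define B where "B = (\<Sum>n. norm (a n) * real n powr (-3/2))"
  have B: "B \<ge> 0" unfolding B_def by (rule suminf_nonneg[OF a_summable]) auto
  define K where "K = B * (2 * pi * \<alpha>) powr (-3/2) * exp (T0 * (pi / 2)) * sqrt (2 * pi) * (1 + 2 / (pi / 2))"
  define g where "g = (\<lambda>t. K * exp (- (pi/4) * \<bar>t\<bar>))"
  have gi: "set_integrable lborel {..T0} g"
  proof -
    have "set_integrable lborel UNIV g" unfolding g_def using integrable_exp_abs[of "pi/4"] by (simp add: set_integrable_def)
    thus ?thesis by (rule set_integrable_subset) auto
  qed
  show ?thesis
  proof (intro exI[of _ "LINT t:{..T0}|lborel. g t"] allI impI set_integral_norm_le[OF gi])
    fix y :: real assume y: "y > 0"
    define z where "z = Complex y \<alpha>"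
    have z: "Re z > 0" "Im z > 0" using y al by (auto simp: z_def)
    have "set_integrable lborel UNIV (\<lambda>t. h z (Complex (3/2) t))"
      using f_eq_Mellin(2)[OF z(1)] by (simp add: set_integrable_def)
    thus "set_integrable lborel {..T0} (\<lambda>t. h (Complex y \<alpha>) (Complex (3/2) t))"
      unfolding z_def by (rule set_integrable_subset) auto
    fix t :: real assume t: "t \<in> {..T0}"
    have w0: "of_real (2 * pi) * z \<noteq> 0" using z by auto
    have nz: "norm (of_real (2 * pi) * z) \<ge> 2 * pi * \<alpha>"
      using abs_Im_le_cmod[of z] z by (simp add: norm_mult z_def)
    have p: "norm ((of_real (2 * pi) * z) powr (- Complex (3/2) t)) \<le> (2 * pi * \<alpha>) powr (-3/2) * exp (T0 * (pi / 2))"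
      unfolding norm_powr_minus_Complex[OF w0]
    proof (rule mult_mono)
      show "norm (of_real (2 * pi) * z) powr - (3/2) \<le> (2 * pi * \<alpha>) powr (- 3/2)"
        using nz al powr_mono2'[of "-3/2" "2 * pi * \<alpha>"] by simp
      have "t * Arg (of_real (2 * pi) * z) \<le> T0 * Arg (of_real (2 * pi) * z)" using t Arg_first_quadrant[OF z] by (intro mult_right_mono) auto
      also have "\<dots> \<le> T0 * (pi / 2)" using T0 Arg_first_quadrant[OF z] by (intro mult_left_mono) auto
      finally show "exp (t * Arg (of_real (2 * pi) * z)) \<le> exp (T0 * (pi / 2))" by simp
    qed auto
    have G: "norm (Gamma (Complex (3/2) t)) \<le> sqrt (2 * pi) * ((1 + 2 / (pi / 2)) * exp (- (pi/4) * \<bar>t\<bar>))"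
    proof -
      have "norm (Gamma (Complex (3/2) t)) \<le> sqrt (2 * pi) * ((1 + \<bar>t\<bar>) * exp (- (pi/2) * \<bar>t\<bar>))"
        using norm_Gamma_three_halves_line_le[of t] by (simp add: mult_ac)
      also have "\<dots> \<le> sqrt (2 * pi) * ((1 + 2 / (pi / 2)) * exp (- (pi / 2 / 2) * \<bar>t\<bar>))"
        by (intro mult_left_mono one_plus_abs_mult_exp_le) auto
      finally show ?thesis by simp
    qed
    have "norm (h z (Complex (3/2) t)) \<le> (sqrt (2 * pi) * ((1 + 2 / (pi / 2)) * exp (- (pi/4) * \<bar>t\<bar>))) * B * ((2 * pi * \<alpha>) powr (-3/2) * exp (T0 * (pi / 2)))"
      unfolding h_def norm_mult using norm_F_le[of t] B by (intro mult_mono G p) (auto simp: B_def)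
    also have "\<dots> = g t" by (simp add: g_def K_def mult_ac)
    finally show "norm (h (Complex y \<alpha>) (Complex (3/2) t)) \<le> g t" by (simp add: z_def)
  qed auto
qed

lemma bottom_part_bounded:
  assumes T0: "T0 > 0" and al: "\<alpha> > 0"
  shows "\<exists>C. \<forall>y. 0 < y \<longrightarrow> y < 1 \<longrightarrow> norm (LINT x:{-1/2..3/2}|lborel. h (Complex y \<alpha>) (Complex x T0)) \<le> C"
proof -
  have cont: "continuous_on {-1/2..3/2} (\<lambda>x. Gamma (Complex x T0) * F (Complex x T0))"
  proof -
    have "(\<lambda>s. Gamma s * F s) holomorphic_on {s. Im s > 0}"
      by (intro holomorphic_intros holomorphic_on_subset[OF F_hol]) (auto elim!: nonpos_Ints_cases)
    hence "continuous_on {s. Im s > 0} (\<lambda>s. Gamma s * F s)" by (rule holomorphic_on_imp_continuous_on)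
    thus ?thesis
      by (rule continuous_on_compose2) (use T0 in \<open>auto intro!: continuous_intros\<close>)
  qed
  have "compact ((\<lambda>x. Gamma (Complex x T0) * F (Complex x T0)) ` {-1/2..3/2})"
    by (intro compact_continuous_image cont) auto
  then obtain M where M: "\<And>x. x \<in> {-1/2..3/2} \<Longrightarrow> norm (Gamma (Complex x T0) * F (Complex x T0)) \<le> M"
    using compact_imp_bounded bounded_iff by (metis (no_types, lifting) imageI)
  have M0: "M \<ge> 0" by (rule order_trans[OF norm_ge_zero M[of 0]]) simp
  \<comment> \<open>Z bounds both |2 pi z| and its reciprocal for all 0 < y < 1, so every power with
    exponent of modulus at most 2 is at most Z^2.\<close>
  define Z where "Z = 2 * pi * (\<alpha> + 1) + 1 / (2 * pi * \<alpha>) + 1"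
  have Z: "Z \<ge> 1" using al by (simp add: Z_def)
  define C where "C = M * (Z\<^sup>2 * exp (T0 * (pi / 2)))"
  show ?thesis
  proof (intro exI[of _ "LINT x:{-1/2..3/2::real}|lborel. C"] allI impI)
    fix y :: real assume y: "0 < y" "y < 1"
    define z where "z = Complex y \<alpha>"
    have z: "Re z > 0" "Im z > 0" using y al by (auto simp: z_def)
    have w0: "of_real (2 * pi) * z \<noteq> 0" using z by auto
    have int: "set_integrable lborel {-1/2..3/2} (\<lambda>x. h (Complex y \<alpha>) (Complex x T0))"
      unfolding h_def
      by (intro borel_integrable_atLeastAtMost' continuous_on_mult cont) (use w0 z in \<open>auto simp: z_def intro!: continuous_intros\<close>)
    have bound: "norm (h (Complex y \<alpha>) (Complex x T0)) \<le> C" if x: "x \<in> {-1/2..3/2}" for x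
    proof -
    have lo: "norm (of_real (2 * pi) * z) \<ge> 2 * pi * \<alpha>"
      using abs_Im_le_cmod[of z] z by (simp add: norm_mult z_def)
    have hi: "norm (of_real (2 * pi) * z) \<le> 2 * pi * (\<alpha> + 1)"
      using cmod_le[of z] z y by (simp add: norm_mult z_def)
    have "norm (of_real (2 * pi) * z) powr (- x) \<le> Z\<^sup>2"
    proof (cases "x \<ge> 0")
      case True
      have "norm (of_real (2 * pi) * z) powr (- x) = (1 / norm (of_real (2 * pi) * z)) powr x"
        using w0 by (simp only: powr_minus_divide powr_divide powr_one_eq_one)
      also have "\<dots> \<le> Z powr x"
      proof (rule powr_mono2)
        have "1 / norm (of_real (2 * pi) * z) \<le> 1 / (2 * pi * \<alpha>)" using lo al w0 by (intro divide_left_mono mult_pos_pos) (simp_all only: zero_less_norm_iff, auto)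
        also have "\<dots> \<le> Z" using al by (simp add: Z_def)
        finally show "1 / norm (of_real (2 * pi) * z) \<le> Z" .
      qed (use True in auto)
      also have "\<dots> \<le> Z powr 2" using x Z by (intro powr_mono) auto
      finally show ?thesis using Z by (simp add: powr_numeral)
    next
      case False
      have "norm (of_real (2 * pi) * z) powr (- x) \<le> Z powr (- x)"
      proof (rule powr_mono2)
        have "1 / (2 * pi * \<alpha>) \<ge> 0" using al by auto
        thus "norm (of_real (2 * pi) * z) \<le> Z" using hi unfolding Z_def by linarith
      qed (use False in auto)
      also have "\<dots> \<le> Z powr 2" using x Z by (intro powr_mono) auto
      finally show ?thesis using Z by (simp add: powr_numeral)
    qed
    moreover have "T0 * Arg (of_real (2 * pi) * z) \<le> T0 * (pi / 2)" using T0 Arg_first_quadrant[OF z] by (intro mult_left_mono) auto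
    ultimately have "norm ((of_real (2 * pi) * z) powr (- Complex x T0)) \<le> Z\<^sup>2 * exp (T0 * (pi / 2))"
      unfolding norm_powr_minus_Complex[OF w0] by (intro mult_mono) auto
    hence "norm (Gamma (Complex x T0) * F (Complex x T0)) * norm ((of_real (2 * pi) * z) powr (- Complex x T0)) \<le> C"
      unfolding C_def using M[OF x] M0 by (intro mult_mono) auto
    thus ?thesis by (simp add: h_def z_def norm_mult)
    qed
    show "norm (LINT x:{-1/2..3/2}|lborel. h (Complex y \<alpha>) (Complex x T0)) \<le> (LINT x:{-1/2..3/2::real}|lborel. C)"
      by (rule set_integral_norm_le[OF _ _ int bound]) (auto intro!: borel_integrable_atLeastAtMost')
  qed
qed

text \<open>The point y + \<i> \<alpha> equals \<i> \<alpha> (1 - \<i> y / \<alpha>), and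
  \<open>phase\<close> is minus the logarithm of the last factor. Multiplied by - \<i> it is
  asymptotic to y / \<alpha> and becomes the decay rate of the Laplace integral.\<close>

definition phase :: "real \<Rightarrow> real \<Rightarrow> complex" where
  "phase \<alpha> y = - Ln (1 - \<i> * of_real (y / \<alpha>))"

definition freq :: "real \<Rightarrow> nat \<Rightarrow> real" where
  "freq \<alpha> n = ln (real n) - ln (q * \<alpha>)"

text \<open>For n > 0 this is cnj (a n) n^(-3/2) (q \<alpha>)^(1/2), in a form that reduces to cnj
  (a n) / n at a stationary frequency. At n = 0 the value \<open>a 0 = 0\<close> overrides the
  default value of ln 0.\<close>

definition dual_coeff :: "real \<Rightarrow> nat \<Rightarrow> complex" where
  "dual_coeff \<alpha> n = cnj (a n) * of_real (exp (- ln (real n) - freq \<alpha> n / 2))"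

section \<open>The integrand on the line Re s = -1/2\<close>

lemma Ln_scaled_Complex:
  assumes "y > 0" "\<alpha> > 0"
  shows "Ln (of_real (2 * pi) * Complex y \<alpha>) = of_real (ln (2 * pi * \<alpha>)) + \<i> * of_real (pi / 2) - phase \<alpha> y"
proof -
  define u where "u = 1 - \<i> * of_real (y / \<alpha>)"
  have u0: "u \<noteq> 0" by (simp add: u_def complex_eq_iff)
  have Imu: "\<bar>Im (Ln u)\<bar> < pi / 2" using Re_Ln_pos_lt[OF u0] by (simp add: u_def)
  have L: "Ln (of_real (2 * pi * \<alpha>) * \<i>) = of_real (ln (2 * pi * \<alpha>)) + \<i> * of_real (pi / 2)"
    by (subst Ln_times_of_real) (use assms in \<open>auto simp: Ln_of_real simp del: of_real_mult\<close>)
  have "of_real (2 * pi) * Complex y \<alpha> = (of_real (2 * pi * \<alpha>) * \<i>) * u"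
    using assms by (simp add: u_def complex_eq_iff)
  also have "Ln \<dots> = Ln (of_real (2 * pi * \<alpha>) * \<i>) + Ln u"
  proof (rule Ln_times_simple)
    have "Im (Ln (of_real (2 * pi * \<alpha>) * \<i>)) = pi / 2" unfolding L by simp
    thus "- pi < Im (Ln (of_real (2 * pi * \<alpha>) * \<i>)) + Im (Ln u)" "Im (Ln (of_real (2 * pi * \<alpha>) * \<i>)) + Im (Ln u) \<le> pi"
      using Imu by linarith+
  qed (use u0 assms in auto)
  finally show ?thesis unfolding L by (simp add: u_def phase_def)
qed

lemma norm_dual_coeff:
  assumes "\<alpha> > 0"
  shows "norm (dual_coeff \<alpha> n) = norm (a n) * real n powr (-3/2) * exp (ln (q * \<alpha>) / 2)"
proof (cases "n = 0")
  case False
  have "exp (- ln (real n) - freq \<alpha> n / 2) = exp (-3/2 * ln (real n)) * exp (ln (q * \<alpha>) / 2)"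
    by (simp add: freq_def field_simps flip: exp_add)
  thus ?thesis using False by (simp add: dual_coeff_def norm_mult powr_def)
qed (simp add: dual_coeff_def a0)

lemma dual_coeff_summable: "\<alpha> > 0 \<Longrightarrow> summable (\<lambda>n. norm (dual_coeff \<alpha> n))"
  by (simp only: norm_dual_coeff) (intro summable_mult2 a_summable)

text \<open>Brings the integrand into the shape demanded by
  \<open>Laplace_almost_periodic_limit\<close>: a convergent weight, a power of t, an almost
  periodic sum and an exponential decay with rate - \<i> \<open>phase \<alpha> y\<close>.\<close>

lemma h_dual_line:
  assumes al: "\<alpha> > 0" and y: "y > 0" and t: "t > 0"
    and FE: "F (Complex (-1/2) t) = gamma_quotient t * cnj (F (1 - cnj (Complex (-1/2) t)))"
  shows "h (Complex y \<alpha>) (Complex (-1/2) t) = exp (- phase \<alpha> y / 2) *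
    (weight t * (of_real t powr (- \<i> * of_real \<theta>) * (\<Sum>n. dual_coeff \<alpha> n * exp (\<i> * of_real (t * freq \<alpha> n))) *
      exp (- (- \<i> * phase \<alpha> y) * of_real t)))"
proof -
  define s where "s = Complex (-1/2) t"
  define X where "X = Gamma s * gamma_quotient t * exp (- s * (\<i> * of_real (pi/2))) * exp (s * of_real (ln (q / (2*pi))))"
  have s1: "1 - cnj s = Complex (3/2) t" by (simp add: s_def complex_eq_iff)
  have W: "weight t * of_real t powr (- \<i> * of_real \<theta>) = X"
  proof -
    have "of_real t powr (- \<i> * of_real \<theta>) = exp (- (\<i> * of_real (\<theta> * ln t)))"
      using t by (simp add: powr_def Ln_of_real mult.assoc)
    hence "exp (\<i> * of_real (\<theta> * ln t)) * of_real t powr (- \<i> * of_real \<theta>) = 1" by (simp flip: exp_add)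
    thus ?thesis unfolding weight_def X_def s_def[symmetric] by (simp add: mult.assoc)
  qed
  have trm: "cnj (a n * of_nat n powr (- Complex (3/2) t)) =
      dual_coeff \<alpha> n * exp (\<i> * of_real (t * freq \<alpha> n)) * exp (s * of_real (ln (q * \<alpha>)))" for n
  proof (cases "n = 0")
    case False
    have "cnj (of_nat n powr (- Complex (3/2) t)) = exp (- cnj (Complex (3/2) t) * of_real (ln (real n)))"
      using False by (simp add: powr_def exp_cnj Ln_of_nat)
    also have "- cnj (Complex (3/2) t) * of_real (ln (real n)) = of_real (- ln (real n) - freq \<alpha> n / 2) + \<i> * of_real (t * freq \<alpha> n) + s * of_real (ln (q * \<alpha>))"
      by (simp add: s_def freq_def complex_eq_iff field_simps)
    finally show ?thesis by (simp add: dual_coeff_def exp_add mult.assoc flip: exp_of_real)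
  qed (simp add: a0 dual_coeff_def)
  have sm: "summable (\<lambda>n. dual_coeff \<alpha> n * exp (\<i> * of_real (t * freq \<alpha> n)))"
    by (rule summable_norm_cancel) (use dual_coeff_summable[OF al] in \<open>simp add: norm_mult\<close>)
  define S where "S = (\<Sum>n. dual_coeff \<alpha> n * exp (\<i> * of_real (t * freq \<alpha> n)))"
  have "(\<lambda>n. cnj (a n * of_nat n powr (- Complex (3/2) t))) sums cnj (F (Complex (3/2) t))"
    unfolding F_series by (subst sums_cnj) (rule summable_sums[OF summable_norm_cancel[OF F_summable]])
  moreover have "(\<lambda>n. cnj (a n * of_nat n powr (- Complex (3/2) t))) sums (S * exp (s * of_real (ln (q * \<alpha>))))"
    unfolding trm S_def by (intro sums_mult2 summable_sums sm)
  ultimately have cF: "cnj (F (Complex (3/2) t)) = S * exp (s * of_real (ln (q * \<alpha>)))" by (rule sums_unique2)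
  have ln: "ln (q * \<alpha>) = ln (2 * pi * \<alpha>) + ln (q / (2 * pi))"
    using al q_pos by (simp add: ln_mult ln_div)
  have w0: "of_real (2 * pi) * Complex y \<alpha> \<noteq> 0" using y by (simp add: complex_eq_iff)
  have "(of_real (2 * pi) * Complex y \<alpha>) powr (- s) = exp (- s * (of_real (ln (2 * pi * \<alpha>)) + \<i> * of_real (pi / 2) - phase \<alpha> y))"
    unfolding Ln_scaled_Complex[OF y al, symmetric] using w0 by (simp add: powr_def)
  also have "\<dots> = exp (- s * of_real (ln (2 * pi * \<alpha>))) * exp (- s * (\<i> * of_real (pi/2))) * exp (s * phase \<alpha> y)"
    by (simp add: algebra_simps flip: exp_add)
  also have "exp (s * phase \<alpha> y) = exp (- phase \<alpha> y / 2) * exp (- (- \<i> * phase \<alpha> y) * of_real t)"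
  proof -
    have s: "s = - 1/2 + \<i> * of_real t" by (simp add: s_def complex_eq_iff)
    have "s * phase \<alpha> y = - phase \<alpha> y / 2 + - (- \<i> * phase \<alpha> y) * of_real t" unfolding s by (simp add: algebra_simps)
    thus ?thesis by (simp only: exp_add)
  qed
  finally have pw: "(of_real (2 * pi) * Complex y \<alpha>) powr (- s) = exp (- s * of_real (ln (2 * pi * \<alpha>))) * exp (- s * (\<i> * of_real (pi/2))) *
     (exp (- phase \<alpha> y / 2) * exp (- (- \<i> * phase \<alpha> y) * of_real t))" .
  have ee: "exp (s * of_real (ln (q * \<alpha>))) * exp (- s * of_real (ln (2 * pi * \<alpha>))) = exp (s * of_real (ln (q / (2*pi))))"
    unfolding ln exp_add[symmetric] by (simp add: algebra_simps)
  have "h (Complex y \<alpha>) s = Gamma s * (gamma_quotient t * (S * exp (s * of_real (ln (q * \<alpha>))))) *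
     (exp (- s * of_real (ln (2 * pi * \<alpha>))) * exp (- s * (\<i> * of_real (pi/2))) * (exp (- phase \<alpha> y / 2) * exp (- (- \<i> * phase \<alpha> y) * of_real t)))"
    unfolding h_def pw FE[folded s_def, unfolded s1 cF] ..
  also have "\<dots> = exp (- phase \<alpha> y / 2) * (Gamma s * gamma_quotient t * exp (- s * (\<i> * of_real (pi/2))) * (exp (s * of_real (ln (q * \<alpha>))) * exp (- s * of_real (ln (2 * pi * \<alpha>)))) * S * exp (- (- \<i> * phase \<alpha> y) * of_real t))"
    by (simp only: mult_ac)
  also have "\<dots> = exp (- phase \<alpha> y / 2) * (X * S * exp (- (- \<i> * phase \<alpha> y) * of_real t))" unfolding ee X_def by (simp only: mult_ac)
  finally show ?thesis unfolding W[symmetric] S_def s_def by (simp only: mult.assoc)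
qed

lemma phase_limits:
  assumes "\<alpha> > 0"
  shows "((\<lambda>y. (- \<i> * phase \<alpha> y) / of_real y) \<longlongrightarrow> of_real (1 / \<alpha>)) (at_right 0)"
    and "(phase \<alpha> \<longlongrightarrow> 0) (at_right 0)"
proof -
  have inf: "filterlim (\<lambda>y::real. 1 / complex_of_real y) at_infinity (at_right 0)"
  proof -
    have "filterlim (\<lambda>y::real. norm (1 / complex_of_real y)) at_top (at_right 0)"
      by (rule filterlim_mono_eventually[OF filterlim_inverse_at_top_right order.refl order.refl])
         (use eventually_at_right_less[of 0] in eventually_elim, simp add: norm_divide inverse_eq_divide)
    thus ?thesis by (simp only: filterlim_at_infinity_conv_norm_at_top)
  qed
  have "((\<lambda>y. (1 / complex_of_real y + 0) * Ln (1 + (- \<i> * of_real (1 / \<alpha>)) / (1 / complex_of_real y))) \<longlongrightarrow> - \<i> * of_real (1 / \<alpha>)) (at_right 0)"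
    by (rule filterlim_compose[OF tendsto_add_mult_Ln_one_plus inf])
  hence "((\<lambda>y. \<i> * ((1 / complex_of_real y + 0) * Ln (1 + (- \<i> * of_real (1 / \<alpha>)) / (1 / complex_of_real y)))) \<longlongrightarrow> \<i> * (- \<i> * of_real (1 / \<alpha>))) (at_right 0)"
    by (rule tendsto_mult[OF tendsto_const])
  moreover have "(\<lambda>y. \<i> * ((1 / complex_of_real y + 0) * Ln (1 + (- \<i> * of_real (1 / \<alpha>)) / (1 / complex_of_real y)))) = (\<lambda>y. (- \<i> * phase \<alpha> y) / of_real y)"
    by (auto simp: phase_def fun_eq_iff field_simps)
  ultimately show "((\<lambda>y. (- \<i> * phase \<alpha> y) / of_real y) \<longlongrightarrow> of_real (1 / \<alpha>)) (at_right 0)" by (simp flip: mult.assoc)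
  have "((\<lambda>y. - Ln (1 - \<i> * complex_of_real (y / \<alpha>))) \<longlongrightarrow> - Ln (1 - \<i> * of_real (0 / \<alpha>))) (at_right 0)"
    by (intro tendsto_intros tendsto_ident_at) (use assms in auto)
  thus "(phase \<alpha> \<longlongrightarrow> 0) (at_right 0)" by (simp add: phase_def[abs_def])
qed

lemma Im_nonzero_not_nonpos_Ints: "Im z \<noteq> 0 \<Longrightarrow> z \<notin> \<int>\<^sub>\<le>\<^sub>0"
  by (auto elim!: nonpos_Ints_cases)

lemma weight_continuous:
  shows "\<exists>T>0. continuous_on {T..} weight"
proof -
  \<comment> \<open>Above this height the imaginary part lam j t exceeds |Im (mu j)| for every j, so
    no Gamma argument is real and the quotient has neither poles nor zeros in its
    denominator.\<close>
  define T where "T = Max (insert 1 ((\<lambda>j. (\<bar>Im (mu j)\<bar> + 1) / lam j) ` {1..r}))"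
  have T1: "T \<ge> 1" unfolding T_def by (intro Max_ge) auto
  have Tj: "lam j * t > \<bar>Im (mu j)\<bar>" if "t \<ge> T" "j \<in> {1..r}" for t j
  proof -
    have "(\<bar>Im (mu j)\<bar> + 1) / lam j \<le> T" unfolding T_def using that by (intro Max_ge) auto
    hence "(\<bar>Im (mu j)\<bar> + 1) / lam j \<le> t" using that by linarith
    hence "\<bar>Im (mu j)\<bar> + 1 \<le> lam j * t" using lam_pos[OF that(2)] by (simp add: field_simps)
    thus ?thesis by linarith
  qed
  have Gc: "continuous_on {T..} (\<lambda>t. Gamma (g t))" if "continuous_on {T..} g" "\<And>t. t \<ge> T \<Longrightarrow> Im (g t) \<noteq> 0" for g :: "real \<Rightarrow> complex"
    by (rule continuous_on_compose2[OF continuous_on_Gamma[of "- \<int>\<^sub>\<le>\<^sub>0"] that(1)]) (use that(2) Im_nonzero_not_nonpos_Ints in auto)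
  have "continuous_on {T..} weight"
    unfolding weight_def gamma_quotient_def
  proof (intro continuous_on_mult continuous_on_prod continuous_on_divide)
    show "continuous_on {T..} (\<lambda>t. Gamma (Complex (- 1 / 2) t))"
      by (intro Gc continuous_intros) (use T1 in auto)
    show "continuous_on {T..} (\<lambda>t. complex_of_real Q powr (1 - 2 * Complex (- 1 / 2) t))"
      using Q_pos by (intro continuous_intros) auto
    show "continuous_on {T..} (\<lambda>t. exp (\<i> * complex_of_real (\<theta> * ln t)))"
      using T1 by (intro continuous_intros) auto
    fix j assume j: "j \<in> {1..r}"
    show "continuous_on {T..} (\<lambda>t. Gamma (of_real (lam j) * (1 - Complex (- 1 / 2) t) + cnj (mu j)))"
    proof (intro Gc continuous_intros)
      fix t assume "T \<le> t"
      thus "Im (of_real (lam j) * (1 - Complex (- 1 / 2) t) + cnj (mu j)) \<noteq> 0" using Tj[of t j] j by auto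
    qed
    show "continuous_on {T..} (\<lambda>t. Gamma (of_real (lam j) * Complex (- 1 / 2) t + mu j))"
    proof (intro Gc continuous_intros)
      fix t assume "T \<le> t"
      thus "Im (of_real (lam j) * Complex (- 1 / 2) t + mu j) \<noteq> 0" using Tj[of t j] j by auto
    qed
    show "\<forall>t\<in>{T..}. Gamma (of_real (lam j) * Complex (- 1 / 2) t + mu j) \<noteq> 0"
    proof
      fix t assume t: "t \<in> {T..}"
      have "Im (of_real (lam j) * Complex (- 1 / 2) t + mu j) \<noteq> 0" using Tj[of t j] t j by auto
      thus "Gamma (of_real (lam j) * Complex (- 1 / 2) t + mu j) \<noteq> 0"
        by (simp add: Gamma_eq_zero_iff Im_nonzero_not_nonpos_Ints)
    qed
  qed (auto intro!: continuous_intros)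
  thus ?thesis using T1 by (intro exI[of _ T]) auto
qed

lemma weight_bounded:
  assumes "continuous_on {T..} weight"
  shows "\<exists>M. \<forall>t\<ge>T. norm (weight t) \<le> M"
proof -
  have "eventually (\<lambda>t. dist (weight t) Stirling_const < 1) at_top" using weight_limit by (rule tendstoD) simp
  then obtain T' where T': "\<And>t. t \<ge> T' \<Longrightarrow> dist (weight t) Stirling_const < 1" by (auto simp: eventually_at_top_linorder)
  have "compact (weight ` {T..T'})" by (intro compact_continuous_image continuous_on_subset[OF assms]) auto
  then obtain M where M: "\<And>t. t \<in> {T..T'} \<Longrightarrow> norm (weight t) \<le> M"
    using compact_imp_bounded bounded_iff by (metis (no_types, lifting) imageI)
  show ?thesis
  proof (intro exI[of _ "max M (norm Stirling_const + 1)"] allI impI)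
    fix t assume t: "t \<ge> T"
    show "norm (weight t) \<le> max M (norm Stirling_const + 1)"
    proof (cases "t \<le> T'")
      case True
      thus ?thesis using M[of t] t by auto
    next
      case False
      hence "norm (weight t - Stirling_const) < 1" using T'[of t] by (simp add: dist_norm)
      thus ?thesis using norm_triangle_ineq2[of "weight t" Stirling_const] by linarith
    qed
  qed
qed

text \<open>N and T are chosen before z, so that the height of the cut in \<open>f_limit\<close>
  stays fixed while y tends to 0. The constant C may depend on z, because it does not appear in the
  result of \<open>half_strip_shift\<close>.\<close>

lemma h_growth:
  shows "\<exists>N T. T > 0 \<and> (\<forall>z. Re z > 0 \<longrightarrow> Im z > 0 \<longrightarrow> (\<exists>C. \<forall>s. -1/2 \<le> Re s \<longrightarrow> Re s \<le> 3/2 \<longrightarrow> T \<le> Im s \<longrightarrow> norm (h z s) \<le> C * exp (Im s ^ N)))"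
proof -
  obtain \<rho> R where R: "\<And>s. norm s \<ge> R \<Longrightarrow> norm (F s) \<le> exp (norm s powr \<rho>)" using F_growth by blast
  obtain G where G: "G > 0" "\<And>s. -1/2 \<le> Re s \<Longrightarrow> Re s \<le> 3/2 \<Longrightarrow> \<bar>Im s\<bar> \<ge> 1 \<Longrightarrow> norm (Gamma s) \<le> G"
    using Gamma_bounded_vertical_strip[of "-1/2" "3/2"] by blast
  define m where "m = nat \<lceil>\<bar>\<rho>\<bar>\<rceil>"
  have m: "\<bar>\<rho>\<bar> \<le> real m" unfolding m_def by linarith
  \<comment> \<open>From |s| \<le> 2 t \<le> t^2 the finite order bound becomes exp (t^(2 m)); two
    further powers of t absorb the factor exp (2 t) that comes from the power of z.\<close>
  define N where "N = 2 * m + 2"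
  define T where "T = max 4 R"
  show ?thesis
  proof (rule exI[of _ N], rule exI[of _ T], intro conjI allI impI)
    show "T > 0" by (simp add: T_def)
    fix z :: complex assume z: "Re z > 0" "Im z > 0"
    have w0: "of_real (2 * pi) * z \<noteq> 0" using z by auto
    define K where "K = exp (2 * \<bar>ln (norm (of_real (2 * pi) * z))\<bar>)"
    show "\<exists>C. \<forall>s. -1/2 \<le> Re s \<longrightarrow> Re s \<le> 3/2 \<longrightarrow> T \<le> Im s \<longrightarrow> norm (h z s) \<le> C * exp (Im s ^ N)"
    proof (intro exI[of _ "G * K"] allI impI)
      fix s :: complex assume s: "-1/2 \<le> Re s" "Re s \<le> 3/2" "T \<le> Im s"
      define t where "t = Im s"
      have t: "t \<ge> 4" "t \<ge> R" using s by (auto simp: t_def T_def)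
      have "t \<le> norm s" using abs_Im_le_cmod[of s] by (simp add: t_def)
      moreover have "norm s \<le> 2 * t" using cmod_le[of s] s t by (simp add: t_def)
      ultimately have ns: "t \<le> norm s" "norm s \<le> 2 * t" by auto
      have "norm s powr \<rho> \<le> norm s powr (real m)" using m ns t by (intro powr_mono) auto
      also have "\<dots> = norm s ^ m" by (rule powr_realpow) (use ns t in linarith)
      also have "\<dots> \<le> (t ^ 2) ^ m"
        using ns t by (intro power_mono) (auto simp: power2_eq_square intro: order_trans[OF _ mult_right_mono])
      also have "\<dots> = t ^ (2 * m)" by (simp add: power_mult)
      finally have F: "norm (F s) \<le> exp (t ^ (2 * m))" using R[of s] ns t by (meson exp_le_cancel_iff order_trans)
      have P: "norm ((of_real (2 * pi) * z) powr (- s)) \<le> K * exp (2 * t)"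
      proof -
        have "norm ((of_real (2 * pi) * z) powr (- s)) = exp (- Re s * ln (norm (of_real (2 * pi) * z)) + t * Arg (of_real (2 * pi) * z))"
        proof -
          have "norm (w powr (- s)) = exp (- Re s * ln (norm w) + t * Arg w)" if "w \<noteq> 0" for w :: complex
            using that by (simp add: norm_powr_complex powr_def[of "norm w"] t_def flip: exp_add)
          from this[OF w0] show ?thesis .
        qed
        also have "\<dots> \<le> exp (2 * \<bar>ln (norm (of_real (2 * pi) * z))\<bar> + 2 * t)"
        proof -
          have "- Re s * ln (norm (of_real (2 * pi) * z)) \<le> \<bar>Re s\<bar> * \<bar>ln (norm (of_real (2 * pi) * z))\<bar>"
            by (metis abs_ge_self abs_minus_cancel abs_mult)
          also have "\<dots> \<le> 2 * \<bar>ln (norm (of_real (2 * pi) * z))\<bar>" using s by (intro mult_right_mono) auto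
          finally have "- Re s * ln (norm (of_real (2 * pi) * z)) \<le> 2 * \<bar>ln (norm (of_real (2 * pi) * z))\<bar>" .
          moreover have "t * Arg (of_real (2 * pi) * z) \<le> t * 2"
            using Arg_first_quadrant[OF z] pi_less_4 t by (intro mult_left_mono) auto
          ultimately show ?thesis by simp
        qed
        finally show ?thesis by (simp add: K_def exp_add)
      qed
      have "norm (h z s) \<le> G * exp (t ^ (2 * m)) * (K * exp (2 * t))"
        unfolding h_def norm_mult using G(1) G(2)[of s] s t by (intro mult_mono F P) (auto simp: t_def)
      also have "\<dots> = G * K * exp (t ^ (2 * m) + 2 * t)" by (simp add: exp_add)
      also have "\<dots> \<le> G * K * exp (t ^ N)"
      proof -
        have t1: "t ^ (2 * m) \<ge> 1" using t by (intro one_le_power) auto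
        have "t ^ (2 * m) + 2 * t \<le> t ^ (2 * m) * 1 + t ^ (2 * m) * (2 * t)" using t1 t by simp
        also have "\<dots> \<le> t ^ (2 * m) * t\<^sup>2"
        proof -
          have "1 + 2 * t \<le> t\<^sup>2"
          proof -
            have "4 * t \<le> t * t" using t by (intro mult_right_mono) auto
            thus ?thesis using t unfolding power2_eq_square by linarith
          qed
          hence "t ^ (2 * m) * (1 + 2 * t) \<le> t ^ (2 * m) * t\<^sup>2" using t1 by (intro mult_left_mono) auto
          thus ?thesis by (simp only: distrib_left)
        qed
        also have "\<dots> = t ^ N" by (simp only: N_def power_add)
        finally show ?thesis using G by (intro mult_left_mono) (auto simp: K_def)
      qed
      finally show "norm (h z s) \<le> G * K * exp (Im s ^ N)" by (simp add: t_def)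
    qed
  qed
qed

lemma Re_decay_pos:
  assumes "y > 0" "\<alpha> > 0"
  shows "Re (- \<i> * phase \<alpha> y) > 0"
proof -
  define u where "u = 1 - \<i> * of_real (y / \<alpha>)"
  have u: "u \<noteq> 0" "Im u < 0" using assms by (auto simp: u_def complex_eq_iff)
  have "Im (Ln u) < 0"
  proof (rule ccontr)
    assume "\<not> Im (Ln u) < 0"
    hence "0 \<le> Im (Ln u)" by simp
    hence "0 \<le> Im u" using Im_Ln_pos_le[OF u(1)] Im_Ln_le_pi[OF u(1)] by simp
    thus False using u by simp
  qed
  thus ?thesis by (simp add: phase_def u_def)
qed

text \<open>The Mellin integral is cut at a fixed height. The part below and the horizontal edge
  stay bounded and vanish after multiplication by y^u, which has modulus y; the part above is moved
  to Re s = -1/2, where the Abelian theorem gives the limit.\<close>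

lemma f_limit:
  assumes al: "\<alpha> > 0"
  defines "u \<equiv> 1 - \<i> * of_real \<theta>"
  shows "((\<lambda>y. of_real y powr u * f (Complex y \<alpha>)) \<longlongrightarrow>
     Stirling_const * (Gamma u * of_real (1 / \<alpha>) powr (- u)) * (\<Sum>n. if freq \<alpha> n = 0 then dual_coeff \<alpha> n else 0) / (2 * pi)) (at_right 0)"
proof -
  obtain N Tg where Tg: "Tg > 0" "\<And>z. Re z > 0 \<Longrightarrow> Im z > 0 \<Longrightarrow> \<exists>C. \<forall>s. -1/2 \<le> Re s \<longrightarrow> Re s \<le> 3/2 \<longrightarrow> Tg \<le> Im s \<longrightarrow> norm (h z s) \<le> C * exp (Im s ^ N)"
    using h_growth by blast
  obtain Tw where Tw: "Tw > 0" "continuous_on {Tw..} weight" using weight_continuous by blast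
  obtain TF where TF: "\<And>t. t \<ge> TF \<Longrightarrow> F (Complex (-1/2) t) = gamma_quotient t * cnj (F (1 - cnj (Complex (-1/2) t)))"
    using fun_eq unfolding gamma_quotient_def by (meson abs_ge_self order_trans)
  obtain Ts where Ts: "Ts > 0" "\<And>s. -1/2 \<le> Re s \<Longrightarrow> Re s \<le> 3/2 \<Longrightarrow> Im s \<ge> Ts \<Longrightarrow> Re ((- \<i> * s) ^ Suc N) \<ge> Im s ^ Suc N / 2"
    using Re_power_half_strip[of "-1/2" "3/2" "Suc N"] by blast
  define T0 where "T0 = Max {Tg, Tw, TF, Ts}"
  have T0: "T0 \<ge> Tg" "T0 \<ge> Tw" "T0 \<ge> TF" "T0 \<ge> Ts" by (auto simp: T0_def)
  have T0pos: "T0 > 0" using T0 Tg by linarith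
  define B where "B = (\<Sum>n. norm (dual_coeff \<alpha> n))"
  define S where "S = (\<lambda>t. \<Sum>n. dual_coeff \<alpha> n * exp (\<i> * of_real (t * freq \<alpha> n)))"
  define D where "D = (\<lambda>y. - \<i> * phase \<alpha> y)"
  \<comment> \<open>Setting the weight to 0 below T0 extends the integral to the whole half-line
    without changing its limit at infinity, and keeps it bounded.\<close>
  define W where "W = (\<lambda>t. if t \<in> {T0..} then weight t else 0)"
  have SB: "norm (S t) \<le> B" for t
  proof -
    have "norm (S t) \<le> (\<Sum>n. norm (dual_coeff \<alpha> n * exp (\<i> * of_real (t * freq \<alpha> n))))"
      unfolding S_def by (rule summable_norm) (use dual_coeff_summable[OF al] in \<open>simp add: norm_mult\<close>)
    thus ?thesis by (simp add: norm_mult B_def)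
  qed
  obtain M where M: "\<And>t. t \<ge> Tw \<Longrightarrow> norm (weight t) \<le> M" using weight_bounded[OF Tw(2)] by blast
  have M0: "M \<ge> 0" using M[of Tw] norm_ge_zero order_trans by blast
  have Wmeas: "W \<in> borel_measurable borel"
  proof -
    have "(\<lambda>t. indicat_real {T0..} t *\<^sub>R weight t) \<in> borel_measurable borel"
      by (rule borel_measurable_continuous_on_indicator) (use T0 continuous_on_subset[OF Tw(2)] in auto)
    also have "(\<lambda>t. indicat_real {T0..} t *\<^sub>R weight t) = W" by (auto simp: W_def fun_eq_iff indicator_def)
    finally show ?thesis .
  qed
  have Wbound: "norm (W t) \<le> M" for t using M[of t] M0 T0 by (auto simp: W_def)
  have Wlim: "(W \<longlongrightarrow> Stirling_const) at_top"
    by (rule Lim_transform_eventually[OF weight_limit]) (use eventually_ge_at_top[of T0] in eventually_elim, simp add: W_def)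
  have main: "((\<lambda>y. of_real y powr u * (LINT t:{0<..}|lborel. W t * (of_real t powr (u - 1) * S t * exp (- D y * of_real t))))
     \<longlongrightarrow> Stirling_const * (Gamma u * of_real (1 / \<alpha>) powr (- u)) * (\<Sum>n. if freq \<alpha> n = 0 then dual_coeff \<alpha> n else 0)) (at_right 0)"
    unfolding S_def u_def
    by (rule Laplace_almost_periodic_limit[OF Wmeas Wbound Wlim dual_coeff_summable[OF al]])
       (use al phase_limits(1)[OF al] in \<open>auto simp: D_def\<close>)
  have hdual: "h (Complex y \<alpha>) (Complex (-1/2) t) = exp (- phase \<alpha> y / 2) * (W t * (of_real t powr (u - 1) * S t * exp (- D y * of_real t)))"
    if "y > 0" "t \<ge> T0" for y t
    using h_dual_line[OF al that(1) _ TF[of t]] that T0 T0pos by (simp add: W_def S_def D_def u_def)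
  obtain C1 where C1: "\<And>y. y > 0 \<Longrightarrow> norm (LINT t:{..T0}|lborel. h (Complex y \<alpha>) (Complex (3/2) t)) \<le> C1"
    using lower_part_bounded[OF T0pos al] by blast
  obtain C2 where C2: "\<And>y. 0 < y \<Longrightarrow> y < 1 \<Longrightarrow> norm (LINT x:{-1/2..3/2}|lborel. h (Complex y \<alpha>) (Complex x T0)) \<le> C2"
    using bottom_part_bounded[OF T0pos al] by blast
  define E where "E = (\<lambda>y. (LINT t:{..T0}|lborel. h (Complex y \<alpha>) (Complex (3/2) t)) + \<i> * (LINT x:{-1/2..3/2}|lborel. h (Complex y \<alpha>) (Complex x T0)))"
  have decomp: "2 * pi * f (Complex y \<alpha>) = E y + exp (- phase \<alpha> y / 2) * (LINT t:{0<..}|lborel. W t * (of_real t powr (u - 1) * S t * exp (- D y * of_real t)))"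
    if y: "y > 0" for y
  proof -
    define z where "z = Complex y \<alpha>"
    have z: "Re z > 0" "Im z > 0" using y al by (auto simp: z_def)
    have int32: "set_integrable lborel A (\<lambda>t. h z (Complex (3/2) t))" if "A \<in> sets borel" for A
    proof -
      have "set_integrable lborel UNIV (\<lambda>t. h z (Complex (3/2) t))"
        using f_eq_Mellin(2)[OF z(1)] by (simp add: set_integrable_def)
      thus ?thesis by (rule set_integrable_subset) (use that in auto)
    qed
    have hhol: "h z holomorphic_on {s. Im s > 0}"
      unfolding h_def using z
      by (intro holomorphic_intros holomorphic_on_subset[OF F_hol]) (auto elim!: nonpos_Ints_cases)
    have intm: "set_integrable lborel {T0..} (\<lambda>t. h z (Complex (-1/2) t))"
    proof (rule set_integrable_continuous_bound)
      show "set_integrable lborel {T0..} (\<lambda>t. norm (exp (- phase \<alpha> y / 2)) * (M * B) * exp (- Re (D y) * t))"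
        using set_integrable_exp_decay(1)[OF Re_decay_pos[OF y al]] by (auto simp: D_def)
      show "continuous_on {T0..} (\<lambda>t. h z (Complex (-1/2) t))"
        by (rule continuous_on_compose2[OF holomorphic_on_imp_continuous_on[OF hhol]])
           (use T0pos in \<open>auto intro!: continuous_intros\<close>)
      fix t assume t: "t \<in> {T0..}"
      have "norm (h z (Complex (-1/2) t)) = norm (exp (- phase \<alpha> y / 2)) * (norm (W t) * norm (S t) * exp (- Re (D y) * t))"
        using hdual[OF y, of t] t T0pos by (simp add: z_def norm_mult norm_powr_real_powr u_def)
      also have "\<dots> \<le> norm (exp (- phase \<alpha> y / 2)) * (M * B * exp (- Re (D y) * t))"
        using M0 by (intro mult_left_mono mult_right_mono mult_mono Wbound SB) auto
      finally show "norm (h z (Complex (-1/2) t)) \<le> norm (exp (- phase \<alpha> y / 2)) * (M * B) * exp (- Re (D y) * t)" by (simp add: mult.assoc)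
    qed auto
    obtain C where C: "\<And>s. -1/2 \<le> Re s \<Longrightarrow> Re s \<le> 3/2 \<Longrightarrow> Tg \<le> Im s \<Longrightarrow> norm (h z s) \<le> C * exp (Im s ^ N)"
      using Tg(2)[OF z] by blast
    have shift: "(LINT t:{T0..}|lborel. h z (Complex (3/2) t)) - (LINT t:{T0..}|lborel. h z (Complex (-1/2) t)) = \<i> * (LINT x:{-1/2..3/2}|lborel. h z (Complex x T0))"
    proof (rule half_strip_shift[where C = C and N = N])
      show "h z holomorphic_on {s. - 1 / 2 \<le> Re s \<and> Re s \<le> 3 / 2 \<and> T0 \<le> Im s}"
        by (rule holomorphic_on_subset[OF hhol]) (use T0pos in auto)
      show "Re ((- \<i> * s) ^ Suc N) \<ge> Im s ^ Suc N / 2" if "-1/2 \<le> Re s" "Re s \<le> 3/2" "T0 \<le> Im s" for s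
        by (rule Ts(2)) (use that T0 in auto)
      show "norm (h z s) \<le> C * exp (Im s ^ N)" if "-1/2 \<le> Re s" "Re s \<le> 3/2" "T0 \<le> Im s" for s
        by (rule C) (use that T0 in auto)
    qed (use T0pos intm int32 in auto)
    have "2 * pi * f z = (LINT t:({..T0} \<union> {T0..})|lborel. h z (Complex (3/2) t))"
    proof -
      have "{..T0} \<union> {T0..} = UNIV" by auto
      thus ?thesis using f_eq_Mellin(1)[OF z(1)] by (simp add: set_lebesgue_integral_def)
    qed
    also have "\<dots> = (LINT t:{..T0}|lborel. h z (Complex (3/2) t)) + (LINT t:{T0..}|lborel. h z (Complex (3/2) t))"
    proof (rule set_integral_Un_AE)
      have "AE t in lborel. t \<noteq> T0" by (rule AE_lborel_singleton)
      thus "AE t in lborel. \<not> (t \<in> {..T0} \<and> t \<in> {T0..})" by eventually_elim auto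
    qed (use int32 in auto)
    also have "(LINT t:{T0..}|lborel. h z (Complex (3/2) t)) = (LINT t:{T0..}|lborel. h z (Complex (-1/2) t)) + \<i> * (LINT x:{-1/2..3/2}|lborel. h z (Complex x T0))"
      using shift by (simp add: algebra_simps)
    also have "(LINT t:{T0..}|lborel. h z (Complex (-1/2) t)) = exp (- phase \<alpha> y / 2) * (LINT t:{0<..}|lborel. W t * (of_real t powr (u - 1) * S t * exp (- D y * of_real t)))"
    proof -
      have "(LINT t:{T0..}|lborel. h z (Complex (-1/2) t)) = (LINT t:{0<..}|lborel. exp (- phase \<alpha> y / 2) * (W t * (of_real t powr (u - 1) * S t * exp (- D y * of_real t))))"
        unfolding set_lebesgue_integral_def z_def
      proof (rule Bochner_Integration.integral_cong[OF refl])
        fix t :: real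
        show "indicat_real {T0..} t *\<^sub>R h (Complex y \<alpha>) (Complex (-1/2) t) =
          indicat_real {0<..} t *\<^sub>R (exp (- phase \<alpha> y / 2) * (W t * (of_real t powr (u - 1) * S t * exp (- D y * of_real t))))"
        proof (cases "t \<ge> T0")
          case True
          thus ?thesis using hdual[OF y True] T0pos by (simp add: indicator_def)
        qed (simp add: W_def)
      qed
      thus ?thesis by (simp only: set_integral_mult_right)
    qed
    finally show ?thesis by (simp add: E_def z_def)
  qed
  have Elim: "((\<lambda>y. of_real y powr u * E y) \<longlongrightarrow> 0) (at_right 0)"
  proof (rule Lim_null_comparison)
    have "((\<lambda>y::real. y * (C1 + C2)) \<longlongrightarrow> 0 * (C1 + C2)) (at_right 0)" by (intro tendsto_intros tendsto_ident_at)
    thus "((\<lambda>y::real. y * (C1 + C2)) \<longlongrightarrow> 0) (at_right 0)" by simp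
    have "eventually (\<lambda>y::real. y < 1) (at_right 0)" by (rule eventually_at_right_real[THEN eventually_mono]) auto
    thus "\<forall>\<^sub>F y in at_right 0. norm (of_real y powr u * E y) \<le> y * (C1 + C2)"
      using eventually_at_right_less[of 0]
    proof eventually_elim
      case (elim y)
      have "norm (E y) \<le> C1 + C2"
        unfolding E_def using norm_triangle_mono[OF C1[OF elim(2)], of "\<i> * (LINT x:{-1/2..3/2}|lborel. h (Complex y \<alpha>) (Complex x T0))" C2] C2[OF elim(2) elim(1)]
        by (simp add: norm_mult)
      moreover have "norm (complex_of_real y powr u) = y" using elim by (simp add: norm_powr_real_powr u_def)
      ultimately show ?case unfolding norm_mult using elim by (auto intro: mult_left_mono)
    qed
  qed
  have ph: "((\<lambda>y. exp (- phase \<alpha> y / 2)) \<longlongrightarrow> exp (- 0 / 2)) (at_right 0)"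
    by (intro tendsto_intros phase_limits(2) al) auto
  have "((\<lambda>y. (of_real y powr u * E y + exp (- phase \<alpha> y / 2) * (of_real y powr u * (LINT t:{0<..}|lborel. W t * (of_real t powr (u - 1) * S t * exp (- D y * of_real t))))) / (2 * pi))
     \<longlongrightarrow> (0 + exp (- 0 / 2) * (Stirling_const * (Gamma u * of_real (1 / \<alpha>) powr (- u)) * (\<Sum>n. if freq \<alpha> n = 0 then dual_coeff \<alpha> n else 0))) / (2 * pi)) (at_right 0)"
    by (intro tendsto_intros Elim ph main) auto
  hence "((\<lambda>y. (of_real y powr u * E y + exp (- phase \<alpha> y / 2) * (of_real y powr u * (LINT t:{0<..}|lborel. W t * (of_real t powr (u - 1) * S t * exp (- D y * of_real t))))) / (2 * pi))
     \<longlongrightarrow> Stirling_const * (Gamma u * of_real (1 / \<alpha>) powr (- u)) * (\<Sum>n. if freq \<alpha> n = 0 then dual_coeff \<alpha> n else 0) / (2 * pi)) (at_right 0)"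
    by simp
  thus ?thesis
  proof (rule Lim_transform_eventually)
    show "\<forall>\<^sub>F y in at_right 0. (of_real y powr u * E y + exp (- phase \<alpha> y / 2) * (of_real y powr u * (LINT t:{0<..}|lborel. W t * (of_real t powr (u - 1) * S t * exp (- D y * of_real t))))) / (2 * pi)
      = of_real y powr u * f (Complex y \<alpha>)"
      using eventually_at_right_less[of 0]
    proof eventually_elim
      case (elim y)
      have gen: "(p * e + x * (p * l)) / c = p * g" if "c * g = e + x * l" "c \<noteq> 0" for p e x l c g :: complex
      proof -
        have "(p * e + x * (p * l)) = p * (c * g)" unfolding that(1) by (simp add: algebra_simps)
        thus ?thesis using that(2) by simp
      qed
      show ?case by (rule gen) (use decomp[OF elim] in auto)
    qed
  qed
qed

text \<open>The numbers a(n) n^(i theta), extended by 0 to real arguments: the period can then be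
  stated before q is known to be an integer.\<close>

definition coef :: "real \<Rightarrow> complex" where
  "coef x = (if x \<in> \<nat> then a (nat \<lfloor>x\<rfloor>) * of_real x powr (\<i> * of_real \<theta>) else 0)"

lemma coef_of_nat: "coef (real n) = a n * of_nat n powr (\<i> * of_real \<theta>)"
  by (simp add: coef_def)

definition limit_const :: complex where
  "limit_const = Stirling_const * Gamma (1 - \<i> * of_real \<theta>) * of_real q powr (- (1 - \<i> * of_real \<theta>)) / (2 * pi)"

text \<open>At most one positive n has vanishing frequency, namely n = q \<alpha>. For it \<alpha>^u
  / n equals q^(-u) n^(u - 1), and n^(u - 1) = n^(-i theta) is the conjugate of n^(i theta).\<close>

theorem f_boundary_limit:
  assumes al: "\<alpha> > 0"
  shows "((\<lambda>y. of_real y powr (1 - \<i> * of_real \<theta>) * f (Complex y \<alpha>)) \<longlongrightarrow> limit_const * cnj (coef (q * \<alpha>))) (at_right 0)"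
proof -
  define u where "u = 1 - \<i> * of_real \<theta>"
  have qa: "q * \<alpha> > 0" using q_pos al by simp
  have freq0: "freq \<alpha> n = 0 \<longleftrightarrow> real n = q * \<alpha>" if "n > 0" for n
    using that qa by (simp add: freq_def)
  have "of_real (1 / \<alpha>) powr (- u) * (\<Sum>n. if freq \<alpha> n = 0 then dual_coeff \<alpha> n else 0) = of_real q powr (- u) * cnj (coef (q * \<alpha>))"
  proof (cases "q * \<alpha> \<in> \<nat>")
    case False
    have "(\<lambda>n. if freq \<alpha> n = 0 then dual_coeff \<alpha> n else 0) = (\<lambda>n. 0)"
    proof
      fix n show "(if freq \<alpha> n = 0 then dual_coeff \<alpha> n else 0) = 0"
      proof (cases "n = 0")
        case n: False
        have "real n \<noteq> q * \<alpha>" using False by (metis of_nat_in_Nats)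
        thus ?thesis using freq0[of n] n by simp
      qed (simp add: dual_coeff_def a0)
    qed
    thus ?thesis using False by (simp add: coef_def)
  next
    case True
    then obtain m where m: "q * \<alpha> = real m" by (auto simp: Nats_def)
    have m0: "m > 0" using qa m by (cases m) auto
    have "(\<lambda>n. if freq \<alpha> n = 0 then dual_coeff \<alpha> n else 0) = (\<lambda>n. if n = m then cnj (a m) / of_nat m else 0)"
    proof
      fix n show "(if freq \<alpha> n = 0 then dual_coeff \<alpha> n else 0) = (if n = m then cnj (a m) / of_nat m else 0)"
      proof (cases "n = 0")
        case True
        thus ?thesis using m0 by (simp add: dual_coeff_def a0)
      next
        case False
        hence n: "freq \<alpha> n = 0 \<longleftrightarrow> n = m" using freq0[of n] m by simp
        have "exp (- ln (real m)) = 1 / real m" using m0 by (simp add: exp_minus inverse_eq_divide)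
        hence "dual_coeff \<alpha> m = cnj (a m) / of_nat m" if "freq \<alpha> m = 0"
          using that by (simp add: dual_coeff_def)
        thus ?thesis using n by auto
      qed
    qed
    moreover have "(\<lambda>n. if n = m then cnj (a m) / of_nat m else 0) sums (cnj (a m) / of_nat m)"
      using sums_single[of m "\<lambda>_. cnj (a m) / of_nat m"] .
    ultimately have "(\<Sum>n. if freq \<alpha> n = 0 then dual_coeff \<alpha> n else 0) = cnj (a m) / of_nat m"
      by (simp add: sums_iff)
    moreover have "of_real (1 / \<alpha>) powr (- u) / of_nat m = of_real q powr (- u) * cnj (of_nat m powr (\<i> * of_real \<theta>))"
    proof -
      have "1 / \<alpha> = q * (1 / real m)" using m m0 al by (simp add: field_simps)
      hence "complex_of_real (1 / \<alpha>) powr (- u) = of_real q powr (- u) * of_real (1 / real m) powr (- u)"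
        using q_pos powr_times_real[of "of_real q" "of_real (1 / real m)" "- u"] by simp
      also have "complex_of_real (1 / real m) powr (- u) = of_nat m powr u"
      proof -
        have "complex_of_real (1 / real m) powr (- u) = exp (- u * of_real (ln (1 / real m)))"
          using m0 Ln_of_real[of "1 / real m"] by (simp add: powr_def del: of_real_divide)
        also have "ln (1 / real m) = - ln (real m)" using m0 by (simp add: ln_div)
        finally show ?thesis using m0 by (simp add: powr_def Ln_of_nat)
      qed
      also have "of_nat m powr u = of_nat m * of_nat m powr (- \<i> * of_real \<theta>)"
      proof -
        have "of_nat m powr u = of_nat m powr (1 + (- \<i> * of_real \<theta>))" by (simp add: u_def)
        thus ?thesis unfolding powr_add using m0 by simp
      qed
      also have "of_nat m powr (- \<i> * of_real \<theta>) = cnj (of_nat m powr (\<i> * of_real \<theta>))"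
        using m0 by (simp add: powr_def exp_cnj Ln_of_nat)
      finally show ?thesis using m0 by simp
    qed
    moreover have "p * (c / k) = e * cnj (b * v)" if "p / k = e * cnj v" "c = cnj b" for p c k e b v :: complex
      using that by (metis complex_cnj_mult mult.commute mult.left_commute times_divide_eq_right)
    ultimately show ?thesis unfolding m coef_of_nat by simp
  qed
  hence "Stirling_const * (Gamma u * of_real (1 / \<alpha>) powr (- u)) * (\<Sum>n. if freq \<alpha> n = 0 then dual_coeff \<alpha> n else 0) / (2 * pi) = limit_const * cnj (coef (q * \<alpha>))"
    unfolding limit_const_def u_def[symmetric] by (simp add: mult.assoc)
  thus ?thesis using f_limit[OF al] unfolding u_def[symmetric] by simp
qed

end

section \<open>Periodicity and Fourier expansion of the coefficients\<close>

text \<open>A sum written as the Laplace transform of a step function, so that the Abelian theorem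
  for integrals becomes applicable. The additional factor is the integral of exp (- \<tau> t) over
  [0, 1].\<close>

lemma sum_exp_eq_Laplace_step:
  fixes g :: "nat \<Rightarrow> complex"
  assumes \<tau>: "\<tau> > 0" and g: "\<And>j. norm (g j) \<le> M"
  shows "(LINT t:{0<..}|lborel. g (nat \<lfloor>t\<rfloor>) * exp (- of_real (\<tau> * t))) =
         (\<Sum>j. g j * exp (- of_real (\<tau> * real j))) * of_real ((1 - exp (- \<tau>)) / \<tau>)"
proof -
  define f where "f = (\<lambda>j t. indicat_real {real j..<real (Suc j)} t *\<^sub>R (g j * exp (- of_real (\<tau> * t))))"
  have M0: "M \<ge> 0" using g[of 0] norm_ge_zero order_trans by blast
  have ei: "set_integrable lborel {T..} (\<lambda>t. exp (- \<tau> * t))" "(LINT t:{T..}|lborel. exp (- \<tau> * t)) = exp (- \<tau> * T) / \<tau>" for T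
    by (rule set_integrable_exp_decay[OF \<tau>])+
  have ri: "integrable lborel (\<lambda>t. indicat_real {real j..<real (Suc j)} t * exp (- \<tau> * t))"
       "(LINT t|lborel. indicat_real {real j..<real (Suc j)} t * exp (- \<tau> * t)) = exp (- \<tau> * real j) * ((1 - exp (- \<tau>)) / \<tau>)" for j
  proof -
    have eq: "indicat_real {real j..<real (Suc j)} t * exp (- \<tau> * t) =
       indicat_real {real j..} t *\<^sub>R exp (- \<tau> * t) - indicat_real {real (Suc j)..} t *\<^sub>R exp (- \<tau> * t)" for t
      by (auto simp: indicator_def)
    have i1: "integrable lborel (\<lambda>t. indicat_real {real j..} t *\<^sub>R exp (- \<tau> * t))"
      "integrable lborel (\<lambda>t. indicat_real {real (Suc j)..} t *\<^sub>R exp (- \<tau> * t))"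
      using ei(1) unfolding set_integrable_def by blast+
    show "integrable lborel (\<lambda>t. indicat_real {real j..<real (Suc j)} t * exp (- \<tau> * t))"
      unfolding eq by (intro Bochner_Integration.integrable_diff i1)
    have "(LINT t|lborel. indicat_real {real j..<real (Suc j)} t * exp (- \<tau> * t)) = exp (- \<tau> * real j) / \<tau> - exp (- \<tau> * real (Suc j)) / \<tau>"
      unfolding eq Bochner_Integration.integral_diff[OF i1] using ei(2) unfolding set_lebesgue_integral_def by simp
    also have "exp (- \<tau> * real (Suc j)) = exp (- \<tau> * real j) * exp (- \<tau>)" by (simp add: algebra_simps flip: exp_add)
    also have "exp (- \<tau> * real j) / \<tau> - exp (- \<tau> * real j) * exp (- \<tau>) / \<tau> = exp (- \<tau> * real j) * ((1 - exp (- \<tau>)) / \<tau>)"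
      by (simp add: algebra_simps diff_divide_distrib)
    finally show "(LINT t|lborel. indicat_real {real j..<real (Suc j)} t * exp (- \<tau> * t)) = exp (- \<tau> * real j) * ((1 - exp (- \<tau>)) / \<tau>)" .
  qed
  have f_eq: "f j t = g j * of_real (indicat_real {real j..<real (Suc j)} t * exp (- \<tau> * t))" for j t
    by (simp add: f_def scaleR_conv_of_real flip: exp_of_real)
  have fint: "integrable lborel (f j)" for j
    unfolding f_eq[abs_def] using integrable_of_real[OF ri(1)[of j]] by (intro integrable_mult_right) auto
  have fI: "(LINT t|lborel. f j t) = g j * of_real (exp (- \<tau> * real j) * ((1 - exp (- \<tau>)) / \<tau>))" for j
    unfolding f_eq integral_mult_right_zero integral_complex_of_real ri(2) ..
  have fn: "(LINT t|lborel. norm (f j t)) = norm (g j) * (exp (- \<tau> * real j) * ((1 - exp (- \<tau>)) / \<tau>))" for j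
  proof -
    have "norm (f j t) = norm (g j) * (indicat_real {real j..<real (Suc j)} t * exp (- \<tau> * t))" for t
      unfolding f_eq norm_mult norm_of_real by simp
    thus ?thesis using ri(2)[of j] by simp
  qed
  have geo: "summable (\<lambda>j. exp (- \<tau> * real j))"
  proof -
    have "(\<lambda>j. exp (- \<tau> * real j)) = (\<lambda>j. exp (- \<tau>) ^ j)" by (simp flip: exp_of_nat_mult add: mult.commute)
    thus ?thesis using \<tau> by (simp add: summable_geometric)
  qed
  have gs: "summable (\<lambda>j. norm (g j) * exp (- \<tau> * real j))"
    by (rule summable_comparison_test'[OF summable_mult[OF geo, of M]]) (use g in \<open>auto intro: mult_right_mono\<close>)
  \<comment> \<open>At t = 0 the interval with j = 0 contributes, but the half-line of integration
    does not; this one point is a null set.\<close>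
  have single: "(\<lambda>j. f j t) sums (indicat_real {0<..} t *\<^sub>R (g (nat \<lfloor>t\<rfloor>) * exp (- of_real (\<tau> * t))))" if "t \<noteq> 0" for t
  proof (cases "t > 0")
    case True
    have "f j t = (if j = nat \<lfloor>t\<rfloor> then g j * exp (- of_real (\<tau> * t)) else 0)" for j
    proof -
      have "real j \<le> t \<and> t < real (Suc j) \<longleftrightarrow> j = nat \<lfloor>t\<rfloor>"
      proof -
        have "j = nat \<lfloor>t\<rfloor> \<longleftrightarrow> \<lfloor>t\<rfloor> = int j" using True by auto
        thus ?thesis by (simp add: floor_eq_iff add.commute)
      qed
      thus ?thesis by (auto simp: f_def indicator_def)
    qed
    thus ?thesis using True sums_single[of "nat \<lfloor>t\<rfloor>" "\<lambda>j. g j * exp (- of_real (\<tau> * t))"] by simp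
  next
    case False
    hence "f j t = 0" for j using that by (auto simp: f_def indicator_def)
    thus ?thesis using False by simp
  qed
  have AE0: "AE t in lborel. t \<noteq> (0::real)" by (rule AE_lborel_singleton)
  have sm1: "AE t in lborel. summable (\<lambda>j. norm (f j t))"
  proof (intro always_eventually allI)
    fix t
    have "(\<lambda>j. norm (f j t)) = (\<lambda>j. if j = nat \<lfloor>t\<rfloor> then norm (f j t) else 0)"
    proof
      fix j show "norm (f j t) = (if j = nat \<lfloor>t\<rfloor> then norm (f j t) else 0)"
      proof (cases "real j \<le> t \<and> t < real (Suc j)")
        case True
        hence "j = nat \<lfloor>t\<rfloor>" by linarith
        thus ?thesis by simp
      qed (auto simp: f_def indicator_def)
    qed
    thus "summable (\<lambda>j. norm (f j t))" using summable_single[of "nat \<lfloor>t\<rfloor>" "\<lambda>j. norm (f j t)"] by simp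
  qed
  have sm2: "summable (\<lambda>j. LINT t|lborel. norm (f j t))"
    unfolding fn mult.assoc[symmetric] by (intro summable_mult2 gs)
  have "(LINT t:{0<..}|lborel. g (nat \<lfloor>t\<rfloor>) * exp (- of_real (\<tau> * t))) = (LINT t|lborel. (\<Sum>j. f j t))"
    unfolding set_lebesgue_integral_def
  proof (rule integral_cong_AE)
    show "AE t in lborel. indicat_real {0<..} t *\<^sub>R (g (nat \<lfloor>t\<rfloor>) * exp (- of_real (\<tau> * t))) = (\<Sum>j. f j t)"
      using AE0 by eventually_elim (use single in \<open>auto simp: sums_iff\<close>)
    have "(\<lambda>t::real. g (nat \<lfloor>t\<rfloor>)) \<in> borel_measurable borel" by measurable
    moreover have "(\<lambda>t. exp (- complex_of_real (\<tau> * t))) \<in> borel_measurable borel"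
      by (intro borel_measurable_continuous_onI continuous_intros)
    ultimately show "(\<lambda>t. indicat_real {0<..} t *\<^sub>R (g (nat \<lfloor>t\<rfloor>) * exp (- of_real (\<tau> * t)))) \<in> borel_measurable lborel"
      by (auto intro!: borel_measurable_scaleR borel_measurable_times borel_measurable_indicator)
    show "(\<lambda>t. \<Sum>j. f j t) \<in> borel_measurable lborel"
      using integrable_suminf[OF fint sm1 sm2] by auto
  qed
  also have "\<dots> = (\<Sum>j. LINT t|lborel. f j t)" by (rule integral_suminf[OF fint sm1 sm2])
  also have "\<dots> = (\<Sum>j. (g j * exp (- of_real (\<tau> * real j))) * of_real ((1 - exp (- \<tau>)) / \<tau>))"
    unfolding fI by (intro suminf_cong) (simp add: mult.assoc flip: exp_of_real)
  also have "\<dots> = (\<Sum>j. g j * exp (- of_real (\<tau> * real j))) * of_real ((1 - exp (- \<tau>)) / \<tau>)"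
  proof (rule suminf_mult2[symmetric], rule summable_norm_cancel)
    show "summable (\<lambda>j. norm (g j * exp (- complex_of_real (\<tau> * real j))))" using gs by (simp add: norm_mult)
  qed
  finally show ?thesis .
qed

text \<open>The model case for \<open>f_boundary_limit\<close>: n^(-i theta) summed over one residue
  class has a singularity of the same type. Comparison of the two limits yields the finite Fourier
  expansion.\<close>

lemma arithmetic_progression_limit:
  fixes \<theta> :: real and k N :: nat
  assumes k: "k > 0" and N: "N > 0"
  defines "u \<equiv> 1 - \<i> * of_real \<theta>"
  shows "((\<lambda>y. of_real y powr u * (\<Sum>j. of_nat (k + N * j) powr (u - 1) * exp (- of_real (2 * pi * real N * y * real j))))
     \<longlongrightarrow> Gamma u * of_real (2 * pi) powr (- u) / of_nat N) (at_right 0)"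
proof -
  define g where "g = (\<lambda>j. of_nat (k + N * j) powr (u - 1) :: complex)"
  have ng: "norm (g j) = 1" for j
  proof -
    have "norm (of_nat n powr (u - 1) :: complex) = 1" if "n > 0" for n
      using that by (simp add: norm_powr_real_powr u_def)
    from this[of "k + N * j"] show ?thesis using k by (simp add: g_def)
  qed
  define W where "W = (\<lambda>t. g (nat \<lfloor>t\<rfloor>) * exp (\<i> * of_real (\<theta> * ln t)))"
  define d where "d = 2 * pi * real N"
  have d: "d > 0" using N by (simp add: d_def)
  have Wm: "W \<in> borel_measurable borel"
  proof -
    have "(\<lambda>t::real. g (nat \<lfloor>t\<rfloor>)) \<in> borel_measurable borel" by measurable
    moreover have "(\<lambda>t::real. exp (\<i> * complex_of_real (\<theta> * ln t))) \<in> borel_measurable borel"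
    proof -
      have "(\<lambda>x::real. exp (\<i> * complex_of_real (\<theta> * x))) \<in> borel_measurable borel"
        by (intro borel_measurable_continuous_onI continuous_intros)
      from measurable_compose[OF borel_measurable_ln[OF measurable_ident_sets[OF refl]] this] show ?thesis by simp
    qed
    ultimately show ?thesis unfolding W_def by (intro borel_measurable_times)
  qed
  have Wb: "norm (W t) \<le> 1" for t by (simp add: W_def norm_mult ng)
  \<comment> \<open>W t is ((k + N \<lfloor>t\<rfloor>) / t)^(-i theta), and the base tends to
    N.\<close>
  have Wl: "(W \<longlongrightarrow> exp (- \<i> * of_real (\<theta> * ln (real N)))) at_top"
  proof -
    have fl: "((\<lambda>t::real. real_of_int \<lfloor>t\<rfloor> / t) \<longlongrightarrow> 1) at_top"
    proof (rule tendsto_sandwich)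
      show "((\<lambda>t::real. 1 - 1 / t) \<longlongrightarrow> 1) at_top"
        using tendsto_diff[OF tendsto_const[of 1] tendsto_divide_0[OF tendsto_const[of 1] filterlim_at_top_imp_at_infinity[OF filterlim_ident]]] by simp
      show "\<forall>\<^sub>F t in at_top. 1 - 1 / t \<le> real_of_int \<lfloor>t\<rfloor> / t"
        using eventually_gt_at_top[of 0]
      proof eventually_elim
        case (elim t)
        have "1 - 1 / t = (t - 1) / t" using elim by (simp add: diff_divide_distrib)
        also have "\<dots> \<le> real_of_int \<lfloor>t\<rfloor> / t" using elim by (intro divide_right_mono) linarith+
        finally show ?case .
      qed
      show "\<forall>\<^sub>F t in at_top. real_of_int \<lfloor>t\<rfloor> / t \<le> 1"
        using eventually_gt_at_top[of 0] by eventually_elim (simp add: field_simps)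
    qed auto
    have k0: "((\<lambda>t::real. real k / t) \<longlongrightarrow> 0) at_top"
      by (rule tendsto_divide_0[OF tendsto_const filterlim_at_top_imp_at_infinity[OF filterlim_ident]])
    have "((\<lambda>t. exp (- \<i> * of_real (\<theta> * ln (real k / t + real N * (real_of_int \<lfloor>t\<rfloor> / t))))) \<longlongrightarrow> exp (- \<i> * of_real (\<theta> * ln (0 + real N * 1)))) at_top"
      by (intro tendsto_intros fl k0) (use N in auto)
    hence "((\<lambda>t. exp (- \<i> * of_real (\<theta> * ln (real k / t + real N * (real_of_int \<lfloor>t\<rfloor> / t))))) \<longlongrightarrow> exp (- \<i> * of_real (\<theta> * ln (real N)))) at_top" by simp
    thus ?thesis
    proof (rule Lim_transform_eventually)
      show "\<forall>\<^sub>F t in at_top. exp (- \<i> * of_real (\<theta> * ln (real k / t + real N * (real_of_int \<lfloor>t\<rfloor> / t)))) = W t"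
        using eventually_gt_at_top[of 0]
      proof eventually_elim
        case (elim t)
        define n where "n = k + N * nat \<lfloor>t\<rfloor>"
        have n: "n > 0" using k by (simp add: n_def)
        have "real k / t + real N * (real_of_int \<lfloor>t\<rfloor> / t) = real n / t"
          using elim by (simp add: n_def add_divide_distrib)
        hence l: "ln (real k / t + real N * (real_of_int \<lfloor>t\<rfloor> / t)) = ln (real n) - ln t" using elim n by (simp add: ln_div)
        have "W t = exp (- \<i> * of_real \<theta> * of_real (ln (real n))) * exp (\<i> * of_real (\<theta> * ln t))"
          unfolding W_def g_def n_def[symmetric] using n by (simp add: powr_def Ln_of_nat u_def)
        also have "\<dots> = exp (- \<i> * of_real (\<theta> * (ln (real n) - ln t)))" by (simp add: algebra_simps flip: exp_add)
        finally show ?case unfolding l ..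
      qed
    qed
  qed
  have D: "((\<lambda>y. of_real (d * y) / complex_of_real y) \<longlongrightarrow> of_real d) (at_right 0)"
    by (rule tendsto_eventually) (use eventually_at_right_less[of 0] in eventually_elim, simp)
  \<comment> \<open>Only one coefficient is nonzero and all frequencies are 0: the almost periodic
    sum of the Abelian theorem is here the constant 1.\<close>
  define b where "b = (\<lambda>n::nat. if n = 0 then 1 else 0 :: complex)"
  have bs: "summable (\<lambda>n. norm (b n))" unfolding b_def by (rule summable_finite[of "{0}"]) auto
  have bsum: "(\<Sum>n. b n * c n) = c 0" for c :: "nat \<Rightarrow> complex"
    using suminf_finite[of "{0}" "\<lambda>n. b n * c n"] by (simp add: b_def)
  have "((\<lambda>y. of_real y powr u * (LINT t:{0<..}|lborel. W t * (of_real t powr (u - 1) * (\<Sum>n. b n * exp (\<i> * of_real (t * 0))) * exp (- of_real (d * y) * of_real t))))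
    \<longlongrightarrow> exp (- \<i> * of_real (\<theta> * ln (real N))) * (Gamma u * of_real d powr (- u)) * (\<Sum>n. if (0::real) = 0 then b n else 0)) (at_right 0)"
    unfolding u_def by (rule Laplace_almost_periodic_limit[OF Wm Wb Wl bs d D])
  moreover have "(\<Sum>n. if (0::real) = 0 then b n else 0) = 1" using bsum[of "\<lambda>_. 1"] by simp
  moreover have "exp (- \<i> * of_real (\<theta> * ln (real N))) * of_real d powr (- u) = of_real (2 * pi) powr (- u) / of_nat N"
  proof -
    have "of_real d powr (- u) = of_real (2 * pi) powr (- u) * of_nat N powr (- u)"
      unfolding d_def using powr_times_real[of "of_real (2 * pi)" "of_nat N" "- u"] by simp
    also have "of_nat N powr (- u) = exp (\<i> * of_real (\<theta> * ln (real N))) / of_nat N"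
    proof -
      have "of_nat N powr (- u) = exp (- of_real (ln (real N)) + \<i> * of_real (\<theta> * ln (real N)))"
        using N by (simp add: powr_def Ln_of_nat u_def algebra_simps)
      also have "\<dots> = exp (\<i> * of_real (\<theta> * ln (real N))) / exp (of_real (ln (real N)))" unfolding exp_diff[symmetric] by simp
      also have "exp (complex_of_real (ln (real N))) = of_nat N" using N by (simp add: exp_of_real)
      finally show ?thesis .
    qed
    finally show ?thesis by (simp add: exp_minus)
  qed
  ultimately have lim: "((\<lambda>y. of_real y powr u * (LINT t:{0<..}|lborel. W t * (of_real t powr (u - 1) * (\<Sum>n. b n * exp (\<i> * of_real (t * 0))) * exp (- of_real (d * y) * of_real t))))
    \<longlongrightarrow> Gamma u * of_real (2 * pi) powr (- u) / of_nat N) (at_right 0)"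
    by (simp add: mult_ac)
  have eq: "(LINT t:{0<..}|lborel. W t * (of_real t powr (u - 1) * (\<Sum>n. b n * exp (\<i> * of_real (t * 0))) * exp (- of_real (d * y) * of_real t))) =
     (\<Sum>j. g j * exp (- of_real (d * y * real j))) * of_real ((1 - exp (- (d * y))) / (d * y))" if y: "y > 0" for y
  proof -
    have "(LINT t:{0<..}|lborel. W t * (of_real t powr (u - 1) * (\<Sum>n. b n * exp (\<i> * of_real (t * 0))) * exp (- of_real (d * y) * of_real t))) =
       (LINT t:{0<..}|lborel. g (nat \<lfloor>t\<rfloor>) * exp (- of_real (d * y * t)))"
    proof (rule set_lebesgue_integral_cong)
      show "\<forall>t. t \<in> {0<..} \<longrightarrow> W t * (of_real t powr (u - 1) * (\<Sum>n. b n * exp (\<i> * of_real (t * 0))) * exp (- of_real (d * y) * of_real t)) = g (nat \<lfloor>t\<rfloor>) * exp (- of_real (d * y * t))"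
      proof (intro allI impI)
        fix t :: real assume t: "t \<in> {0<..}"
        have "exp (\<i> * of_real (\<theta> * ln t)) * of_real t powr (u - 1) = 1"
          using t by (simp add: powr_def Ln_of_real u_def mult.assoc flip: exp_add)
        thus "W t * (of_real t powr (u - 1) * (\<Sum>n. b n * exp (\<i> * of_real (t * 0))) * exp (- of_real (d * y) * of_real t)) = g (nat \<lfloor>t\<rfloor>) * exp (- of_real (d * y * t))"
          using bsum[of "\<lambda>_. 1"] by (simp add: W_def mult_ac)
      qed
    qed auto
    also have "\<dots> = (\<Sum>j. g j * exp (- of_real (d * y * real j))) * of_real ((1 - exp (- (d * y))) / (d * y))"
      by (rule sum_exp_eq_Laplace_step[where M = 1]) (use y d ng in auto)
    finally show ?thesis .
  qed
  have ratio: "((\<lambda>y. complex_of_real ((1 - exp (- (d * y))) / (d * y))) \<longlongrightarrow> of_real 1) (at_right 0)"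
  proof (rule tendsto_of_real)
    have "((\<lambda>x::real. (1 - exp (- x))) has_real_derivative 1) (at 0)" by (auto intro!: derivative_eq_intros)
    hence "((\<lambda>x::real. (1 - exp (- x)) / x) \<longlongrightarrow> 1) (at 0)" by (simp add: DERIV_def)
    moreover have "filterlim (\<lambda>y. d * y) (at 0) (at_right 0)"
    proof (rule filterlim_atI)
      show "((\<lambda>y. d * y) \<longlongrightarrow> 0) (at_right 0)" using tendsto_mult[OF tendsto_const[of d] tendsto_ident_at[of 0 "{0<..}"]] by simp
      show "\<forall>\<^sub>F y in at_right 0. d * y \<noteq> 0" using eventually_at_right_less[of 0] by eventually_elim (use d in auto)
    qed
    ultimately show "((\<lambda>y. (1 - exp (- (d * y))) / (d * y)) \<longlongrightarrow> 1) (at_right 0)" by (rule filterlim_compose)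
  qed
  have "((\<lambda>y. of_real y powr u * (LINT t:{0<..}|lborel. W t * (of_real t powr (u - 1) * (\<Sum>n. b n * exp (\<i> * of_real (t * 0))) * exp (- of_real (d * y) * of_real t))) / of_real ((1 - exp (- (d * y))) / (d * y)))
    \<longlongrightarrow> Gamma u * of_real (2 * pi) powr (- u) / of_nat N / of_real 1) (at_right 0)"
    by (intro tendsto_divide[OF lim ratio]) auto
  hence "((\<lambda>y. of_real y powr u * (LINT t:{0<..}|lborel. W t * (of_real t powr (u - 1) * (\<Sum>n. b n * exp (\<i> * of_real (t * 0))) * exp (- of_real (d * y) * of_real t))) / of_real ((1 - exp (- (d * y))) / (d * y)))
    \<longlongrightarrow> Gamma u * of_real (2 * pi) powr (- u) / of_nat N) (at_right 0)" by simp
  thus ?thesis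
  proof (rule Lim_transform_eventually)
    show "\<forall>\<^sub>F y in at_right 0. of_real y powr u * (LINT t:{0<..}|lborel. W t * (of_real t powr (u - 1) * (\<Sum>n. b n * exp (\<i> * of_real (t * 0))) * exp (- of_real (d * y) * of_real t))) / of_real ((1 - exp (- (d * y))) / (d * y))
      = of_real y powr u * (\<Sum>j. of_nat (k + N * j) powr (u - 1) * exp (- of_real (2 * pi * real N * y * real j)))"
      using eventually_at_right_less[of 0]
    proof eventually_elim
      case (elim y)
      have "(1 - exp (- (d * y))) / (d * y) \<noteq> 0" using elim d by auto
      hence nz: "complex_of_real ((1 - exp (- (d * y))) / (d * y)) \<noteq> 0" by (simp only: of_real_eq_0_iff) simp
      have "p * (s * c) / c = p * s" if "c \<noteq> 0" for p s c :: complex using that by simp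
      note cancel = this[OF nz]
      show ?case unfolding eq[OF elim] cancel unfolding g_def d_def ..
    qed
  qed
qed

lemma sum_cis_multiples:
  fixes N :: nat and d :: int
  assumes N: "N > 0"
  shows "(\<Sum>m=1..N. cis (2 * pi * real m * of_int d / real N)) = (if int N dvd d then of_nat N else 0)"
proof -
  define w where "w = cis (2 * pi * of_int d / real N)"
  have pw: "cis (2 * pi * real m * of_int d / real N) = w ^ m" for m
  proof -
    have "2 * pi * real m * of_int d / real N = real m * (2 * pi * of_int d / real N)" by simp
    thus ?thesis unfolding w_def Complex.DeMoivre by (rule arg_cong)
  qed
  have wN: "w ^ N = 1"
  proof -
    have "real N * (2 * pi * of_int d / real N) = 2 * pi * of_int d" using N by simp
    hence "w ^ N = cis (2 * pi * of_int d)" unfolding w_def Complex.DeMoivre by (rule arg_cong)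
    also have "\<dots> = 1" using cis_multiple_2pi[of "of_int d"] by simp
    finally show ?thesis .
  qed
  have w1: "w = 1 \<longleftrightarrow> int N dvd d"
  proof
    assume "w = 1"
    hence "cos (2 * pi * of_int d / real N) = 1" by (simp add: w_def complex_eq_iff)
    then obtain n :: int where n: "2 * pi * of_int d / real N = of_int n * 2 * pi"
      by (auto simp: cos_one_2pi_int)
    hence "pi * (2 * of_int d) = pi * (2 * (of_int n * real N))" using N by (simp add: field_simps)
    hence "real_of_int d = of_int n * real N" by simp
    hence "of_int d = real_of_int (n * int N)" by simp
    hence "d = n * int N" by (simp only: of_int_eq_iff)
    thus "int N dvd d" by simp
  next
    assume "int N dvd d"
    then obtain n where "d = int N * n" by auto
    hence "2 * pi * of_int d / real N = 2 * pi * of_int n" using N by simp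
    hence "w = cis (2 * pi * of_int n)" unfolding w_def by (rule arg_cong)
    also have "\<dots> = 1" by (rule cis_multiple_2pi) simp
    finally show "w = 1" .
  qed
  have "(\<Sum>m=1..N. cis (2 * pi * real m * of_int d / real N)) = (\<Sum>m=1..N. w ^ m)" by (simp add: pw)
  also have "\<dots> = (\<Sum>m<N. w ^ Suc m)"
    by (rule sum.reindex_bij_witness[of _ Suc "\<lambda>m. m - 1"]) auto
  also have "\<dots> = w * (\<Sum>m<N. w ^ m)" by (simp add: sum_distrib_left)
  finally have eq: "(\<Sum>m=1..N. cis (2 * pi * real m * of_int d / real N)) = w * (\<Sum>m<N. w ^ m)" .
  show ?thesis
  proof (cases "w = 1")
    case True
    thus ?thesis using eq w1 by simp
  next
    case False
    hence "(\<Sum>m<N. w ^ m) = 0" using geometric_sum[OF False, of N] wN by simp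
    thus ?thesis using eq w1 False by simp
  qed
qed

section \<open>Conjugation, period and parity\<close>

context degree_one
begin

text \<open>Conjugating all data changes the sign of \<theta> and reflects \<alpha> to - \<alpha> in
  the exponential series, so the boundary behaviour at - \<alpha> follows from that at
  \<alpha>.\<close>

lemma degree_one_cnj: "degree_one (\<lambda>n. cnj (a n)) (\<lambda>s. cnj (F (cnj s))) Q r lam (\<lambda>j. cnj (mu j)) (cnj om)"
proof
  show "cnj (a 0) = 0" by (simp add: a0)
  show "summable (\<lambda>n. cmod (cnj (a n)) * real n powr (- 3 / 2))" using a_summable by simp
  show "cnj (F (cnj (Complex (3/2) t))) = (\<Sum>n. cnj (a n) * of_nat n powr (- Complex (3/2) t))" for t
  proof -
    have "(\<lambda>n. cnj (a n * of_nat n powr (- Complex (3/2) (-t)))) sums cnj (F (Complex (3/2) (-t)))"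
      unfolding F_series by (subst sums_cnj) (rule summable_sums[OF summable_norm_cancel[OF F_summable]])
    also have "(\<lambda>n. cnj (a n * of_nat n powr (- Complex (3/2) (-t)))) = (\<lambda>n. cnj (a n) * of_nat n powr (- Complex (3/2) t))"
    proof
      fix n :: nat
      have "cnj (- Complex (3/2) (-t)) = - Complex (3/2) t" by (simp add: complex_eq_iff)
      hence "cnj (of_nat n powr (- Complex (3/2) (-t))) = of_nat n powr (- Complex (3/2) t)"
        by (cases "n = 0") (simp_all add: powr_def exp_cnj Ln_of_nat)
      thus "cnj (a n * of_nat n powr (- Complex (3/2) (-t))) = cnj (a n) * of_nat n powr (- Complex (3/2) t)" by simp
    qed
    finally show ?thesis by (simp add: sums_iff complex_cnj)
  qed
  have "cnj \<circ> F \<circ> cnj holomorphic_on - {1}"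
    by (rule holomorphic_on_compose_cnj_cnj) (use F_hol in \<open>auto elim: holomorphic_on_subset\<close>)
  thus "(\<lambda>s. cnj (F (cnj s))) holomorphic_on - {1}" by (simp add: o_def)
  obtain \<rho> R where R: "\<And>s. norm s \<ge> R \<Longrightarrow> norm (F s) \<le> exp (norm s powr \<rho>)" using F_growth by blast
  show "\<exists>\<rho> R. \<forall>s. R \<le> norm s \<longrightarrow> norm (cnj (F (cnj s))) \<le> exp (norm s powr \<rho>)"
    by (intro exI[of _ \<rho>] exI[of _ R] allI impI) (use R[of "cnj s" for s] in auto)
  obtain T where T: "\<And>t. \<bar>t\<bar> \<ge> T \<Longrightarrow> F (Complex (-1/2) t) = gamma_quotient t * cnj (F (1 - cnj (Complex (-1/2) t)))"
    using fun_eq unfolding gamma_quotient_def by blast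
  show "\<exists>T. \<forall>t. T \<le> \<bar>t\<bar> \<longrightarrow> cnj (F (cnj (Complex (- 1 / 2) t))) =
       cnj om * of_real Q powr (1 - 2 * Complex (- 1 / 2) t) *
       (\<Prod>j = 1..r. Gamma (of_real (lam j) * (1 - Complex (- 1 / 2) t) + cnj (cnj (mu j))) / Gamma (of_real (lam j) * Complex (- 1 / 2) t + cnj (mu j))) *
       cnj (cnj (F (cnj (1 - cnj (Complex (- 1 / 2) t)))))"
  proof (intro exI[of _ T] allI impI)
    fix t :: real assume t: "T \<le> \<bar>t\<bar>"
    define s where "s = Complex (-1/2) t"
    have cs: "Complex (-1/2) (-t) = cnj s" by (simp add: s_def complex_eq_iff)
    have Qc: "cnj (of_real Q powr (1 - 2 * cnj s)) = of_real Q powr (1 - 2 * s)"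
      using Q_pos by (simp add: powr_def exp_cnj Ln_of_real)
    have "F (cnj s) = gamma_quotient (-t) * cnj (F (1 - s))" using T[of "-t", unfolded cs] t by simp
    hence "cnj (F (cnj s)) = cnj (gamma_quotient (-t)) * F (1 - s)" by simp
    also have "cnj (gamma_quotient (-t)) = cnj om * of_real Q powr (1 - 2 * s) *
       (\<Prod>j = 1..r. Gamma (of_real (lam j) * (1 - s) + mu j) / Gamma (of_real (lam j) * s + cnj (mu j)))"
      unfolding gamma_quotient_def cs complex_cnj_mult Qc by (simp add: cnj_Gamma)
    finally show "cnj (F (cnj (Complex (- 1 / 2) t))) =
       cnj om * of_real Q powr (1 - 2 * Complex (- 1 / 2) t) *
       (\<Prod>j = 1..r. Gamma (of_real (lam j) * (1 - Complex (- 1 / 2) t) + cnj (cnj (mu j))) / Gamma (of_real (lam j) * Complex (- 1 / 2) t + cnj (mu j))) *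
       cnj (cnj (F (cnj (1 - cnj (Complex (- 1 / 2) t)))))" by (simp add: s_def)
  qed
qed (use Q_pos lam_pos degree in auto)

text \<open>Conjugation turns exp (- i pi (eta + 1) / 2) in \<open>Stirling_const\<close> into its
  inverse, while \<open>om\<close> and \<open>Lam\<close>, conjugated twice, return unchanged. The
  extra factor in the limit is the ratio of the two exponentials.\<close>

theorem f_boundary_limit_neg:
  assumes al: "\<alpha> > 0"
  shows "((\<lambda>y. of_real y powr (1 - \<i> * of_real \<theta>) * f (Complex y (- \<alpha>))) \<longlongrightarrow>
      limit_const * exp (\<i> * of_real (pi * (\<eta> + 1))) * cnj (coef (q * \<alpha>))) (at_right 0)"
proof -
  interpret C: degree_one "\<lambda>n. cnj (a n)" "\<lambda>s. cnj (F (cnj s))" Q r lam "\<lambda>j. cnj (mu j)" "cnj om"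
    by (rule degree_one_cnj)
  have th: "C.\<theta> = - \<theta>" by (simp add: C.\<theta>_def \<theta>_def sum_negf)
  have et: "C.\<eta> = \<eta>" by (simp add: C.\<eta>_def \<eta>_def)
  have Lc: "cnj C.Lam = Lam"
  proof -
    have "cnj (of_real (lam j) powr (-2 * \<i> * of_real (Im (cnj (mu j))))) = of_real (lam j) powr (-2 * \<i> * of_real (Im (mu j)))" if "j \<in> {1..r}" for j
      using lam_pos[OF that] by (simp add: powr_def exp_cnj Ln_of_real)
    thus ?thesis unfolding C.Lam_def Lam_def cnj_prod by (intro prod.cong) auto
  qed
  have co: "C.coef x = cnj (coef x)" if "x > 0" for x
  proof -
    have "cnj (of_real x powr (\<i> * of_real \<theta>)) = of_real x powr (\<i> * of_real C.\<theta>)"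
      using that by (simp add: th powr_def exp_cnj Ln_of_real)
    thus ?thesis by (simp add: C.coef_def coef_def)
  qed
  have lc: "cnj C.limit_const = limit_const * exp (\<i> * of_real (pi * (\<eta> + 1)))"
  proof -
    have e: "exp (\<i> * of_real (pi * (\<eta> + 1) / 2)) = exp (- \<i> * of_real (pi * (\<eta> + 1) / 2)) * exp (\<i> * of_real (pi * (\<eta> + 1)))"
      by (simp flip: exp_add)
    have g: "cnj (Gamma (1 - \<i> * of_real C.\<theta>)) = Gamma (1 - \<i> * of_real \<theta>)" by (simp add: cnj_Gamma th)
    have p: "cnj (of_real q powr (- (1 - \<i> * of_real C.\<theta>))) = of_real q powr (- (1 - \<i> * of_real \<theta>))"
      using q_pos by (simp add: powr_def exp_cnj Ln_of_real th)
    have "cnj C.Stirling_const = om * of_real (sqrt q) * Lam * exp (\<i> * of_real (pi * (\<eta> + 1) / 2))"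
    proof -
      have ce: "cnj (exp (- \<i> * of_real x)) = exp (\<i> * of_real x)" for x :: real by (simp add: exp_cnj)
      show ?thesis
        unfolding C.Stirling_const_def complex_cnj_mult Lc et ce complex_cnj_cnj complex_cnj_complex_of_real ..
    qed
    also have "\<dots> = Stirling_const * exp (\<i> * of_real (pi * (\<eta> + 1)))"
      unfolding Stirling_const_def e by (rule mult.assoc[symmetric])
    finally have S: "cnj C.Stirling_const = Stirling_const * exp (\<i> * of_real (pi * (\<eta> + 1)))" .
    show ?thesis unfolding C.limit_const_def limit_const_def complex_cnj_mult complex_cnj_divide g p S by simp
  qed
  have ff: "cnj (C.f (Complex y \<alpha>)) = f (Complex y (- \<alpha>))" if "y > 0" for y
  proof -
    have "(\<lambda>n. cnj (a n * exp (- of_real (2 * pi) * of_nat n * Complex y (- \<alpha>)))) sums cnj (f (Complex y (- \<alpha>)))"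
      unfolding f_def by (subst sums_cnj) (rule summable_sums, rule f_eq_Mellin(3), use that in simp)
    moreover have "cnj (a n * exp (- of_real (2 * pi) * of_nat n * Complex y (- \<alpha>))) = cnj (a n) * exp (- of_real (2 * pi) * of_nat n * Complex y \<alpha>)" for n
    proof -
      have "cnj (Complex y (- \<alpha>)) = Complex y \<alpha>" by (simp add: complex_eq_iff)
      thus ?thesis by (simp add: exp_cnj)
    qed
    ultimately have "C.f (Complex y \<alpha>) = cnj (f (Complex y (- \<alpha>)))" unfolding C.f_def by (simp only: sums_iff)
    thus ?thesis by simp
  qed
  have "((\<lambda>y. cnj (of_real y powr (1 - \<i> * of_real C.\<theta>) * C.f (Complex y \<alpha>))) \<longlongrightarrow> cnj (C.limit_const * cnj (C.coef (C.q * \<alpha>)))) (at_right 0)"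
    using C.f_boundary_limit[OF al] by (rule tendsto_cnj)
  also have "cnj (C.limit_const * cnj (C.coef (C.q * \<alpha>))) = limit_const * exp (\<i> * of_real (pi * (\<eta> + 1))) * cnj (coef (q * \<alpha>))"
    using co[of "q * \<alpha>"] q_pos al by (simp add: lc)
  finally show ?thesis
  proof (rule Lim_transform_eventually)
    show "\<forall>\<^sub>F y in at_right 0. cnj (of_real y powr (1 - \<i> * of_real C.\<theta>) * C.f (Complex y \<alpha>)) = of_real y powr (1 - \<i> * of_real \<theta>) * f (Complex y (- \<alpha>))"
      using eventually_at_right_less[of 0]
    proof eventually_elim
      case (elim y)
      have "cnj (of_real y powr (1 - \<i> * of_real C.\<theta>)) = of_real y powr (1 - \<i> * of_real \<theta>)"
        using elim by (simp add: powr_def exp_cnj Ln_of_real th)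
      thus ?case using ff[OF elim] by simp
    qed
  qed
qed

lemma f_add_nat: "f (Complex y (\<alpha> + real k)) = f (Complex y \<alpha>)"
proof (induction k)
  case (Suc k)
  have "exp (- of_real (2 * pi) * of_nat n * Complex y (x + 1)) = exp (- of_real (2 * pi) * of_nat n * Complex y x)" for n x
  proof -
    have "- of_real (2 * pi) * of_nat n * Complex y (x + 1) = - of_real (2 * pi) * of_nat n * Complex y x - of_real (2 * real n * pi) * \<i>"
      by (simp add: complex_eq_iff algebra_simps)
    also have "exp \<dots> = exp (- of_real (2 * pi) * of_nat n * Complex y x) / exp (of_real (2 * real n * pi) * \<i>)"
      by (rule exp_diff)
    also have "exp (of_real (2 * real n * pi) * \<i>) = 1"
      using exp_integer_2pi[of "of_nat n"] by (simp add: mult_ac)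
    finally show ?thesis by simp
  qed
  hence "f (Complex y (\<alpha> + real k + 1)) = f (Complex y (\<alpha> + real k))" unfolding f_def by simp
  thus ?case using Suc.IH by (simp add: add_ac)
qed simp

lemma Stirling_const_nonzero: "om \<noteq> 0 \<Longrightarrow> Stirling_const \<noteq> 0"
  unfolding Stirling_const_def Lam_def using q_pos lam_pos by (force simp: prod_zero_iff)

lemma Gamma_one_minus_nonzero: "Gamma (1 - \<i> * of_real x) \<noteq> 0"
  unfolding Gamma_eq_zero_iff by (auto simp: complex_eq_iff elim!: nonpos_Ints_cases)

lemma limit_const_nonzero: "om \<noteq> 0 \<Longrightarrow> limit_const \<noteq> 0"
  unfolding limit_const_def using Stirling_const_nonzero q_pos by (simp add: Gamma_one_minus_nonzero)

lemma coef_add_q: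
  assumes om: "om \<noteq> 0" and x: "x > 0"
  shows "coef (x + q) = coef x"
proof -
  have "x / q > 0" using x q_pos by simp
  have "limit_const * cnj (coef (q * (x / q + 1))) = limit_const * cnj (coef (q * (x / q)))"
  proof (rule tendsto_unique)
    show "((\<lambda>y. of_real y powr (1 - \<i> * of_real \<theta>) * f (Complex y (x / q))) \<longlongrightarrow> limit_const * cnj (coef (q * (x / q)))) (at_right 0)"
      by (rule f_boundary_limit) fact
    have "((\<lambda>y. of_real y powr (1 - \<i> * of_real \<theta>) * f (Complex y (x / q + real 1))) \<longlongrightarrow> limit_const * cnj (coef (q * (x / q + 1)))) (at_right 0)"
      using f_boundary_limit[of "x / q + 1"] \<open>x / q > 0\<close> by simp
    thus "((\<lambda>y. of_real y powr (1 - \<i> * of_real \<theta>) * f (Complex y (x / q))) \<longlongrightarrow> limit_const * cnj (coef (q * (x / q + 1)))) (at_right 0)"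
      unfolding f_add_nat .
  qed auto
  thus ?thesis using limit_const_nonzero[OF om] q_pos by (simp add: algebra_simps)
qed

text \<open>Compares the limits at - x / q and at k - x / q, between which the periodic function
  \<open>f\<close> does not distinguish; k serves to make the second point positive.\<close>

lemma coef_reflect:
  assumes om: "om \<noteq> 0" and x: "x > 0" "x < real k * q"
  shows "cnj (coef (real k * q - x)) = exp (\<i> * of_real (pi * (\<eta> + 1))) * cnj (coef x)"
proof -
  have "x / q > 0" using x q_pos by simp
  have pos: "real k - x / q > 0" using x q_pos by (simp add: field_simps)
  have "limit_const * cnj (coef (q * (real k - x / q))) = limit_const * exp (\<i> * of_real (pi * (\<eta> + 1))) * cnj (coef (q * (x / q)))"
  proof (rule tendsto_unique)
    show "((\<lambda>y. of_real y powr (1 - \<i> * of_real \<theta>) * f (Complex y (- (x / q)))) \<longlongrightarrow> limit_const * exp (\<i> * of_real (pi * (\<eta> + 1))) * cnj (coef (q * (x / q)))) (at_right 0)"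
      by (rule f_boundary_limit_neg) fact
    have "((\<lambda>y. of_real y powr (1 - \<i> * of_real \<theta>) * f (Complex y (- (x / q) + real k))) \<longlongrightarrow> limit_const * cnj (coef (q * (real k - x / q)))) (at_right 0)"
      using f_boundary_limit[OF pos] by simp
    thus "((\<lambda>y. of_real y powr (1 - \<i> * of_real \<theta>) * f (Complex y (- (x / q)))) \<longlongrightarrow> limit_const * cnj (coef (q * (real k - x / q)))) (at_right 0)"
      unfolding f_add_nat .
  qed auto
  thus ?thesis using limit_const_nonzero[OF om] q_pos by (simp add: algebra_simps)
qed

text \<open>A nonzero value of \<open>coef\<close> at m recurs at m + q, and \<open>coef\<close>
  vanishes outside the natural numbers.\<close>

lemma q_in_Nats:
  assumes om: "om \<noteq> 0" and nz: "a m \<noteq> 0"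
  shows "q \<in> \<nat>"
proof -
  have m: "m > 0" using nz a0 by (cases m) auto
  have "coef (real m) \<noteq> 0" using nz m by (simp add: coef_of_nat)
  hence "coef (real m + q) \<noteq> 0" using coef_add_q[OF om, of "real m"] m by simp
  hence "real m + q \<in> \<nat>" by (auto simp: coef_def split: if_splits)
  then obtain n where n: "real m + q = real n" by (auto simp: Nats_def)
  hence "q = real (n - m)" using q_pos by (simp add: of_nat_diff)
  thus ?thesis by simp
qed

section \<open>The finite Fourier expansion of the coefficients\<close>

definition Fourier_const :: complex where
  "Fourier_const = om * Lam * of_real (q / (2 * pi)) powr (\<i> * of_real \<theta>) * of_real q powr (- 1/2) * exp (- \<i> * of_real (pi * (\<eta> + 1) / 2))"

text \<open>Splits off the constant of \<open>arithmetic_progression_limit\<close>; the other factor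
  is what survives when the two limits are compared. All powers of q and 2 pi are compared through
  their logarithms.\<close>

lemma limit_const_eq:
  "limit_const = Fourier_const * (Gamma (1 - \<i> * of_real \<theta>) * of_real (2 * pi) powr (- (1 - \<i> * of_real \<theta>)))"
proof -
  define lq where "lq = complex_of_real (ln q)"
  define lp where "lp = complex_of_real (ln (2 * pi))"
  have qp: "of_real q powr z = exp (z * lq)" "of_real (q / (2 * pi)) powr z = exp (z * (lq - lp))" "of_real (2 * pi) powr z = exp (z * lp)" for z
    using q_pos Ln_of_real[of q] Ln_of_real[of "q / (2 * pi)"] Ln_of_real[of "2 * pi"]
    by (auto simp: powr_def lq_def lp_def ln_div simp del: of_real_mult of_real_divide)
  have sq: "of_real (sqrt q) = exp (1/2 * lq)"
  proof -
    have "sqrt q = exp (1/2 * ln q)" using q_pos by (simp add: ln_sqrt[symmetric])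
    thus ?thesis by (simp add: lq_def flip: exp_of_real)
  qed
  have p2: "of_real (2 * pi) = exp lp" unfolding lp_def exp_of_real by simp
  have "exp (1/2 * lq) * exp (- (1 - \<i> * of_real \<theta>) * lq) / exp lp =
      exp (\<i> * of_real \<theta> * (lq - lp)) * exp (- 1/2 * lq) * exp (- (1 - \<i> * of_real \<theta>) * lp)"
    unfolding exp_add[symmetric] exp_diff[symmetric] by (intro arg_cong[of _ _ exp]) (simp add: algebra_simps)
  moreover have "v * A * L * X * g * B / P = v * L * C * D * X * (g * E)" if "A * B / P = C * D * E" for v L X g A B C D E P :: complex
  proof -
    have "v * A * L * X * g * B / P = v * L * X * g * (A * B / P)" by simp
    thus ?thesis unfolding that by simp
  qed
  ultimately show ?thesis
    unfolding limit_const_def Stirling_const_def Fourier_const_def qp sq unfolding p2 by blast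
qed

lemma coef_add_mult_q:
  assumes om: "om \<noteq> 0" and x: "x > 0"
  shows "coef (x + real j * q) = coef x"
proof (induction j)
  case (Suc j)
  have "coef (x + real j * q + q) = coef (x + real j * q)"
    by (rule coef_add_q[OF om]) (use x q_pos in \<open>auto intro: add_pos_nonneg\<close>)
  thus ?case using Suc.IH by (simp add: algebra_simps)
qed simp

text \<open>Orthogonality leaves the terms n = k + N j, from which periodicity takes out the factor
  \<open>coef (real k)\<close>. Multiplied by y^u, one side tends to the values given by
  \<open>f_boundary_limit\<close> at m / N, the other to the limit over the arithmetic progression.
  The range 1 \<le> k \<le> N makes k the least positive member of its class.\<close>

lemma coef_Fourier_aux:
  assumes om: "om \<noteq> 0" and N: "q = real N" and k: "k \<ge> 1" "k \<le> N"
  shows "coef (real k) = Fourier_const * (\<Sum>m=1..N. cnj (coef (real m)) * cis (2 * pi * real m * real k / real N))"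
proof -
  define u where "u = 1 - \<i> * of_real \<theta>"
  have N0: "N > 0" using N q_pos by simp
  define e where "e = (\<lambda>y n. a n * exp (- of_real (2 * pi * real n * y)))"
  have coef_n: "a n = coef (real k) * of_nat n powr (u - 1)" if "n = k + N * j" for n j
  proof -
    have n: "n > 0" using that k by simp
    have "coef (real n) = coef (real k)" using coef_add_mult_q[OF om, of "real k" j] k that N by (simp add: mult.commute)
    hence "coef (real k) * of_nat n powr (u - 1) = a n * (of_nat n powr (\<i> * of_real \<theta>) * of_nat n powr (u - 1))"
      unfolding coef_of_nat by simp
    also have "of_nat n powr (\<i> * of_real \<theta>) * of_nat n powr (u - 1) = (1 :: complex)"
      using n by (simp add: u_def flip: powr_add)
    finally show ?thesis by simp
  qed
  have eq: "(\<Sum>m=1..N. cis (2 * pi * real m * real k / real N) * f (Complex y (real m / real N))) =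
      of_nat N * coef (real k) * exp (- of_real (2 * pi * real k * y)) * (\<Sum>j. of_nat (k + N * j) powr (u - 1) * exp (- of_real (2 * pi * real N * y * real j)))"
    if y: "y > 0" for y
  proof -
    have trm: "cis (2 * pi * real m * real k / real N) * (a n * exp (- of_real (2 * pi) * of_nat n * Complex y (real m / real N))) =
       e y n * cis (2 * pi * real m * of_int (int k - int n) / real N)" for m n
    proof -
      have "exp (- of_real (2 * pi) * of_nat n * Complex y (real m / real N)) = exp (- of_real (2 * pi * real n * y)) * cis (- 2 * pi * real n * (real m / real N))"
        by (simp add: cis_conv_exp complex_eq_iff flip: exp_add) (simp add: Complex_eq exp_add algebra_simps cis_conv_exp)
      moreover have "cis (2 * pi * real m * real k / real N) * cis (- 2 * pi * real n * (real m / real N)) = cis (2 * pi * real m * of_int (int k - int n) / real N)"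
        by (simp add: cis_mult) (simp add: algebra_simps diff_divide_distrib)
      moreover have "A * (B * (C * D)) = (B * C) * E" if "A * D = E" for A B C D E :: complex
        unfolding that[symmetric] by (simp add: mult_ac)
      ultimately show ?thesis unfolding e_def by simp
    qed
    have "(\<lambda>n. \<Sum>m=1..N. cis (2 * pi * real m * real k / real N) * (a n * exp (- of_real (2 * pi) * of_nat n * Complex y (real m / real N)))) sums
       (\<Sum>m=1..N. cis (2 * pi * real m * real k / real N) * f (Complex y (real m / real N)))"
      unfolding f_def by (intro sums_sum sums_mult summable_sums f_eq_Mellin(3)) (use y in auto)
    also have "(\<lambda>n. \<Sum>m=1..N. cis (2 * pi * real m * real k / real N) * (a n * exp (- of_real (2 * pi) * of_nat n * Complex y (real m / real N)))) =
       (\<lambda>n. e y n * (if int N dvd int k - int n then of_nat N else 0))"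
      unfolding trm sum_distrib_left[symmetric] sum_cis_multiples[OF N0] ..
    finally have S: "(\<lambda>n. e y n * (if int N dvd int k - int n then of_nat N else 0)) sums (\<Sum>m=1..N. cis (2 * pi * real m * real k / real N) * f (Complex y (real m / real N)))" .
    have "(\<lambda>j. e y (k + N * j) * (if int N dvd int k - int (k + N * j) then of_nat N else 0)) sums (\<Sum>m=1..N. cis (2 * pi * real m * real k / real N) * f (Complex y (real m / real N)))"
    proof (subst sums_mono_reindex[of "\<lambda>j. k + N * j" "\<lambda>n. e y n * (if int N dvd int k - int n then of_nat N else 0)"])
      show "strict_mono (\<lambda>j. k + N * j)" using N0 by (auto simp: strict_mono_def)
      show "e y n * (if int N dvd int k - int n then of_nat N else 0) = 0" if n: "n \<notin> range (\<lambda>j. k + N * j)" for n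
      \<comment> \<open>For k = N the index 0 belongs to the class of k without being of the form k
        + N j; there the term vanishes because of \<open>a 0 = 0\<close>.\<close>
      proof (cases "n = 0")
        case False
        have "\<not> int N dvd int k - int n"
        proof
          assume "int N dvd int k - int n"
          then obtain c where c: "int k - int n = int N * c" by auto
          have "c \<le> 0"
          proof (rule ccontr)
            assume "\<not> c \<le> 0"
            hence "int N * 1 \<le> int N * c" by (intro mult_left_mono) auto
            thus False using c k False by linarith
          qed
          hence "int n = int (k + N * nat (- c))" using c by simp
          hence "n = k + N * nat (- c)" by (simp only: of_nat_eq_iff)
          thus False using n by blast
        qed
        thus ?thesis by simp
      qed (simp add: e_def a0)
    qed (rule S)
    hence "(\<lambda>j. e y (k + N * j) * of_nat N) sums (\<Sum>m=1..N. cis (2 * pi * real m * real k / real N) * f (Complex y (real m / real N)))" by simp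
    moreover have "e y (k + N * j) * of_nat N = (of_nat N * coef (real k) * exp (- of_real (2 * pi * real k * y))) * (of_nat (k + N * j) powr (u - 1) * exp (- of_real (2 * pi * real N * y * real j)))" for j
    proof -
      have "exp (- complex_of_real (2 * pi * real (k + N * j) * y)) = exp (- of_real (2 * pi * real k * y)) * exp (- of_real (2 * pi * real N * y * real j))"
        by (simp add: algebra_simps flip: exp_add)
      thus ?thesis unfolding e_def coef_n[OF refl, of j] by simp
    qed
    ultimately have "(\<Sum>m=1..N. cis (2 * pi * real m * real k / real N) * f (Complex y (real m / real N))) =
      (\<Sum>j. (of_nat N * coef (real k) * exp (- of_real (2 * pi * real k * y))) * (of_nat (k + N * j) powr (u - 1) * exp (- of_real (2 * pi * real N * y * real j))))"
      by (simp add: sums_iff)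
    also have "\<dots> = (of_nat N * coef (real k) * exp (- of_real (2 * pi * real k * y))) * (\<Sum>j. of_nat (k + N * j) powr (u - 1) * exp (- of_real (2 * pi * real N * y * real j)))"
    proof (rule suminf_mult, rule summable_norm_cancel)
      have "summable (\<lambda>j. exp (- (2 * pi * real N * y)) ^ j)" using y N0 by (intro summable_geometric) auto
      moreover have "norm (of_nat (k + N * j) powr (u - 1) * exp (- of_real (2 * pi * real N * y * real j)) :: complex) = exp (- (2 * pi * real N * y)) ^ j" for j
      proof -
        have "norm (of_nat n powr (u - 1) :: complex) = 1" if "n > 0" for n
          using that by (simp add: norm_powr_real_powr u_def)
        from this[of "k + N * j"] k have "norm (of_nat (k + N * j) powr (u - 1) :: complex) = 1" by simp
        moreover have "norm (exp (- of_real (2 * pi * real N * y * real j)) :: complex) = exp (- (2 * pi * real N * y)) ^ j"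
          by (simp add: mult_ac flip: exp_of_nat_mult)
        ultimately show ?thesis unfolding norm_mult by simp
      qed
      ultimately show "summable (\<lambda>j. norm (of_nat (k + N * j) powr (u - 1) * exp (- of_real (2 * pi * real N * y * real j)) :: complex))" by simp
    qed
    finally show ?thesis .
  qed
  have lim1: "((\<lambda>y. \<Sum>m=1..N. cis (2 * pi * real m * real k / real N) * (of_real y powr u * f (Complex y (real m / real N)))) \<longlongrightarrow>
     (\<Sum>m=1..N. cis (2 * pi * real m * real k / real N) * (limit_const * cnj (coef (q * (real m / real N)))))) (at_right 0)"
    unfolding u_def by (intro tendsto_sum tendsto_mult tendsto_const f_boundary_limit) (use N0 in auto)
  have ex: "((\<lambda>y::real. exp (- complex_of_real (2 * pi * real k * y))) \<longlongrightarrow> exp (- of_real (2 * pi * real k * 0))) (at_right 0)"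
    by (intro tendsto_intros tendsto_ident_at)
  have "((\<lambda>y. of_nat N * coef (real k) * exp (- of_real (2 * pi * real k * y)) *
      (of_real y powr u * (\<Sum>j. of_nat (k + N * j) powr (u - 1) * exp (- of_real (2 * pi * real N * y * real j))))) \<longlongrightarrow>
      of_nat N * coef (real k) * exp (- of_real (2 * pi * real k * 0)) * (Gamma u * of_real (2 * pi) powr (- u) / of_nat N)) (at_right 0)"
    unfolding u_def by (intro tendsto_mult tendsto_const ex arithmetic_progression_limit) (use k N0 in auto)
  hence lim2: "((\<lambda>y. of_nat N * coef (real k) * exp (- of_real (2 * pi * real k * y)) *
      (of_real y powr u * (\<Sum>j. of_nat (k + N * j) powr (u - 1) * exp (- of_real (2 * pi * real N * y * real j))))) \<longlongrightarrow>
      coef (real k) * (Gamma u * of_real (2 * pi) powr (- u))) (at_right 0)" using N0 by simp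
  have "(\<Sum>m=1..N. cis (2 * pi * real m * real k / real N) * (limit_const * cnj (coef (q * (real m / real N))))) = coef (real k) * (Gamma u * of_real (2 * pi) powr (- u))"
  proof (rule tendsto_unique[OF _ lim1])
    show "((\<lambda>y. \<Sum>m=1..N. cis (2 * pi * real m * real k / real N) * (of_real y powr u * f (Complex y (real m / real N)))) \<longlongrightarrow> coef (real k) * (Gamma u * of_real (2 * pi) powr (- u))) (at_right 0)"
      using lim2
    proof (rule Lim_transform_eventually)
      show "\<forall>\<^sub>F y in at_right 0. of_nat N * coef (real k) * exp (- of_real (2 * pi * real k * y)) *
      (of_real y powr u * (\<Sum>j. of_nat (k + N * j) powr (u - 1) * exp (- of_real (2 * pi * real N * y * real j)))) =
       (\<Sum>m=1..N. cis (2 * pi * real m * real k / real N) * (of_real y powr u * f (Complex y (real m / real N))))"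
        using eventually_at_right_less[of 0]
      proof eventually_elim
        case (elim y)
        have "(\<Sum>m=1..N. cis (2 * pi * real m * real k / real N) * (of_real y powr u * f (Complex y (real m / real N)))) =
          of_real y powr u * (\<Sum>m=1..N. cis (2 * pi * real m * real k / real N) * f (Complex y (real m / real N)))"
          unfolding sum_distrib_left by (intro sum.cong) (auto simp: mult_ac)
        thus ?case unfolding eq[OF elim] by (simp add: mult_ac)
      qed
    qed
  qed auto
  also have "(\<Sum>m=1..N. cis (2 * pi * real m * real k / real N) * (limit_const * cnj (coef (q * (real m / real N))))) =
      Fourier_const * (\<Sum>m=1..N. cnj (coef (real m)) * cis (2 * pi * real m * real k / real N)) * (Gamma u * of_real (2 * pi) powr (- u))"
    unfolding limit_const_eq u_def[symmetric] sum_distrib_left sum_distrib_right using N N0 by (intro sum.cong) (auto simp: mult_ac)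
  finally show ?thesis
  proof -
    assume *: "Fourier_const * (\<Sum>m=1..N. cnj (coef (real m)) * cis (2 * pi * real m * real k / real N)) * (Gamma u * of_real (2 * pi) powr (- u)) = coef (real k) * (Gamma u * of_real (2 * pi) powr (- u))"
    have "Gamma u * of_real (2 * pi) powr (- u) \<noteq> 0"
      by (simp add: u_def Gamma_one_minus_nonzero)
    thus ?thesis using * by (simp only: mult_cancel_right) simp
  qed
qed

theorem coef_Fourier:
  assumes om: "om \<noteq> 0" and N: "q = real N" and n: "n \<ge> 1"
  shows "coef (real n) = Fourier_const * (\<Sum>m=1..N. cnj (coef (real m)) * cis (2 * pi * real m * real n / real N))"
proof -
  have N0: "N > 0" using N q_pos by simp
  define k where "k = (n - 1) mod N + 1"
  define j where "j = (n - 1) div N"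
  have k: "k \<ge> 1" "k \<le> N" using N0 by (auto simp: k_def Suc_le_eq)
  have nk: "n = k + N * j" using n unfolding k_def j_def by simp
  have "coef (real n) = coef (real k)" using coef_add_mult_q[OF om, of "real k" j] k nk N by (simp add: mult.commute)
  moreover have "cis (2 * pi * real m * real n / real N) = cis (2 * pi * real m * real k / real N)" for m
  proof -
    have "2 * pi * real m * real n / real N = 2 * pi * real m * real k / real N + 2 * pi * real (m * j)"
      using N0 by (simp add: nk field_simps)
    moreover have "cis (2 * pi * real (m * j)) = 1" by (rule cis_multiple_2pi) simp
    ultimately show ?thesis by (simp only: cis_mult[symmetric]) simp
  qed
  ultimately show ?thesis using coef_Fourier_aux[OF om N k] by simp
qed

end

section \<open>Periodic and Hurwitz zeta functions\<close>

text \<open>The product Gamma z Gamma (1 - z) sin (pi z) is constant, so its derivative expresses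
  the cotangent by Digamma z - Digamma (1 - z). The series of Digamma then gives the partial
  fractions, paired in such a way that no symmetric summation is needed.\<close>

lemma cot_partial_fractions:
  fixes z :: complex
  assumes z: "z \<notin> \<int>"
  shows "(\<lambda>k. 1 / (z + of_nat k) - 1 / (1 - z + of_nat k)) sums (of_real pi * cos (of_real pi * z) / sin (of_real pi * z))"
proof -
  have z1: "1 - z \<notin> \<int>" using z Ints_diff[of 1 "1 - z"] by auto
  have zn: "z \<notin> \<int>\<^sub>\<le>\<^sub>0" "1 - z \<notin> \<int>\<^sub>\<le>\<^sub>0" using z z1 nonpos_Ints_Int by auto
  have s0: "sin (of_real pi * w) \<noteq> 0" if "w \<notin> \<int>" for w :: complex
  proof
    assume "sin (of_real pi * w) = 0"
    then obtain n :: int where "of_real pi * w = of_real (of_int n * pi)" by (auto simp: sin_eq_0)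
    hence "w = of_int n" by simp
    thus False using that by simp
  qed
  define G where "G = (\<lambda>w::complex. Gamma w * Gamma (1 - w) * sin (of_real pi * w))"
  have "(G has_field_derivative (Gamma z * Digamma z * Gamma (1 - z) - Gamma z * (Gamma (1 - z) * Digamma (1 - z))) * sin (of_real pi * z)
     + Gamma z * Gamma (1 - z) * (of_real pi * cos (of_real pi * z))) (at z)"
    unfolding G_def using zn by (auto intro!: derivative_eq_intros simp: algebra_simps)
  moreover have "(G has_field_derivative 0) (at z)"
  proof (rule has_field_derivative_transform_within_open[of "\<lambda>_. of_real pi"])
    show "open (- \<int> :: complex set)" using closed_Ints by (simp add: open_Compl)
    show "of_real pi = G w" if "w \<in> - \<int>" for w
      using Gamma_reflection_complex[of w] s0[of w] that by (simp add: G_def)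
  qed (use z in auto)
  ultimately have "(Gamma z * Digamma z * Gamma (1 - z) - Gamma z * (Gamma (1 - z) * Digamma (1 - z))) * sin (of_real pi * z)
     + Gamma z * Gamma (1 - z) * (of_real pi * cos (of_real pi * z)) = 0" by (rule DERIV_unique)
  hence "(Gamma z * Gamma (1 - z)) * ((Digamma z - Digamma (1 - z)) * sin (of_real pi * z) + of_real pi * cos (of_real pi * z)) = 0"
    by (simp add: algebra_simps)
  moreover have "Gamma z * Gamma (1 - z) \<noteq> 0" using zn by (simp add: Gamma_eq_zero_iff)
  ultimately have "(Digamma z - Digamma (1 - z)) * sin (of_real pi * z) + of_real pi * cos (of_real pi * z) = 0"
    by (simp only: mult_eq_0_iff) blast
  hence "(Digamma (1 - z) - Digamma z) * sin (of_real pi * z) = of_real pi * cos (of_real pi * z)"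
    by (simp add: algebra_simps add_eq_0_iff)
  hence D: "Digamma (1 - z) - Digamma z = of_real pi * cos (of_real pi * z) / sin (of_real pi * z)"
    using s0[OF z] by (simp add: field_simps)
  have z0: "z \<noteq> 0" "1 - z \<noteq> 0" using z z1 by auto
  have sums: "(\<lambda>k. inverse (of_nat (Suc k)) - inverse (w + of_nat k)) sums (Digamma w + euler_mascheroni)" if "w \<noteq> 0" for w :: complex
    using summable_sums[OF summable_Digamma[OF that]] by (simp add: Digamma_def)
  have "(\<lambda>k. (inverse (of_nat (Suc k)) - inverse (1 - z + of_nat k)) - (inverse (of_nat (Suc k)) - inverse (z + of_nat k))) sums
     ((Digamma (1 - z) + euler_mascheroni) - (Digamma z + euler_mascheroni))"
    by (intro sums_diff sums z0)
  thus ?thesis by (simp add: D inverse_eq_divide)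
qed

text \<open>The contribution of a single pole to the partial fractions below, after y has been
  scaled by the modulus of the pole and the linear factors have been taken out.\<close>

definition pole_kernel :: "real \<Rightarrow> complex" where
  "pole_kernel v = 1 / (1 + \<i> * of_real v)"

lemma norm_one_plus_ii: "norm (1 + \<i> * of_real v) \<ge> 1" "norm (1 + \<i> * of_real v) \<ge> \<bar>v\<bar>"
  using abs_Re_le_cmod[of "1 + \<i> * of_real v"] abs_Im_le_cmod[of "1 + \<i> * of_real v"] by auto

text \<open>\<open>g y\<close> is \<i> / (2 pi) times the partial fraction series of the cotangent
  at x + \<i> y / (2 pi), minus 1/2. Subtracting the value at y = 0 makes the terms decay like
  k^(-2) and vanish linearly in y, which permits termwise Mellin transforms in the strip -1 < Re s <
  0.\<close>

lemma exp_geometric_partial_fractions: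
  fixes x y :: real
  assumes x: "0 < x" "x < 1"
  defines "g \<equiv> \<lambda>y. 1 / (exp (of_real y - 2 * pi * \<i> * of_real x) - 1)"
  shows "(\<lambda>k. of_real y / of_real ((2 * pi * (real k + x))\<^sup>2) * pole_kernel (y / (2 * pi * (real k + x))) +
              of_real y / of_real ((2 * pi * (real k + (1 - x)))\<^sup>2) * pole_kernel (- y / (2 * pi * (real k + (1 - x)))))
         sums (g y - g 0)"
proof -
  have nI: "of_real x + \<i> * of_real t \<notin> \<int>" for t
  proof
    assume "of_real x + \<i> * of_real t \<in> \<int>"
    then obtain n where "of_real x + \<i> * of_real t = of_int n" by (auto elim: Ints_cases)
    hence "x = of_int n" by (simp add: complex_eq_iff)
    thus False using x by simp
  qed
  define c where "c = (\<lambda>z::complex. of_real pi * cos (of_real pi * z) / sin (of_real pi * z))"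
  have g_cot: "g y = \<i> / (2 * pi) * c (of_real x + \<i> * of_real (y / (2 * pi))) - 1/2" for y
  proof -
    define \<zeta> where "\<zeta> = of_real x + \<i> * of_real (y / (2 * pi))"
    define p where "p = exp (\<i> * (of_real pi * \<zeta>))"
    have p0: "p \<noteq> 0" by (simp add: p_def)
    have E: "exp (of_real y - 2 * pi * \<i> * of_real x) = 1 / p\<^sup>2"
    proof -
      have "of_real y - 2 * pi * \<i> * of_real x = - (2 * (\<i> * (of_real pi * \<zeta>)))"
        by (simp add: \<zeta>_def complex_eq_iff)
      thus ?thesis by (simp add: p_def exp_minus inverse_eq_divide exp_double)
    qed
    have "sin (of_real pi * \<zeta>) \<noteq> 0"
    proof
      assume "sin (of_real pi * \<zeta>) = 0"
      then obtain n :: int where "of_real pi * \<zeta> = of_real (of_int n * pi)" by (auto simp: sin_eq_0)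
      hence "\<zeta> = of_int n" by simp
      thus False using nI[of "y / (2 * pi)"] by (simp add: \<zeta>_def)
    qed
    moreover have sc: "sin (of_real pi * \<zeta>) = (p - 1 / p) / (2 * \<i>)" "cos (of_real pi * \<zeta>) = (p + 1 / p) / 2"
      by (simp_all add: sin_exp_eq cos_exp_eq p_def exp_minus inverse_eq_divide)
    ultimately have p1: "p\<^sup>2 - 1 \<noteq> 0" using p0 by (auto simp: field_simps power2_eq_square)
    have "c \<zeta> = of_real pi * \<i> * (p\<^sup>2 + 1) / (p\<^sup>2 - 1)"
      unfolding c_def sc using p0 p1 by (simp add: field_simps power2_eq_square)
    moreover have "\<i> / (2 * pi) * (of_real pi * \<i> * A / B) = - A / (2 * B)" for A B :: complex
      by (cases "B = 0") (simp_all add: field_simps)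
    ultimately have "\<i> / (2 * pi) * c \<zeta> - 1/2 = - (p\<^sup>2 + 1) / (2 * (p\<^sup>2 - 1)) - 1/2" by simp
    also have "\<dots> = p\<^sup>2 / (1 - p\<^sup>2)" using p1 by (simp add: field_simps)
    also have "\<dots> = 1 / (1 / p\<^sup>2 - 1)" using p0 p1 by (simp add: field_simps)
    finally show ?thesis unfolding g_def E \<zeta>_def[symmetric] ..
  qed
  define \<zeta> where "\<zeta> = of_real x + \<i> * of_real (y / (2 * pi))"
  have "(\<lambda>k. \<i> / (2 * pi) * ((1 / (\<zeta> + of_nat k) - 1 / (1 - \<zeta> + of_nat k)) - (1 / (of_real x + of_nat k) - 1 / (1 - of_real x + of_nat k)))) sums
     (\<i> / (2 * pi) * (c \<zeta> - c (of_real x)))"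
    unfolding c_def using nI[of "y / (2 * pi)"] nI[of 0]
    by (intro sums_mult sums_diff cot_partial_fractions) (simp_all add: \<zeta>_def)
  also have "\<i> / (2 * pi) * (c \<zeta> - c (of_real x)) = g y - g 0"
    unfolding g_cot \<zeta>_def by (simp add: algebra_simps)
  also have "(\<lambda>k. \<i> / (2 * pi) * ((1 / (\<zeta> + of_nat k) - 1 / (1 - \<zeta> + of_nat k)) - (1 / (of_real x + of_nat k) - 1 / (1 - of_real x + of_nat k)))) =
     (\<lambda>k. of_real y / of_real ((2 * pi * (real k + x))\<^sup>2) * pole_kernel (y / (2 * pi * (real k + x))) +
              of_real y / of_real ((2 * pi * (real k + (1 - x)))\<^sup>2) * pole_kernel (- y / (2 * pi * (real k + (1 - x)))))"
  proof
    fix k :: nat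
    have gen: "\<i> / (2 * pi) * (1 / (of_real b + \<i> * of_real (t / (2 * pi))) - 1 / of_real b) = of_real t / of_real ((2 * pi * b)\<^sup>2) * pole_kernel (t / (2 * pi * b))"
      if b: "b > 0" for b t :: real
    proof -
      define v where "v = t / (2 * pi * b)"
      define e where "e = 1 + \<i> * complex_of_real v"
      have t: "t = v * (2 * pi * b)" using b by (simp add: v_def)
      have e0: "e \<noteq> 0" by (simp add: complex_eq_iff e_def)
      have "t / (2 * pi) = v * b" by (simp add: t)
      hence "of_real b + \<i> * of_real (t / (2 * pi)) = of_real b * e"
        by (simp add: e_def algebra_simps)
      hence "\<i> / (2 * pi) * (1 / (of_real b + \<i> * of_real (t / (2 * pi))) - 1 / of_real b) = \<i> / (2 * pi) * ((1 - e) / (of_real b * e))"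
        using b e0 by (simp add: field_simps)
      also have "1 - e = - \<i> * of_real v" by (simp add: e_def)
      also have "\<i> / (2 * pi) * (- \<i> * of_real v / (of_real b * e)) = of_real (v / (2 * pi * b)) * (1 / e)"
        by simp
      also have "v / (2 * pi * b) = t / (2 * pi * b)\<^sup>2" using b unfolding t by (simp add: power2_eq_square)
      also have "complex_of_real (t / (2 * pi * b)\<^sup>2) = of_real t / of_real ((2 * pi * b)\<^sup>2)" by (rule of_real_divide)
      also have "1 / e = pole_kernel (t / (2 * pi * b))" by (simp only: pole_kernel_def e_def v_def)
      finally show ?thesis .
    qed
    have "\<zeta> + of_nat k = of_real (real k + x) + \<i> * of_real (y / (2 * pi))" "1 - \<zeta> + of_nat k = of_real (real k + (1 - x)) + \<i> * of_real (- y / (2 * pi))"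
      "of_real x + of_nat k = complex_of_real (real k + x)" "1 - of_real x + of_nat k = complex_of_real (real k + (1 - x))"
      by (simp_all add: \<zeta>_def)
    hence "\<i> / (2 * pi) * ((1 / (\<zeta> + of_nat k) - 1 / (1 - \<zeta> + of_nat k)) - (1 / (of_real x + of_nat k) - 1 / (1 - of_real x + of_nat k))) =
      \<i> / (2 * pi) * (1 / (of_real (real k + x) + \<i> * of_real (y / (2 * pi))) - 1 / of_real (real k + x)) -
      \<i> / (2 * pi) * (1 / (of_real (real k + (1 - x)) + \<i> * of_real (- y / (2 * pi))) - 1 / of_real (real k + (1 - x)))"
      by (simp only: right_diff_distrib) (simp only: algebra_simps)
    also have "\<dots> = of_real y / of_real ((2 * pi * (real k + x))\<^sup>2) * pole_kernel (y / (2 * pi * (real k + x))) -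
       of_real (- y) / of_real ((2 * pi * (real k + (1 - x)))\<^sup>2) * pole_kernel (- y / (2 * pi * (real k + (1 - x))))"
      by (subst (1 2) gen) (use x in auto)
    finally show "\<i> / (2 * pi) * ((1 / (\<zeta> + of_nat k) - 1 / (1 - \<zeta> + of_nat k)) - (1 / (of_real x + of_nat k) - 1 / (1 - of_real x + of_nat k))) =
       of_real y / of_real ((2 * pi * (real k + x))\<^sup>2) * pole_kernel (y / (2 * pi * (real k + x))) +
              of_real y / of_real ((2 * pi * (real k + (1 - x)))\<^sup>2) * pole_kernel (- y / (2 * pi * (real k + (1 - x))))" by simp
  qed
  finally show ?thesis .
qed

section \<open>The Mellin transform of a single pole\<close>

lemma Laplace_powr_real:
  fixes p v :: real
  assumes p: "p > 0" and v: "v > 0"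
  shows "(LINT y:{0<..}|lborel. y powr (p - 1) * exp (- v * y)) = Gamma p * v powr (- p)"
proof -
  have "complex_of_real (LINT y:{0<..}|lborel. y powr (p - 1) * exp (- v * y)) = (LINT y:{0<..}|lborel. complex_of_real (y powr (p - 1) * exp (- v * y)))"
    by (rule set_integral_complex_of_real[symmetric])
  also have "\<dots> = (LINT y:{0<..}|lborel. of_real y powr (of_real p - 1) * exp (- of_real v * of_real y))"
    by (rule set_lebesgue_integral_cong) (auto simp: powr_of_real[symmetric] exp_of_real[symmetric])
  also have "\<dots> = Gamma (of_real p) * of_real v powr (- of_real p)"
    by (rule Laplace_powr) (use p v in auto)
  also have "\<dots> = of_real (Gamma p * v powr (- p))"
    using v powr_of_real[of v "-p"] by (simp add: Gamma_complex_of_real)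
  finally show ?thesis by (simp only: of_real_eq_iff)
qed

text \<open>1 / (y + c) is the integral of exp (- (y + c) v) over v > 0. Exchanging the integrals by
  Fubini leaves two integrals of the type of \<open>Laplace_powr\<close>.\<close>

lemma beta_integral_pole_right:
  fixes u c :: complex
  assumes u: "0 < Re u" "Re u < 1" and c: "Re c > 0"
  shows "(LINT y:{0<..}|lborel. of_real y powr (u - 1) / (of_real y + c)) = Gamma u * Gamma (1 - u) * c powr (u - 1)"
proof -
  define P where "P = (\<lambda>y. indicat_real {0<..} y *\<^sub>R complex_of_real y powr (u - 1))"
  define f where "f = (\<lambda>v y. indicat_real {0<..} v *\<^sub>R (P y * exp (- (of_real y + c) * of_real v)))"
  have P: "P \<in> borel_measurable borel"
    unfolding P_def by (rule borel_measurable_continuous_on_indicator) (auto intro!: continuous_intros)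
  have meas: "case_prod f \<in> borel_measurable (lborel \<Otimes>\<^sub>M lborel)"
  proof -
    have "(\<lambda>z::real\<times>real. P (snd z)) \<in> borel_measurable borel"
    proof -
      have "(\<lambda>z::real\<times>real. P (snd z)) \<in> borel_measurable (borel \<Otimes>\<^sub>M borel)"
        by (rule measurable_compose[OF measurable_snd P])
      thus ?thesis by (simp only: borel_prod)
    qed
    moreover have "(\<lambda>z::real\<times>real. exp (- (of_real (snd z) + c) * of_real (fst z))) \<in> borel_measurable borel"
      by (intro borel_measurable_continuous_onI continuous_intros)
    moreover have "(\<lambda>z::real\<times>real. indicat_real {0<..} (fst z)) \<in> borel_measurable borel"
    proof -
      have "(\<lambda>z::real\<times>real. indicat_real {0<..} (fst z)) \<in> borel_measurable (borel \<Otimes>\<^sub>M borel)"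
        by (rule measurable_compose[OF measurable_fst]) auto
      thus ?thesis by (simp only: borel_prod)
    qed
    ultimately have "(\<lambda>z. indicat_real {0<..} (fst z) *\<^sub>R (P (snd z) * exp (- (of_real (snd z) + c) * of_real (fst z)))) \<in> borel_measurable borel"
      by (intro borel_measurable_scaleR borel_measurable_times)
    moreover have "case_prod f = (\<lambda>z. indicat_real {0<..} (fst z) *\<^sub>R (P (snd z) * exp (- (of_real (snd z) + c) * of_real (fst z))))"
      by (simp add: f_def fun_eq_iff)
    ultimately have "case_prod f \<in> borel_measurable borel" by simp
    thus ?thesis by (simp add: lborel_prod)
  qed
  have ce: "exp (- (of_real y + c) * of_real v) = exp (- of_real v * of_real y) * exp (- c * of_real v)" for y v :: real
    by (simp add: algebra_simps flip: exp_add)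
  have fn: "norm (f v y) = indicat_real {0<..} y *\<^sub>R (y powr (Re u - 1) * exp (- v * y)) * (indicat_real {0<..} v * exp (- Re c * v))" for v y
    unfolding f_def ce by (auto simp: P_def indicator_def norm_mult norm_powr_real_powr)
  have int1: "integrable lborel (\<lambda>v. LINT y|lborel. norm (f v y))"
  proof -
    have "set_integrable lborel {0<..} (\<lambda>v. Gamma (Re u) * (v powr ((1 - Re u) - 1) * exp (- Re c * v)))"
      by (intro set_integrable_mult_right set_integrable_powr_exp_real) (use u c in auto)
    moreover have "(LINT y|lborel. norm (f v y)) = indicat_real {0<..} v *\<^sub>R (Gamma (Re u) * (v powr ((1 - Re u) - 1) * exp (- Re c * v)))" for v
    proof (cases "v > 0")
      case True
      have "(LINT y|lborel. norm (f v y)) = (LINT y:{0<..}|lborel. y powr (Re u - 1) * exp (- v * y)) * (indicat_real {0<..} v * exp (- Re c * v))"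
        unfolding fn set_lebesgue_integral_def by simp
      thus ?thesis using Laplace_powr_real[OF u(1) True] True by simp
    qed (simp add: fn)
    ultimately show ?thesis by (simp add: set_integrable_def)
  qed
  have fint2: "integrable lborel (f v)" for v
  proof (cases "v > 0")
    case True
    have "set_integrable lborel {0<..} (\<lambda>y. of_real y powr (u - 1) * exp (- of_real v * of_real y) * exp (- c * of_real v))"
      by (intro set_integrable_mult_left set_integrable_powr_exp) (use u True in auto)
    moreover have "f v = (\<lambda>y. indicat_real {0<..} y *\<^sub>R (of_real y powr (u - 1) * exp (- of_real v * of_real y) * exp (- c * of_real v)))"
      using True unfolding f_def ce by (auto simp: P_def fun_eq_iff indicator_def)
    ultimately show ?thesis by (simp add: set_integrable_def)
  qed (simp add: f_def)
  have intf: "integrable (lborel \<Otimes>\<^sub>M lborel) (case_prod f)"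
    by (rule lborel_pair.Fubini_integrable[OF meas]) (use int1 fint2 in auto)
  have "(LINT y|lborel. (LINT v|lborel. f v y)) = (LINT v|lborel. (LINT y|lborel. f v y))"
    by (rule lborel_pair.Fubini_integral[OF intf])
  moreover have "(LINT v|lborel. f v y) = indicat_real {0<..} y *\<^sub>R (of_real y powr (u - 1) / (of_real y + c))" for y
  proof (cases "y > 0")
    case True
    have "(LINT v|lborel. f v y) = (LINT v:{0<..}|lborel. P y * (of_real v powr (1 - 1) * exp (- (of_real y + c) * of_real v)))"
      unfolding set_lebesgue_integral_def f_def by (rule Bochner_Integration.integral_cong) (auto simp: indicator_def)
    also have "\<dots> = P y * (Gamma 1 * (of_real y + c) powr (- 1))"
      unfolding set_integral_mult_right by (subst Laplace_powr) (use True c in auto)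
    finally show ?thesis using True by (simp add: P_def powr_minus divide_inverse)
  qed (simp add: f_def P_def)
  moreover have "(LINT v|lborel. (LINT y|lborel. f v y)) = Gamma u * (Gamma (1 - u) * c powr (- (1 - u)))"
  proof -
    have "(LINT y|lborel. f v y) = indicat_real {0<..} v *\<^sub>R (Gamma u * (of_real v powr ((1 - u) - 1) * exp (- c * of_real v)))" for v
    proof (cases "v > 0")
      case True
      have "(LINT y|lborel. f v y) = (LINT y:{0<..}|lborel. of_real y powr (u - 1) * exp (- of_real v * of_real y) * exp (- c * of_real v))"
        unfolding set_lebesgue_integral_def
        by (rule Bochner_Integration.integral_cong) (use True in \<open>auto simp only: f_def ce P_def indicator_def, auto\<close>)
      also have "\<dots> = Gamma u * of_real v powr (- u) * exp (- c * of_real v)"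
        unfolding set_integral_mult_left by (subst Laplace_powr) (use True u in auto)
      finally show ?thesis using True by (simp add: mult_ac)
    qed (simp add: f_def)
    hence "(LINT v|lborel. (LINT y|lborel. f v y)) = (LINT v:{0<..}|lborel. Gamma u * (of_real v powr ((1 - u) - 1) * exp (- c * of_real v)))"
      by (simp only: set_lebesgue_integral_def)
    also have "\<dots> = Gamma u * (Gamma (1 - u) * c powr (- (1 - u)))"
      unfolding set_integral_mult_right by (subst Laplace_powr) (use u c in auto)
    finally show ?thesis .
  qed
  ultimately show ?thesis by (simp add: set_lebesgue_integral_def)
qed

lemma norm_add_ii_ge:
  fixes y e :: real and \<delta> :: complex
  assumes "y > 0" "e \<ge> 0" "\<delta> = \<i> \<or> \<delta> = - \<i>"
  shows "norm (of_real y + (of_real e + \<delta>)) \<ge> 1" "norm (of_real y + (of_real e + \<delta>)) \<ge> y"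
proof -
  have "\<bar>Im (of_real y + (of_real e + \<delta>))\<bar> = 1" "\<bar>Re (of_real y + (of_real e + \<delta>))\<bar> \<ge> y"
    using assms by (elim disjE; simp)+
  thus "norm (of_real y + (of_real e + \<delta>)) \<ge> 1" "norm (of_real y + (of_real e + \<delta>)) \<ge> y"
    using abs_Re_le_cmod[of "of_real y + (of_real e + \<delta>)"] abs_Im_le_cmod[of "of_real y + (of_real e + \<delta>)"] by linarith+
qed

lemma divide_le_if_one:
  fixes b N y :: real
  assumes "b \<ge> 0" "N \<ge> 1" "N \<ge> y" "y > 0"
  shows "b / N \<le> (if y \<le> 1 then b else b / y)"
proof -
  have "b / N \<le> b / 1" using assms by (intro divide_left_mono) auto
  moreover have "b / N \<le> b / y" using assms by (intro divide_left_mono mult_pos_pos) auto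
  ultimately show ?thesis by simp
qed

lemma set_integrable_pole_bound:
  fixes p :: real
  assumes "-1 < p" "p < 0"
  shows "set_integrable lborel {0<..} (\<lambda>y. if y \<le> 1 then y powr p else y powr (p - 1))"
proof -
  have 1: "set_integrable lborel {0<..1} (\<lambda>y. y powr p)"
  proof -
    have "(\<lambda>y. y powr p) integrable_on {0..1}"
      using integrable_on_powr_from_0[of p 1] assms by simp
    hence "(\<lambda>y. y powr p) absolutely_integrable_on {0..1}"
      by (intro nonnegative_absolutely_integrable_1) auto
    hence "set_integrable lborel {0..1} (\<lambda>y. y powr p)"
      unfolding set_integrable_def absolutely_integrable_on_def by (subst (asm) integrable_completion) auto
    thus ?thesis by (rule set_integrable_subset) auto
  qed
  have 2: "set_integrable lborel {1<..} (\<lambda>y. y powr (p - 1))"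
  proof -
    have "(\<lambda>y. y powr (p - 1)) integrable_on {1..}"
      by (rule has_integral_integrable[OF has_integral_powr_to_inf]) (use assms in auto)
    hence "(\<lambda>y. y powr (p - 1)) absolutely_integrable_on {1..}"
      by (intro nonnegative_absolutely_integrable_1) auto
    hence "set_integrable lborel {1..} (\<lambda>y. y powr (p - 1))"
      unfolding set_integrable_def absolutely_integrable_on_def by (subst (asm) integrable_completion) auto
    thus ?thesis by (rule set_integrable_subset) auto
  qed
  have "set_integrable lborel ({0<..1} \<union> {1<..}) (\<lambda>y. if y \<le> 1 then y powr p else y powr (p - 1))"
  proof (rule set_integrable_Un)
    show "set_integrable lborel {0<..1} (\<lambda>y. if y \<le> 1 then y powr p else y powr (p - 1))"
      using 1 by (subst set_integrable_cong[OF refl]) auto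
    show "set_integrable lborel {1<..} (\<lambda>y. if y \<le> 1 then y powr p else y powr (p - 1))"
      using 2 by (subst set_integrable_cong[OF refl]) auto
  qed auto
  moreover have "{0<..1} \<union> {1<..} = {0::real<..}" by auto
  ultimately show ?thesis by simp
qed

lemma beta_integral_pole_imaginary:
  fixes u \<delta> :: complex
  assumes u: "0 < Re u" "Re u < 1" and \<delta>: "\<delta> = \<i> \<or> \<delta> = - \<i>"
  shows "(LINT y:{0<..}|lborel. of_real y powr (u - 1) / (of_real y + \<delta>)) = Gamma u * Gamma (1 - u) * \<delta> powr (u - 1)"
proof (rule LIMSEQ_unique)
  have nz: "of_real y + (of_real e + \<delta>) \<noteq> 0" if "y > 0" "e \<ge> 0" for y e
    using norm_add_ii_ge(1)[OF that \<delta>] by auto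
  have nz0: "of_real y + \<delta> \<noteq> 0" if "y > 0" for y using nz[OF that, of 0] by simp
  define c where "c = (\<lambda>n. of_real (1 / real (Suc n)) + \<delta>)"
  have clim: "c \<longlonglongrightarrow> \<delta>"
  proof -
    have "(\<lambda>n. of_real (1 / real (Suc n)) + \<delta>) \<longlonglongrightarrow> of_real 0 + \<delta>"
      by (intro tendsto_intros LIMSEQ_Suc lim_const_over_n)
    thus ?thesis by (simp add: c_def)
  qed
  show "(\<lambda>n. LINT y:{0<..}|lborel. of_real y powr (u - 1) / (of_real y + c n)) \<longlonglongrightarrow> (LINT y:{0<..}|lborel. of_real y powr (u - 1) / (of_real y + \<delta>))"
  proof (rule set_integral_dominated_convergence)
    show "set_integrable lborel {0<..} (\<lambda>y. if y \<le> 1 then y powr (Re u - 1) else y powr (Re u - 1 - 1))"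
      by (rule set_integrable_pole_bound) (use u in auto)
    show "continuous_on {0<..} (\<lambda>y. of_real y powr (u - 1) / (of_real y + c n))" for n
      using nz[of _ "1 / real (Suc n)"] by (intro continuous_intros) (auto simp: c_def)
    show "(\<lambda>y. of_real y powr (u - 1) / (of_real y + \<delta>)) \<in> borel_measurable borel \<or> continuous_on {0<..} (\<lambda>y. of_real y powr (u - 1) / (of_real y + \<delta>))"
      using nz0 by (intro disjI2 continuous_intros) auto
    show "norm (of_real y powr (u - 1) / (of_real y + c n)) \<le> (if y \<le> 1 then y powr (Re u - 1) else y powr (Re u - 1 - 1))"
      if y: "y \<in> {0<..}" for y n
    proof -
      have b: "norm (of_real y + c n) \<ge> 1" "norm (of_real y + c n) \<ge> y"
        unfolding c_def using y by (intro norm_add_ii_ge \<delta>; simp)+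
      have "norm (of_real y powr (u - 1) / (of_real y + c n)) = y powr (Re u - 1) / norm (of_real y + c n)"
        using y by (simp add: norm_divide norm_powr_real_powr)
      also have "\<dots> \<le> (if y \<le> 1 then y powr (Re u - 1) else y powr (Re u - 1) / y)"
        using b y by (intro divide_le_if_one) auto
      also have "\<dots> = (if y \<le> 1 then y powr (Re u - 1) else y powr (Re u - 1 - 1))"
        using y powr_diff[of y "Re u - 1" 1] by simp
      finally show ?thesis .
    qed
    show "(\<lambda>n. of_real y powr (u - 1) / (of_real y + c n)) \<longlonglongrightarrow> of_real y powr (u - 1) / (of_real y + \<delta>)" if "y \<in> {0<..}" for y
      using nz0[of y] that by (intro tendsto_intros clim) auto
  qed auto
  have "(\<lambda>n. Gamma u * Gamma (1 - u) * c n powr (u - 1)) \<longlonglongrightarrow> Gamma u * Gamma (1 - u) * \<delta> powr (u - 1)"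
    by (intro tendsto_intros clim) (use \<delta> in auto)
  moreover have "(LINT y:{0<..}|lborel. of_real y powr (u - 1) / (of_real y + c n)) = Gamma u * Gamma (1 - u) * c n powr (u - 1)" for n
    by (rule beta_integral_pole_right[OF u]) (use \<delta> in \<open>auto simp: c_def\<close>)
  ultimately show "(\<lambda>n. LINT y:{0<..}|lborel. of_real y powr (u - 1) / (of_real y + c n)) \<longlonglongrightarrow> Gamma u * Gamma (1 - u) * \<delta> powr (u - 1)"
    by simp
qed

text \<open>The kernel at v is - \<i> / (v - \<i>) and at - v it is \<i> / (v + \<i>), so these are
  beta integrals at s + 1. The prefactors combine with the powers of - \<i> and \<i> to the two
  exponentials that later accompany the Hurwitz series.\<close>

lemma pole_kernel_Mellin:
  fixes s :: complex
  assumes s: "-1 < Re s" "Re s < 0"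
  shows "(LINT v:{0<..}|lborel. of_real v powr s * pole_kernel v) = Gamma s * Gamma (1 - s) * exp (\<i> * of_real (pi / 2) * (1 - s))"
    and "(LINT v:{0<..}|lborel. of_real v powr s * pole_kernel (- v)) = Gamma s * Gamma (1 - s) * exp (- \<i> * of_real (pi / 2) * (1 - s))"
    and "set_integrable lborel {0<..} (\<lambda>v. of_real v powr s * pole_kernel v)"
    and "set_integrable lborel {0<..} (\<lambda>v. of_real v powr s * pole_kernel (- v))"
proof -
  have nzs: "s \<noteq> 0" "s \<notin> \<int>\<^sub>\<le>\<^sub>0"
  proof -
    show "s \<noteq> 0" using s by auto
    show "s \<notin> \<int>\<^sub>\<le>\<^sub>0"
    proof
      assume "s \<in> \<int>\<^sub>\<le>\<^sub>0"
      then obtain n where "s = - of_nat n" by (auto elim: nonpos_Ints_cases')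
      hence "- 1 < - real n \<and> - real n < 0" using s by simp
      thus False by (cases n) auto
    qed
  qed
  have GG: "Gamma (s + 1) * Gamma (1 - (s + 1)) = - (Gamma s * Gamma (1 - s))"
  proof -
    have "Gamma (s + 1) = s * Gamma s" by (rule Gamma_plus1[OF nzs(2)])
    moreover have "Gamma (1 - s) = (- s) * Gamma (- s)"
    proof -
      have "- s \<notin> \<int>\<^sub>\<le>\<^sub>0"
      proof
        assume "- s \<in> \<int>\<^sub>\<le>\<^sub>0"
        then obtain n where "- s = - of_nat n" by (auto elim: nonpos_Ints_cases')
        hence "Re s = real n" by simp
        thus False using s by simp
      qed
      from Gamma_plus1[OF this] show ?thesis by (simp add: add.commute)
    qed
    ultimately show ?thesis by simp
  qed
  have cont: "continuous_on {0<..} (\<lambda>v::real. of_real v powr s * pole_kernel (e * v))" for e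
    unfolding pole_kernel_def by (intro continuous_intros) (auto simp: complex_eq_iff)
  have int: "set_integrable lborel {0<..} (\<lambda>v. of_real v powr s * pole_kernel (e * v))" if e: "e = 1 \<or> e = -1" for e
  proof (rule set_integrable_continuous_bound[OF set_integrable_pole_bound[OF s] _ cont])
    fix v :: real assume v: "v \<in> {0<..}"
    have b: "norm (1 + \<i> * of_real (e * v)) \<ge> 1" "norm (1 + \<i> * of_real (e * v)) \<ge> v"
      using norm_one_plus_ii[of "e * v"] e v by auto
    have "norm (of_real v powr s * pole_kernel (e * v)) = v powr Re s / norm (1 + \<i> * of_real (e * v))"
      using v by (simp add: norm_mult norm_divide norm_powr_real_powr pole_kernel_def)
    also have "\<dots> \<le> (if v \<le> 1 then v powr Re s else v powr Re s / v)"
      using b v by (intro divide_le_if_one) auto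
    also have "\<dots> = (if v \<le> 1 then v powr Re s else v powr (Re s - 1))"
      using v powr_diff[of v "Re s" 1] by simp
    finally show "norm (of_real v powr s * pole_kernel (e * v)) \<le> (if v \<le> 1 then v powr Re s else v powr (Re s - 1))" .
  qed auto
  show "set_integrable lborel {0<..} (\<lambda>v. of_real v powr s * pole_kernel v)" using int[of 1] by simp
  show "set_integrable lborel {0<..} (\<lambda>v. of_real v powr s * pole_kernel (- v))" using int[of "-1"] by simp
  have pk: "pole_kernel v = - \<i> * (1 / (of_real v + - \<i>))" "pole_kernel (- v) = \<i> * (1 / (of_real v + \<i>))" for v
  proof -
    have "1 + \<i> * of_real v \<noteq> 0" "of_real v + - \<i> \<noteq> 0" "1 - \<i> * of_real v \<noteq> 0" "of_real v + \<i> \<noteq> 0"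
      by (auto simp: complex_eq_iff)
    thus "pole_kernel v = - \<i> * (1 / (of_real v + - \<i>))" "pole_kernel (- v) = \<i> * (1 / (of_real v + \<i>))"
      by (auto simp: pole_kernel_def field_simps)
  qed
  have "(LINT v:{0<..}|lborel. of_real v powr s * pole_kernel v) = (LINT v:{0<..}|lborel. - \<i> * (of_real v powr ((s + 1) - 1) / (of_real v + - \<i>)))"
    unfolding pk(1) by (rule set_lebesgue_integral_cong) auto
  also have "\<dots> = - \<i> * (Gamma (s + 1) * Gamma (1 - (s + 1)) * (- \<i>) powr ((s + 1) - 1))"
    unfolding set_integral_mult_right by (subst beta_integral_pole_imaginary) (use s in auto)
  also have "\<dots> = Gamma s * Gamma (1 - s) * (\<i> * (- \<i>) powr s)" unfolding GG by simp
  also have "\<i> * (- \<i>) powr s = exp (\<i> * of_real (pi / 2) * (1 - s))"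
  proof -
    have e: "exp (\<i> * of_real (pi / 2)) = \<i>" using cis_pi_half unfolding cis_conv_exp .
    have p: "(- \<i>) powr s = exp (s * (- (\<i> * of_real (pi / 2))))" by (simp add: powr_def)
    have x: "x * (1 - s) = x + s * (- x)" for x by (simp add: algebra_simps)
    show ?thesis unfolding x exp_add e p ..
  qed
  finally show "(LINT v:{0<..}|lborel. of_real v powr s * pole_kernel v) = Gamma s * Gamma (1 - s) * exp (\<i> * of_real (pi / 2) * (1 - s))" .
  have "(LINT v:{0<..}|lborel. of_real v powr s * pole_kernel (- v)) = (LINT v:{0<..}|lborel. \<i> * (of_real v powr ((s + 1) - 1) / (of_real v + \<i>)))"
    unfolding pk(2) by (rule set_lebesgue_integral_cong) auto
  also have "\<dots> = \<i> * (Gamma (s + 1) * Gamma (1 - (s + 1)) * \<i> powr ((s + 1) - 1))"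
    unfolding set_integral_mult_right by (subst beta_integral_pole_imaginary) (use s in auto)
  also have "\<dots> = Gamma s * Gamma (1 - s) * (- \<i> * \<i> powr s)" unfolding GG by simp
  also have "- \<i> * \<i> powr s = exp (- \<i> * of_real (pi / 2) * (1 - s))"
  proof -
    have "exp (\<i> * of_real (pi / 2)) = \<i>" using cis_pi_half unfolding cis_conv_exp .
    hence e: "exp (- (\<i> * of_real (pi / 2))) = - \<i>" by (simp only: exp_minus) simp
    have p: "\<i> powr s = exp (s * (\<i> * of_real (pi / 2)))" by (simp add: powr_def)
    have x: "- x * (1 - s) = - x + s * x" for x by (simp add: algebra_simps)
    show ?thesis unfolding mult_minus_left[of \<i>] x exp_add e p by simp
  qed
  finally show "(LINT v:{0<..}|lborel. of_real v powr s * pole_kernel (- v)) = Gamma s * Gamma (1 - s) * exp (- \<i> * of_real (pi / 2) * (1 - s))" .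
qed

lemma set_integral_sums:
  fixes f :: "nat \<Rightarrow> real \<Rightarrow> complex"
  assumes int: "\<And>n. set_integrable lborel S (f n)"
    and sm: "\<And>y. y \<in> S \<Longrightarrow> summable (\<lambda>n. norm (f n y))"
    and sums: "\<And>y. y \<in> S \<Longrightarrow> (\<lambda>n. f n y) sums G y"
    and sI: "summable (\<lambda>n. LINT y:S|lborel. norm (f n y))"
  shows "(\<lambda>n. LINT y:S|lborel. f n y) sums (LINT y:S|lborel. G y)" "set_integrable lborel S G"
proof -
  have eq: "(\<Sum>n. indicat_real S y *\<^sub>R f n y) = indicat_real S y *\<^sub>R G y" for y
    using sums[of y] by (cases "y \<in> S") (auto simp: sums_iff)
  have i: "integrable lborel (\<lambda>y. indicat_real S y *\<^sub>R f n y)" for n using int[of n] by (simp add: set_integrable_def)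
  have ae: "AE y in lborel. summable (\<lambda>n. norm (indicat_real S y *\<^sub>R f n y))"
    using sm by (intro always_eventually) (auto simp: indicator_def)
  have sI': "summable (\<lambda>n. LINT y|lborel. norm (indicat_real S y *\<^sub>R f n y))"
    using sI by (simp add: set_lebesgue_integral_def)
  show "(\<lambda>n. LINT y:S|lborel. f n y) sums (LINT y:S|lborel. G y)"
    using sums_integral[OF i ae sI'] unfolding eq set_lebesgue_integral_def .
  show "set_integrable lborel S G"
    using integrable_suminf[OF i ae sI'] unfolding eq set_integrable_def .
qed

lemma set_integral_scale:
  fixes f :: "real \<Rightarrow> 'a::{banach, second_countable_topology}"
  assumes c: "c > 0"
  shows "(LINT y:{0<..}|lborel. f y) = c *\<^sub>R (LINT v:{0<..}|lborel. f (c * v))"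
    and "set_integrable lborel {0<..} f \<longleftrightarrow> set_integrable lborel {0<..} (\<lambda>v. f (c * v))"
proof -
  have ind: "indicat_real {0<..} (c * v) = indicat_real {0<..} v" for v :: real
    using c by (auto simp: indicator_def zero_less_mult_iff)
  show "(LINT y:{0<..}|lborel. f y) = c *\<^sub>R (LINT v:{0<..}|lborel. f (c * v))"
    unfolding set_lebesgue_integral_def
    using lborel_integral_real_affine[of c "\<lambda>y. indicat_real {0<..} y *\<^sub>R f y" 0] c
    by (simp add: ind)
  show "set_integrable lborel {0<..} f \<longleftrightarrow> set_integrable lborel {0<..} (\<lambda>v. f (c * v))"
    unfolding set_integrable_def
    using lborel_integrable_real_affine_iff[of c "\<lambda>y. indicat_real {0<..} y *\<^sub>R f y" 0] c
    by (simp add: ind)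
qed

section \<open>Series representations and Mellin transforms in the two regions\<close>

definition Hurwitz_series :: "real \<Rightarrow> complex \<Rightarrow> complex" where
  "Hurwitz_series x w = (\<Sum>k. of_real (real k + x) powr (- w))"

definition periodic_zeta_series :: "real \<Rightarrow> complex \<Rightarrow> complex" where
  "periodic_zeta_series x s = (\<Sum>n. cis (2 * pi * real (Suc n) * x) * of_nat (Suc n) powr (- s))"

lemma summable_shifted_powr:
  fixes x p :: real
  assumes x: "x > 0" and p: "p > 1"
  shows "summable (\<lambda>k. (real k + x) powr (- p))"
proof (rule summable_comparison_test'[where N = 1])
  show "summable (\<lambda>n. real n powr (- p))" using p by (simp add: summable_real_powr_iff)
  show "norm ((real n + x) powr (- p)) \<le> real n powr (- p)" if "n \<ge> 1" for n
    using that x p by (auto intro!: powr_mono2')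
qed

lemma Hurwitz_sums:
  assumes "x > 0" "Re w > 1"
  shows "(\<lambda>k. of_real (real k + x) powr (- w)) sums Hurwitz_series x w"
    and "summable (\<lambda>k. norm (complex_of_real (real k + x) powr (- w)))"
proof -
  have "norm (complex_of_real (real k + x) powr (- w)) = (real k + x) powr (- Re w)" for k
    using assms by (subst norm_powr_real_powr) auto
  thus *: "summable (\<lambda>k. norm (complex_of_real (real k + x) powr (- w)))"
    using summable_shifted_powr[OF assms] by simp
  show "(\<lambda>k. of_real (real k + x) powr (- w)) sums Hurwitz_series x w"
    unfolding Hurwitz_series_def by (rule summable_sums[OF summable_norm_cancel[OF *]])
qed

lemma Hurwitz_series_holomorphic:
  assumes x: "x > 0"
  shows "Hurwitz_series x holomorphic_on {w. Re w > 1}"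
proof -
  have "(\<lambda>w. \<Sum>k. of_real (real k + x) powr (- w)) holomorphic_on {w. Re w > 1}"
  proof (rule holomorphic_uniform_sequence[where f = "\<lambda>n w. \<Sum>k<n. of_real (real k + x) powr (- w)"])
    show "open {w. Re w > 1}" by (rule open_halfspace_Re_gt)
    show "(\<lambda>w. \<Sum>k<n. of_real (real k + x) powr (- w)) holomorphic_on {w. Re w > 1}" for n
      by (intro holomorphic_intros)
    fix w :: complex assume w: "w \<in> {w. Re w > 1}"
    define p where "p = (Re w + 1) / 2"
    define d where "d = (Re w - 1) / 2"
    have d: "d > 0" "p > 1" using w by (auto simp: d_def p_def)
    have sub: "Re z \<ge> p" if "z \<in> cball w d" for z
      using that abs_Re_le_cmod[of "w - z"] by (auto simp: dist_norm d_def p_def field_simps)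
    have "uniform_limit (cball w d) (\<lambda>n z. \<Sum>k<n. of_real (real k + x) powr (- z)) (\<lambda>z. \<Sum>k. of_real (real k + x) powr (- z)) sequentially"
    proof (rule Weierstrass_m_test_ev)
      show "\<forall>\<^sub>F n in sequentially. \<forall>z\<in>cball w d. norm (of_real (real n + x) powr (- z)) \<le> (real n + x) powr (- p)"
        using eventually_ge_at_top[of 1]
      proof eventually_elim
        case (elim n)
        show ?case
        proof
          fix z assume z: "z \<in> cball w d"
          have "norm (of_real (real n + x) powr (- z)) = (real n + x) powr (- Re z)"
            using x by (subst norm_powr_real_powr) auto
          also have "\<dots> \<le> (real n + x) powr (- p)" using sub[OF z] elim x by (intro powr_mono) auto
          finally show "norm (of_real (real n + x) powr (- z)) \<le> (real n + x) powr (- p)" .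
        qed
      qed
      show "summable (\<lambda>n. (real n + x) powr (- p))" by (rule summable_shifted_powr) (use x d in auto)
    qed
    moreover have "cball w d \<subseteq> {w. Re w > 1}" using sub d by force
    ultimately show "\<exists>d>0. cball w d \<subseteq> {w. Re w > 1} \<and> uniform_limit (cball w d) (\<lambda>n z. \<Sum>k<n. of_real (real k + x) powr (- z)) (\<lambda>z. \<Sum>k. of_real (real k + x) powr (- z)) sequentially"
      using d by blast
  qed
  thus ?thesis by (simp only: Hurwitz_series_def[abs_def])
qed

text \<open>The Mellin transform of this kernel is \<open>\<Gamma>(s)\<close> times the periodic zeta function.\<close>

definition twist_kernel :: "real \<Rightarrow> real \<Rightarrow> complex" where
  "twist_kernel x y = 1 / (exp (of_real y - 2 * pi * \<i> * of_real x) - 1)"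

lemma exp_twist: "exp (of_real y - 2 * pi * \<i> * of_real x) = of_real (exp y) * cis (- 2 * pi * x)"
proof -
  have "of_real y - 2 * pi * \<i> * of_real x = of_real y + \<i> * complex_of_real (- 2 * pi * x)"
    by (simp add: complex_eq_iff)
  thus ?thesis by (simp only: exp_add cis_conv_exp exp_of_real)
qed

lemma twist_kernel_denom_nonzero:
  assumes "0 < x" "x < 1"
  shows "exp (of_real y - 2 * pi * \<i> * of_real x) - 1 \<noteq> 0"
proof
  assume "exp (of_real y - 2 * pi * \<i> * of_real x) - 1 = 0"
  hence "exp (of_real y - 2 * pi * \<i> * of_real x) = 1" by simp
  then obtain n :: int where "Im (of_real y - 2 * pi * \<i> * of_real x) = of_int (2 * n) * pi"
    unfolding exp_eq_1 by auto
  hence "pi * x = pi * (- of_int n)" by simp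
  hence "x = - of_int n" by (simp only: mult_cancel_left) simp
  hence "0 < - n \<and> - n < 1" using assms by linarith
  thus False by presburger
qed

lemma continuous_on_twist_kernel:
  assumes "0 < x" "x < 1"
  shows "continuous_on S (twist_kernel x)"
  unfolding twist_kernel_def using twist_kernel_denom_nonzero[OF assms] by (intro continuous_intros) auto

lemma norm_twist_kernel_le:
  assumes y: "y \<ge> 1"
  shows "norm (twist_kernel x y) \<le> 2 * exp (- y)"
proof -
  have "exp y \<ge> 2" using exp_ge_add_one_self[of y] y by linarith
  have "norm (exp (of_real y - 2 * pi * \<i> * of_real x) - 1) \<ge> norm (exp (of_real y - 2 * pi * \<i> * of_real x)) - norm (1::complex)"
    by (rule norm_triangle_ineq2)
  also have "norm (exp (of_real y - 2 * pi * \<i> * of_real x)) = exp y" by (simp add: exp_twist norm_mult)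
  finally have "norm (exp (of_real y - 2 * pi * \<i> * of_real x) - 1) \<ge> exp y / 2" using \<open>exp y \<ge> 2\<close> by simp
  hence "1 / norm (exp (of_real y - 2 * pi * \<i> * of_real x) - 1) \<le> 1 / (exp y / 2)"
    by (intro divide_left_mono mult_pos_pos) (auto intro: less_le_trans[of 0 "exp y / 2"])
  thus ?thesis by (simp add: twist_kernel_def norm_divide exp_minus field_simps)
qed

text \<open>Read off from the partial fractions, each of whose terms is at most y times a summable
  constant. Linear vanishing at 0 is what carries the Mellin integral from Re s > 0 down to Re s >
  -1.\<close>

lemma twist_kernel_diff_le:
  assumes x: "0 < x" "x < 1"
  shows "\<exists>C. \<forall>y\<ge>0. norm (twist_kernel x y - twist_kernel x 0) \<le> C * y"
proof -
  define A where "A = (\<lambda>k. 1 / (2 * pi * (real k + x))\<^sup>2 + 1 / (2 * pi * (real k + (1 - x)))\<^sup>2)"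
  have s2: "summable (\<lambda>k. 1 / (2 * pi * (real k + z))\<^sup>2)" if "z > 0" for z
  proof -
    have "summable (\<lambda>k. 1 / (2 * pi)\<^sup>2 * (real k + z) powr (- 2))"
      by (intro summable_mult summable_shifted_powr) (use that in auto)
    moreover have "1 / (2 * pi)\<^sup>2 * (real k + z) powr (- 2) = 1 / (2 * pi * (real k + z))\<^sup>2" for k
      using that by (simp add: powr_minus_divide power_mult_distrib)
    ultimately show ?thesis by (simp only:)
  qed
  have sA: "summable A" unfolding A_def by (intro summable_add s2) (use x in auto)
  have "norm (twist_kernel x y - twist_kernel x 0) \<le> suminf A * y" if y: "y \<ge> 0" for y
  proof -
    have S: "(\<lambda>k. of_real y / of_real ((2 * pi * (real k + x))\<^sup>2) * pole_kernel (y / (2 * pi * (real k + x))) +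
              of_real y / of_real ((2 * pi * (real k + (1 - x)))\<^sup>2) * pole_kernel (- y / (2 * pi * (real k + (1 - x)))))
         sums (twist_kernel x y - twist_kernel x 0)" (is "?f sums _")
      unfolding twist_kernel_def using exp_geometric_partial_fractions[OF x, of y] .
    have pk: "norm (pole_kernel v) \<le> 1" for v
      using norm_one_plus_ii(1)[of v] by (simp add: pole_kernel_def norm_divide divide_le_eq_1)
    have t: "norm (of_real y / complex_of_real ((2 * pi * b)\<^sup>2) * pole_kernel v) \<le> y * (1 / (2 * pi * b)\<^sup>2)" for b v
    proof -
      have "norm (of_real y / complex_of_real ((2 * pi * b)\<^sup>2) * pole_kernel v) = y * (1 / (2 * pi * b)\<^sup>2) * norm (pole_kernel v)"
        using y by (simp only: norm_mult norm_divide norm_of_real) simp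
      also have "\<dots> \<le> y * (1 / (2 * pi * b)\<^sup>2) * 1" by (intro mult_left_mono pk) (use y in auto)
      finally show ?thesis by simp
    qed
    have "norm (?f k) \<le> y * A k" for k
      unfolding A_def by (subst distrib_left, rule norm_triangle_mono) (rule t)+
    moreover have "(\<lambda>k. y * A k) sums (y * suminf A)" by (intro sums_mult summable_sums sA)
    ultimately have "norm (suminf ?f) \<le> (\<Sum>k. y * A k)" by (intro norm_suminf_le) (auto simp: sums_iff)
    hence "norm (twist_kernel x y - twist_kernel x 0) \<le> y * suminf A"
      using S sA by (simp only: sums_unique[OF S, symmetric] suminf_mult)
    thus ?thesis by (simp add: mult.commute)
  qed
  thus ?thesis by blast
qed

lemma powr_sums_periodic:
  assumes s: "Re s > 1"
  shows "summable (\<lambda>n. norm (cis (2 * pi * real (Suc n) * x) * of_nat (Suc n) powr (- s)))"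
proof -
  have "summable (\<lambda>n. norm (complex_of_real (real n + 1) powr (- s)))" by (rule Hurwitz_sums) (use s in auto)
  thus ?thesis by (simp add: norm_mult add.commute)
qed

text \<open>The kernel is a geometric series in exp (- y + 2 pi \<i> x) without its constant term;
  each of its terms is transformed by \<open>Laplace_powr\<close>.\<close>

lemma twist_kernel_Mellin_series:
  assumes s: "Re s > 1"
  shows "(LINT y:{0<..}|lborel. twist_kernel x y * of_real y powr (s - 1)) = Gamma s * periodic_zeta_series x s"
    and "set_integrable lborel {0<..} (\<lambda>y. twist_kernel x y * of_real y powr (s - 1))"
proof -
  define f where "f = (\<lambda>n y. cis (2 * pi * real (Suc n) * x) * (complex_of_real y powr (s - 1) * exp (- of_nat (Suc n) * of_real y)))"
  have n1: "norm (f n y) = y powr (Re s - 1) * exp (- real (Suc n) * y)" if "y > 0" for n y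
  proof -
    have "norm (exp (- of_nat (Suc n) * complex_of_real y)) = exp (- real (Suc n) * y)"
      unfolding norm_exp_eq_Re by simp
    thus ?thesis unfolding f_def norm_mult using that by (simp add: norm_powr_real_powr)
  qed
  have int: "set_integrable lborel {0<..} (f n)" for n
    unfolding f_def by (intro set_integrable_mult_right set_integrable_powr_exp) (use s in auto)
  have geo: "summable (\<lambda>n. exp (- real (Suc n) * y))" if "y > 0" for y
  proof -
    have "summable (\<lambda>n. exp (- y) ^ Suc n)" using that by (subst summable_Suc_iff) (simp add: summable_geometric)
    thus ?thesis by (simp add: exp_of_nat_mult[symmetric] algebra_simps del: power_Suc)
  qed
  have sm: "summable (\<lambda>n. norm (f n y))" if "y \<in> {0<..}" for y
  proof -
    have y: "y > 0" using that by simp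
    show ?thesis unfolding n1[OF y] by (intro summable_mult geo y)
  qed
  have sums: "(\<lambda>n. f n y) sums (twist_kernel x y * of_real y powr (s - 1))" if "y \<in> {0<..}" for y
  proof -
    have y: "y > 0" using that by simp
    define Z where "Z = exp (of_real y - 2 * pi * \<i> * of_real x)"
    have nZ: "norm Z > 1" using y by (simp add: Z_def exp_twist norm_mult)
    have Z0: "Z \<noteq> 0" using nZ by auto
    have "(\<lambda>n. inverse Z ^ n) sums (1 / (1 - inverse Z))"
      using nZ by (intro geometric_sums) (simp add: norm_inverse inverse_less_1_iff)
    hence "(\<lambda>n. of_real y powr (s - 1) * inverse Z * inverse Z ^ n) sums (of_real y powr (s - 1) * inverse Z * (1 / (1 - inverse Z)))"
      by (rule sums_mult)
    also have "inverse Z * (1 / (1 - inverse Z)) = twist_kernel x y"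
    proof -
      have "Z \<noteq> 1" using nZ by auto
      thus ?thesis using Z0 unfolding twist_kernel_def Z_def[symmetric] by (simp add: field_simps)
    qed
    hence "of_real y powr (s - 1) * inverse Z * (1 / (1 - inverse Z)) = twist_kernel x y * of_real y powr (s - 1)"
      by (metis mult.assoc mult.commute)
    also have "(\<lambda>n. of_real y powr (s - 1) * inverse Z * inverse Z ^ n) = (\<lambda>n. f n y)"
    proof
      fix n
      have "inverse Z = exp (- of_real y + 2 * pi * \<i> * of_real x)" by (simp add: Z_def exp_minus[symmetric])
      hence "inverse Z ^ Suc n = exp (of_nat (Suc n) * (- of_real y + 2 * pi * \<i> * of_real x))" by (simp only: exp_of_nat_mult)
      also have "of_nat (Suc n) * (- of_real y + 2 * pi * \<i> * of_real x) = \<i> * of_real (2 * pi * real (Suc n) * x) + - of_nat (Suc n) * complex_of_real y"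
        by (simp add: complex_eq_iff algebra_simps)
      finally have "inverse Z ^ Suc n = cis (2 * pi * real (Suc n) * x) * exp (- of_nat (Suc n) * complex_of_real y)"
        by (simp only: exp_add cis_conv_exp)
      hence "of_real y powr (s - 1) * inverse Z ^ Suc n = f n y" unfolding f_def by (simp only: mult_ac)
      thus "of_real y powr (s - 1) * inverse Z * inverse Z ^ n = f n y" by (simp add: mult_ac)
    qed
    finally show ?thesis .
  qed
  have n2: "(LINT y:{0<..}|lborel. norm (f n y)) = Gamma (Re s) * real (Suc n) powr (- Re s)" for n
  proof -
    have "(LINT y:{0<..}|lborel. norm (f n y)) = (LINT y:{0<..}|lborel. y powr (Re s - 1) * exp (- real (Suc n) * y))"
      by (rule set_lebesgue_integral_cong) (auto simp: n1 simp del: of_nat_Suc)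
    also have "\<dots> = Gamma (Re s) * real (Suc n) powr (- Re s)" by (rule Laplace_powr_real) (use s in auto)
    finally show ?thesis .
  qed
  have "summable (\<lambda>n. Gamma (Re s) * (real n + 1) powr (- Re s))"
    by (intro summable_mult summable_shifted_powr) (use s in auto)
  hence sI: "summable (\<lambda>n. LINT y:{0<..}|lborel. norm (f n y))" unfolding n2 by (simp add: add.commute)
  note SS = set_integral_sums[OF int sm sums sI]
  show "set_integrable lborel {0<..} (\<lambda>y. twist_kernel x y * of_real y powr (s - 1))" by (rule SS(2)) auto
  have fi: "(LINT y:{0<..}|lborel. f n y) = Gamma s * (cis (2 * pi * real (Suc n) * x) * of_nat (Suc n) powr (- s))" for n
  proof -
    have "(LINT y:{0<..}|lborel. complex_of_real y powr (s - 1) * exp (- of_nat (Suc n) * of_real y)) = Gamma s * of_nat (Suc n) powr (- s)"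
      by (rule Laplace_powr) (use s in auto)
    thus ?thesis unfolding f_def by (subst set_integral_mult_right) (simp only: mult_ac)
  qed
  have "(\<lambda>n. LINT y:{0<..}|lborel. f n y) sums (Gamma s * periodic_zeta_series x s)"
    unfolding fi periodic_zeta_series_def
    by (intro sums_mult summable_sums) (rule summable_norm_cancel[OF powr_sums_periodic[OF s]])
  thus "(LINT y:{0<..}|lborel. twist_kernel x y * of_real y powr (s - 1)) = Gamma s * periodic_zeta_series x s"
    using SS(1) sums_unique2 by blast
qed

text \<open>The right-hand side of Hurwitz's formula in the variable w = 1 - s. The two shifts are
  separate parameters because for x = 0 they are 1 and 1 instead of x and 1 - x.\<close>

definition Hurwitz_dual :: "real \<Rightarrow> real \<Rightarrow> complex \<Rightarrow> complex" where
  "Hurwitz_dual x x' w = Gamma w * of_real (2 * pi) powr (- w) *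
     (exp (\<i> * of_real (pi / 2) * w) * Hurwitz_series x w + exp (- \<i> * of_real (pi / 2) * w) * Hurwitz_series x' w)"

text \<open>The substitution y = 2 pi (k + x) v reduces every term to the same Mellin integral of
  the pole kernel times (2 pi (k + x))^(s - 1), and these powers sum to the Hurwitz series. The sign
  e distinguishes the poles on the two sides of the real axis.\<close>

lemma Hurwitz_pole_series:
  fixes s :: complex and e :: real
  assumes s: "-1 < Re s" "Re s < 0" and x: "x > 0" and e: "e = 1 \<or> e = -1"
  defines "f \<equiv> \<lambda>k y. of_real y / of_real ((2 * pi * (real k + x))\<^sup>2) * pole_kernel (e * y / (2 * pi * (real k + x))) * of_real y powr (s - 1)"
  shows "(\<lambda>k. LINT y:{0<..}|lborel. f k y) sums
          (Gamma s * Gamma (1 - s) * of_real (2 * pi) powr (- (1 - s)) * exp (\<i> * of_real (e * pi / 2) * (1 - s)) * Hurwitz_series x (1 - s))"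
    and "set_integrable lborel {0<..} (f k)"
    and "summable (\<lambda>k. LINT y:{0<..}|lborel. norm (f k y))"
proof -
  define K where "K = (\<lambda>v. complex_of_real v powr s * pole_kernel (e * v))"
  have K: "set_integrable lborel {0<..} K" "(LINT v:{0<..}|lborel. K v) = Gamma s * Gamma (1 - s) * exp (\<i> * of_real (e * pi / 2) * (1 - s))"
    unfolding K_def using pole_kernel_Mellin[OF s] e by auto
  define B where "B = (\<lambda>k. 2 * pi * (real k + x))"
  have B: "B k > 0" for k using x by (simp add: B_def)
  have fK: "f k (B k * v) = of_real (B k) powr (s - 2) * K v" if "v > 0" for k v
  proof -
    have "of_real (B k * v) powr (s - 1) = of_real (B k) powr (s - 1) * complex_of_real v powr (s - 1)"
      using B[of k] that by (simp add: powr_times_real)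
    moreover have "complex_of_real v powr s = of_real v * of_real v powr (s - 1)"
      using that powr_add[of "complex_of_real v" 1 "s - 1"] by simp
    moreover have "complex_of_real (B k) powr (s - 1) = of_real (B k) * of_real (B k) powr (s - 2)"
      using B[of k] powr_add[of "complex_of_real (B k)" 1 "s - 2"] by simp
    moreover have "e * (B k * v) / B k = e * v" using B[of k] by simp
    moreover have "f k y = of_real y / of_real ((B k)\<^sup>2) * pole_kernel (e * y / B k) * of_real y powr (s - 1)" for y
      by (simp only: f_def B_def)
    ultimately show ?thesis unfolding K_def using B[of k]
      by (simp add: power2_eq_square)
  qed
  have Bp: "of_real (B k) * of_real (B k) powr (s - 2) = complex_of_real (B k) powr (s - 1)" for k
    using B[of k] powr_add[of "complex_of_real (B k)" 1 "s - 2"] by simp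
  show int: "set_integrable lborel {0<..} (f k)" for k
  proof -
    have "set_integrable lborel {0<..} (\<lambda>v. of_real (B k) powr (s - 2) * K v)" by (intro set_integrable_mult_right K)
    hence "set_integrable lborel {0<..} (\<lambda>v. f k (B k * v))"
      by (subst set_integrable_cong[OF refl refl fK]) auto
    thus ?thesis using set_integral_scale(2)[OF B, of "f k" k] by blast
  qed
  have I: "(LINT y:{0<..}|lborel. f k y) = of_real (B k) powr (s - 1) * (LINT v:{0<..}|lborel. K v)" for k
  proof -
    have "(LINT y:{0<..}|lborel. f k y) = B k *\<^sub>R (LINT v:{0<..}|lborel. f k (B k * v))" by (rule set_integral_scale(1)[OF B])
    also have "(LINT v:{0<..}|lborel. f k (B k * v)) = (LINT v:{0<..}|lborel. of_real (B k) powr (s - 2) * K v)"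
      by (rule set_lebesgue_integral_cong) (auto simp: fK)
    also have "\<dots> = of_real (B k) powr (s - 2) * (LINT v:{0<..}|lborel. K v)" by (rule set_integral_mult_right)
    finally show ?thesis by (simp only: scaleR_conv_of_real mult.assoc[symmetric] Bp)
  qed
  have NI: "(LINT y:{0<..}|lborel. norm (f k y)) = B k powr (Re s - 1) * (LINT v:{0<..}|lborel. norm (K v))" for k
  proof -
    have "(LINT y:{0<..}|lborel. norm (f k y)) = B k *\<^sub>R (LINT v:{0<..}|lborel. norm (f k (B k * v)))" by (rule set_integral_scale(1)[OF B])
    also have "(LINT v:{0<..}|lborel. norm (f k (B k * v))) = (LINT v:{0<..}|lborel. norm (complex_of_real (B k) powr (s - 2)) * norm (K v))"
      by (rule set_lebesgue_integral_cong) (auto simp: fK norm_mult)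
    also have "\<dots> = norm (complex_of_real (B k) powr (s - 2)) * (LINT v:{0<..}|lborel. norm (K v))" by (rule set_integral_mult_right)
    also have "B k *\<^sub>R \<dots> = norm (of_real (B k) * complex_of_real (B k) powr (s - 2)) * (LINT v:{0<..}|lborel. norm (K v))"
      using B[of k] by (simp add: norm_mult)
    also have "norm (of_real (B k) * complex_of_real (B k) powr (s - 2)) = B k powr (Re s - 1)"
      unfolding Bp using B[of k] by (subst norm_powr_real_powr) auto
    finally show ?thesis .
  qed
  have "summable (\<lambda>k. (2 * pi) powr (Re s - 1) * (real k + x) powr (- (1 - Re s)))"
    by (intro summable_mult summable_shifted_powr) (use x s in auto)
  also have "(\<lambda>k. (2 * pi) powr (Re s - 1) * (real k + x) powr (- (1 - Re s))) = (\<lambda>k. B k powr (Re s - 1))"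
    using x by (auto simp: B_def powr_mult)
  finally show "summable (\<lambda>k. LINT y:{0<..}|lborel. norm (f k y))"
    unfolding NI by (rule summable_mult2)
  have "(\<lambda>k. of_real (2 * pi) powr (- (1 - s)) * of_real (real k + x) powr (- (1 - s))) sums (of_real (2 * pi) powr (- (1 - s)) * Hurwitz_series x (1 - s))"
    by (intro sums_mult Hurwitz_sums) (use x s in auto)
  also have "(\<lambda>k. of_real (2 * pi) powr (- (1 - s)) * of_real (real k + x) powr (- (1 - s))) = (\<lambda>k. complex_of_real (B k) powr (s - 1))"
    unfolding B_def of_real_mult[of "2 * pi"] using x by (subst powr_times_real) auto
  finally have "(\<lambda>k. of_real (B k) powr (s - 1) * (LINT v:{0<..}|lborel. K v)) sums (of_real (2 * pi) powr (- (1 - s)) * Hurwitz_series x (1 - s) * (LINT v:{0<..}|lborel. K v))"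
    by (rule sums_mult2)
  thus "(\<lambda>k. LINT y:{0<..}|lborel. f k y) sums
          (Gamma s * Gamma (1 - s) * of_real (2 * pi) powr (- (1 - s)) * exp (\<i> * of_real (e * pi / 2) * (1 - s)) * Hurwitz_series x (1 - s))"
    unfolding I K(2) by (simp only: mult_ac)
qed

text \<open>Termwise integration of the partial fractions; the two families of poles give the two
  Hurwitz series. The kernel minus its value at 0 is of order y near 0 and bounded at infinity,
  which makes -1 < Re s < 0 the natural strip.\<close>

lemma twist_kernel_Mellin_strip:
  fixes s :: complex
  assumes s: "-1 < Re s" "Re s < 0" and x: "0 < x" "x < 1"
  shows "(LINT y:{0<..}|lborel. (twist_kernel x y - twist_kernel x 0) * of_real y powr (s - 1)) = Gamma s * Hurwitz_dual x (1 - x) (1 - s)"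
    and "set_integrable lborel {0<..} (\<lambda>y. (twist_kernel x y - twist_kernel x 0) * of_real y powr (s - 1))"
proof -
  have x': "1 - x > 0" using x by simp
  define f1 where "f1 = (\<lambda>k y. of_real y / of_real ((2 * pi * (real k + x))\<^sup>2) * pole_kernel (1 * y / (2 * pi * (real k + x))) * of_real y powr (s - 1))"
  define f2 where "f2 = (\<lambda>k y. of_real y / of_real ((2 * pi * (real k + (1 - x)))\<^sup>2) * pole_kernel (-1 * y / (2 * pi * (real k + (1 - x)))) * of_real y powr (s - 1))"
  have p1: "(1::real) = 1 \<or> (1::real) = -1" and p2: "(-1::real) = 1 \<or> (-1::real) = -1" by auto
  have S1: "(\<lambda>k. LINT y:{0<..}|lborel. f1 k y) sums
          (Gamma s * Gamma (1 - s) * of_real (2 * pi) powr (- (1 - s)) * exp (\<i> * of_real (1 * pi / 2) * (1 - s)) * Hurwitz_series x (1 - s))"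
    "set_integrable lborel {0<..} (f1 k)" "summable (\<lambda>k. LINT y:{0<..}|lborel. norm (f1 k y))" for k
    unfolding f1_def by (rule Hurwitz_pole_series[OF s x(1) p1])+
  have S2: "(\<lambda>k. LINT y:{0<..}|lborel. f2 k y) sums
          (Gamma s * Gamma (1 - s) * of_real (2 * pi) powr (- (1 - s)) * exp (\<i> * of_real (-1 * pi / 2) * (1 - s)) * Hurwitz_series (1 - x) (1 - s))"
    "set_integrable lborel {0<..} (f2 k)" "summable (\<lambda>k. LINT y:{0<..}|lborel. norm (f2 k y))" for k
    unfolding f2_def by (rule Hurwitz_pole_series[OF s x' p2])+
  have n1: "norm (of_real y / complex_of_real ((2 * pi * (real k + b))\<^sup>2) * pole_kernel v * of_real y powr (s - 1)) \<le>
      y * y powr (Re s - 1) / (2 * pi)\<^sup>2 * (real k + b) powr (- 2)" if "y > 0" "b > 0" for y b v k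
  proof -
    have pk: "norm (pole_kernel v) \<le> 1"
      using norm_one_plus_ii(1)[of v] by (simp add: pole_kernel_def norm_divide divide_le_eq_1)
    have "norm (of_real y / complex_of_real ((2 * pi * (real k + b))\<^sup>2) * pole_kernel v * of_real y powr (s - 1)) =
       (y / (2 * pi * (real k + b))\<^sup>2 * y powr (Re s - 1)) * norm (pole_kernel v)"
      using that by (simp only: norm_mult norm_divide norm_of_real) (simp add: norm_powr_real_powr)
    also have "\<dots> \<le> (y / (2 * pi * (real k + b))\<^sup>2 * y powr (Re s - 1)) * 1" by (intro mult_left_mono pk) (use that in auto)
    also have "\<dots> = y * y powr (Re s - 1) / (2 * pi)\<^sup>2 * (real k + b) powr (- 2)"
      using that by (simp add: powr_minus_divide power_mult_distrib)
    finally show ?thesis .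
  qed
  have sm1: "summable (\<lambda>k. norm (of_real y / complex_of_real ((2 * pi * (real k + b))\<^sup>2) * pole_kernel (v k) * of_real y powr (s - 1)))"
    if "y > 0" "b > 0" for y b v
  proof (rule summable_comparison_test')
    show "summable (\<lambda>k. y * y powr (Re s - 1) / (2 * pi)\<^sup>2 * (real k + b) powr (- 2))"
      by (intro summable_mult summable_shifted_powr) (use that in auto)
    show "norm (norm (of_real y / complex_of_real ((2 * pi * (real k + b))\<^sup>2) * pole_kernel (v k) * of_real y powr (s - 1))) \<le>
      y * y powr (Re s - 1) / (2 * pi)\<^sup>2 * (real k + b) powr (- 2)" if "k \<ge> 0" for k
      using n1[OF \<open>y > 0\<close> \<open>b > 0\<close>] by simp
  qed
  define T where "T = (\<lambda>y. (twist_kernel x y - twist_kernel x 0) * complex_of_real y powr (s - 1))"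
  have int: "set_integrable lborel {0<..} (\<lambda>y. f1 k y + f2 k y)" for k by (intro set_integral_add S1 S2)
  have nn: "summable (\<lambda>k. norm (f1 k y) + norm (f2 k y))" if "y \<in> {0<..}" for y
    unfolding f1_def f2_def by (intro summable_add sm1) (use that x in auto)
  have sm: "summable (\<lambda>k. norm (f1 k y + f2 k y))" if "y \<in> {0<..}" for y
    by (rule summable_comparison_test'[OF nn[OF that], of 0]) (simp add: norm_triangle_ineq)
  have sums: "(\<lambda>k. f1 k y + f2 k y) sums T y" if "y \<in> {0<..}" for y
  proof -
    have "(\<lambda>k. (of_real y / of_real ((2 * pi * (real k + x))\<^sup>2) * pole_kernel (y / (2 * pi * (real k + x))) +
              of_real y / of_real ((2 * pi * (real k + (1 - x)))\<^sup>2) * pole_kernel (- y / (2 * pi * (real k + (1 - x))))) * of_real y powr (s - 1))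
         sums T y"
      unfolding T_def twist_kernel_def by (rule sums_mult2[OF exp_geometric_partial_fractions[OF x, of y]])
    thus ?thesis unfolding f1_def f2_def by (simp only: distrib_right mult_1 mult_minus1)
  qed
  have sI: "summable (\<lambda>k. LINT y:{0<..}|lborel. norm (f1 k y + f2 k y))"
  proof (rule summable_comparison_test'[OF summable_add[OF S1(3) S2(3)], of 0])
    fix k :: nat
    have i: "set_integrable lborel {0<..} (\<lambda>y. norm (f1 k y))" "set_integrable lborel {0<..} (\<lambda>y. norm (f2 k y))"
      by (intro set_integrable_norm S1 S2)+
    have "(LINT y:{0<..}|lborel. norm (f1 k y + f2 k y)) \<le> (LINT y:{0<..}|lborel. norm (f1 k y) + norm (f2 k y))"
      by (intro set_integral_mono set_integrable_norm int set_integral_add i norm_triangle_ineq)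
    also have "\<dots> = (LINT y:{0<..}|lborel. norm (f1 k y)) + (LINT y:{0<..}|lborel. norm (f2 k y))" by (intro set_integral_add i)
    finally show "norm (LINT y:{0<..}|lborel. norm (f1 k y + f2 k y)) \<le> (LINT y:{0<..}|lborel. norm (f1 k y)) + (LINT y:{0<..}|lborel. norm (f2 k y))"
      by (simp add: set_lebesgue_integral_def integral_nonneg_AE)
  qed
  note SS = set_integral_sums[OF int sm sums sI]
  show "set_integrable lborel {0<..} (\<lambda>y. (twist_kernel x y - twist_kernel x 0) * of_real y powr (s - 1))"
    unfolding T_def[symmetric] by (rule SS(2)) auto
  have "(\<lambda>k. (LINT y:{0<..}|lborel. f1 k y) + (LINT y:{0<..}|lborel. f2 k y)) sums
     (Gamma s * Gamma (1 - s) * of_real (2 * pi) powr (- (1 - s)) * exp (\<i> * of_real (1 * pi / 2) * (1 - s)) * Hurwitz_series x (1 - s) +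
      Gamma s * Gamma (1 - s) * of_real (2 * pi) powr (- (1 - s)) * exp (\<i> * of_real (-1 * pi / 2) * (1 - s)) * Hurwitz_series (1 - x) (1 - s))" (is "_ sums ?R")
    by (intro sums_add S1 S2)
  moreover have "(LINT y:{0<..}|lborel. f1 k y + f2 k y) = (LINT y:{0<..}|lborel. f1 k y) + (LINT y:{0<..}|lborel. f2 k y)" for k
    by (intro set_integral_add S1 S2)
  ultimately have "(\<lambda>k. LINT y:{0<..}|lborel. f1 k y + f2 k y) sums ?R" by (simp only:)
  moreover have "(\<lambda>k. LINT y:{0<..}|lborel. f1 k y + f2 k y) sums (LINT y:{0<..}|lborel. T y)" by (rule SS(1)) auto
  ultimately have "?R = (LINT y:{0<..}|lborel. T y)" by (rule sums_unique2)
  hence "(LINT y:{0<..}|lborel. T y) = ?R" by (rule sym)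
  also have "exp (\<i> * of_real (-1 * pi / 2) * (1 - s)) = exp (- \<i> * of_real (pi / 2) * (1 - s))" by simp
  also have "exp (\<i> * of_real (1 * pi / 2) * (1 - s)) = exp (\<i> * of_real (pi / 2) * (1 - s))" by simp
  finally show "(LINT y:{0<..}|lborel. (twist_kernel x y - twist_kernel x 0) * of_real y powr (s - 1)) = Gamma s * Hurwitz_dual x (1 - x) (1 - s)"
    unfolding T_def Hurwitz_dual_def by (simp only: distrib_left mult.assoc)
qed

section \<open>Analytic continuation of the periodic zeta function\<close>

lemma set_integrable_powr_Ioc:
  fixes p :: real
  assumes p: "p > -1"
  shows "set_integrable lborel {0<..1} (\<lambda>y. y powr p)"
proof -
  have "((\<lambda>y. y powr p) has_integral (1 powr (p + 1) / (p + 1))) {0..1}" by (rule has_integral_powr_from_0) (use p in auto)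
  hence "(\<lambda>y. y powr p) absolutely_integrable_on {0..1}"
    by (intro nonnegative_absolutely_integrable_1) auto
  hence "set_integrable lborel {0..1} (\<lambda>y. y powr p)"
    by (simp add: absolutely_integrable_on_def set_integrable_def integrable_completion)
  thus ?thesis by (rule set_integrable_subset) auto
qed

lemma set_integrable_powr_Ioi:
  fixes p :: real
  assumes p: "p < -1"
  shows "set_integrable lborel {1<..} (\<lambda>y. y powr p)"
proof -
  have "((\<lambda>y. y powr p) has_integral (- (1 powr (p + 1)) / (p + 1))) {1..}" by (rule has_integral_powr_to_inf) (use p in auto)
  hence "(\<lambda>y. y powr p) absolutely_integrable_on {1..}"
    by (intro nonnegative_absolutely_integrable_1) auto
  hence "set_integrable lborel {1..} (\<lambda>y. y powr p)"
    by (simp add: absolutely_integrable_on_def set_integrable_def integrable_completion)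
  thus ?thesis by (rule set_integrable_subset) auto
qed

lemma powr_has_vector_derivative:
  assumes "s \<noteq> 0" "x > 0"
  shows "((\<lambda>y. complex_of_real y powr s / s) has_vector_derivative (of_real x powr (s - 1))) (at x)"
  using assms by (intro has_vector_derivative_real_field) (auto intro!: derivative_eq_intros)

lemma set_integral_powr_Ioc:
  fixes s :: complex
  assumes s: "Re s > 0"
  shows "(LINT y:{0<..1}|lborel. of_real y powr (s - 1)) = 1 / s"
    and "set_integrable lborel {0<..1} (\<lambda>y. complex_of_real y powr (s - 1))"
proof -
  have s0: "s \<noteq> 0" using s by auto
  show int: "set_integrable lborel {0<..1} (\<lambda>y. complex_of_real y powr (s - 1))"
    by (rule set_integrable_continuous_bound[OF set_integrable_powr_Ioc[of "Re s - 1"]])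
       (use s in \<open>auto intro!: continuous_intros simp: norm_powr_real_powr\<close>)
  have "(LBINT y=ereal 0..ereal 1. complex_of_real y powr (s - 1)) = of_real 1 powr s / s - 0"
  proof (rule interval_integral_FTC_integrable)
    show "set_integrable lborel (einterval (ereal 0) (ereal 1)) (\<lambda>y. complex_of_real y powr (s - 1))"
      using int by (rule set_integrable_subset) (auto simp: einterval_iff)
    show "((\<lambda>y. complex_of_real y powr s / s) has_vector_derivative (of_real x powr (s - 1))) (at x)"
      if "ereal 0 < ereal x" "ereal x < ereal 1" for x by (rule powr_has_vector_derivative) (use s0 that in auto)
    show "isCont (\<lambda>y. complex_of_real y powr (s - 1)) x" if "ereal 0 < ereal x" "ereal x < ereal 1" for x
      using that by (intro continuous_intros) auto
    have "((\<lambda>y. y powr Re s) \<longlongrightarrow> 0) (at_right 0)"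
      by (rule tendsto_zero_powrI[where b = "Re s"]) (use s in \<open>auto intro!: tendsto_intros simp: eventually_at_right_less eventually_at_filter\<close>)
    hence "((\<lambda>y. norm (complex_of_real y powr s)) \<longlongrightarrow> 0) (at_right 0)"
      by (rule tendsto_cong[THEN iffD1, rotated]) (auto simp: eventually_at_filter norm_powr_real_powr)
    hence "((\<lambda>y. complex_of_real y powr s) \<longlongrightarrow> 0) (at_right 0)" by (rule tendsto_norm_zero_cancel)
    hence "((\<lambda>y. complex_of_real y powr s / s) \<longlongrightarrow> 0 / s) (at_right 0)" by (intro tendsto_divide tendsto_const s0)
    thus "(((\<lambda>y. complex_of_real y powr s / s) \<circ> real_of_ereal) \<longlongrightarrow> 0) (at_right (ereal 0))"
      by (simp only: ereal_tendsto_simps1 div_0)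
    have "((\<lambda>y. complex_of_real y powr s / s) \<longlongrightarrow> of_real 1 powr s / s) (at_left 1)"
      by (intro tendsto_intros) (use s0 in auto)
    thus "(((\<lambda>y. complex_of_real y powr s / s) \<circ> real_of_ereal) \<longlongrightarrow> of_real 1 powr s / s) (at_left (ereal 1))"
      by (simp only: ereal_tendsto_simps1)
  qed auto
  thus "(LINT y:{0<..1}|lborel. of_real y powr (s - 1)) = 1 / s"
    by (simp add: interval_integral_Ioc)
qed

lemma set_integral_powr_Ioi:
  fixes s :: complex
  assumes s: "Re s < 0"
  shows "(LINT y:{1<..}|lborel. of_real y powr (s - 1)) = - 1 / s"
    and "set_integrable lborel {1<..} (\<lambda>y. complex_of_real y powr (s - 1))"
proof -
  have s0: "s \<noteq> 0" using s by auto
  show int: "set_integrable lborel {1<..} (\<lambda>y. complex_of_real y powr (s - 1))"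
    by (rule set_integrable_continuous_bound[OF set_integrable_powr_Ioi[of "Re s - 1"]])
       (use s in \<open>auto intro!: continuous_intros simp: norm_powr_real_powr\<close>)
  have "(LBINT y=ereal 1..\<infinity>. complex_of_real y powr (s - 1)) = 0 - of_real 1 powr s / s"
  proof (rule interval_integral_FTC_integrable)
    show "set_integrable lborel (einterval (ereal 1) \<infinity>) (\<lambda>y. complex_of_real y powr (s - 1))"
      using int by (rule set_integrable_subset) (auto simp: einterval_iff)
    show "((\<lambda>y. complex_of_real y powr s / s) has_vector_derivative (of_real x powr (s - 1))) (at x)"
      if "ereal 1 < ereal x" "ereal x < \<infinity>" for x by (rule powr_has_vector_derivative) (use s0 that in auto)
    show "isCont (\<lambda>y. complex_of_real y powr (s - 1)) x" if "ereal 1 < ereal x" "ereal x < \<infinity>" for x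
      using that by (intro continuous_intros) auto
    have "((\<lambda>y. y powr Re s) \<longlongrightarrow> 0) at_top"
      by (rule tendsto_neg_powr) (use s in \<open>auto simp: filterlim_ident\<close>)
    hence "((\<lambda>y. norm (complex_of_real y powr s)) \<longlongrightarrow> 0) at_top"
      by (rule tendsto_cong[THEN iffD1, rotated]) (auto intro!: eventually_mono[OF eventually_gt_at_top[of 0]] simp: norm_powr_real_powr)
    hence "((\<lambda>y. complex_of_real y powr s) \<longlongrightarrow> 0) at_top" by (rule tendsto_norm_zero_cancel)
    hence "((\<lambda>y. complex_of_real y powr s / s) \<longlongrightarrow> 0 / s) at_top" by (intro tendsto_divide tendsto_const s0)
    thus "(((\<lambda>y. complex_of_real y powr s / s) \<circ> real_of_ereal) \<longlongrightarrow> 0) (at_left \<infinity>)"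
      by (simp only: ereal_tendsto_simps1 div_0)
    have "((\<lambda>y. complex_of_real y powr s / s) \<longlongrightarrow> of_real 1 powr s / s) (at_right 1)"
      by (intro tendsto_intros) (use s0 in auto)
    thus "(((\<lambda>y. complex_of_real y powr s / s) \<circ> real_of_ereal) \<longlongrightarrow> of_real 1 powr s / s) (at_right (ereal 1))"
      by (simp only: ereal_tendsto_simps1)
  qed auto
  thus "(LINT y:{1<..}|lborel. of_real y powr (s - 1)) = - 1 / s"
    by (simp add: interval_integral_to_infinity_eq)
qed

text \<open>The Mellin integral split at 1, with the value of the kernel at 0 subtracted on (0, 1]
  and its integral 1 / s added back. Since rGamma s / s = rGamma (s + 1), the expression has no
  singularity at s = 0.\<close>

definition periodic_zeta_right :: "real \<Rightarrow> complex \<Rightarrow> complex" where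
  "periodic_zeta_right x s = rGamma s *
     ((LINT y:{0<..1}|lborel. (twist_kernel x y - twist_kernel x 0) * of_real y powr (s - 1)) +
      (LINT y:{1<..}|lborel. twist_kernel x y * of_real y powr (s - 1))) + twist_kernel x 0 * rGamma (s + 1)"

lemma set_integrable_twist_kernel_right:
  assumes x: "0 < x" "x < 1"
  shows "set_integrable lborel {1<..} (\<lambda>y. twist_kernel x y * of_real y powr (s - 1))"
proof -
  define p where "p = \<bar>Re s\<bar> + 1"
  have "set_integrable lborel {1<..} (\<lambda>y. 2 * (y powr (p - 1) * exp (- 1 * y)))"
    by (rule set_integrable_subset[where A = "{0<..}"], intro set_integrable_mult_right set_integrable_powr_exp_real) (auto simp: p_def)
  thus ?thesis
  proof (rule set_integrable_continuous_bound)
    show "continuous_on {1<..} (\<lambda>y. twist_kernel x y * complex_of_real y powr (s - 1))"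
      by (intro continuous_intros continuous_on_twist_kernel x) auto
    fix y :: real assume y: "y \<in> {1<..}"
    have "norm (twist_kernel x y * complex_of_real y powr (s - 1)) \<le> (2 * exp (- y)) * y powr (p - 1)"
      unfolding norm_mult using y
      by (intro mult_mono norm_twist_kernel_le) (auto simp: norm_powr_real_powr p_def intro!: powr_mono)
    thus "norm (twist_kernel x y * complex_of_real y powr (s - 1)) \<le> 2 * (y powr (p - 1) * exp (- 1 * y))" by (simp add: mult_ac)
  qed auto
qed

lemma periodic_zeta_right_holomorphic:
  assumes x: "0 < x" "x < 1"
  shows "periodic_zeta_right x holomorphic_on {s. Re s > -1}"
proof -
  obtain C where C: "\<And>y. y \<ge> 0 \<Longrightarrow> norm (twist_kernel x y - twist_kernel x 0) \<le> C * y"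
    using twist_kernel_diff_le[OF x] by blast
  have C0: "C \<ge> 0" using order_trans[OF norm_ge_zero C[of 1]] by simp
  have o: "open {s. Re s > -1}" by (rule open_halfspace_Re_gt)
  have h1: "(\<lambda>s. LINT y:{0<..1}|lborel. (twist_kernel x y - twist_kernel x 0) * of_real y powr (s - 1)) holomorphic_on {s. Re s > -1}"
  proof (rule holomorphic_on_set_integral[OF o])
    show "(\<lambda>s. (twist_kernel x y - twist_kernel x 0) * of_real y powr (s - 1)) holomorphic_on {s. Re s > -1}" for y
      by (intro holomorphic_intros)
    show "continuous_on {0<..1} (\<lambda>y. (twist_kernel x y - twist_kernel x 0) * of_real y powr (s - 1))" for s
      by (intro continuous_intros continuous_on_twist_kernel x) auto
    fix s assume s: "s \<in> {s. Re s > -1}"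
    define r where "r = (Re s + 1) / 2"
    define p where "p = (Re s - 1) / 2"
    have rp: "r > 0" "p > -1" using s by (auto simp: r_def p_def)
    have "norm ((twist_kernel x y - twist_kernel x 0) * of_real y powr (s' - 1)) \<le> C * y powr p"
      if s': "s' \<in> cball s r" and y: "y \<in> {0<..1}" for s' y
    proof -
      have R: "Re s' \<ge> p" using s' abs_Re_le_cmod[of "s - s'"] by (auto simp: dist_norm r_def p_def field_simps)
      have "norm ((twist_kernel x y - twist_kernel x 0) * of_real y powr (s' - 1)) \<le> C * y * y powr (Re s' - 1)"
        unfolding norm_mult using y C[of y] by (intro mult_mono) (auto simp: norm_powr_real_powr C0)
      also have "\<dots> = C * y powr Re s'" using y powr_add[of y 1 "Re s' - 1"] by simp
      also have "\<dots> \<le> C * y powr p" using R y C0 by (intro mult_left_mono powr_mono') auto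
      finally show ?thesis .
    qed
    moreover have "set_integrable lborel {0<..1} (\<lambda>y. C * y powr p)"
      by (intro set_integrable_mult_right set_integrable_powr_Ioc rp)
    ultimately show "\<exists>r>0. \<exists>g. set_integrable lborel {0<..1} g \<and> (\<forall>s'\<in>cball s r \<inter> {s. Re s > -1}. \<forall>y\<in>{0<..1}.
        norm ((twist_kernel x y - twist_kernel x 0) * of_real y powr (s' - 1)) \<le> g y)"
      using rp(1) by blast
  qed auto
  have h2: "(\<lambda>s. LINT y:{1<..}|lborel. twist_kernel x y * of_real y powr (s - 1)) holomorphic_on {s. Re s > -1}"
  proof (rule holomorphic_on_set_integral[OF o])
    show "(\<lambda>s. twist_kernel x y * of_real y powr (s - 1)) holomorphic_on {s. Re s > -1}" for y
      by (intro holomorphic_intros)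
    show "continuous_on {1<..} (\<lambda>y. twist_kernel x y * of_real y powr (s - 1))" for s
      by (intro continuous_intros continuous_on_twist_kernel x) auto
    fix s assume s: "s \<in> {s. Re s > -1}"
    define p where "p = \<bar>Re s\<bar> + 2"
    have "norm (twist_kernel x y * of_real y powr (s' - 1)) \<le> 2 * (y powr (p - 1) * exp (- 1 * y))"
      if s': "s' \<in> cball s 1" and y: "y \<in> {1<..}" for s' y
    proof -
      have R: "Re s' \<le> p" using s' abs_Re_le_cmod[of "s - s'"] by (auto simp: dist_norm p_def)
      have "norm (twist_kernel x y * complex_of_real y powr (s' - 1)) \<le> (2 * exp (- y)) * y powr (p - 1)"
        unfolding norm_mult using y R
        by (intro mult_mono norm_twist_kernel_le) (auto simp: norm_powr_real_powr intro!: powr_mono)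
      thus ?thesis by (simp add: mult_ac)
    qed
    moreover have "set_integrable lborel {1<..} (\<lambda>y. 2 * (y powr (p - 1) * exp (- 1 * y)))"
      by (rule set_integrable_subset[where A = "{0<..}"], intro set_integrable_mult_right set_integrable_powr_exp_real) (auto simp: p_def)
    ultimately show "\<exists>r>0. \<exists>g. set_integrable lborel {1<..} g \<and> (\<forall>s'\<in>cball s r \<inter> {s. Re s > -1}. \<forall>y\<in>{1<..}.
        norm (twist_kernel x y * of_real y powr (s' - 1)) \<le> g y)"
      using zero_less_one by blast
  qed auto
  show ?thesis unfolding periodic_zeta_right_def[abs_def] by (intro holomorphic_intros h1 h2)
qed

text \<open>The power y^(s - 1) has integral 1 / s over (0, 1] if Re s > 0 and - 1 / s over (1,
  infinity) if Re s < 0. Subtracting the constant on the first interval or restoring it on the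
  second therefore leads to the same equation, and one criterion serves both regions.\<close>

lemma periodic_zeta_right_eqI:
  assumes s: "s \<noteq> 0" "Gamma s \<noteq> 0"
    and I: "(LINT y:{0<..1}|lborel. (twist_kernel x y - twist_kernel x 0) * of_real y powr (s - 1)) +
      (LINT y:{1<..}|lborel. twist_kernel x y * of_real y powr (s - 1)) = Gamma s * X - twist_kernel x 0 * (1 / s)"
  shows "periodic_zeta_right x s = X"
proof -
  have a: "rGamma s * Gamma s = 1" using s by (simp add: Gamma_def)
  have "rGamma s = s * rGamma (s + 1)" by (simp add: rGamma_plus1)
  hence b: "rGamma s * (1 / s) = rGamma (s + 1)" using s by simp
  have c: "g * (G * X - t * u) + t * v = (g * G) * X + t * (v - g * u)" for g G t u v :: complex
    by (simp add: algebra_simps)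
  show ?thesis unfolding periodic_zeta_right_def I c a b by simp
qed

lemma Ioi_split: "{0::real<..} = {0<..1} \<union> {1<..}" "{0::real<..1} \<inter> {1<..} = {}" by auto

lemma periodic_zeta_right_eq_series:
  assumes x: "0 < x" "x < 1" and s: "Re s > 1"
  shows "periodic_zeta_right x s = periodic_zeta_series x s"
proof (rule periodic_zeta_right_eqI)
  let ?h = "\<lambda>y. twist_kernel x y * complex_of_real y powr (s - 1)"
  show "s \<noteq> 0" using s by auto
  show "Gamma s \<noteq> 0" using s by (auto simp: Gamma_eq_zero_iff elim!: nonpos_Ints_cases)
  have i: "set_integrable lborel {0<..1} ?h" "set_integrable lborel {1<..} ?h"
    by (rule set_integrable_subset[OF twist_kernel_Mellin_series(2)[OF s]]; auto)+
  have "Gamma s * periodic_zeta_series x s = (LINT y:{0<..1}|lborel. ?h y) + (LINT y:{1<..}|lborel. ?h y)"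
    unfolding twist_kernel_Mellin_series(1)[OF s, symmetric] Ioi_split(1) by (rule set_integral_Un) (use i Ioi_split in auto)
  moreover have "(LINT y:{0<..1}|lborel. (twist_kernel x y - twist_kernel x 0) * of_real y powr (s - 1)) =
      (LINT y:{0<..1}|lborel. ?h y) - (LINT y:{0<..1}|lborel. twist_kernel x 0 * of_real y powr (s - 1))"
    unfolding left_diff_distrib using s by (intro set_integral_diff i set_integrable_mult_right set_integral_powr_Ioc) auto
  moreover have "(LINT y:{0<..1}|lborel. twist_kernel x 0 * of_real y powr (s - 1)) = twist_kernel x 0 * (1 / s)"
    using s by (subst set_integral_mult_right) (simp add: set_integral_powr_Ioc)
  ultimately show "(LINT y:{0<..1}|lborel. (twist_kernel x y - twist_kernel x 0) * of_real y powr (s - 1)) +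
      (LINT y:{1<..}|lborel. ?h y) = Gamma s * periodic_zeta_series x s - twist_kernel x 0 * (1 / s)"
    by (simp only:) (simp only: algebra_simps)
qed

lemma periodic_zeta_right_eq_dual:
  assumes x: "0 < x" "x < 1" and s: "-1 < Re s" "Re s < 0"
  shows "periodic_zeta_right x s = Hurwitz_dual x (1 - x) (1 - s)"
proof (rule periodic_zeta_right_eqI)
  let ?h = "\<lambda>y. twist_kernel x y * complex_of_real y powr (s - 1)"
  let ?d = "\<lambda>y. (twist_kernel x y - twist_kernel x 0) * complex_of_real y powr (s - 1)"
  show s0: "s \<noteq> 0" using s by auto
  show "Gamma s \<noteq> 0"
  proof
    assume "Gamma s = 0"
    then obtain n where "s = - of_nat n" by (auto simp: Gamma_eq_zero_iff elim: nonpos_Ints_cases')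
    hence "- 1 < - real n \<and> - real n < 0" using s by simp
    thus False by (cases n) auto
  qed
  have i: "set_integrable lborel {0<..1} ?d" "set_integrable lborel {1<..} ?d"
    by (rule set_integrable_subset[OF twist_kernel_Mellin_strip(2)[OF s x]]; auto)+
  have "Gamma s * Hurwitz_dual x (1 - x) (1 - s) = (LINT y:{0<..1}|lborel. ?d y) + (LINT y:{1<..}|lborel. ?d y)"
    unfolding twist_kernel_Mellin_strip(1)[OF s x, symmetric] Ioi_split(1) by (rule set_integral_Un) (use i Ioi_split in auto)
  moreover have "(LINT y:{1<..}|lborel. ?d y) =
      (LINT y:{1<..}|lborel. ?h y) - (LINT y:{1<..}|lborel. twist_kernel x 0 * of_real y powr (s - 1))"
    unfolding left_diff_distrib using s
    by (intro set_integral_diff set_integrable_twist_kernel_right x set_integrable_mult_right set_integral_powr_Ioi) auto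
  moreover have "(LINT y:{1<..}|lborel. twist_kernel x 0 * of_real y powr (s - 1)) = - (twist_kernel x 0 * (1 / s))"
    using s by (subst set_integral_mult_right) (simp add: set_integral_powr_Ioi)
  ultimately show "(LINT y:{0<..1}|lborel. ?d y) +
      (LINT y:{1<..}|lborel. ?h y) = Gamma s * Hurwitz_dual x (1 - x) (1 - s) - twist_kernel x 0 * (1 / s)"
    by simp
qed

text \<open>The two expressions agree in the strip -1 < Re s < 0, so their union is entire and
  satisfies Hurwitz's formula by construction.\<close>

definition periodic_zeta_entire :: "real \<Rightarrow> complex \<Rightarrow> complex" where
  "periodic_zeta_entire x s = (if Re s > -1 then periodic_zeta_right x s else Hurwitz_dual x (1 - x) (1 - s))"

lemma Hurwitz_dual_holomorphic:
  assumes "x > 0" "x' > 0"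
  shows "(\<lambda>s. Hurwitz_dual x x' (1 - s)) holomorphic_on {s. Re s < 0}"
proof -
  have H: "(\<lambda>s. Hurwitz_series z (1 - s)) holomorphic_on {s. Re s < 0}" if "z > 0" for z
    by (rule holomorphic_on_compose_gen[OF _ Hurwitz_series_holomorphic[OF that], unfolded o_def])
       (auto intro!: holomorphic_intros)
  have G: "(\<lambda>s. Gamma (1 - s)) holomorphic_on {s. Re s < 0}"
    by (intro holomorphic_intros) (auto elim!: nonpos_Ints_cases simp: complex_eq_iff)
  show ?thesis unfolding Hurwitz_dual_def by (intro holomorphic_intros H G assms)
qed

lemma periodic_zeta_entire_eq_dual:
  assumes "0 < x" "x < 1" "Re s < 0"
  shows "periodic_zeta_entire x s = Hurwitz_dual x (1 - x) (1 - s)"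
  using assms by (simp add: periodic_zeta_entire_def periodic_zeta_right_eq_dual)

lemma periodic_zeta_entire_holomorphic:
  assumes x: "0 < x" "x < 1"
  shows "periodic_zeta_entire x holomorphic_on UNIV"
proof -
  have "periodic_zeta_entire x holomorphic_on {s. Re s > -1}"
    by (rule holomorphic_transform[OF periodic_zeta_right_holomorphic[OF x]]) (auto simp: periodic_zeta_entire_def)
  moreover have "periodic_zeta_entire x holomorphic_on {s. Re s < 0}"
    by (rule holomorphic_transform[OF Hurwitz_dual_holomorphic[of x "1 - x"]]) (use x in \<open>auto simp: periodic_zeta_entire_eq_dual\<close>)
  ultimately have "periodic_zeta_entire x holomorphic_on {s. Re s > -1} \<union> {s. Re s < 0}"
    by (rule holomorphic_on_Un) (simp_all add: open_halfspace_Re_gt open_halfspace_Re_lt)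
  also have "{s. Re s > -1} \<union> {s. Re s < 0} = UNIV" by auto
  finally show ?thesis .
qed

text \<open>Obtained by grouping consecutive terms into pairs according to parity. The lemma reduces
  the frequency x = 0, where the kernel has a pole at y = 0, to the frequency 1/2.\<close>

lemma Hurwitz_series_half:
  fixes w :: complex
  assumes w: "Re w > 1"
  shows "Hurwitz_series (1/2) w = (2 powr w - 1) * Hurwitz_series 1 w"
    and "periodic_zeta_series (1/2) w = (2 powr (1 - w) - 1) * Hurwitz_series 1 w"
    and "periodic_zeta_series 0 w = Hurwitz_series 1 w"
proof -
  have p: "complex_of_real (real (n * 2) + 1) powr (- w) = 2 powr (- w) * of_real (real n + 1/2) powr (- w)"
       "complex_of_real (real (n * 2 + 1) + 1) powr (- w) = 2 powr (- w) * of_real (real n + 1) powr (- w)" for n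
  proof -
    have "of_real 2 powr (- w) * of_real (real n + 1/2) powr (- w) = (of_real 2 * complex_of_real (real n + 1/2)) powr (- w)"
      by (rule powr_times_real[symmetric]) auto
    also have "of_real 2 * complex_of_real (real n + 1/2) = of_real (real (n * 2) + 1)" by simp
    finally show "complex_of_real (real (n * 2) + 1) powr (- w) = 2 powr (- w) * of_real (real n + 1/2) powr (- w)" by simp
    have "of_real 2 powr (- w) * of_real (real n + 1) powr (- w) = (of_real 2 * complex_of_real (real n + 1)) powr (- w)"
      by (rule powr_times_real[symmetric]) auto
    also have "of_real 2 * complex_of_real (real n + 1) = of_real (real (n * 2 + 1) + 1)" by simp
    finally show "complex_of_real (real (n * 2 + 1) + 1) powr (- w) = 2 powr (- w) * of_real (real n + 1) powr (- w)" by simp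
  qed
  have pw: "2 powr (- w) * 2 powr w = (1::complex)" by (simp add: powr_add[symmetric])
  have two: "sum f {n * 2..<n * 2 + 2} = f (n * 2) + f (n * 2 + 1)" for n and f :: "nat \<Rightarrow> complex"
  proof -
    have "{n * 2..<n * 2 + 2} = {n * 2, n * 2 + 1}" by auto
    thus ?thesis by simp
  qed
  note h1 = Hurwitz_sums(1)[OF zero_less_one w]
  have h2: "(\<lambda>k. of_real (real k + 1/2) powr (- w)) sums Hurwitz_series (1/2) w" by (rule Hurwitz_sums) (use w in auto)
  have "(\<lambda>n. \<Sum>k\<in>{n * 2..<n * 2 + 2}. of_real (real k + 1) powr (- w)) sums Hurwitz_series 1 w"
    by (rule sums_group[OF h1]) simp
  hence "(\<lambda>n. 2 powr (- w) * of_real (real n + 1/2) powr (- w) + 2 powr (- w) * of_real (real n + 1) powr (- w)) sums Hurwitz_series 1 w"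
    unfolding two p .
  moreover have "(\<lambda>n. 2 powr (- w) * of_real (real n + 1/2) powr (- w) + 2 powr (- w) * of_real (real n + 1) powr (- w)) sums
     (2 powr (- w) * Hurwitz_series (1/2) w + 2 powr (- w) * Hurwitz_series 1 w)"
    by (intro sums_add sums_mult h1 h2)
  ultimately have E: "Hurwitz_series 1 w = 2 powr (- w) * Hurwitz_series (1/2) w + 2 powr (- w) * Hurwitz_series 1 w"
    by (rule sums_unique2)
  hence "2 powr w * Hurwitz_series 1 w = 2 powr w * (2 powr (- w) * Hurwitz_series (1/2) w + 2 powr (- w) * Hurwitz_series 1 w)" by (rule arg_cong)
  also have "\<dots> = (2 powr (- w) * 2 powr w) * (Hurwitz_series (1/2) w + Hurwitz_series 1 w)" by (simp only: ring_distribs mult_ac)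
  finally show H: "Hurwitz_series (1/2) w = (2 powr w - 1) * Hurwitz_series 1 w" unfolding pw by (simp add: left_diff_distrib)
  have "(\<lambda>n. cis (2 * pi * real (Suc n) * (1/2)) * of_nat (Suc n) powr (- w)) sums periodic_zeta_series (1/2) w"
    unfolding periodic_zeta_series_def by (rule summable_sums[OF summable_norm_cancel[OF powr_sums_periodic[OF w]]])
  hence "(\<lambda>n. \<Sum>k\<in>{n * 2..<n * 2 + 2}. cis (2 * pi * real (Suc k) * (1/2)) * of_nat (Suc k) powr (- w)) sums periodic_zeta_series (1/2) w"
    by (rule sums_group) simp
  moreover have "(\<Sum>k\<in>{n * 2..<n * 2 + 2}. cis (2 * pi * real (Suc k) * (1/2)) * of_nat (Suc k) powr (- w)) =
      2 powr (- w) * of_real (real n + 1) powr (- w) - 2 powr (- w) * of_real (real n + 1/2) powr (- w)" for n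
  proof -
    have c1: "cis (2 * pi * real (Suc (n * 2)) * (1/2)) = -1"
    proof -
      have "2 * pi * real (Suc (n * 2)) * (1/2) = pi + 2 * pi * real n" by (simp add: algebra_simps)
      hence "cis (2 * pi * real (Suc (n * 2)) * (1/2)) = cis pi * cis (2 * pi * real n)" by (simp only: cis_mult)
      thus ?thesis by (simp add: cis_multiple_2pi)
    qed
    have c2: "cis (2 * pi * real (Suc (n * 2 + 1)) * (1/2)) = 1"
    proof -
      have "2 * pi * real (Suc (n * 2 + 1)) * (1/2) = 2 * pi * real (Suc n)" by (simp add: algebra_simps)
      thus ?thesis by (simp only:) (rule cis_multiple_2pi, auto)
    qed
    have nat: "complex_of_nat (Suc k) = of_real (real k + 1)" for k by (simp add: add.commute)
    show ?thesis unfolding two c1 c2 nat p by simp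
  qed
  ultimately have "(\<lambda>n. 2 powr (- w) * of_real (real n + 1) powr (- w) - 2 powr (- w) * of_real (real n + 1/2) powr (- w)) sums periodic_zeta_series (1/2) w"
    by (simp only:)
  moreover have "(\<lambda>n. 2 powr (- w) * of_real (real n + 1) powr (- w) - 2 powr (- w) * of_real (real n + 1/2) powr (- w)) sums
     (2 powr (- w) * Hurwitz_series 1 w - 2 powr (- w) * Hurwitz_series (1/2) w)"
    by (intro sums_diff sums_mult h1 h2)
  ultimately have "periodic_zeta_series (1/2) w = 2 powr (- w) * Hurwitz_series 1 w - 2 powr (- w) * Hurwitz_series (1/2) w"
    by (rule sums_unique2)
  also have "\<dots> = (2 * 2 powr (- w) - 2 powr (- w) * 2 powr w) * Hurwitz_series 1 w" unfolding H by (simp only: ring_distribs mult_ac) simp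
  also have "2 * 2 powr (- w) = 2 powr (1 - w)" using powr_add[of 2 1 "- w"] by simp
  finally show "periodic_zeta_series (1/2) w = (2 powr (1 - w) - 1) * Hurwitz_series 1 w" unfolding pw .
  show "periodic_zeta_series 0 w = Hurwitz_series 1 w"
    unfolding periodic_zeta_series_def Hurwitz_series_def by (simp add: add.commute)
qed

text \<open>At x = 0 this is the Riemann zeta function, continued through the alternating series,
  which is (2 powr (1 - s) - 1) times it.\<close>

definition periodic_zeta :: "real \<Rightarrow> complex \<Rightarrow> complex" where
  "periodic_zeta x s = (if x = 0 then periodic_zeta_entire (1/2) s / (2 powr (1 - s) - 1) else periodic_zeta_entire x s)"

lemma periodic_zeta_meromorphic:
  assumes "0 \<le> x" "x < 1"
  shows "periodic_zeta x meromorphic_on UNIV"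
proof -
  have E: "periodic_zeta_entire z meromorphic_on UNIV" if "0 < z" "z < 1" for z
    using periodic_zeta_entire_holomorphic[OF that] by (intro analytic_on_imp_meromorphic_on) (simp add: analytic_on_open)
  have "(\<lambda>s::complex. 2 powr (1 - s) - 1) meromorphic_on UNIV"
    by (intro analytic_on_imp_meromorphic_on) (simp add: analytic_on_open, intro holomorphic_intros)
  hence "(\<lambda>s. periodic_zeta_entire (1/2) s / (2 powr (1 - s) - 1)) meromorphic_on UNIV"
    by (intro meromorphic_on_divide E) auto
  thus ?thesis using E[of x] assms unfolding periodic_zeta_def[abs_def] by (cases "x = 0") auto
qed

lemma norm_two_powr: "norm (2 powr s :: complex) = 2 powr Re s"
  using norm_powr_real_powr[of 2 s] by simp

lemma periodic_zeta_eq_series: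
  assumes "0 \<le> x" "x < 1" "Re s > 1"
  shows "periodic_zeta x s = periodic_zeta_series x s"
proof (cases "x = 0")
  case True
  have "norm (2 powr (1 - s) :: complex) < 1" using assms powr_less_mono[of "1 - Re s" 0 2] by (simp add: norm_two_powr)
  hence "2 powr (1 - s) \<noteq> (1::complex)" by auto
  thus ?thesis using assms True by (simp add: periodic_zeta_def periodic_zeta_entire_def periodic_zeta_right_eq_series Hurwitz_series_half)
next
  case False
  thus ?thesis using assms by (simp add: periodic_zeta_def periodic_zeta_entire_def periodic_zeta_right_eq_series)
qed

lemma periodic_zeta_reflect:
  assumes "0 \<le> x" "x < 1" "Re w > 1"
  shows "periodic_zeta x (1 - w) = Hurwitz_dual (if x = 0 then 1 else x) (1 - x) w"
proof (cases "x = 0")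
  case True
  \<comment> \<open>The denominator at 1 - w is 2 powr w - 1. It is nonzero here and cancels the
    same factor in \<open>Hurwitz_series (1/2) w\<close>.\<close>
  have "norm (2 powr w :: complex) > 1" using assms by (simp add: norm_two_powr)
  hence "2 powr w \<noteq> (1::complex)" by auto
  thus ?thesis using assms True
    by (simp add: periodic_zeta_def periodic_zeta_entire_eq_dual Hurwitz_dual_def Hurwitz_series_half) (simp add: field_simps)
next
  case False
  thus ?thesis using assms by (simp add: periodic_zeta_def periodic_zeta_entire_eq_dual)
qed

text \<open>Hurwitz's formula for y and for 1 - y is a linear system for the two Hurwitz series,
  with determinant 2 \<i> sin (pi w); solving it expresses each of them by entire functions. At the
  zeros of the determinant the quotient takes a dummy value, hence the restriction on w.\<close>

lemma Hurwitz_series_continuation: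
  assumes y: "0 < y" "y \<le> 1"
  obtains M where "M meromorphic_on UNIV" "\<And>w. Re w > 1 \<Longrightarrow> sin (of_real pi * w) \<noteq> 0 \<Longrightarrow> M w = Hurwitz_series y w"
proof (cases "y = 1")
  case True
  show ?thesis
    by (rule that[of "periodic_zeta 0"]) (auto simp: True periodic_zeta_meromorphic periodic_zeta_eq_series Hurwitz_series_half)
next
  case False
  hence y: "0 < y" "y < 1" using y by auto
  define E where "E = (\<lambda>w. exp (\<i> * of_real (pi / 2) * w))"
  define E' where "E' = (\<lambda>w. exp (- \<i> * of_real (pi / 2) * w))"
  define M where "M = (\<lambda>w. of_real (2 * pi) powr w * rGamma w * (E w * periodic_zeta_entire y (1 - w) - E' w * periodic_zeta_entire (1 - y) (1 - w)) /
      (2 * \<i> * sin (of_real pi * w)))"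
  have P: "(\<lambda>w. periodic_zeta_entire z (1 - w)) holomorphic_on UNIV" if "0 < z" "z < 1" for z
    by (rule holomorphic_on_compose_gen[OF _ periodic_zeta_entire_holomorphic[OF that], unfolded o_def]) (auto intro!: holomorphic_intros)
  have "(\<lambda>w. of_real (2 * pi) powr w * rGamma w * (E w * periodic_zeta_entire y (1 - w) - E' w * periodic_zeta_entire (1 - y) (1 - w))) meromorphic_on UNIV"
    unfolding E_def E'_def
    by (intro analytic_on_imp_meromorphic_on) (simp only: analytic_on_open open_UNIV, intro holomorphic_intros P, use y in auto)
  moreover have "(\<lambda>w::complex. 2 * \<i> * sin (of_real pi * w)) meromorphic_on UNIV"
    by (intro analytic_on_imp_meromorphic_on) (simp only: analytic_on_open open_UNIV, intro holomorphic_intros)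
  ultimately have "M meromorphic_on UNIV" unfolding M_def by (rule meromorphic_on_divide)
  moreover have "M w = Hurwitz_series y w" if w: "Re w > 1" "sin (of_real pi * w) \<noteq> 0" for w
  proof -
    have 1: "periodic_zeta_entire y (1 - w) = Gamma w * of_real (2 * pi) powr (- w) * (E w * Hurwitz_series y w + E' w * Hurwitz_series (1 - y) w)"
      using y w by (simp add: periodic_zeta_entire_eq_dual Hurwitz_dual_def E_def E'_def)
    have 2: "periodic_zeta_entire (1 - y) (1 - w) = Gamma w * of_real (2 * pi) powr (- w) * (E w * Hurwitz_series (1 - y) w + E' w * Hurwitz_series y w)"
      using y w by (simp add: periodic_zeta_entire_eq_dual Hurwitz_dual_def E_def E'_def)
    have "w \<notin> \<int>\<^sub>\<le>\<^sub>0" using w by (auto elim!: nonpos_Ints_cases)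
    hence g: "rGamma w * Gamma w = 1" by (simp add: Gamma_def rGamma_eq_zero_iff)
    have t: "of_real (2 * pi) powr w * of_real (2 * pi) powr (- w) = (1::complex)" by (subst powr_add[symmetric]) simp
    have "E w * E w = exp (\<i> * (of_real pi * w))" "E' w * E' w = exp (- (\<i> * (of_real pi * w)))"
      unfolding E_def E'_def exp_add[symmetric] by (intro arg_cong[of _ _ exp]; simp)+
    hence sn: "E w * E w - E' w * E' w = 2 * \<i> * sin (of_real pi * w)"
      by (simp add: sin_exp_eq)
    have alg: "T * g * (e * (G * T' * (e * A + e' * B)) - e' * (G * T' * (e * B + e' * A))) = (T * T') * (g * G) * (e * e - e' * e') * A" for T T' g G e e' A B :: complex
      by (simp add: algebra_simps)
    show ?thesis unfolding M_def 1 2 alg t g sn using w by simp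
  qed
  ultimately show ?thesis using that by blast
qed

section \<open>The linear twist\<close>

lemma infsum_Ici_eq_suminf:
  fixes f :: "nat \<Rightarrow> complex"
  assumes "f 0 = 0"
  shows "(\<lambda>n. norm (f n)) summable_on {1..} \<longleftrightarrow> summable (\<lambda>n. norm (f n))"
    and "summable (\<lambda>n. norm (f n)) \<Longrightarrow> infsum f {1..} = suminf f"
proof -
  have "(\<lambda>n. norm (f n)) summable_on {1..} \<longleftrightarrow> (\<lambda>n. norm (f n)) summable_on UNIV"
  proof (rule summable_on_cong_neutral)
    show "norm (f n) = 0" if "n \<in> UNIV - {1..}" for n using that assms by (cases n) auto
  qed auto
  thus "(\<lambda>n. norm (f n)) summable_on {1..} \<longleftrightarrow> summable (\<lambda>n. norm (f n))"
    by (simp add: summable_on_UNIV_nonneg_real_iff)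
  assume s: "summable (\<lambda>n. norm (f n))"
  have "infsum f {1..} = infsum f UNIV"
  proof (rule infsum_cong_neutral)
    show "f n = 0" if "n \<in> UNIV - {1..}" for n using that assms by (cases n) auto
  qed auto
  also have "\<dots> = suminf f"
    by (rule infsumI[OF norm_summable_imp_has_sum[OF s summable_sums[OF summable_norm_cancel[OF s]]]])
  finally show "infsum f {1..} = suminf f" .
qed

text \<open>Recovers a pointwise identity from one that holds off a discrete set, away from points
  where dummy values spoil continuity.\<close>

lemma cosparse_eq_at_continuous:
  fixes f g :: "complex \<Rightarrow> complex"
  assumes "\<forall>\<^sub>\<approx>s\<in>UNIV. f s = g s" "isCont f z" "isCont g z"
  shows "f z = g z"
proof (rule tendsto_unique)
  have "eventually (\<lambda>s. f s = g s) (at z)"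
    by (rule eventually_cosparse_imp_eventually_at[OF assms(1)]) auto
  thus "(f \<longlongrightarrow> g z) (at z)"
    using assms(3) by (simp add: isCont_def tendsto_cong)
  show "(f \<longlongrightarrow> f z) (at z)" using assms(2) by (simp add: isCont_def)
qed auto

text \<open>\<open>a 0\<close> is arbitrary in \<open>extended_selberg\<close>, whereas the series
  of the locale start at index 0; this is the reason for the update. The functional equation, given
  off a discrete set, becomes a pointwise one at large heights by continuity.\<close>

lemma extended_selberg_degree_one:
  assumes sel: "extended_selberg a F D" and deg: "sel_degree D = 1"
  shows "degree_one (a(0 := 0)) F (Qpar D) (rnum D) (lam D) (mu D) (omega D)"
proof
  define a' where "a' = a(0 := 0)"
  have series: "(\<lambda>n. norm (a n * of_nat n powr (- s))) summable_on {1..}" "F s = (\<Sum>\<^sub>\<infinity>n\<in>{1..}. a n * of_nat n powr (- s))" if "Re s > 1" for s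
    using sel that unfolding extended_selberg_def by blast+
  obtain m G where G: "entire_finite_order G" "\<And>s. s \<noteq> 1 \<Longrightarrow> G s = (s - 1) ^ m * F s"
    using sel unfolding extended_selberg_def by blast
  have Q: "Qpar D > 0" and lam: "\<And>j. j \<in> {1..rnum D} \<Longrightarrow> lam D j > 0"
    and fe: "\<forall>\<^sub>\<approx>s\<in>UNIV. completed D F s = omega D * conj_fun (completed D F) (1 - s)"
    using sel unfolding extended_selberg_def by blast+
  have eq: "a n * of_nat n powr (- s) = a' n * of_nat n powr (- s)" for n s by (cases n) (auto simp: a'_def)
  show "(a(0 := 0)) 0 = 0" by simp
  have sm: "summable (\<lambda>n. norm (a' n * of_nat n powr (- s)))" if "Re s > 1" for s
    using series(1)[OF that] infsum_Ici_eq_suminf(1)[of "\<lambda>n. a' n * of_nat n powr (- s)"] unfolding eq by simp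
  show "summable (\<lambda>n. norm ((a(0 := 0)) n) * real n powr (- 3 / 2))"
    unfolding a'_def[symmetric] using sm[of "3 / 2"] by (simp add: norm_mult norm_powr_real_powr)
  show "F (Complex (3/2) t) = (\<Sum>n. (a(0 := 0)) n * of_nat n powr (- Complex (3/2) t))" for t
    unfolding a'_def[symmetric] using infsum_Ici_eq_suminf(2)[OF _ sm[of "Complex (3/2) t"]] series(2)[of "Complex (3/2) t"] by (simp add: eq)
  have "G holomorphic_on - {1}" using G(1) unfolding entire_finite_order_def by (auto intro: holomorphic_on_subset)
  hence "(\<lambda>s. G s / (s - 1) ^ m) holomorphic_on - {1}" by (intro holomorphic_intros) auto
  thus hol: "F holomorphic_on - {1}" by (rule holomorphic_transform) (auto simp: G(2))
  show "\<exists>\<rho> R. \<forall>s. norm s \<ge> R \<longrightarrow> norm (F s) \<le> exp (norm s powr \<rho>)"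
  proof -
    obtain \<rho> b where b: "\<And>s. norm s \<ge> b \<Longrightarrow> norm (G s) \<le> exp (norm s powr \<rho>)"
      using G(1) unfolding entire_finite_order_def eventually_at_infinity by blast
    have "norm (F s) \<le> exp (norm s powr \<rho>)" if "norm s \<ge> max b 2" for s
    proof -
      have "norm (s - 1) \<ge> 1" using that norm_triangle_ineq2[of s 1] by simp
      hence "1 * norm (F s) \<le> norm (s - 1) ^ m * norm (F s)" by (intro mult_right_mono one_le_power) auto
      moreover have "s \<noteq> 1" using that by auto
      hence "norm (G s) = norm (s - 1) ^ m * norm (F s)" by (simp add: G(2) norm_mult norm_power)
      ultimately show ?thesis using b[of s] that by simp
    qed
    thus ?thesis by blast
  qed
  show "Qpar D > 0" by (rule Q)
  show "lam D j > 0" if "j \<in> {1..rnum D}" for j by (rule lam[OF that])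
  show "2 * (\<Sum>j=1..rnum D. lam D j) = 1" using deg by (simp add: sel_degree_def)
  \<comment> \<open>If a Gamma argument lam s + mu is a pole, then |Im s| = |Im mu| / lam; the sum
    dominates all these values at once. The condition |Im s| \<ge> T covers the arguments at s and
    at 1 - cnj s alike.\<close>
  define T where "T = 1 + (\<Sum>j=1..rnum D. \<bar>Im (mu D j)\<bar> / lam D j)"
  have T: "of_real (lam D j) * s + mu D j \<notin> \<int>\<^sub>\<le>\<^sub>0" if j: "j \<in> {1..rnum D}" and s: "\<bar>Im s\<bar> \<ge> T" for j s
  proof
    assume "of_real (lam D j) * s + mu D j \<in> \<int>\<^sub>\<le>\<^sub>0"
    then obtain n where "of_real (lam D j) * s + mu D j = complex_of_int n" by (auto elim!: nonpos_Ints_cases)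
    hence "Im (of_real (lam D j) * s + mu D j) = 0" using arg_cong[of _ _ Im] by fastforce
    hence "lam D j * Im s = - Im (mu D j)" by simp
    hence "lam D j * \<bar>Im s\<bar> = \<bar>Im (mu D j)\<bar>" using lam[OF j] by (metis abs_minus_cancel abs_mult abs_of_pos)
    hence "\<bar>Im s\<bar> = \<bar>Im (mu D j)\<bar> / lam D j" using lam[OF j] by (simp add: field_simps)
    also have "\<dots> \<le> (\<Sum>j=1..rnum D. \<bar>Im (mu D j)\<bar> / lam D j)"
      using j lam by (intro member_le_sum) (auto intro: divide_nonneg_pos less_imp_le)
    finally show False using s by (simp add: T_def)
  qed
  have T0: "T > 0" using lam by (auto simp: T_def intro!: add_pos_nonneg sum_nonneg divide_nonneg_pos)
  have contF: "isCont F s" if "s \<noteq> 1" for s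
    using continuous_on_interior[OF holomorphic_on_imp_continuous_on[OF hol], of s] that by (simp add: interior_open open_Compl)
  have contC: "isCont (completed D F) s" if "\<bar>Im s\<bar> \<ge> T" for s
  proof -
    have "s \<noteq> 1" using that T0 by auto
    have G: "isCont (\<lambda>s. Gamma (of_real (lam D j) * s + mu D j)) s" if "j \<in> {1..rnum D}" for j
      using T[OF that \<open>\<bar>Im s\<bar> \<ge> T\<close>] by (intro continuous_intros) auto
    have P: "isCont (\<lambda>s. \<Prod>j=1..rnum D. Gamma (of_real (lam D j) * s + mu D j)) s"
      unfolding isCont_def by (intro tendsto_prod) (use G in \<open>auto simp: isCont_def\<close>)
    have pw: "isCont (\<lambda>s. complex_of_real (Qpar D) powr s) s" using Q by (auto simp: powr_def intro!: continuous_intros)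
    show ?thesis unfolding completed_def[abs_def] by (intro isCont_mult pw P contF \<open>s \<noteq> 1\<close>)
  qed
  have fe': "F s = omega D * of_real (Qpar D) powr (1 - 2 * s) *
        (\<Prod>j=1..rnum D. Gamma (of_real (lam D j) * (1 - s) + cnj (mu D j)) / Gamma (of_real (lam D j) * s + mu D j)) *
        cnj (F (1 - cnj s))" if s: "\<bar>Im s\<bar> \<ge> T" for s
  proof -
    have "isCont (\<lambda>s. omega D * conj_fun (completed D F) (1 - s)) s"
    proof -
      have "isCont (\<lambda>s. completed D F (cnj (1 - s))) s"
        by (rule isCont_o2[where f = "\<lambda>s. cnj (1 - s)"]) (use s in \<open>auto intro!: continuous_intros contC\<close>)
      thus ?thesis unfolding conj_fun_def by (intro continuous_intros)
    qed
    hence "completed D F s = omega D * conj_fun (completed D F) (1 - s)"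
      by (intro cosparse_eq_at_continuous[OF fe] contC s)
    moreover have "conj_fun (completed D F) (1 - s) = of_real (Qpar D) powr (1 - s) *
        (\<Prod>j=1..rnum D. Gamma (of_real (lam D j) * (1 - s) + cnj (mu D j))) * cnj (F (1 - cnj s))"
      using Q by (simp add: conj_fun_def completed_def cnj_Gamma cnj_powr)
    moreover define P where "P = (\<Prod>j=1..rnum D. Gamma (of_real (lam D j) * s + mu D j))"
    moreover define P' where "P' = (\<Prod>j=1..rnum D. Gamma (of_real (lam D j) * (1 - s) + cnj (mu D j)))"
    ultimately have E: "of_real (Qpar D) powr s * P * F s = omega D * (of_real (Qpar D) powr (1 - s) * P' * cnj (F (1 - cnj s)))"
      by (simp add: completed_def)
    have P0: "P \<noteq> 0" using T[OF _ s] by (auto simp: P_def Gamma_eq_zero_iff)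
    have q0: "of_real (Qpar D) powr s \<noteq> (0::complex)" using Q by simp
    have "complex_of_real (Qpar D) powr (1 - s) = of_real (Qpar D) powr (1 - 2 * s) * of_real (Qpar D) powr s"
      by (simp add: powr_add[symmetric])
    hence "of_real (Qpar D) powr s * P * F s = of_real (Qpar D) powr s * P * (omega D * of_real (Qpar D) powr (1 - 2 * s) * (P' / P) * cnj (F (1 - cnj s)))"
      unfolding E using P0 by simp
    hence "F s = omega D * of_real (Qpar D) powr (1 - 2 * s) * (P' / P) * cnj (F (1 - cnj s))"
      by (rule mult_left_cancel[THEN iffD1, rotated]) (use P0 q0 in simp)
    thus ?thesis by (simp only: P_def P'_def prod_dividef)
  qed
  show "\<exists>T. \<forall>t. \<bar>t\<bar> \<ge> T \<longrightarrow> F (Complex (-1/2) t) =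
        omega D * of_real (Qpar D) powr (1 - 2 * Complex (-1/2) t) *
        (\<Prod>j=1..rnum D. Gamma (of_real (lam D j) * (1 - Complex (-1/2) t) + cnj (mu D j)) / Gamma (of_real (lam D j) * Complex (-1/2) t + mu D j)) *
        cnj (F (1 - cnj (Complex (-1/2) t)))"
    by (intro exI[of _ T] allI impI fe') simp
qed

lemma extended_selberg_coeff_nonzero:
  assumes sel: "extended_selberg a F D"
  shows "\<exists>m\<ge>1. a m \<noteq> 0"
proof (rule ccontr)
  assume "\<not> ?thesis"
  hence "a m = 0" if "m \<ge> 1" for m using that by blast
  moreover obtain s where "Re s > 1" "F s \<noteq> 0" "F s = (\<Sum>\<^sub>\<infinity>n\<in>{1..}. a n * of_nat n powr (- s))"
    using sel unfolding extended_selberg_def by blast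
  moreover have "(\<Sum>\<^sub>\<infinity>n\<in>{1..}. a n * of_nat n powr (- s)) = 0" using calculation(1) by (intro infsum_0) auto
  ultimately show False by (simp only:)
qed

text \<open>Agreement near a single point of the half-plane suffices by the identity theorem.
  \<open>M\<close> may carry dummy values on a discrete set; \<open>remove_sings\<close> replaces
  them by the values that \<open>is_mero_continuation\<close> prescribes.\<close>

lemma mero_continuationI:
  assumes M: "M meromorphic_on UNIV" and f: "f holomorphic_on {s. Re s > 1}"
    and ev: "\<forall>\<^sub>F s in at z. M s = f s" and z: "Re z > 1"
  shows "is_mero_continuation f (remove_sings M)"
  unfolding is_mero_continuation_def
proof (intro conjI allI impI)
  show "remove_sings M nicely_meromorphic_on UNIV" by (rule remove_sings_nicely_meromorphic[OF M])
  fix s :: complex assume s: "Re s > 1"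
  let ?H = "{s::complex. Re s > 1}"
  have o: "open ?H" by (rule open_halfspace_Re_gt)
  have fa: "f analytic_on ?H" using f o by (simp add: analytic_on_open)
  have "(\<lambda>s. M s - f s) meromorphic_on ?H"
    by (intro meromorphic_on_diff analytic_on_imp_meromorphic_on[OF fa] meromorphic_on_subset[OF M]) auto
  moreover have "connected ?H" by (intro convex_connected convex_halfspace_Re_gt)
  ultimately have alt: "(\<forall>\<^sub>\<approx>s\<in>?H. M s - f s = 0) \<or> (\<forall>\<^sub>\<approx>s\<in>?H. M s - f s \<noteq> 0)"
    using o by (intro meromorphic_imp_constant_or_avoid)
  have "\<not> (\<forall>\<^sub>\<approx>s\<in>?H. M s - f s \<noteq> 0)"
  proof
    assume "\<forall>\<^sub>\<approx>s\<in>?H. M s - f s \<noteq> 0"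
    hence "\<forall>\<^sub>F s in at z. M s - f s \<noteq> 0" by (rule eventually_cosparse_imp_eventually_at) (use z in auto)
    hence "\<forall>\<^sub>F s in at z. False" using ev by eventually_elim simp
    thus False by simp
  qed
  hence "\<forall>\<^sub>\<approx>s\<in>?H. M s - f s = 0" using alt by blast
  hence "\<forall>\<^sub>F w in at s. M w - f w = 0" by (rule eventually_cosparse_imp_eventually_at) (use s in auto)
  hence "\<forall>\<^sub>F w in at s. f w = M w" by eventually_elim simp
  moreover have "f \<midarrow>s\<rightarrow> f s" using fa s by (intro isContD analytic_at_imp_isCont) (auto intro: analytic_on_subset)
  ultimately have "M \<midarrow>s\<rightarrow> f s" by (simp add: tendsto_cong)
  thus "remove_sings M s = f s" by (rule remove_sings_eqI)
qed

lemma meromorphic_eq_cosparse: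
  assumes "f meromorphic_on UNIV" "g meromorphic_on UNIV" and ev: "\<forall>\<^sub>F s in at z. f s = g s"
  shows "\<forall>\<^sub>\<approx>s\<in>UNIV. f s = g s"
proof -
  have "(\<lambda>s. f s - g s) meromorphic_on UNIV" by (intro meromorphic_on_diff assms)
  hence alt: "(\<forall>\<^sub>\<approx>s\<in>UNIV. f s - g s = 0) \<or> (\<forall>\<^sub>\<approx>s\<in>UNIV. f s - g s \<noteq> 0)"
    by (rule meromorphic_imp_constant_or_avoid) auto
  have "\<not> (\<forall>\<^sub>\<approx>s\<in>UNIV. f s - g s \<noteq> 0)"
  proof
    assume "\<forall>\<^sub>\<approx>s\<in>UNIV. f s - g s \<noteq> 0"
    hence "\<forall>\<^sub>F s in at z. f s - g s \<noteq> 0" by (rule eventually_cosparse_imp_eventually_at) auto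
    hence "\<forall>\<^sub>F s in at z. False" using ev by eventually_elim simp
    thus False by simp
  qed
  thus ?thesis using alt by simp
qed

text \<open>The least positive element of y + Z, hence the shift with which a Hurwitz series over
  the positive elements of this class begins. It differs from \<open>frac\<close> only at integers,
  where it is 1.\<close>

definition upper_frac :: "real \<Rightarrow> real" where
  "upper_frac y = y - (of_int \<lceil>y\<rceil> - 1)"

lemma upper_frac_bounds: "0 < upper_frac y" "upper_frac y \<le> 1"
  unfolding upper_frac_def by linarith+

lemma upper_frac_eq: "upper_frac y = (if frac y = 0 then 1 else frac y)"
proof (cases "y \<in> \<int>")
  case True
  thus ?thesis by (auto simp: upper_frac_def elim: Ints_cases)
next
  case False
  thus ?thesis using ceiling_altdef[of y] by (auto simp: upper_frac_def frac_def frac_eq_0_iff elim: Ints_cases)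
qed

lemma upper_frac_minus: "upper_frac (- y) = 1 - frac y"
  by (simp add: upper_frac_def frac_def ceiling_minus)

text \<open>In the class of r m the positive values of n + b are N (k + \<open>upper_frac\<close>
  ((r m + b) / N)) with k = 0, 1, 2, .... The system of residues r is kept free, since the theorem
  uses m for one of its two series and - m for the other.\<close>

lemma periodic_Hurwitz_sum:
  fixes c :: "int \<Rightarrow> complex" and r :: "nat \<Rightarrow> int" and b :: real
  assumes N: "N > 0" and c: "\<And>n j. c (n + int N * j) = c n"
    and res: "\<And>n. \<exists>m\<in>{1..N}. \<exists>j. n = r m + int N * j"
    and inj: "\<And>m m' j. m \<in> {1..N} \<Longrightarrow> m' \<in> {1..N} \<Longrightarrow> r m = r m' + int N * j \<Longrightarrow> m = m'"
    and w: "Re w > 1"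
  shows "(\<Sum>\<^sub>\<infinity>n\<in>{n::int. of_int n + b > 0}. c n * of_real (of_int n + b) powr (- w)) =
     of_nat N powr (- w) * (\<Sum>m=1..N. c (r m) * Hurwitz_series (upper_frac ((of_int (r m) + b) / real N)) w)"
proof -
  define y where "y = (\<lambda>m. (of_int (r m) + b) / real N)"
  \<comment> \<open>\<open>g m k\<close> is the k-th integer n in the class of r m with n + b > 0;
    the ceiling makes the enumeration start at the first of them.\<close>
  define g where "g = (\<lambda>m k. r m + int N * (int k - \<lceil>y m\<rceil> + 1))"
  define f where "f = (\<lambda>n::int. c n * of_real (of_int n + b) powr (- w))"
  have N': "real N > 0" using N by simp
  have gb: "of_int (g m k) + b = real N * (real k + upper_frac (y m))" for m k
  proof -
    have "of_int (r m) + b = real N * y m" using N' by (simp add: y_def)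
    thus ?thesis unfolding g_def upper_frac_def by (simp add: algebra_simps)
  qed
  have hs: "(f has_sum (of_nat N powr (- w) * (c (r m) * Hurwitz_series (upper_frac (y m)) w))) (range (g m))" for m
  proof -
    have inj_g: "inj (g m)" using N by (auto simp: g_def inj_def)
    have "f (g m k) = (of_nat N powr (- w) * c (r m)) * of_real (real k + upper_frac (y m)) powr (- w)" for k
    proof -
      have "complex_of_real (real N * (real k + upper_frac (y m))) powr (- w) = of_real (real N) powr (- w) * of_real (real k + upper_frac (y m)) powr (- w)"
        unfolding of_real_mult[of "real N"] using N' upper_frac_bounds[of "y m"] by (intro powr_times_real) auto
      moreover have "c (g m k) = c (r m)" unfolding g_def by (rule c)
      ultimately show ?thesis unfolding f_def gb by simp
    qed
    moreover have "((\<lambda>k. (of_nat N powr (- w) * c (r m)) * of_real (real k + upper_frac (y m)) powr (- w)) has_sum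
        (of_nat N powr (- w) * c (r m)) * Hurwitz_series (upper_frac (y m)) w) UNIV"
      by (intro has_sum_cmult_right norm_summable_imp_has_sum Hurwitz_sums w upper_frac_bounds)
    ultimately have "((f \<circ> g m) has_sum (of_nat N powr (- w) * c (r m)) * Hurwitz_series (upper_frac (y m)) w) UNIV"
      unfolding o_def by simp
    thus ?thesis unfolding has_sum_reindex[OF inj_g] by (simp only: mult.assoc)
  qed
  have "(f has_sum (\<Sum>m=1..N. of_nat N powr (- w) * (c (r m) * Hurwitz_series (upper_frac (y m)) w))) (\<Union>m\<in>{1..N}. range (g m))"
  proof (rule sum_has_sum)
    show "range (g m) \<inter> range (g m') = {}" if "m \<in> {1..N}" "m' \<in> {1..N}" "m \<noteq> m'" for m m'
    proof -
      have "g m k \<noteq> g m' k'" for k k'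
      proof
        assume "g m k = g m' k'"
        hence "r m = r m' + int N * ((int k' - \<lceil>y m'\<rceil> + 1) - (int k - \<lceil>y m\<rceil> + 1))"
          by (simp add: g_def algebra_simps)
        thus False using inj[OF that(1,2)] that(3) by blast
      qed
      thus ?thesis by auto
    qed
  qed (use hs in auto)
  also have "(\<Union>m\<in>{1..N}. range (g m)) = {n::int. of_int n + b > 0}"
  proof (intro equalityI subsetI)
    fix n assume "n \<in> (\<Union>m\<in>{1..N}. range (g m))"
    then obtain m k where "n = g m k" by auto
    moreover have "real N * (real k + upper_frac (y m)) > 0" using N' upper_frac_bounds[of "y m"] by (intro mult_pos_pos) auto
    ultimately show "n \<in> {n. of_int n + b > 0}" by (simp only: mem_Collect_eq gb)
  next
    fix n :: int assume n: "n \<in> {n. of_int n + b > 0}"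
    obtain m j where m: "m \<in> {1..N}" "n = r m + int N * j" using res by blast
    have "of_int n + b = real N * (y m + of_int j)" using N' by (simp add: m y_def field_simps)
    hence "y m + of_int j > 0" using n N' by (simp add: zero_less_mult_iff)
    hence "\<lceil>y m\<rceil> + j \<ge> 1" by linarith
    hence "n = g m (nat (\<lceil>y m\<rceil> + j - 1))" using m by (simp add: g_def)
    thus "n \<in> (\<Union>m\<in>{1..N}. range (g m))" using m by blast
  qed
  finally show ?thesis unfolding f_def y_def sum_distrib_left by (rule infsumI)
qed

lemma periodic_zeta_series_holomorphic:
  assumes "0 \<le> x" "x < 1"
  shows "periodic_zeta_series x holomorphic_on {s. Re s > 1}"
proof (cases "x = 0")
  case True
  show ?thesis by (rule holomorphic_transform[OF Hurwitz_series_holomorphic[of 1]]) (auto simp: True Hurwitz_series_half)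
next
  case False
  have "periodic_zeta_entire x holomorphic_on {s. Re s > 1}"
    by (rule holomorphic_on_subset[OF periodic_zeta_entire_holomorphic]) (use assms False in auto)
  thus ?thesis
    by (rule holomorphic_transform) (use assms False periodic_zeta_eq_series[OF assms] in \<open>auto simp: periodic_zeta_def\<close>)
qed

lemma meromorphic_affine:
  assumes "M meromorphic_on UNIV"
  shows "(\<lambda>s. M (s + c)) meromorphic_on UNIV" "(\<lambda>s. M (s - c)) meromorphic_on UNIV" "(\<lambda>s. M (c - s)) meromorphic_on UNIV"
  by (rule meromorphic_on_compose[OF assms]; auto intro!: analytic_intros)+

lemma holomorphic_half_plane_shift:
  assumes "g holomorphic_on {s. Re s > 1}"
  shows "(\<lambda>s. g (s + \<i> * of_real t)) holomorphic_on {s. Re s > 1}"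
    "(\<lambda>s. g (s - \<i> * of_real t)) holomorphic_on {s. Re s > 1}"
  by (rule holomorphic_on_compose_gen[OF _ assms, unfolded o_def]; auto intro!: holomorphic_intros)+

lemma is_mero_continuation_periodic_Hurwitz:
  fixes c :: "int \<Rightarrow> complex" and r :: "nat \<Rightarrow> int" and b t :: real
  assumes N: "N > 0" and c: "\<And>n j. c (n + int N * j) = c n"
    and res: "\<And>n. \<exists>m\<in>{1..N}. \<exists>j. n = r m + int N * j"
    and inj: "\<And>m m' j. m \<in> {1..N} \<Longrightarrow> m' \<in> {1..N} \<Longrightarrow> r m = r m' + int N * j \<Longrightarrow> m = m'"
  shows "\<exists>M. is_mero_continuation (\<lambda>s. \<Sum>\<^sub>\<infinity>n\<in>{n::int. of_int n + b > 0}. c n * of_real (of_int n + b) powr (- (s - \<i> * of_real t))) M"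
proof -
  define x where "x = (\<lambda>m. upper_frac ((of_int (r m) + b) / real N))"
  have x: "0 < x m" "x m \<le> 1" for m unfolding x_def by (rule upper_frac_bounds)+
  have "\<exists>M. M meromorphic_on UNIV \<and> (\<forall>w. Re w > 1 \<longrightarrow> sin (of_real pi * w) \<noteq> 0 \<longrightarrow> M w = Hurwitz_series (x m) w)" for m
    using Hurwitz_series_continuation[OF x] by metis
  then obtain H where H: "\<And>m. H m meromorphic_on UNIV"
     "\<And>m w. Re w > 1 \<Longrightarrow> sin (of_real pi * w) \<noteq> 0 \<Longrightarrow> H m w = Hurwitz_series (x m) w" by metis
  define f where "f = (\<lambda>s. \<Sum>\<^sub>\<infinity>n\<in>{n::int. of_int n + b > 0}. c n * of_real (of_int n + b) powr (- (s - \<i> * of_real t)))"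
  define M where "M = (\<lambda>s. of_nat N powr (- (s - \<i> * of_real t)) * (\<Sum>m=1..N. c (r m) * H m (s - \<i> * of_real t)))"
  have fs: "f s = of_nat N powr (- (s - \<i> * of_real t)) * (\<Sum>m=1..N. c (r m) * Hurwitz_series (x m) (s - \<i> * of_real t))" if "Re s > 1" for s
    unfolding f_def x_def by (rule periodic_Hurwitz_sum[OF N c res inj]) (use that in auto)
  \<comment> \<open>At this point s - \<i> t equals 3/2, where sin (pi w) does not vanish and the
    continuations \<open>H m\<close> agree with the Hurwitz series.\<close>
  define z where "z = 3/2 + \<i> * complex_of_real t"
  have "is_mero_continuation f (remove_sings M)"
  proof (rule mero_continuationI)
    have "(\<lambda>s. of_nat N powr (- (s - \<i> * of_real t))) meromorphic_on UNIV"
      using N by (intro analytic_on_imp_meromorphic_on analytic_intros) auto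
    moreover have "(\<lambda>s. H m (s - \<i> * of_real t)) meromorphic_on UNIV" for m by (rule meromorphic_affine(2)[OF H(1)])
    ultimately show "M meromorphic_on UNIV" unfolding M_def
      by (intro meromorphic_on_mult meromorphic_on_sum) auto
    have "(\<lambda>s. Hurwitz_series (x m) (s - \<i> * of_real t)) holomorphic_on {s. Re s > 1}" for m
      by (rule holomorphic_half_plane_shift(2)[OF Hurwitz_series_holomorphic[OF x(1)]])
    hence "(\<lambda>s. of_nat N powr (- (s - \<i> * of_real t)) * (\<Sum>m=1..N. c (r m) * Hurwitz_series (x m) (s - \<i> * of_real t))) holomorphic_on {s. Re s > 1}"
      by (intro holomorphic_intros)
    thus "f holomorphic_on {s. Re s > 1}" by (rule holomorphic_transform) (simp add: fs)
    show "Re z > 1" by (simp add: z_def)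
    have "isCont (\<lambda>s. sin (of_real pi * (s - \<i> * of_real t))) z" by (intro continuous_intros)
    moreover have "sin (of_real pi * (z - \<i> * of_real t)) \<noteq> 0"
    proof -
      have "of_real pi * (z - \<i> * of_real t) = complex_of_real (pi + pi / 2)" by (simp add: z_def algebra_simps)
      thus ?thesis by (simp only: sin_of_real sin_add) simp
    qed
    ultimately have "\<forall>\<^sub>F s in at z. sin (of_real pi * (s - \<i> * of_real t)) \<noteq> 0"
      unfolding isCont_def by (rule tendsto_imp_eventually_ne)
    moreover have "\<forall>\<^sub>F s in at z. s \<in> {s. Re s > 1}"
      by (rule eventually_at_in_open') (auto simp: open_halfspace_Re_gt z_def)
    ultimately show "\<forall>\<^sub>F s in at z. M s = f s"
      by eventually_elim (simp add: fs M_def H)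
  qed
  thus ?thesis unfolding f_def by blast
qed

section \<open>Assembly of the functional equation\<close>

context degree_one
begin

text \<open>Writing a(n) = \<open>coef\<close> n times n^(-i theta) and inserting the Fourier
  expansion produces exponentials of frequency m / N - \<alpha> at the exponent s + i theta. Only
  the fractional part of the frequency matters, since n is an integer.\<close>

lemma twist_series:
  assumes om: "om \<noteq> 0" and N: "q = real N" and s: "Re s > 1"
  shows "(\<Sum>\<^sub>\<infinity>n\<in>{1..}. a n * of_nat n powr (- s) * cis (- 2 * pi * of_nat n * \<alpha>)) =
    Fourier_const * (\<Sum>m=1..N. cnj (coef (real m)) * periodic_zeta_series (frac (real m / real N - \<alpha>)) (s + \<i> * of_real \<theta>))"
proof -
  define t where "t = (\<lambda>n. a n * of_nat n powr (- s) * cis (- 2 * pi * real n * \<alpha>))"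
  define x where "x = (\<lambda>m. frac (real m / real N - \<alpha>))"
  define u where "u = (\<lambda>m n. cis (2 * pi * real (Suc n) * x m) * of_nat (Suc n) powr (- (s + \<i> * of_real \<theta>)))"
  have s': "Re (s + \<i> * of_real \<theta>) > 1" using s by simp
  have su: "summable (\<lambda>n. norm (u m n))" for m unfolding u_def by (rule powr_sums_periodic[OF s'])
  have tu: "t (Suc n) = (\<Sum>m=1..N. Fourier_const * cnj (coef (real m)) * u m n)" for n
  proof -
    define k where "k = Suc n"
    have k: "k \<ge> 1" by (simp add: k_def)
    have "a k * of_nat k powr (- s) = coef (real k) * of_nat k powr (- (s + \<i> * of_real \<theta>))"
      using k by (simp add: coef_of_nat mult.assoc powr_add[symmetric])
    hence "t k = (\<Sum>m=1..N. Fourier_const * cnj (coef (real m)) * (cis (2 * pi * real m * real k / real N) * cis (- 2 * pi * real k * \<alpha>) * of_nat k powr (- (s + \<i> * of_real \<theta>))))"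
      unfolding t_def coef_Fourier[OF om N k] by (simp add: sum_distrib_left sum_distrib_right mult_ac)
    moreover have "cis (2 * pi * real m * real k / real N) * cis (- 2 * pi * real k * \<alpha>) = cis (2 * pi * real k * x m)" for m
    proof -
      have "2 * pi * real m * real k / real N + - 2 * pi * real k * \<alpha> = 2 * pi * real k * x m + 2 * pi * of_int (int k * \<lfloor>real m / real N - \<alpha>\<rfloor>)"
        by (simp add: x_def frac_def algebra_simps)
      hence "cis (2 * pi * real m * real k / real N) * cis (- 2 * pi * real k * \<alpha>) = cis (2 * pi * real k * x m) * cis (2 * pi * of_int (int k * \<lfloor>real m / real N - \<alpha>\<rfloor>))"
        by (simp only: cis_mult)
      also have "cis (2 * pi * of_int (int k * \<lfloor>real m / real N - \<alpha>\<rfloor>)) = 1" by (rule cis_multiple_2pi) auto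
      finally show ?thesis by simp
    qed
    ultimately show ?thesis unfolding k_def u_def by (simp only:)
  qed
  have pu: "periodic_zeta_series (x m) (s + \<i> * of_real \<theta>) = suminf (u m)" for m
    by (simp only: periodic_zeta_series_def u_def)
  have S: "(\<lambda>n. t (Suc n)) sums (\<Sum>m=1..N. Fourier_const * cnj (coef (real m)) * periodic_zeta_series (x m) (s + \<i> * of_real \<theta>))"
    unfolding tu pu
    by (intro sums_sum sums_mult summable_sums) (rule summable_norm_cancel[OF su])
  have t0: "t 0 = 0" by (simp add: t_def a0)
  have "summable (\<lambda>n. norm (t (Suc n)))"
  proof (rule summable_comparison_test')
    show "summable (\<lambda>n. \<Sum>m=1..N. norm (Fourier_const * cnj (coef (real m)) * u m n))"
      unfolding norm_mult[of "Fourier_const * cnj (coef (real m))" for m] by (intro summable_sum summable_mult su)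
    show "norm (norm (t (Suc n))) \<le> (\<Sum>m=1..N. norm (Fourier_const * cnj (coef (real m)) * u m n))" if "n \<ge> 0" for n
      unfolding tu by (simp only: real_norm_def abs_norm_cancel) (rule norm_sum)
  qed
  hence "summable (\<lambda>n. norm (t n))" using summable_Suc_iff[of "\<lambda>n. norm (t n)"] by blast
  hence "(\<Sum>\<^sub>\<infinity>n\<in>{1..}. t n) = suminf t" by (rule infsum_Ici_eq_suminf(2)[of t, OF t0])
  also have "\<dots> = (\<Sum>m=1..N. Fourier_const * cnj (coef (real m)) * periodic_zeta_series (x m) (s + \<i> * of_real \<theta>))"
    using S t0 by (simp add: sums_Suc_iff sums_iff)
  finally show ?thesis unfolding t_def x_def by (simp add: sum_distrib_left mult.assoc)
qed

text \<open>The reflection x -> k q - x, applied twice at a point where \<open>coef\<close> does not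
  vanish, returns the same value with the squared factor.\<close>

lemma parity_square:
  assumes om: "om \<noteq> 0" and nz: "a m \<noteq> 0"
  shows "exp (\<i> * of_real (pi * (\<eta> + 1))) * exp (\<i> * of_real (pi * (\<eta> + 1))) = 1"
proof -
  let ?\<rho> = "exp (\<i> * of_real (pi * (\<eta> + 1)))"
  have m: "m > 0" using nz a0 by (cases m) auto
  have c: "coef (real m) \<noteq> 0" using nz m by (simp add: coef_of_nat)
  obtain k where k: "real m < real k * q" using reals_Archimedean3[OF q_pos] by blast
  have "cnj (coef (real k * q - (real k * q - real m))) = ?\<rho> * cnj (coef (real k * q - real m))"
    using k m by (intro coef_reflect[OF om]) auto
  also have "cnj (coef (real k * q - real m)) = ?\<rho> * cnj (coef (real m))" using k m by (intro coef_reflect[OF om]) auto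
  finally show ?thesis using c by simp
qed

end

theorem theorem3:
  fixes a :: "nat \<Rightarrow> complex" and F :: "complex \<Rightarrow> complex" and D :: selberg_data
    and \<alpha> q \<theta> \<aa> :: real
  assumes F: "extended_selberg a F D" and degree: "sel_degree D = 1"
    and \<alpha>: "0 < \<alpha>" "\<alpha> \<le> 1"
  defines "q \<equiv> conductor D" and "\<theta> \<equiv> sel_theta D" and "\<aa> \<equiv> sel_parity D"
  shows "\<forall>\<^sub>\<approx>s\<in>UNIV. linear_twist a (1 - s) \<alpha> =
    root_number D * Gamma (s - \<i> * of_real \<theta>) * of_real q powr (s - \<i> * of_real \<theta> - 1 / 2) /
      (\<i> powr of_real \<aa> * of_real (2 * pi) powr (s - \<i> * of_real \<theta>)) *
    (exp (\<i> * of_real (pi / 2) * (s - \<i> * of_real \<theta>)) * Fbar_star a D s (- (\<alpha> * q)) +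
     (-1) powr of_real \<aa> * exp (- \<i> * of_real (pi / 2) * (s - \<i> * of_real \<theta>)) *
       Fbar_star a D s (\<alpha> * q))"
proof -
  interpret S: degree_one "a(0 := 0)" F "Qpar D" "rnum D" "lam D" "mu D" "omega D"
    by (rule extended_selberg_degree_one[OF F degree])
  have th: "S.\<theta> = \<theta>" by (simp add: S.\<theta>_def \<theta>_def sel_theta_def sel_xi_def)
  have et: "S.\<eta> + 1 = \<aa>" by (simp add: S.\<eta>_def \<aa>_def sel_parity_def sel_eta_def sel_xi_def sum_subtractf)
  have qq: "S.q = q" by (simp add: S.q_def q_def conductor_def sel_beta_def)
  have om: "omega D \<noteq> 0" using F by (auto simp: extended_selberg_def)
  obtain m0 where m0: "m0 \<ge> 1" "a m0 \<noteq> 0" using extended_selberg_coeff_nonzero[OF F] by blast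
  hence nz: "(a(0 := 0)) m0 \<noteq> 0" by simp
  obtain N where N: "q = real N" using S.q_in_Nats[OF om nz] qq by (auto simp: Nats_def)
  have N': "S.q = real N" using N qq by simp
  have N0: "N > 0" using S.q_pos N' by simp
  define \<rho> where "\<rho> = exp (\<i> * of_real (pi * \<aa>))"
  have \<rho>2: "\<rho> * \<rho> = 1" using S.parity_square[OF om nz] unfolding \<rho>_def et .
  have m1: "(-1) powr of_real \<aa> = \<rho>" by (simp add: powr_def \<rho>_def mult_ac)
  have ii: "\<i> powr of_real \<aa> = exp (\<i> * of_real (pi * \<aa> / 2))" by (simp add: powr_def mult_ac)
  define C where "C = S.Fourier_const"
  \<comment> \<open>Since beta Q^2 = q / (2 pi), the power of q / (2 pi) in
    \<open>Fourier_const\<close> is the one in the root number; what remains is q^(-1/2) and, for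
    principal powers, the inverse of \<i> powr \<aa>.\<close>
  have C: "C = root_number D * of_real q powr (- 1/2) / \<i> powr of_real \<aa>"
  proof -
    have "q / (2 * pi) = sel_beta D * (Qpar D)\<^sup>2" by (simp add: q_def conductor_def)
    hence r: "root_number D = omega D * of_real (q / (2 * pi)) powr (\<i> * of_real \<theta>) * S.Lam"
      by (simp only: root_number_def S.Lam_def \<theta>_def)
    have e: "exp (- \<i> * of_real (pi * \<aa> / 2)) = 1 / \<i> powr of_real \<aa>" unfolding ii by (simp add: exp_minus field_simps)
    show ?thesis unfolding C_def S.Fourier_const_def th et qq r e by simp
  qed

  define c where "c = (\<lambda>n. cnj (atilde a D n))"
  \<comment> \<open>\<open>atilde\<close> uses n itself for n \<ge> 1 and the representative in
    {1..N} otherwise; the period of \<open>coef\<close> merges the two cases.\<close>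
  have at: "atilde a D n = S.coef (of_int ((n - 1) mod int N + 1))" for n
  proof -
    have fl: "\<lfloor>conductor D\<rfloor> = int N" using N q_def by simp
    define k where "k = nat ((n - 1) mod int N + 1)"
    have k: "int k = (n - 1) mod int N + 1" using N0 by (simp add: k_def)
    have k1: "k \<ge> 1" using N0 by (simp add: k_def nat_add_distrib)
    have co: "a j * of_nat j powr (\<i> * of_real (sel_theta D)) = S.coef (real j)" if "j \<ge> 1" for j
      using that unfolding S.coef_of_nat th \<theta>_def[symmetric] by simp
    show ?thesis
    proof (cases "n \<ge> 1")
      case False
      have "atilde a D n = S.coef (real k)" using False co[OF k1] by (simp add: atilde_def fl k_def Let_def)
      also have "real k = of_int ((n - 1) mod int N + 1)" using k by (metis of_int_of_nat_eq)
      finally show ?thesis .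
    next
      case True
      have d: "(n - 1) div int N \<ge> 0" using True N0 by (simp add: pos_imp_zdiv_nonneg_iff)
      have "n = int k + int N * ((n - 1) div int N)" unfolding k using mult_div_mod_eq[of "int N" "n - 1"] by linarith
      hence "n = int (k + N * nat ((n - 1) div int N))" using d by simp
      hence nn: "nat n = k + N * nat ((n - 1) div int N)" by linarith
      have "atilde a D n = S.coef (real (nat n))" using True co[of "nat n"] by (simp add: atilde_def Let_def)
      also have "real (nat n) = real k + real (nat ((n - 1) div int N)) * S.q" unfolding nn N' by simp
      also have "S.coef \<dots> = S.coef (real k)" using k1 by (intro S.coef_add_mult_q[OF om]) simp
      also have "real k = of_int ((n - 1) mod int N + 1)" using k by (metis of_int_of_nat_eq)
      finally show ?thesis .
    qed
  qed
  have per: "c (n + int N * j) = c n" for n j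
  proof -
    have "(n + int N * j - 1) mod int N = (n - 1) mod int N" using mod_mult_self2[of "n - 1" "int N" j] by (simp add: algebra_simps)
    thus ?thesis by (simp add: c_def at)
  qed
  have c_pos: "c (int m) = cnj (S.coef (real m))" if "m \<in> {1..N}" for m
  proof -
    have "(int m - 1) mod int N = int m - 1" using that by (intro mod_pos_pos_trivial) auto
    thus ?thesis by (simp add: c_def at)
  qed
  have c_neg: "c (- int m) = \<rho> * cnj (S.coef (real m))" if m: "m \<in> {1..N}" for m
  \<comment> \<open>For m = N the reflected point q - m is 0, which \<open>coef_reflect\<close>
    excludes; reflection at 2 q is used instead.\<close>
  proof (cases "m = N")
    case True
    have "c (- int m) = c (- int N + int N * 2)" unfolding True by (rule per[symmetric])
    also have "\<dots> = cnj (S.coef (real N))" using c_pos[of N] N0 by simp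
    also have "\<dots> = cnj (S.coef (real 2 * S.q - real N))" by (simp add: N')
    also have "\<dots> = \<rho> * cnj (S.coef (real N))"
      unfolding \<rho>_def et[symmetric] by (rule S.coef_reflect[OF om]) (use N0 in \<open>auto simp: N'\<close>)
    finally show ?thesis by (simp add: True)
  next
    case False
    hence m: "m \<ge> 1" "m < N" using m by auto
    have "c (- int m) = c (- int m + int N * 1)" by (rule per[symmetric])
    also have "- int m + int N * 1 = int (N - m)" using m by simp
    also have "c (int (N - m)) = cnj (S.coef (real (N - m)))" using m by (intro c_pos) auto
    also have "real (N - m) = real 1 * S.q - real m" using m by (simp add: N' of_nat_diff)
    also have "cnj (S.coef \<dots>) = \<rho> * cnj (S.coef (real m))"
      unfolding \<rho>_def et[symmetric] by (rule S.coef_reflect[OF om]) (use m in \<open>auto simp: N'\<close>)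
    finally show ?thesis .
  qed
  have res1: "\<exists>m\<in>{1..N}. \<exists>j. n = int m + int N * j" for n
  proof -
    have "n = int (nat ((n - 1) mod int N + 1)) + int N * ((n - 1) div int N)"
      using N0 mult_div_mod_eq[of "int N" "n - 1"] pos_mod_sign[of "int N" "n - 1"] by simp
    moreover have "nat ((n - 1) mod int N + 1) \<in> {1..N}"
    proof -
      have "0 \<le> (n - 1) mod int N" "(n - 1) mod int N < int N" using N0 by auto
      thus ?thesis unfolding atLeastAtMost_iff by (metis le_nat_iff nat_le_iff add.commute add_nonneg_nonneg le_add_same_cancel1 of_nat_1 zless_imp_add1_zle zero_le_one)
    qed
    ultimately show ?thesis by blast
  qed
  have res2: "\<exists>m\<in>{1..N}. \<exists>j. n = - int m + int N * j" for n
  proof -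
    obtain m j where "m \<in> {1..N}" "- n = int m + int N * j" using res1 by blast
    hence "m \<in> {1..N} \<and> n = - int m + int N * (- j)" by simp
    thus ?thesis by blast
  qed
  have inj1: "m = m'" if m: "m \<in> {1..N}" "m' \<in> {1..N}" and eq: "int m = int m' + int N * j" for m m' j
  proof -
    have "int N dvd int m - int m'" using eq by simp
    moreover have "\<bar>int m - int m'\<bar> < int N" using m by auto
    ultimately have "int m - int m' = 0" using dvd_imp_le_int[of "int m - int m'" "int N"] by fastforce
    thus ?thesis by simp
  qed
  have inj2: "m = m'" if m: "m \<in> {1..N}" "m' \<in> {1..N}" and eq: "- int m = - int m' + int N * j" for m m' j
    by (rule inj1[OF m, of "- j"]) (use eq in simp)

  define f2 where "f2 = (\<lambda>b s. \<Sum>\<^sub>\<infinity>n\<in>{n::int. of_int n + b > 0}. c n * of_real (of_int n + b) powr (- (s - \<i> * of_real \<theta>)))"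
  have "\<exists>M. is_mero_continuation (f2 b) M" for b
    unfolding f2_def by (rule is_mero_continuation_periodic_Hurwitz[OF N0 per res1 inj1])
  then obtain M2 where M2: "\<And>b. is_mero_continuation (f2 b) (M2 b)" by metis
  have Fbar: "Fbar_star a D s b = M2 b s" for s b
    using mero_continuation_eqI[OF M2[of b]] unfolding Fbar_star_def f2_def c_def \<theta>_def by simp
  have M2m: "M2 b meromorphic_on UNIV" for b
    using M2[of b] by (auto simp: is_mero_continuation_def nicely_meromorphic_on_def)
  have M2e: "M2 b s = f2 b s" if "Re s > 1" for b s using M2[of b] that by (auto simp: is_mero_continuation_def)

  define x where "x = (\<lambda>m. frac (real m / real N - \<alpha>))"
  have x: "0 \<le> x m" "x m < 1" for m by (simp_all add: x_def frac_lt_1)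
  have f2_minus: "f2 (- (\<alpha> * q)) s = of_nat N powr (- (s - \<i> * of_real \<theta>)) *
      (\<Sum>m=1..N. cnj (S.coef (real m)) * Hurwitz_series (if x m = 0 then 1 else x m) (s - \<i> * of_real \<theta>))" if s: "Re s > 1" for s
  proof -
    have u: "upper_frac ((of_int (int m) + - (\<alpha> * q)) / real N) = (if x m = 0 then 1 else x m)" for m
    proof -
      have "(of_int (int m) + - (\<alpha> * q)) / real N = real m / real N - \<alpha>" using N0 by (simp add: N field_simps)
      thus ?thesis by (simp only: upper_frac_eq x_def)
    qed
    have "f2 (- (\<alpha> * q)) s = of_nat N powr (- (s - \<i> * of_real \<theta>)) *
      (\<Sum>m=1..N. c (int m) * Hurwitz_series (upper_frac ((of_int (int m) + - (\<alpha> * q)) / real N)) (s - \<i> * of_real \<theta>))"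
      unfolding f2_def by (rule periodic_Hurwitz_sum[OF N0 per res1 inj1]) (use s in auto)
    thus ?thesis unfolding u by (simp add: c_pos)
  qed
  have f2_plus: "f2 (\<alpha> * q) s = of_nat N powr (- (s - \<i> * of_real \<theta>)) *
      (\<Sum>m=1..N. \<rho> * cnj (S.coef (real m)) * Hurwitz_series (1 - x m) (s - \<i> * of_real \<theta>))" if s: "Re s > 1" for s
  proof -
    \<comment> \<open>With the residues - m the shift is the negative of m / N - \<alpha>, so the
      same x m appears in both series. For x m = 0 it equals 1, the second shift in
      \<open>periodic_zeta_reflect\<close>.\<close>
    have u: "upper_frac ((of_int (- int m) + \<alpha> * q) / real N) = 1 - x m" for m
    proof -
      have "(of_int (- int m) + \<alpha> * q) / real N = - (real m / real N - \<alpha>)" using N0 by (simp add: N field_simps)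
      thus ?thesis by (simp only: upper_frac_minus x_def)
    qed
    have "f2 (\<alpha> * q) s = of_nat N powr (- (s - \<i> * of_real \<theta>)) *
      (\<Sum>m=1..N. c (- int m) * Hurwitz_series (upper_frac ((of_int (- int m) + \<alpha> * q) / real N)) (s - \<i> * of_real \<theta>))"
      unfolding f2_def by (rule periodic_Hurwitz_sum[OF N0 per res2 inj2]) (use s in auto)
    thus ?thesis unfolding u by (simp add: c_neg)
  qed

  define f1 where "f1 = (\<lambda>s. \<Sum>\<^sub>\<infinity>n\<in>{1..}. a n * of_nat n powr (- s) * cis (- 2 * pi * of_nat n * \<alpha>))"
  define M1 where "M1 = (\<lambda>s. C * (\<Sum>m=1..N. cnj (S.coef (real m)) * periodic_zeta (x m) (s + \<i> * of_real \<theta>)))"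
  have f1_eq: "f1 s = C * (\<Sum>m=1..N. cnj (S.coef (real m)) * periodic_zeta_series (x m) (s + \<i> * of_real \<theta>))" if s: "Re s > 1" for s
  proof -
    have "f1 s = (\<Sum>\<^sub>\<infinity>n\<in>{1..}. (a(0 := 0)) n * of_nat n powr (- s) * cis (- 2 * pi * of_nat n * \<alpha>))"
      unfolding f1_def by (rule infsum_cong) auto
    also have "\<dots> = C * (\<Sum>m=1..N. cnj (S.coef (real m)) * periodic_zeta_series (x m) (s + \<i> * of_real \<theta>))"
      unfolding S.twist_series[OF om N' s] C_def x_def th ..
    finally show ?thesis .
  qed
  have M1m: "M1 meromorphic_on UNIV"
  proof -
    have "(\<lambda>s. periodic_zeta (x m) (s + \<i> * of_real \<theta>)) meromorphic_on UNIV" for m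
      by (rule meromorphic_affine(1)[OF periodic_zeta_meromorphic[OF x]])
    thus ?thesis unfolding M1_def by (intro meromorphic_on_mult meromorphic_on_sum) auto
  qed
  have "is_mero_continuation f1 (remove_sings M1)"
  proof (rule mero_continuationI[OF M1m, where z = 2])
    have "(\<lambda>s. periodic_zeta_series (x m) (s + \<i> * of_real \<theta>)) holomorphic_on {s. Re s > 1}" for m
      by (rule holomorphic_half_plane_shift(1)[OF periodic_zeta_series_holomorphic[OF x]])
    hence "(\<lambda>s. C * (\<Sum>m=1..N. cnj (S.coef (real m)) * periodic_zeta_series (x m) (s + \<i> * of_real \<theta>))) holomorphic_on {s. Re s > 1}"
      by (intro holomorphic_intros)
    thus "f1 holomorphic_on {s. Re s > 1}" by (rule holomorphic_transform) (simp add: f1_eq)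
    have "\<forall>\<^sub>F s in at 2. s \<in> {s. Re s > 1}"
      by (rule eventually_at_in_open') (auto simp: open_halfspace_Re_gt)
    thus "\<forall>\<^sub>F s in at 2. M1 s = f1 s"
      by eventually_elim (simp add: f1_eq M1_def periodic_zeta_eq_series[OF x])
  qed auto
  hence twist: "linear_twist a s \<alpha> = remove_sings M1 s" for s
    using mero_continuation_eqI[of f1] unfolding linear_twist_def f1_def by simp

  define R where "R = (\<lambda>s. root_number D * Gamma (s - \<i> * of_real \<theta>) * of_real q powr (s - \<i> * of_real \<theta> - 1 / 2) /
      (\<i> powr of_real \<aa> * of_real (2 * pi) powr (s - \<i> * of_real \<theta>)) *
    (exp (\<i> * of_real (pi / 2) * (s - \<i> * of_real \<theta>)) * M2 (- (\<alpha> * q)) s +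
     (-1) powr of_real \<aa> * exp (- \<i> * of_real (pi / 2) * (s - \<i> * of_real \<theta>)) * M2 (\<alpha> * q) s))"
  \<comment> \<open>The sign \<rho> occurs twice on the right, as (-1) powr \<aa> and through the
    coefficients at - m, and \<rho> \<rho> = 1 removes it. The power q^(w - 1/2) splits into N^w,
    which cancels the N^(-w) from the regrouping, and q^(-1/2), which belongs to C.\<close>
  have FE: "M1 (1 - s) = R s" if s: "Re s > 1" for s
  proof -
    define w where "w = s - \<i> * of_real \<theta>"
    have w: "Re w > 1" using s by (simp add: w_def)
    define E where "E = exp (\<i> * of_real (pi / 2) * w)"
    define E' where "E' = exp (- \<i> * of_real (pi / 2) * w)"
    define X where "X = (\<Sum>m=1..N. cnj (S.coef (real m)) * Hurwitz_series (if x m = 0 then 1 else x m) w)"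
    define Y where "Y = (\<Sum>m=1..N. cnj (S.coef (real m)) * Hurwitz_series (1 - x m) w)"
    have A1: "M2 (- (\<alpha> * q)) s = of_nat N powr (- w) * X" unfolding M2e[OF s] f2_minus[OF s] X_def w_def ..
    have A2: "M2 (\<alpha> * q) s = of_nat N powr (- w) * (\<rho> * Y)"
      unfolding M2e[OF s] f2_plus[OF s] Y_def w_def sum_distrib_left by (simp only: mult.assoc)
    have "M1 (1 - s) = C * (\<Sum>m=1..N. cnj (S.coef (real m)) * Hurwitz_dual (if x m = 0 then 1 else x m) (1 - x m) w)"
    proof -
      have "1 - s + \<i> * of_real \<theta> = 1 - w" by (simp add: w_def)
      thus ?thesis unfolding M1_def by (simp only: periodic_zeta_reflect[OF x w])
    qed
    also have "(\<Sum>m=1..N. cnj (S.coef (real m)) * Hurwitz_dual (if x m = 0 then 1 else x m) (1 - x m) w) =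
        Gamma w * of_real (2 * pi) powr (- w) * (E * X + E' * Y)"
      unfolding Hurwitz_dual_def E_def[symmetric] E'_def[symmetric] X_def Y_def
      by (simp add: sum_distrib_left sum.distrib[symmetric] algebra_simps)
    finally have L: "M1 (1 - s) = C * (Gamma w * of_real (2 * pi) powr (- w) * (E * X + E' * Y))" .
    have qp: "complex_of_real q powr (w - 1/2) = of_real q powr (- 1/2) * of_nat N powr w"
      using powr_add[of "of_real q" "- 1/2" w] by (simp add: N)
    have NN: "of_nat N powr w * of_nat N powr (- w) = (1::complex)" using N0 by (subst powr_add[symmetric]) simp
    have tp: "complex_of_real (2 * pi) powr (- w) = 1 / of_real (2 * pi) powr w" by (simp add: powr_minus_divide)
    have alg: "r * g * (h * n) / (i * p) * (e * (n' * A) + \<rho>' * e' * (n' * (\<rho>' * B))) = r * h / i * (g * (1 / p) * (e * A + e' * B))"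
      if "n * n' = 1" "\<rho>' * \<rho>' = 1" for r g h n n' i p e e' A B \<rho>' :: complex
    proof -
      have "e * (n' * A) + \<rho>' * e' * (n' * (\<rho>' * B)) = n' * (e * A + (\<rho>' * \<rho>') * e' * B)" by (simp add: algebra_simps)
      hence "r * g * (h * n) / (i * p) * (e * (n' * A) + \<rho>' * e' * (n' * (\<rho>' * B))) = (n * n') * (r * h / i * (g * (1 / p) * (e * A + e' * B)))"
        by (simp add: that(2))
      thus ?thesis by (simp add: that(1))
    qed
    show ?thesis unfolding R_def w_def[symmetric] A1 A2 m1 E_def[symmetric] E'_def[symmetric] L C qp tp
      by (rule alg[OF NN \<rho>2, symmetric])
  qed
  have Rm: "R meromorphic_on UNIV"
  proof -
    have G: "(\<lambda>s. Gamma (s - \<i> * of_real \<theta>)) meromorphic_on UNIV"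
    proof -
      have "(\<lambda>s. inverse (rGamma (s - \<i> * of_real \<theta>))) meromorphic_on UNIV"
        by (intro meromorphic_on_inverse analytic_on_imp_meromorphic_on analytic_intros)
      thus ?thesis by (simp add: Gamma_def)
    qed
    have q: "q > 0" using N N0 by simp
    have P: "(\<lambda>s. of_real q powr (s - \<i> * of_real \<theta> - 1 / 2)) meromorphic_on UNIV"
      "(\<lambda>s. \<i> powr of_real \<aa> * of_real (2 * pi) powr (s - \<i> * of_real \<theta>)) meromorphic_on UNIV"
      "(\<lambda>s. exp (\<i> * of_real (pi / 2) * (s - \<i> * of_real \<theta>))) meromorphic_on UNIV"
      "(\<lambda>s. exp (- \<i> * of_real (pi / 2) * (s - \<i> * of_real \<theta>))) meromorphic_on UNIV"
      by (intro analytic_on_imp_meromorphic_on; simp only: analytic_on_open open_UNIV; intro holomorphic_intros)+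
    show ?thesis unfolding R_def
      by (intro meromorphic_on_mult meromorphic_on_divide meromorphic_on_add G P M2m) auto
  qed
  \<comment> \<open>Both sides are meromorphic, so agreement near s = 2 suffices.
    \<open>remove_sings\<close> alters \<open>M1\<close> only on a discrete set, and the values near
    -1 = 1 - 2 are known from the reflected formula.\<close>
  have Lm: "(\<lambda>s. remove_sings M1 (1 - s)) meromorphic_on UNIV"
    by (rule meromorphic_affine(3)[OF remove_sings_meromorphic[OF M1m]])
  have "\<forall>\<^sub>F s in at 2. remove_sings M1 (1 - s) = R s"
  proof -
    have "\<forall>\<^sub>\<approx>s\<in>UNIV. remove_sings M1 s = M1 s" by (rule eventually_remove_sings_eq[OF M1m])
    hence "\<forall>\<^sub>F s in at (1 - 2). remove_sings M1 s = M1 s" by (rule eventually_cosparse_imp_eventually_at) auto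
    moreover have "filterlim (\<lambda>s::complex. 1 - s) (at (1 - 2)) (at 2)"
      by (intro filterlim_atI tendsto_intros) (auto simp: eventually_at_filter)
    ultimately have "\<forall>\<^sub>F s in at 2. remove_sings M1 (1 - s) = M1 (1 - s)" by (rule eventually_compose_filterlim)
    moreover have "\<forall>\<^sub>F s in at 2. s \<in> {s. Re s > 1}"
      by (rule eventually_at_in_open') (auto simp: open_halfspace_Re_gt)
    ultimately show ?thesis by eventually_elim (simp add: FE)
  qed
  hence "\<forall>\<^sub>\<approx>s\<in>UNIV. remove_sings M1 (1 - s) = R s" by (rule meromorphic_eq_cosparse[OF Lm Rm])
  thus ?thesis unfolding twist Fbar R_def .
qed

end
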